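(* Let $(t,x)\in[0,T)\times\mathbb R^n$. A couple $(e_1,e_2)\in\mathbb R^2$ is a Nash equilibrium payoff at the position $(t,x)$ if and only if for any $\epsilon>0$ there exists $\delta_\epsilon>0$ such that for any partition $\pi=\{0=t_0<t_1<\cdots<t_N=T\}$ with $|\pi|<\delta_\epsilon$ and $t=t_{k-1}$ (for some $1\le k\le N$), there exists $(u^\epsilon,v^\epsilon)\in\mathcal U^{\pi,1}_{t,T}\times\mathcal V^{\pi,1}_{t,T}$ such that for $i=k,\dots,N$ and $m=1,2$, $$P\Big\{E\big[g_m(X_T^{t,x,u^\epsilon,v^\epsilon})\,\big|\,\mathcal F_{t_{k-2},t_{i-2}}\big]\ \ge\ U_m\big(t_{i-1},X_{t_{i-1}}^{t,x,u^\epsilon,v^\epsilon}\big)-\epsilon\Big\}\ \ge\ 1-\epsilon,$$ and $$\big|E[g_m(X_T^{t,x,u^\epsilon,v^\epsilon})]-e_m\big|\le\epsilon.$$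
   Context: Dynamics. $T>0$; $U,V$ are compact metric spaces; $f:\mathbb R^n\times U\times V\to\mathbb R^n$ is bounded, continuous in $(u,v)$ and Lipschitz in $x$ uniformly in $(u,v)$; $g_1,g_2:\mathbb R^n\to\mathbb R$ are bounded and Lipschitz. $\mathcal U_{t,T}$ (resp. $\mathcal V_{t,T}$) is the set of Lebesgue measurable functions $[t,T]\to U$ (resp. $[t,T]\to V$), a.e. equal functions being identified, with the Borel $\sigma$-field of convergence in Lebesgue measure. $X^{t,x,u,v}$ is the unique solution of $X_s=x+\int_t^sf(X_r,u_r,v_r)dr$, $s\in[t,T]$ (pathwise for random controls). Probability space. $(\Omega,\mathcal F,P)$ is the canonical Wiener space of continuous functions $[0,T]\to\mathbb R^2$ with coordinate Brownian motion $B=(B^1,B^2)$, $\mathcal N$ the $P$-null sets, $\mathcal F_{t,s}=\sigma\{B_r-B_t,\ r\in[t,s]\}\vee\mathcal N$. For a partition $\pi=\{0=t_0<\dots<t_N=T\}$, $|\pi|=\max_j(t_j-t_{j-1})$, put $\zeta^\pi_{i,j}=\Phi_{0,1}\big((B^i_{t_j}-B^i_{t_{j-1}})/\sqrt{t_j-t_{j-1}}\big)$, $i=1,2$, $1\le j\le N$, with $\Phi_{0,1}$ the standard normal distribution function, and $\zeta^\pi_j=(\zeta^\pi_{1,j},\zeta^\pi_{2,j})$. Convention for index $0$: $\Omega$ is enlarged to carry two further variables $\zeta^\pi_{1,0},\zeta^\pi_{2,0}$ (the same for all $\pi$), uniform on $[0,1]$, independent of each other and of $B$; $t_{-1}$ is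 a formal symbol, $\mathcal F_{t_{-1},t_{-1}}$ is trivial (generated by $\mathcal N$), and $\mathcal F_{t_{-1},s}=\sigma\{\zeta^\pi_{1,0},\zeta^\pi_{2,0},B_r,\ r\in[0,s]\}\vee\mathcal N$ for $s\ge0$. Strategies and controls. Let $t\in[t_{k-1},t_k)$. $\mathcal A_1^\pi(t,T)$ is the set of maps $\alpha:\Omega\times[t,T]\times\mathcal V_{t,T}\to U$ (so that $\alpha(\omega,v)\in\mathcal U_{t,T}$) of the form $\alpha(\omega,v)(s)=\sum_{l=k}^N\alpha_l((\zeta^\pi_{k-1},\dots,\zeta^\pi_{l-2},\zeta^\pi_{1,l-1})(\omega),v)(s)\,I_{[t\vee t_{l-1},t_l)}(s)$ (for $l=k$ the first argument is $\zeta^\pi_{1,k-1}$), where $\alpha_l(y,v)(s)$ is Borel measurable in $(y,s,v)\in\mathbb R^{2(l-k)+1}\times[t\vee t_{l-1},t_l]\times\mathcal V_{t,T}$ and, for $k\le l\le N$, if $v=v'$ a.e. on $[t,t_{l-1}]$ then for all $y$, $\alpha_l(y,v)=\alpha_l(y,v')$ a.e. on $[t\vee t_{l-1},t_l]$ (so $\alpha_k$ does not depend on $v$). $\mathcal B_1^\pi(t,T)$ is defined symmetrically: maps $\beta:\Omega\times[t,T]\times\mathcal U_{t,T}\to V$ with $\zeta^\pi_{2,l-1}$ in place of $\zeta^\pi_{1,l-1}$. $\mathcal U^{\pi,1}_{t,T}$ is the set of processes $u(\omega,s)=\sum_{l=k}^Nu^l(\zeta^\pi_{k-1},\dots,\zeta^\pi_{l-2},\zeta^\pi_{1,l-1},s)I_{[t\vee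 t_{l-1},t_l)}(s)$ with Borel $U$-valued $u^l$; $\mathcal V^{\pi,1}_{t,T}$ is the set of processes $v(\omega,s)=\sum_{l=k}^Nv^l(\zeta^\pi_{k-1},\dots,\zeta^\pi_{l-2},\zeta^\pi_{2,l-1},s)I_{[t\vee t_{l-1},t_l)}(s)$ with Borel $V$-valued $v^l$. For a random control $v$, $\alpha(v)$ denotes $\omega\mapsto\alpha(\omega,v(\omega))$; similarly $\beta(u)$. For each $(\alpha,\beta)\in\mathcal A_1^\pi(t,T)\times\mathcal B_1^\pi(t,T)$ there is a unique $(u,v)\in\mathcal U^{\pi,1}_{t,T}\times\mathcal V^{\pi,1}_{t,T}$ with $\alpha(v)=u$, $\beta(u)=v$. Payoffs. $J_m(t,x,u,v)=E[g_m(X_T^{t,x,u,v})]$ and $J_m(t,x,\alpha,\beta)=J_m(t,x,u,v)$ for the pair $(u,v)$ associated with $(\alpha,\beta)$, $m=1,2$. Player I maximizes $J_1$, Player II maximizes $J_2$. The functions $U_1,U_2$ are (the limits exist and the two expressions coincide) $$U_1(t,x)=\lim_{|\pi|\to0}\inf_{\beta\in\mathcal B_1^\pi(t,T)}\sup_{\alpha\in\mathcal A_1^\pi(t,T)}J_1(t,x,\alpha,\beta)=\lim_{|\pi|\to0}\sup_{\alpha}\inf_{\beta}J_1(t,x,\alpha,\beta),$$ $$U_2(t,x)=\lim_{|\pi|\to0}\sup_{\beta\in\mathcal B_1^\pi(t,T)}\inf_{\alpha\in\mathcal A_1^\pi(t,T)}J_2(t,x,\alpha,\beta)=\lim_{|\pi|\to0}\inf_{\alpha}\sup_{\beta}J_2(t,x,\alpha,\beta),$$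 with $U_m(T,x)=g_m(x)$. Nash equilibrium payoff. $(e_1,e_2)\in\mathbb R^2$ is a Nash equilibrium payoff at $(t,x)$ if for any $\epsilon>0$ there exists $\delta_\epsilon>0$ such that for any partition $\pi$ of $[0,T]$ with $|\pi|\le\delta_\epsilon$ there exist $(\alpha^\epsilon,\beta^\epsilon)\in\mathcal A_1^\pi(t,T)\times\mathcal B_1^\pi(t,T)$ such that for all $(\alpha,\beta)\in\mathcal A_1^\pi(t,T)\times\mathcal B_1^\pi(t,T)$: $J_1(t,x,\alpha^\epsilon,\beta^\epsilon)\ge J_1(t,x,\alpha,\beta^\epsilon)-\epsilon$, $J_2(t,x,\alpha^\epsilon,\beta^\epsilon)\ge J_2(t,x,\alpha^\epsilon,\beta)-\epsilon$, and $|J_m(t,x,\alpha^\epsilon,\beta^\epsilon)-e_m|\le\epsilon$ for $m=1,2$. *)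

theory Defs
  imports "HOL-Probability.Probability"
begin

section \<open>Partitions\<close>

text \<open>A partition \<open>0 = t\<^sub>0 < \<dots> < t\<^sub>N = T\<close> is a pair of \<open>N\<close> and a function \<open>p\<close> with \<open>p j = t\<^sub>j\<close>;
  the values of \<open>p\<close> above \<open>N\<close> are never used.\<close>

definition time_partition :: "real \<Rightarrow> nat \<Rightarrow> (nat \<Rightarrow> real) \<Rightarrow> bool" where
  "time_partition T N p \<longleftrightarrow> 1 \<le> N \<and> p 0 = 0 \<and> p N = T \<and> strict_mono_on {..N} p"

definition mesh :: "nat \<Rightarrow> (nat \<Rightarrow> real) \<Rightarrow> real" where
  "mesh N p = Max ((\<lambda>j. p j - p (j - 1)) ` {1..N})"

definition mesh_to_0 :: "real \<Rightarrow> (nat \<times> (nat \<Rightarrow> real)) filter" where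
  "mesh_to_0 T = (INF \<delta>\<in>{0<..}. principal {(N, p). time_partition T N p \<and> mesh N p < \<delta>})"

text \<open>The index \<open>k\<close> with \<open>t \<in> [t\<^bsub>k-1\<^esub>, t\<^sub>k)\<close>.\<close>

definition cell :: "nat \<Rightarrow> (nat \<Rightarrow> real) \<Rightarrow> real \<Rightarrow> nat" where
  "cell N p t = (THE k. 1 \<le> k \<and> k \<le> N \<and> p (k - 1) \<le> t \<and> t < p k)"

section \<open>The probability space\<close>

definition paths :: "real \<Rightarrow> (real \<Rightarrow> real \<times> real) set" where
  "paths T = {w \<in> extensional {0..T}. continuous_on {0..T} w}"

text \<open>\<open>W\<close> is the (uncompleted) two-dimensional Wiener measure on the canonical space. The
  conditions determine \<open>W\<close>.\<close>

definition wiener_measure :: "real \<Rightarrow> (real \<Rightarrow> real \<times> real) measure \<Rightarrow> bool" where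
  "wiener_measure T W \<longleftrightarrow>
     prob_space W \<and>
     space W = paths T \<and>
     sets W = sets (restrict_space (Pi\<^sub>M {0..T} (\<lambda>_. borel)) (paths T)) \<and>
     (AE w in W. w 0 = 0) \<and>
     (\<forall>s r. 0 \<le> s \<and> s < r \<and> r \<le> T \<longrightarrow>
        distributed W lborel (\<lambda>w. w r - w s)
          (\<lambda>(a, b). ennreal (normal_density 0 (sqrt (r - s)) a * normal_density 0 (sqrt (r - s)) b))) \<and>
     (\<forall>n \<tau>. mono_on {..n} \<tau> \<and> \<tau> ` {..n} \<subseteq> {0..T} \<longrightarrow>
        prob_space.indep_vars W (\<lambda>_. borel) (\<lambda>j w. w (\<tau> (Suc j)) - w (\<tau> j)) {..<n})"

text \<open>A sample point consists of a path of \<open>(B\<^sup>1, B\<^sup>2)\<close> and of the values of the two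
  additional variables of index 0.\<close>

type_synonym sample = "(real \<Rightarrow> real \<times> real) \<times> (real \<times> real)"

definition Omega :: "real \<Rightarrow> sample set" where
  "Omega T = paths T \<times> UNIV"

definition wiener_ext :: "(real \<Rightarrow> real \<times> real) measure \<Rightarrow> sample measure" where
  "wiener_ext W =
     completion (W \<Otimes>\<^sub>M (uniform_measure lborel {0..1} \<Otimes>\<^sub>M uniform_measure lborel {0..1}))"

definition BM :: "real \<Rightarrow> sample \<Rightarrow> real \<times> real" where
  "BM r \<omega> = fst \<omega> r"

definition Phi01 :: "real \<Rightarrow> real" where
  "Phi01 = cdf (density lborel (\<lambda>x. ennreal (std_normal_density x)))"

text \<open>The pair \<open>\<zeta>\<^sub>j = (\<zeta>\<^bsub>1,j\<^esub>, \<zeta>\<^bsub>2,j\<^esub>)\<close>; player I observes \<open>fst\<close>, player II observes \<open>snd\<close>.\<close>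

definition zeta :: "(nat \<Rightarrow> real) \<Rightarrow> nat \<Rightarrow> sample \<Rightarrow> real \<times> real" where
  "zeta p j \<omega> =
     (if j = 0 then snd \<omega>
      else (Phi01 ((fst (BM (p j) \<omega>) - fst (BM (p (j - 1)) \<omega>)) / sqrt (p j - p (j - 1))),
            Phi01 ((snd (BM (p j) \<omega>) - snd (BM (p (j - 1)) \<omega>)) / sqrt (p j - p (j - 1)))))"

definition Fil :: "sample measure \<Rightarrow> real \<Rightarrow> real \<Rightarrow> sample measure" where
  "Fil P t s = sigma (space P)
     ({(\<lambda>\<omega>. BM r \<omega> - BM t \<omega>) -` A \<inter> space P | r A. r \<in> {t..s} \<and> A \<in> sets borel} \<union> null_sets P)"

text \<open>\<open>\<F>\<close> with the formal initial index \<open>t\<^bsub>-1\<^esub>\<close> and final time \<open>s\<close>.\<close>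

definition Fil0 :: "sample measure \<Rightarrow> real \<Rightarrow> sample measure" where
  "Fil0 P s = sigma (space P)
     ({snd -` A \<inter> space P | A. A \<in> sets borel} \<union>
      {BM r -` A \<inter> space P | r A. r \<in> {0..s} \<and> A \<in> sets borel} \<union> null_sets P)"

text \<open>\<open>Fil_idx P p a b\<close> is the \<open>\<sigma>\<close>-field with the time indices \<open>t\<^sub>a\<close>, \<open>t\<^sub>b\<close>, where \<open>-1 \<le> a \<le> b\<close> are
  integers since \<open>t\<^bsub>-1\<^esub>\<close> is a formal symbol.\<close>

definition Fil_idx :: "sample measure \<Rightarrow> (nat \<Rightarrow> real) \<Rightarrow> int \<Rightarrow> int \<Rightarrow> sample measure" where
  "Fil_idx P p a b =
     (if 0 \<le> a then Fil P (p (nat a)) (p (nat b))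
      else if 0 \<le> b then Fil0 P (p (nat b))
      else sigma (space P) (null_sets P))"

section \<open>Deterministic controls and the dynamics\<close>

text \<open>The space of Lebesgue measurable functions on \<open>[t, T]\<close> with the Borel \<open>\<sigma>\<close>-field of
  convergence in Lebesgue measure. It consists of representatives instead of a.e. classes; all the
  generating open sets are invariant under a.e. equality, so the measurable sets (and the measurable
  maps into a metric space) are those of the quotient. The sets
  \<open>{w. \<lambda>{dist v w > e} < e}\<close>, \<open>e > 0\<close>, form a base of neighbourhoods of \<open>v\<close>.\<close>

definition ctrl_space :: "real \<Rightarrow> real \<Rightarrow> (real \<Rightarrow> 'a::metric_space) measure" where
  "ctrl_space t T = sigma (borel_measurable (lebesgue_on {t..T}))
     {S. S \<subseteq> borel_measurable (lebesgue_on {t..T}) \<and>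
         (\<forall>v\<in>S. \<exists>e>0. \<forall>w\<in>borel_measurable (lebesgue_on {t..T}).
            measure lebesgue {s \<in> {t..T}. dist (v s) (w s) > e} < e \<longrightarrow> w \<in> S)}"

definition solves :: "(real^'n \<Rightarrow> 'u \<Rightarrow> 'v \<Rightarrow> real^'n) \<Rightarrow> real \<Rightarrow> real \<Rightarrow> real^'n \<Rightarrow>
    (real \<Rightarrow> 'u) \<Rightarrow> (real \<Rightarrow> 'v) \<Rightarrow> (real \<Rightarrow> real^'n) \<Rightarrow> bool" where
  "solves f t T x u v X \<longleftrightarrow>
     set_integrable lebesgue {t..T} (\<lambda>r. f (X r) (u r) (v r)) \<and>
     (\<forall>s\<in>{t..T}. X s = x + (LINT r:{t..s}|lebesgue. f (X r) (u r) (v r)))"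

definition traj :: "(real^'n \<Rightarrow> 'u \<Rightarrow> 'v \<Rightarrow> real^'n) \<Rightarrow> real \<Rightarrow> real \<Rightarrow> real^'n \<Rightarrow>
    (real \<Rightarrow> 'u) \<Rightarrow> (real \<Rightarrow> 'v) \<Rightarrow> real \<Rightarrow> real^'n" where
  "traj f t T x u v = (THE X. X \<in> extensional {t..T} \<and> solves f t T x u v X)"

section \<open>Strategies and random controls\<close>

text \<open>The first argument \<open>(\<zeta>\<^bsub>k-1\<^esub>, \<dots>, \<zeta>\<^bsub>l-2\<^esub>, \<zeta>\<^bsub>i,l-1\<^esub>)\<close> of \<open>\<alpha>\<^sub>l\<close>; the space \<open>\<real>\<^bsup>2(l-k)+1\<^esup>\<close> is
  written as \<open>(\<real>\<^sup>2)\<^bsup>{k-1..<l-1}\<^esup> \<times> \<real>\<close>. The projection \<open>sel\<close> is \<open>fst\<close> for player I and \<open>snd\<close>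
  for player II.\<close>

definition signal_space :: "nat \<Rightarrow> nat \<Rightarrow> ((nat \<Rightarrow> real \<times> real) \<times> real) measure" where
  "signal_space k l = Pi\<^sub>M {k - 1..<l - 1} (\<lambda>_. borel) \<Otimes>\<^sub>M borel"

definition signal :: "(real \<times> real \<Rightarrow> real) \<Rightarrow> (nat \<Rightarrow> real) \<Rightarrow> nat \<Rightarrow> nat \<Rightarrow> sample \<Rightarrow>
    (nat \<Rightarrow> real \<times> real) \<times> real" where
  "signal sel p k l \<omega> = ((\<lambda>j\<in>{k - 1..<l - 1}. zeta p j \<omega>), sel (zeta p (l - 1) \<omega>))"

text \<open>\<open>strategies fst\<close> with \<open>'a\<close> the control space of player I and \<open>'b\<close> that of player II is
  \<open>\<A>\<^sub>1\<close>, and \<open>strategies snd\<close> with the roles exchanged is \<open>\<B>\<^sub>1\<close>. The values \<open>\<alpha> \<omega> v s\<close> for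
  \<open>s\<close> outside \<open>[t, T)\<close> are irrelevant, as functions on \<open>[t, T]\<close> are identified a.e.\<close>

definition strategies :: "(real \<times> real \<Rightarrow> real) \<Rightarrow> real \<Rightarrow> nat \<Rightarrow> (nat \<Rightarrow> real) \<Rightarrow> real \<Rightarrow>
    (sample \<Rightarrow> (real \<Rightarrow> 'b::metric_space) \<Rightarrow> real \<Rightarrow> 'a::metric_space) set" where
  "strategies sel T N p t = {\<alpha>. \<exists>a. \<forall>l\<in>{cell N p t..N}.
     (\<lambda>(y, s, v). a l y v s) \<in> borel_measurable
        (signal_space (cell N p t) l \<Otimes>\<^sub>M
         (restrict_space borel {max t (p (l - 1))..p l} \<Otimes>\<^sub>M ctrl_space t T)) \<and>
     (\<forall>v\<in>space (ctrl_space t T). \<forall>v'\<in>space (ctrl_space t T).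
        (AE s in lebesgue_on {t..p (l - 1)}. v s = v' s) \<longrightarrow>
        (\<forall>y\<in>space (signal_space (cell N p t) l).
           AE s in lebesgue_on {max t (p (l - 1))..p l}. a l y v s = a l y v' s)) \<and>
     (\<forall>\<omega>\<in>Omega T. \<forall>v\<in>space (ctrl_space t T). \<forall>s\<in>{max t (p (l - 1))..<p l}.
        \<alpha> \<omega> v s = a l (signal sel p (cell N p t) l \<omega>) v s)}"

text \<open>Similarly, \<open>\<U>\<^bsup>\<pi>,1\<^esup>\<close> is \<open>controls fst\<close> and \<open>\<V>\<^bsup>\<pi>,1\<^esup>\<close> is \<open>controls snd\<close>.\<close>

definition controls :: "(real \<times> real \<Rightarrow> real) \<Rightarrow> real \<Rightarrow> nat \<Rightarrow> (nat \<Rightarrow> real) \<Rightarrow> real \<Rightarrow>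
    (sample \<Rightarrow> real \<Rightarrow> 'a::metric_space) set" where
  "controls sel T N p t = {u. \<exists>a. \<forall>l\<in>{cell N p t..N}.
     (\<lambda>(y, s). a l y s) \<in> borel_measurable
        (signal_space (cell N p t) l \<Otimes>\<^sub>M restrict_space borel {max t (p (l - 1))..p l}) \<and>
     (\<forall>\<omega>\<in>Omega T. \<forall>s\<in>{max t (p (l - 1))..<p l}.
        u \<omega> s = a l (signal sel p (cell N p t) l \<omega>) s)}"

definition associated :: "real \<Rightarrow> nat \<Rightarrow> (nat \<Rightarrow> real) \<Rightarrow> real \<Rightarrow>
    (sample \<Rightarrow> (real \<Rightarrow> 'v::metric_space) \<Rightarrow> real \<Rightarrow> 'u::metric_space) \<Rightarrow>
    (sample \<Rightarrow> (real \<Rightarrow> 'u) \<Rightarrow> real \<Rightarrow> 'v) \<Rightarrow>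
    (sample \<Rightarrow> real \<Rightarrow> 'u) \<Rightarrow> (sample \<Rightarrow> real \<Rightarrow> 'v) \<Rightarrow> bool" where
  "associated T N p t \<alpha> \<beta> u v \<longleftrightarrow>
     u \<in> controls fst T N p t \<and> v \<in> controls snd T N p t \<and>
     (\<forall>\<omega>\<in>Omega T. (AE s in lebesgue_on {t..T}. \<alpha> \<omega> (v \<omega>) s = u \<omega> s) \<and>
                   (AE s in lebesgue_on {t..T}. \<beta> \<omega> (u \<omega>) s = v \<omega> s))"

section \<open>Payoffs\<close>

definition payoff :: "sample measure \<Rightarrow> (real^'n \<Rightarrow> 'u \<Rightarrow> 'v \<Rightarrow> real^'n) \<Rightarrow> (real^'n \<Rightarrow> real) \<Rightarrow>
    real \<Rightarrow> real \<Rightarrow> real^'n \<Rightarrow> (sample \<Rightarrow> real \<Rightarrow> 'u) \<Rightarrow> (sample \<Rightarrow> real \<Rightarrow> 'v) \<Rightarrow> real" where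
  "payoff P f g T t x u v = (LINT \<omega>|P. g (traj f t T x (u \<omega>) (v \<omega>) T))"

text \<open>The associated pair is unique only up to a.e. equality in \<open>s\<close>, hence the definite description
  is over its payoff.\<close>

definition spayoff :: "sample measure \<Rightarrow> (real^'n \<Rightarrow> 'u::metric_space \<Rightarrow> 'v::metric_space \<Rightarrow> real^'n) \<Rightarrow>
    (real^'n \<Rightarrow> real) \<Rightarrow> real \<Rightarrow> nat \<Rightarrow> (nat \<Rightarrow> real) \<Rightarrow> real \<Rightarrow> real^'n \<Rightarrow>
    (sample \<Rightarrow> (real \<Rightarrow> 'v) \<Rightarrow> real \<Rightarrow> 'u) \<Rightarrow> (sample \<Rightarrow> (real \<Rightarrow> 'u) \<Rightarrow> real \<Rightarrow> 'v) \<Rightarrow> real" where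
  "spayoff P f g T N p t x \<alpha> \<beta> =
     (THE r. \<exists>u v. associated T N p t \<alpha> \<beta> u v \<and> r = payoff P f g T t x u v)"

definition nash_payoff :: "sample measure \<Rightarrow>
    (real^'n \<Rightarrow> 'u::metric_space \<Rightarrow> 'v::metric_space \<Rightarrow> real^'n) \<Rightarrow>
    (nat \<Rightarrow> real^'n \<Rightarrow> real) \<Rightarrow> real \<Rightarrow> real \<Rightarrow> real^'n \<Rightarrow> (nat \<Rightarrow> real) \<Rightarrow> bool" where
  "nash_payoff P f g T t x e \<longleftrightarrow>
     (\<forall>\<epsilon>>0. \<exists>\<delta>>0. \<forall>N p. time_partition T N p \<and> mesh N p \<le> \<delta> \<longrightarrow>
       (\<exists>\<alpha>\<^sub>\<epsilon>\<in>strategies fst T N p t. \<exists>\<beta>\<^sub>\<epsilon>\<in>strategies snd T N p t.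
          (\<forall>\<alpha>\<in>strategies fst T N p t. \<forall>\<beta>\<in>strategies snd T N p t.
             spayoff P f (g 1) T N p t x \<alpha>\<^sub>\<epsilon> \<beta>\<^sub>\<epsilon> \<ge> spayoff P f (g 1) T N p t x \<alpha> \<beta>\<^sub>\<epsilon> - \<epsilon> \<and>
             spayoff P f (g 2) T N p t x \<alpha>\<^sub>\<epsilon> \<beta>\<^sub>\<epsilon> \<ge> spayoff P f (g 2) T N p t x \<alpha>\<^sub>\<epsilon> \<beta> - \<epsilon>) \<and>
          (\<forall>m\<in>{1, 2}. \<bar>spayoff P f (g m) T N p t x \<alpha>\<^sub>\<epsilon> \<beta>\<^sub>\<epsilon> - e m\<bar> \<le> \<epsilon>)))"

text \<open>\<open>U 1\<close> and \<open>U 2\<close> are the functions \<open>U\<^sub>1\<close>, \<open>U\<^sub>2\<close>: each of them is the common limit of its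
  two defining expressions.\<close>

definition value_functions :: "sample measure \<Rightarrow>
    (real^'n \<Rightarrow> 'u::metric_space \<Rightarrow> 'v::metric_space \<Rightarrow> real^'n) \<Rightarrow>
    (nat \<Rightarrow> real^'n \<Rightarrow> real) \<Rightarrow> real \<Rightarrow> (nat \<Rightarrow> real \<Rightarrow> real^'n \<Rightarrow> real) \<Rightarrow> bool" where
  "value_functions P f g T U \<longleftrightarrow>
     (\<forall>t\<in>{0..<T}. \<forall>x.
        ((\<lambda>(N, p). INF \<beta>\<in>strategies snd T N p t. SUP \<alpha>\<in>strategies fst T N p t.
            spayoff P f (g 1) T N p t x \<alpha> \<beta>) \<longlongrightarrow> U 1 t x) (mesh_to_0 T) \<and>
        ((\<lambda>(N, p). SUP \<alpha>\<in>strategies fst T N p t. INF \<beta>\<in>strategies snd T N p t.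
            spayoff P f (g 1) T N p t x \<alpha> \<beta>) \<longlongrightarrow> U 1 t x) (mesh_to_0 T) \<and>
        ((\<lambda>(N, p). SUP \<beta>\<in>strategies snd T N p t. INF \<alpha>\<in>strategies fst T N p t.
            spayoff P f (g 2) T N p t x \<alpha> \<beta>) \<longlongrightarrow> U 2 t x) (mesh_to_0 T) \<and>
        ((\<lambda>(N, p). INF \<alpha>\<in>strategies fst T N p t. SUP \<beta>\<in>strategies snd T N p t.
            spayoff P f (g 2) T N p t x \<alpha> \<beta>) \<longlongrightarrow> U 2 t x) (mesh_to_0 T)) \<and>
     (\<forall>m\<in>{1, 2}. \<forall>x. U m T x = g m x)"

end

theory Submission
  imports Defs
begin

text \<open>
  The equivalence is proved for a game in which the Wiener space does not occur any more. Seen from the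
  initial time \<open>t\<close>, the variables \<open>\<zeta>\<close> from the current cell on are independent pairs of independent uniform
  variables. So strategies and controls become measurable functions of a sequence of such pairs, played on a
  grid \<open>t = ts 0 < \<dots> < ts n = T\<close> (\<open>noise_game\<close>, \<open>rstrat\<close>, \<open>rctrl\<close>). At each stage a strategy depends on the
  past pairs, on one component of the current pair and on what the opponent did before the stage. Hence two
  strategies determine a play, stage by stage (\<open>plays_exists\<close>, \<open>plays_unique\<close>). Of the functions \<open>U\<^sub>1\<close>, \<open>U\<^sub>2\<close> only
  the following is used: on fine grids, each side can keep the expected payoff on its side of the value up to
  \<open>\<epsilon>\<close> (\<open>game_value\<close>). From this the value inherits Lipschitz continuity in time and space (\<open>value_lipschitz\<close>), so
  that one bound on the steps serves all initial states in a ball (\<open>uniformly_secures\<close>), and securing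
  strategies can be chosen measurably in the state (\<open>measurable_secure_selection\<close>). This makes them usable
  after any stage, from the random state that has been reached.

  Let \<open>(a, b)\<close> be a near-equilibrium, and suppose that after some stage the conditional expected payoff of a player
  is below the value of the current state by more than \<open>\<epsilon>\<close> with probability larger than \<open>\<epsilon>\<close>. The player knows when
  this happens and could switch then to a strategy that secures the value, with a gain of at least the order
  \<open>\<epsilon>\<^sup>2\<close>, which is impossible if the equilibrium is good enough (\<open>equilibrium_continues\<close>).

  Conversely, let \<open>(u, v)\<close> be controls for which the conditional expected payoffs are almost never below the
  value. Each player plays their control as long as the opponent does, and after a deviation, from the next
  grid time on, holds the opponent down to the opponent's value (\<open>punishment\<close>). The deviation is unnoticed only
  during one short stage, so it brings the opponent about the value of the current state at most, while
  the play \<open>(u, v)\<close> promises at least that value, except on the event that the condition fails. At every grid time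
  this event has small probability, but the number of grid times is not bounded. Therefore the condition is used at
  boundedly many selected times only, one of which follows soon after any deviation (\<open>coarse_times\<close>).

  The translation rests on two facts about Brownian motion. The normal quantile of a normalized increment is
  uniformly distributed (\<open>Phi01_uniform\<close>), and the increments of the future are independent of the past, so that a
  conditional expectation is an average over the future pairs with the past ones fixed (\<open>signals_cond_exp\<close>).

  Measurability needs some care, because controls are identified almost everywhere. The space of controls is
  separable, and a representative of a control can be chosen such that its value at a time is a measurable
  function of the time and of the control (\<open>controls_separable\<close>, \<open>canonical_control\<close>).
\<close>

section \<open>Borel functions with values in a compact metric space\<close>

text \<open>The control sets carry only the class of metric spaces, while measurability of pairs and of
  distances needs a countable base of the topology. Compactness supplies it: for every \<open>n\<close> finitely
  many balls of radius \<open>1 / (n + 1)\<close> cover the space.\<close>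

lemma compact_countable_basis:
  assumes "compact (UNIV :: 'a::metric_space set)"
  obtains B :: "'a::metric_space set set" where "countable B" "topological_basis B"
proof -
  have "\<forall>n. \<exists>D. finite D \<and> (\<forall>x::'a. \<exists>d\<in>D. dist d x < 1 / real (Suc n))"
  proof
    fix n
    have "(UNIV::'a set) \<subseteq> (\<Union>d\<in>UNIV. ball d (1 / real (Suc n)))" by auto
    then obtain D where "finite D" "(UNIV::'a set) \<subseteq> (\<Union>d\<in>D. ball d (1 / real (Suc n)))"
      using assms by (auto elim!: compactE_image[where C=UNIV and f="\<lambda>d. ball d (1 / real (Suc n))"])
    then show "\<exists>D. finite D \<and> (\<forall>x::'a. \<exists>d\<in>D. dist d x < 1 / real (Suc n))"
      by (intro exI[of _ D]) (auto simp: mem_ball subset_iff)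
  qed
  then obtain D where fin: "\<And>n. finite (D n)"
    and D: "\<And>n (x::'a). \<exists>d\<in>D n. dist d x < 1 / real (Suc n)" by metis
  let ?B = "\<Union>n. (\<lambda>d. ball d (1 / real (Suc n))) ` D n"
  have "countable ?B" using fin by (intro countable_UN[OF _ countable_image[OF countable_finite]]) simp_all
  moreover have "topological_basis ?B"
  proof (rule topological_basisI)
    fix b assume "b \<in> ?B" then show "open b" by auto
  next
    fix O' :: "'a set" and x assume "open O'" "x \<in> O'"
    then obtain e where e: "e > 0" "ball x e \<subseteq> O'" by (meson openE)
    obtain n where n: "1 / real (Suc n) < e / 2"
      using e(1) by (meson half_gt_zero nat_approx_posE)
    obtain d where d: "d \<in> D n" "dist d x < 1 / real (Suc n)" using D by blast
    have "ball d (1 / real (Suc n)) \<subseteq> ball x e"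
    proof
      fix y assume "y \<in> ball d (1 / real (Suc n))"
      then have "dist d y < 1 / real (Suc n)" by simp
      moreover have "dist x y \<le> dist d x + dist d y" by (metis dist_commute dist_triangle)
      ultimately show "y \<in> ball x e" using n d(2) by (simp only: mem_ball)
    qed
    then show "\<exists>B'\<in>?B. x \<in> B' \<and> B' \<subseteq> O'"
      using d e(2) by (intro bexI[of _ "ball d (1 / real (Suc n))"]) auto
  qed
  ultimately show ?thesis using that by blast
qed

lemma borel_measurable_Pair_basis:
  fixes f :: "'m => 'a::topological_space" and g :: "'m => 'b::topological_space"
  assumes A: "countable (A :: 'a set set)" "topological_basis A" and B: "countable (B :: 'b set set)" "topological_basis B"
    and f[measurable]: "f \<in> borel_measurable M" and g[measurable]: "g \<in> borel_measurable M"
  shows "(\<lambda>x. (f x, g x)) \<in> borel_measurable M"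
proof (rule borel_measurableI)
  fix S :: "('a \<times> 'b) set" assume "open S"
  let ?I = "{(a, b) \<in> A \<times> B. a \<times> b \<subseteq> S}"
  have "?I \<subseteq> A \<times> B" by auto
  then have cI: "countable ?I" by (rule countable_subset) (intro countable_SIGMA A(1) B(1))
  have op: "open a" if "a \<in> A" for a using A(2) that topological_basis_open by blast
  have op': "open b" if "b \<in> B" for b using B(2) that topological_basis_open by blast
  have "(\<lambda>x. (f x, g x)) -` S \<inter> space M = (\<Union>(a, b)\<in>?I. (f -` a \<inter> space M) \<inter> (g -` b \<inter> space M))"
  proof safe
    fix x assume x: "(f x, g x) \<in> S" "x \<in> space M"
    obtain U V where "open U" "open V" "(f x, g x) \<in> U \<times> V" "U \<times> V \<subseteq> S"
      using \<open>open S\<close> x(1) by (rule open_prod_elim)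
    moreover obtain a where "a \<in> A" "f x \<in> a" "a \<subseteq> U"
      using A(2) \<open>open U\<close> \<open>(f x, g x) \<in> U \<times> V\<close> by (elim topological_basisE) auto
    moreover obtain b where "b \<in> B" "g x \<in> b" "b \<subseteq> V"
      using B(2) \<open>open V\<close> \<open>(f x, g x) \<in> U \<times> V\<close> by (elim topological_basisE) auto
    ultimately have ab: "(a, b) \<in> ?I" "f x \<in> a" "g x \<in> b" by (simp, blast, blast, blast)
    show "x \<in> (\<Union>(a, b)\<in>?I. (f -` a \<inter> space M) \<inter> (g -` b \<inter> space M))"
      using x(2) ab(2,3) by (intro UN_I[OF ab(1)]) simp
  qed auto
  also have "\<dots> \<in> sets M"
    by (intro sets.countable_UN'[OF cI]) (auto intro!: sets.Int measurable_sets[OF f] measurable_sets[OF g] borel_open op op')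
  finally show "(\<lambda>x. (f x, g x)) -` S \<inter> space M \<in> sets M" .
qed

lemma borel_measurable_Pair_compact:
  fixes f :: "'m => 'a::metric_space" and g :: "'m => 'b::metric_space"
  assumes "compact (UNIV :: 'a set)" "compact (UNIV :: 'b set)"
    and "f \<in> borel_measurable M" "g \<in> borel_measurable M"
  shows "(\<lambda>x. (f x, g x)) \<in> borel_measurable M"
proof -
  obtain A :: "'a set set" where "countable A" "topological_basis A"
    using compact_countable_basis[OF assms(1)] by blast
  moreover obtain B :: "'b set set" where "countable B" "topological_basis B"
    using compact_countable_basis[OF assms(2)] by blast
  ultimately show ?thesis using borel_measurable_Pair_basis assms(3,4) by blast
qed

lemma borel_measurable_dist_compact:
  fixes f g :: "'m => 'a::metric_space"
  assumes "compact (UNIV :: 'a set)" "f \<in> borel_measurable M" "g \<in> borel_measurable M"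
  shows "(\<lambda>x. dist (f x) (g x)) \<in> borel_measurable M"
proof -
  have "continuous_on UNIV (\<lambda>z::'a \<times> 'a. dist (fst z) (snd z))" by (intro continuous_intros)
  from borel_measurable_continuous_on[OF this borel_measurable_Pair_compact[OF assms(1,1,2,3)]]
  show ?thesis by simp
qed

section \<open>The space of controls\<close>

abbreviation ctrls :: "real => real => (real => 'a::metric_space) set" where
  "ctrls t T \<equiv> space (ctrl_space t T)"

text \<open>\<open>discrep t T v w e\<close> is the measure of the set on which \<open>v\<close> and \<open>w\<close> differ by more than \<open>e\<close>.
  The sets \<open>{w. discrep t T v w e < e}\<close> are the basic neighbourhoods of \<open>v\<close> for convergence in
  measure.\<close>

definition discrep :: "real => real => (real => 'a::metric_space) => (real => 'a) => real => real" where
  "discrep t T v w e = measure lebesgue {s \<in> {t..T}. dist (v s) (w s) > e}"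

lemma space_ctrl: "ctrls t T = borel_measurable (lebesgue_on {t..T})"
  unfolding ctrl_space_def by (rule space_measure_of) auto

lemma ctrl_space_generator:
  "sets (ctrl_space t T) = sigma_sets (ctrls t T)
     {S. S \<subseteq> ctrls t T \<and>
         (\<forall>v\<in>S. \<exists>e>0. \<forall>w\<in>ctrls t T. discrep t T v w e < e --> w \<in> S)}"
  unfolding space_ctrl unfolding ctrl_space_def discrep_def by (rule sets_measure_of) auto

lemma measurable_into_ctrl_space:
  assumes "f \<in> space M \<rightarrow> ctrls t T"
    and "\<And>S. S \<subseteq> ctrls t T ==>
      (\<forall>v\<in>S. \<exists>e>0. \<forall>w\<in>ctrls t T. discrep t T v w e < e --> w \<in> S) ==>
      f -` S \<inter> space M \<in> sets M"
  shows "f \<in> measurable M (ctrl_space t T)"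
  using assms by (intro measurable_sigma_sets[OF ctrl_space_generator]) auto

lemma ctrl_openI:
  assumes "S \<subseteq> ctrls t T"
    "\<And>v. v \<in> S ==> \<exists>e>0. \<forall>w\<in>ctrls t T. discrep t T v w e < e --> w \<in> S"
  shows "S \<in> sets (ctrl_space t T)"
  unfolding ctrl_space_generator using assms by (intro sigma_sets.Basic) auto

text \<open>A map that does not increase discrepancies is continuous; restricting a control to a later
  interval and prefixing it with a fixed control are such maps.\<close>

lemma ctrl_nonexpansive_measurable:
  fixes \<phi> :: "(real => 'a::metric_space) => real => 'b::metric_space"
  assumes sp: "\<And>v. v \<in> ctrls t T ==> \<phi> v \<in> ctrls t' T'"
    and le: "\<And>v w e. v \<in> ctrls t T ==> w \<in> ctrls t T ==> e > 0 ==>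
      discrep t' T' (\<phi> v) (\<phi> w) e \<le> discrep t T v w e"
  shows "\<phi> \<in> measurable (ctrl_space t T) (ctrl_space t' T')"
proof (rule measurable_into_ctrl_space)
  show "\<phi> \<in> ctrls t T \<rightarrow> ctrls t' T'" using sp by auto
  fix S :: "(real => 'b) set" assume S: "\<forall>v\<in>S. \<exists>e>0. \<forall>w\<in>ctrls t' T'. discrep t' T' v w e < e --> w \<in> S"
  show "\<phi> -` S \<inter> ctrls t T \<in> sets (ctrl_space t T)"
  proof (rule ctrl_openI)
    fix v assume v: "v \<in> \<phi> -` S \<inter> ctrls t T"
    then obtain e where "e > 0" "\<forall>w\<in>ctrls t' T'. discrep t' T' (\<phi> v) w e < e --> w \<in> S"
      using S by auto
    then show "\<exists>e>0. \<forall>w\<in>ctrls t T. discrep t T v w e < e --> w \<in> \<phi> -` S \<inter> ctrls t T"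
      using v sp le by (intro exI[of _ e]) (force intro: le_less_trans)
  qed auto
qed

lemma discrep_set_measurable:
  fixes v w :: "real => 'a::metric_space"
  assumes "compact (UNIV :: 'a set)" "v \<in> ctrls t T" "w \<in> ctrls t T"
  shows "{s \<in> {t..T}. dist (v s) (w s) > e} \<in> lmeasurable"
proof -
  have [measurable]: "(\<lambda>s. dist (v s) (w s)) \<in> borel_measurable (lebesgue_on {t..T})"
    using assms borel_measurable_dist_compact unfolding space_ctrl by blast
  have "{s \<in> space (lebesgue_on {t..T}). dist (v s) (w s) > e} \<in> sets (lebesgue_on {t..T})"
    by measurable
  then have "{s \<in> {t..T}. dist (v s) (w s) > e} \<in> sets lebesgue"
    by (simp add: sets_restrict_space_iff)
  then show ?thesis
    by (intro fmeasurableI2[OF lmeasurable_interval(1)[of t T]]) auto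
qed

lemmas discrep_set_sets = discrep_set_measurable[THEN fmeasurableD]

lemma discrep_triangle:
  fixes u v w :: "real => 'a::metric_space"
  assumes "compact (UNIV :: 'a set)" "u \<in> ctrls t T" "v \<in> ctrls t T"
    "w \<in> ctrls t T"
  shows "discrep t T u w (d + e) \<le> discrep t T u v d + discrep t T v w e"
proof -
  have "discrep t T u w (d + e) \<le> measure lebesgue
     ({s \<in> {t..T}. dist (u s) (v s) > d} \<union> {s \<in> {t..T}. dist (v s) (w s) > e})"
    unfolding discrep_def
  proof (rule measure_mono_fmeasurable)
    show "{s \<in> {t..T}. d + e < dist (u s) (w s)}
      \<subseteq> {s \<in> {t..T}. dist (u s) (v s) > d} \<union> {s \<in> {t..T}. dist (v s) (w s) > e}"
    proof
      fix s assume "s \<in> {s \<in> {t..T}. d + e < dist (u s) (w s)}"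
      moreover have "dist (u s) (w s) \<le> dist (u s) (v s) + dist (v s) (w s)" by (rule dist_triangle)
      ultimately show "s \<in> {s \<in> {t..T}. dist (u s) (v s) > d} \<union> {s \<in> {t..T}. dist (v s) (w s) > e}"
        by auto
    qed
    show "{s \<in> {t..T}. d + e < dist (u s) (w s)} \<in> sets lebesgue"
      by (rule discrep_set_sets[OF assms(1,2,4)])
    show "{s \<in> {t..T}. dist (u s) (v s) > d} \<union> {s \<in> {t..T}. dist (v s) (w s) > e} \<in> lmeasurable"
      by (intro fmeasurable.Un discrep_set_measurable[OF assms(1,2,3)] discrep_set_measurable[OF assms(1,3,4)])
  qed
  also have "\<dots> \<le> discrep t T u v d + discrep t T v w e"
    unfolding discrep_def
    by (intro measure_Un_le discrep_set_sets[OF assms(1,2,3)] discrep_set_sets[OF assms(1,3,4)])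
  finally show ?thesis .
qed

lemma discrep_mono:
  fixes v w :: "real => 'a::metric_space"
  assumes "compact (UNIV :: 'a set)" "v \<in> ctrls t T" "w \<in> ctrls t T" "d \<le> e"
  shows "discrep t T v w e \<le> discrep t T v w d"
  unfolding discrep_def
  by (rule measure_mono_fmeasurable[OF _ discrep_set_sets[OF assms(1-3)] discrep_set_measurable[OF assms(1-3)]])
    (use assms(4) in auto)

lemma borel_in_ctrl: "v \<in> borel_measurable borel ==> v \<in> ctrls t T"
  unfolding space_ctrl by (intro measurable_restrict_space1 measurable_completion) simp

section \<open>Measurable families of controls\<close>

text \<open>Step functions given by a list of sets and values; the first set that contains the point
  decides, so the sets need not be disjoint. They form a countable dense set of controls once sets
  and values are taken from countable dense families.\<close>

fun pick :: "(real set \<times> 'a) list => 'a => real => 'a" where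
  "pick [] d s = d"
| "pick ((B, c) # L) d s = (if s \<in> B then c else pick L d s)"

lemma pick_borel: "(\<And>B c. (B, c) \<in> set L ==> B \<in> sets borel) ==> pick L d \<in> borel_measurable borel"
proof (induction L)
  case Nil
  have "pick [] d = (\<lambda>s. d)" by (rule ext) simp
  then show ?case by simp
next
  case (Cons a L)
  obtain B c where a: "a = (B, c)" by (cases a)
  have "pick L d \<in> borel_measurable borel" using Cons.IH Cons.prems by (meson list.set_intros(2))
  moreover have "B \<in> sets borel" using Cons.prems a by auto
  moreover have "pick (a # L) d = (\<lambda>s. if s \<in> B then c else pick L d s)"
    by (rule ext) (simp add: a)
  ultimately show ?case by simp
qed

lemma finite_interval_unions_approximate:
  obtains \<A> :: "real set set" where "countable \<A>" "\<A> \<subseteq> sets borel"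
    "\<And>A t T \<epsilon>. A \<in> sets lebesgue ==> A \<subseteq> {t..T} ==> \<epsilon> > 0 ==>
      \<exists>B\<in>\<A>. emeasure lebesgue (sym_diff A B) < ennreal \<epsilon>"
proof -
  obtain B :: "real set set" where B: "countable B" "topological_basis B"
    using ex_countable_basis by blast
  let ?A = "Union ` {F. finite F \<and> F \<subseteq> B}"
  have "countable ?A" using countable_Collect_finite_subset[OF B(1)] by (intro countable_image) simp
  moreover have "?A \<subseteq> sets borel"
  proof
    fix X assume "X \<in> ?A"
    then obtain F where "F \<subseteq> B" "X = \<Union>F" by auto
    then have "open X" using topological_basis_open[OF B(2)] by blast
    then show "X \<in> sets borel" by simp
  qed
  moreover have "\<exists>X\<in>?A. emeasure lebesgue (sym_diff A X) < ennreal \<epsilon>"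
    if A: "A \<in> sets lebesgue" "A \<subseteq> {t..T}" and e: "\<epsilon> > 0" for A t T \<epsilon>
  proof -
    have e2: "\<epsilon> / 2 > 0" using e by simp
    obtain O' where O': "open O'" "A \<subseteq> O'" "O' - A \<in> lmeasurable" "emeasure lebesgue (O' - A) < ennreal (\<epsilon>/2)"
      using sets_lebesgue_outer_open[OF A(1) e2] by blast
    obtain K where K: "closed K" "K \<subseteq> A" "A - K \<in> lmeasurable" "emeasure lebesgue (A - K) < ennreal (\<epsilon>/2)"
      using sets_lebesgue_inner_closed[OF A(1) e2] by blast
    have "K \<subseteq> {t..T}" using K A by blast
    then have cK: "compact K" using K(1) by (meson bounded_subset bounded_closed_interval compact_eq_bounded_closed)
    let ?C = "{b \<in> B. b \<subseteq> O'}"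
    have cov: "K \<subseteq> \<Union>?C"
    proof
      fix x assume "x \<in> K"
      then have "x \<in> O'" using K(2) O'(2) by blast
      then obtain b where "b \<in> B" "x \<in> b" "b \<subseteq> O'" using topological_basisE[OF B(2) O'(1)] by metis
      then show "x \<in> \<Union>?C" by blast
    qed
    have op: "open b" if "b \<in> ?C" for b using that topological_basis_open[OF B(2)] by blast
    obtain F where F: "F \<subseteq> ?C" "finite F" "K \<subseteq> \<Union>F"
      using compactE[OF cK cov op] by blast
    have oF: "open (\<Union>F)" using F(1) topological_basis_open[OF B(2)] by blast
    have sub: "sym_diff A (\<Union>F) \<subseteq> (A - K) \<union> (O' - A)" using F by blast
    have "emeasure lebesgue (sym_diff A (\<Union>F)) \<le> emeasure lebesgue ((A - K) \<union> (O' - A))"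
      using sub K(3) O'(3) by (intro emeasure_mono) (auto dest: fmeasurableD)
    also have "\<dots> \<le> emeasure lebesgue (A - K) + emeasure lebesgue (O' - A)"
      using K(3) O'(3) by (intro emeasure_subadditive) (auto dest: fmeasurableD)
    also have "\<dots> < ennreal (\<epsilon>/2) + ennreal (\<epsilon>/2)"
      using K(4) O'(4) by (rule add_strict_mono)
    also have "\<dots> = ennreal \<epsilon>" using e by (simp flip: ennreal_plus)
    finally show ?thesis using F by (intro bexI[of _ "\<Union>F"]) auto
  qed
  ultimately show ?thesis by (rule that)
qed

text \<open>Up to an error of measure less than \<open>e\<close>, a control is a step function: finitely many balls of
  radius \<open>e\<close> cover the compact value space, and the set where the control is in such a ball is almost
  a finite union of basic open sets.\<close>

lemma controls_separable:
  assumes cpt: "compact (UNIV :: 'a::metric_space set)"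
  obtains q :: "nat => real => 'a::metric_space" where "\<And>i. q i \<in> borel_measurable borel"
    "\<And>v t T e. v \<in> ctrls t T ==> e > 0 ==> \<exists>i. discrep t T v (q i) e < e"
proof -
  obtain \<A> :: "real set set" where \<A>: "countable \<A>" "\<A> \<subseteq> sets borel"
    "\<And>A t T \<epsilon>. A \<in> sets lebesgue ==> A \<subseteq> {t..T} ==> \<epsilon> > 0 ==>
      \<exists>B\<in>\<A>. emeasure lebesgue (sym_diff A B) < ennreal \<epsilon>"
    by (rule finite_interval_unions_approximate) blast
  obtain B :: "'a set set" where B: "countable B" "topological_basis B"
    using compact_countable_basis[OF cpt] by blast
  define D where "D = (\<lambda>b. SOME x. x \<in> b) ` B"
  have D: "countable D" unfolding D_def using B(1) by simp
  have dense: "\<exists>d\<in>D. dist d x < e" if e: "e > 0" for x :: 'a and e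
  proof -
    obtain b where b: "b \<in> B" "x \<in> b" "b \<subseteq> ball x e"
      by (rule topological_basisE[OF B(2) open_ball[of x e], of x]) (use e in auto)
    then have "(SOME x. x \<in> b) \<in> b" by (intro someI)
    then have "dist (SOME x. x \<in> b) x < e" using b(3) by (auto simp: dist_commute)
    then show ?thesis unfolding D_def using b(1) by blast
  qed
  let ?L = "lists (\<A> \<times> D)"
  let ?Q = "(\<lambda>L. pick L undefined) ` ?L"
  have cQ: "countable ?Q" using \<A>(1) D by (intro countable_image countable_lists countable_SIGMA) auto
  have nQ: "?Q \<noteq> {}" by auto
  have bQ: "w \<in> borel_measurable borel" if "w \<in> ?Q" for w
  proof -
    from that obtain L where L: "w = pick L undefined" "L \<in> ?L" by (rule imageE)
    have "set L \<subseteq> \<A> \<times> D" using L(2) by (simp add: lists_eq_set)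
    then have "B \<in> sets borel" if "(B, c) \<in> set L" for B c using that \<A>(2) by (meson mem_Sigma_iff subsetD)
    then show ?thesis unfolding L(1) by (rule pick_borel)
  qed
  have app: "\<exists>w\<in>?Q. discrep t T v w e < e" if v: "v \<in> ctrls t T" and e: "e > 0" for v :: "real => 'a" and t T e
  proof -
    have "(UNIV::'a set) \<subseteq> (\<Union>d\<in>D. ball d e)" using dense[OF e] by (auto simp: mem_ball)
    then obtain D' where D': "D' \<subseteq> D" "finite D'" "(UNIV::'a set) \<subseteq> (\<Union>d\<in>D'. ball d e)"
      using cpt by (auto elim!: compactE_image[where C=D and f="\<lambda>d. ball d e"])
    obtain ds where ds: "set ds = D'" "distinct ds" using finite_distinct_list[OF D'(2)] by blast
    have vm: "v \<in> borel_measurable (lebesgue_on {t..T})" using v by (simp add: space_ctrl)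
    let ?near = "\<lambda>d. {s\<in>{t..T}. dist d (v s) < e}"
    let ?far = "\<lambda>L. {s\<in>{t..T}. \<not> dist (pick L undefined s) (v s) < e}"
    let ?bad = "\<lambda>L es. {s\<in>{t..T}. (\<exists>d\<in>set es. dist d (v s) < e) \<and> \<not> dist (pick L undefined s) (v s) < e}"
    have Am: "?near d \<in> sets lebesgue" for d
    proof -
      have "(\<lambda>s. dist d (v s)) \<in> borel_measurable (lebesgue_on {t..T})"
        using vm by (intro borel_measurable_dist_compact[OF cpt]) auto
      then have "{s\<in>space (lebesgue_on {t..T}). dist d (v s) < e} \<in> sets (lebesgue_on {t..T})" by measurable
      then show ?thesis by (simp add: sets_restrict_space_iff)
    qed
    have far: "?far L \<in> sets lebesgue" if L: "L \<in> ?L" for L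
    proof -
      have "pick L undefined \<in> ctrls t T" by (rule borel_in_ctrl[OF bQ[OF imageI[OF L]]])
      then have "(\<lambda>s. dist (pick L undefined s) (v s)) \<in> borel_measurable (lebesgue_on {t..T})"
        using vm by (intro borel_measurable_dist_compact[OF cpt]) (auto simp: space_ctrl)
      then have "{s\<in>space (lebesgue_on {t..T}). \<not> dist (pick L undefined s) (v s) < e} \<in> sets (lebesgue_on {t..T})" by measurable
      then show ?thesis by (simp add: sets_restrict_space_iff)
    qed
    \<comment> \<open>One value \<open>d\<close> at a time: the new set \<open>B\<close> is put in front of the list, and where it is wrong
      adds only an arbitrarily small measure.\<close>
    have approx: "\<exists>L\<in>?L. emeasure lebesgue (?bad L es) < ennreal \<eta>"
      if "set es \<subseteq> D" "\<eta> > 0" for es \<eta>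
      using that
    proof (induction es arbitrary: \<eta>)
      case Nil
      have "[] \<in> ?L" by simp
      then show ?case using Nil by (intro bexI[of _ "[]"]) auto
    next
      case (Cons d es)
      obtain L where L: "L \<in> ?L" and Le: "emeasure lebesgue (?bad L es) < ennreal (\<eta>/2)"
        using Cons.IH[of "\<eta>/2"] Cons.prems by auto
      have sub: "?near d \<subseteq> {t..T}" by blast
      obtain B where B: "B \<in> \<A>" "emeasure lebesgue (sym_diff (?near d) B) < ennreal (\<eta>/2)"
        using \<A>(3)[OF Am[of d] sub, of "\<eta>/2"] Cons.prems(2) by auto
      have Bl: "B \<in> sets lebesgue" using B(1) \<A>(2) by (auto intro: sets_completionI_sets)
      have BL: "(B, d) # L \<in> ?L" using B(1) L Cons.prems by auto
      have Sm: "?bad L es \<in> sets lebesgue"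
      proof -
        have 2: "(\<Union>d\<in>set es. ?near d) \<in> sets lebesgue"
          using Am by (intro sets.finite_UN) auto
        have eq: "?bad L es
            = (\<Union>d\<in>set es. ?near d) \<inter> ?far L"
          by auto
        show ?thesis unfolding eq by (rule sets.Int[OF 2 far[OF L]])
      qed
      have Sd: "sym_diff (?near d) B \<in> sets lebesgue"
        by (intro sets.Un sets.Diff Am Bl)
      have "?bad ((B, d) # L) (d # es)
        \<subseteq> sym_diff (?near d) B
          \<union> ?bad L es"
        by (auto split: if_splits)
      then have "emeasure lebesgue (?bad ((B, d) # L) (d # es))
        \<le> emeasure lebesgue (sym_diff (?near d) B
          \<union> ?bad L es)"
        by (rule emeasure_mono[OF _ sets.Un[OF Sd Sm]])
      also have "\<dots> \<le> emeasure lebesgue (sym_diff (?near d) B)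
          + emeasure lebesgue (?bad L es)"
        by (rule emeasure_subadditive[OF Sd Sm])
      also have "\<dots> < ennreal (\<eta>/2) + ennreal (\<eta>/2)" using B(2) Le by (rule add_strict_mono)
      also have "\<dots> = ennreal \<eta>" using Cons.prems by (simp flip: ennreal_plus)
      finally show ?case using BL by blast
    qed
    have "set ds \<subseteq> D" using ds(1) D'(1) by simp
    from approx[OF this e] obtain L where L: "L \<in> ?L"
      "emeasure lebesgue (?bad L ds) < ennreal e"
      by (rule bexE)
    have cov: "\<exists>d\<in>set ds. dist d (v s) < e" for s 
    proof -
      have "v s \<in> (\<Union>d\<in>D'. ball d e)" by (rule subsetD[OF D'(3) UNIV_I])
      then show ?thesis unfolding ds(1) by simp
    qed
    have small: "emeasure lebesgue (?far L) < ennreal e"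
      using L(2) by (simp only: cov simp_thms)
    have sub: "{s\<in>{t..T}. dist (v s) (pick L undefined s) > e} \<subseteq> ?far L"
      by (auto simp: dist_commute)
    from le_less_trans[OF emeasure_mono[OF sub far[OF L(1)]] small] have lt: "emeasure lebesgue {s\<in>{t..T}. dist (v s) (pick L undefined s) > e} < ennreal e" .
    then have "ennreal (discrep t T v (pick L undefined) e) < ennreal e"
      unfolding discrep_def by (subst emeasure_eq_ennreal_measure[symmetric]) auto
    then have "discrep t T v (pick L undefined) e < e"
      by (subst (asm) ennreal_less_iff) (simp_all add: discrep_def)
    then show ?thesis by (rule bexI[where x="pick L undefined"]) (rule imageI[OF L(1)])
  qed
  show ?thesis
  proof (rule that[of "from_nat_into ?Q"])
    show "from_nat_into ?Q i \<in> borel_measurable borel" for i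
      by (rule bQ[OF from_nat_into[OF nQ]])
    show "\<exists>i. discrep t T v (from_nat_into ?Q i) e < e" if "v \<in> ctrls t T" "e > 0" for v :: "real => 'a" and t T e
    proof -
      from app[OF that] obtain w where w: "w \<in> ?Q" "discrep t T v w e < e" by (rule bexE)
      obtain i where "from_nat_into ?Q i = w" using from_nat_into_surj[OF cQ w(1)] by (rule exE)
      with w(2) show ?thesis by (intro exI[of _ i]) simp
    qed
  qed
qed


text \<open>By separability an open set of controls is a countable union of basic neighbourhoods, and the
  discrepancy to a fixed control is measurable in the parameter by Fubini's theorem.\<close>

lemma measurable_ctrl_valued:
  fixes w :: "'m => real => 'a::metric_space"
  assumes cpt: "compact (UNIV :: 'a set)"
    and w: "(\<lambda>(x, s). w x s) \<in> borel_measurable (M \<Otimes>\<^sub>M borel)"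
  shows "w \<in> measurable M (ctrl_space t T)"
proof (rule measurable_into_ctrl_space)
  have wb: "w x \<in> borel_measurable borel" if "x \<in> space M" for x
    using measurable_compose[OF measurable_Pair1'[OF that] w] by simp
  then have wc: "w x \<in> ctrls t T" if "x \<in> space M" for x
    using that by (intro borel_in_ctrl)
  then show "w \<in> space M \<rightarrow> ctrls t T" by auto
  fix S :: "(real => 'a) set"
  assume sub: "S \<subseteq> ctrls t T"
    and S: "\<forall>v\<in>S. \<exists>e>0. \<forall>w\<in>ctrls t T. discrep t T v w e < e --> w \<in> S"
  obtain q :: "nat => real => 'a" where q: "\<And>i. q i \<in> borel_measurable borel"
    "\<And>v t T e. v \<in> ctrls t T ==> e > 0 ==> \<exists>i. discrep t T v (q i) e < e"
    by (rule controls_separable[OF cpt]) blast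
  have qc: "q i \<in> ctrls t T" for i using q(1) by (rule borel_in_ctrl)
  define E where "E k = 1 / (2 * real (Suc k))" for k
  have E0: "E k > 0" for k by (simp add: E_def)
  let ?I = "{(i, k). \<forall>v\<in>ctrls t T. discrep t T v (q i) (E k) < E k --> v \<in> S}"
  have "w -` S \<inter> space M = (\<Union>(i, k)\<in>?I. {x \<in> space M. discrep t T (w x) (q i) (E k) < E k})"
  proof safe
    fix x assume x: "w x \<in> S" "x \<in> space M"
    then obtain e where e: "e > 0" "\<And>v. v \<in> ctrls t T ==> discrep t T (w x) v e < e ==> v \<in> S"
      using S by blast
    obtain k where "inverse (real (Suc k)) < e" using reals_Archimedean e(1) by blast
    then have k: "E k + E k \<le> e" by (simp add: E_def field_simps)
    obtain i where i: "discrep t T (w x) (q i) (E k) < E k" using q(2)[OF wc[OF x(2)] E0] by blast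
    have "v \<in> S" if v: "v \<in> ctrls t T" "discrep t T v (q i) (E k) < E k" for v
    proof -
      have "discrep t T (w x) v e \<le> discrep t T (w x) v (E k + E k)"
        by (rule discrep_mono[OF cpt wc[OF x(2)] v(1) k])
      also have "\<dots> \<le> discrep t T (w x) (q i) (E k) + discrep t T (q i) v (E k)"
        by (rule discrep_triangle[OF cpt wc[OF x(2)] qc v(1)])
      also have "discrep t T (q i) v (E k) = discrep t T v (q i) (E k)"
        by (simp add: discrep_def dist_commute)
      finally show ?thesis using i v(2) k by (intro e(2)[OF v(1)]) linarith
    qed
    then have "(i, k) \<in> ?I" by blast
    then show "x \<in> (\<Union>(i, k)\<in>?I. {x \<in> space M. discrep t T (w x) (q i) (E k) < E k})"
      using i x(2) by (intro UN_I[of "(i, k)"]) auto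
  next
    fix x i k assume "\<forall>v\<in>ctrls t T. discrep t T v (q i) (E k) < E k --> v \<in> S"
      "x \<in> space M" "discrep t T (w x) (q i) (E k) < E k"
    then show "x \<in> w -` S" using wc by auto
  qed
  also have "\<dots> \<in> sets M"
  proof -
    have "{x \<in> space M. discrep t T (w x) (q i) e < e} \<in> sets M" for i e
    proof -
      let ?Q = "{z \<in> space (M \<Otimes>\<^sub>M lborel). snd z \<in> {t..T} \<and> dist (w (fst z) (snd z)) (q i (snd z)) > e}"
      have 1: "(\<lambda>z. dist (w (fst z) (snd z)) (q i (snd z))) \<in> borel_measurable (M \<Otimes>\<^sub>M lborel)"
        using w q(1) by (intro borel_measurable_dist_compact[OF cpt])
          (auto simp: case_prod_beta' cong: measurable_cong_sets intro: measurable_compose[OF measurable_snd])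
      have Q: "?Q \<in> sets (M \<Otimes>\<^sub>M lborel)" using 1 by measurable
      have m: "(\<lambda>x. measure lborel (Pair x -` ?Q)) \<in> borel_measurable M"
        unfolding measure_def using lborel.measurable_emeasure_Pair[OF Q] by measurable
      have eq: "measure lborel (Pair x -` ?Q) = discrep t T (w x) (q i) e" if "x \<in> space M" for x
      proof -
        have "Pair x -` ?Q = {s \<in> {t..T}. dist (w x s) (q i s) > e}"
          using that by (auto simp: space_pair_measure)
        moreover have "Pair x -` ?Q \<in> sets lborel" using Q by (rule sets_Pair1)
        ultimately show ?thesis unfolding discrep_def by (metis measure_completion)
      qed
      have [measurable]: "(\<lambda>x. discrep t T (w x) (q i) e) \<in> borel_measurable M"
        using m measurable_cong[OF eq] by (rule iffD1[rotated])
      show ?thesis by measurable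
    qed
    then show ?thesis by (intro sets.countable_UN') auto
  qed
  finally show "w -` S \<inter> space M \<in> sets M" .
qed

text \<open>A control can be evaluated jointly measurably after a choice of representatives: \<open>h n w\<close> is
  the first element of the dense sequence that is \<open>2\<^sup>-\<^sup>n\<close>-close to \<open>w\<close>, and \<open>h n w\<close> converges to
  \<open>w\<close> almost everywhere by the Borel-Cantelli lemma. This makes the state of the system measurable
  in the control observed by a strategy.\<close>

lemma canonical_control:
  assumes cpt: "compact (UNIV :: 'a::metric_space set)"
  obtains cv :: "(real => 'a::metric_space) => real => 'a" where
    "(\<lambda>(w, s). cv w s) \<in> borel_measurable (ctrl_space t T \<Otimes>\<^sub>M borel)"
    "\<And>w. w \<in> ctrls t T ==> AE s in lebesgue. s \<in> {t..T} --> cv w s = w s"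
proof -
  obtain q :: "nat => real => 'a" where q[measurable]: "\<And>i. q i \<in> borel_measurable borel"
    and dense: "\<And>v t T e. v \<in> ctrls t T ==> e > 0 ==> \<exists>i. discrep t T v (q i) e < e"
    by (rule controls_separable[OF cpt]) blast
  let ?C = "ctrl_space t T :: (real => 'a) measure"
  have qc: "q i \<in> space ?C" for i using q by (rule borel_in_ctrl)
  define near where "near n i v \<longleftrightarrow> (\<exists>d>0. d < (1/2)^n \<and> discrep t T v (q i) d < d)" for n i v
  have near: "Measurable.pred ?C (near n i)" for n i
  proof -
    have "{v \<in> space ?C. near n i v} \<in> sets ?C"
    proof (rule ctrl_openI)
      fix v assume "v \<in> {v \<in> space ?C. near n i v}"
      then obtain d where v: "v \<in> space ?C" and d: "d > 0" "d < (1/2)^n" "discrep t T v (q i) d < d"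
        by (auto simp: near_def)
      define e where "e = ((1/2)^n - d) / 2"
      have e: "e > 0" "d + e < (1/2)^n" using d by (auto simp: e_def field_simps)
      have "near n i w" if w: "w \<in> space ?C" "discrep t T v w e < e" for w
      proof -
        have "discrep t T w (q i) (e + d) \<le> discrep t T w v e + discrep t T v (q i) d"
          by (rule discrep_triangle[OF cpt w(1) v qc])
        also have "discrep t T w v e = discrep t T v w e" by (simp add: discrep_def dist_commute)
        finally show ?thesis unfolding near_def using e d w by (intro exI[of _ "d + e"]) (auto simp: add.commute)
      qed
      then show "\<exists>e>0. \<forall>w\<in>space ?C. discrep t T v w e < e --> w \<in> {v \<in> space ?C. near n i v}"
        using e(1) by auto
    qed auto
    then show ?thesis by (simp add: pred_def)
  qed
  have near_ex: "\<exists>i. near n i v" if "v \<in> space ?C" for n v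
  proof -
    have "(1/2::real)^n / 2 > 0" by simp
    from dense[OF that this] show ?thesis unfolding near_def
      by (metis \<open>0 < (1 / 2) ^ n / 2\<close> field_sum_of_halves less_add_same_cancel1)
  qed
  define h where "h n v = q (LEAST i. near n i v)" for n v
  have hm[measurable]: "(\<lambda>z. h n (fst z) (snd z)) \<in> borel_measurable (?C \<Otimes>\<^sub>M borel)" for n
  proof -
    have L: "(\<lambda>z. LEAST i. near n i (fst z)) \<in> measurable (?C \<Otimes>\<^sub>M borel) (count_space UNIV)"
      using near by (intro measurable_Least) (rule measurable_compose[OF measurable_fst])
    show ?thesis unfolding h_def
      by (rule measurable_compose_countable[OF _ L]) simp
  qed
  have hn: "discrep t T v (h n v) ((1/2)^n) < (1/2)^n" if v: "v \<in> space ?C" for n v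
  proof -
    have "near n (LEAST i. near n i v) v" using near_ex[OF v] by (rule LeastI_ex)
    then obtain d where d: "d > 0" "d < (1/2)^n" "discrep t T v (h n v) d < d" unfolding near_def h_def by blast
    have "h n v \<in> space ?C" by (simp add: h_def qc)
    then show ?thesis using discrep_mono[OF cpt v, of "h n v" d "(1/2)^n"] d by linarith
  qed
  define K where "K = {z \<in> space (?C \<Otimes>\<^sub>M borel). Cauchy (\<lambda>n. h n (fst z) (snd z))}"
  have K: "K \<in> sets (?C \<Otimes>\<^sub>M borel)"
  proof -
    have [measurable]: "(\<lambda>z. dist (h m (fst z) (snd z)) (h n (fst z) (snd z))) \<in> borel_measurable (?C \<Otimes>\<^sub>M borel)" for m n
      by (intro borel_measurable_dist_compact[OF cpt]) (rule hm)+
    have "{z \<in> space (?C \<Otimes>\<^sub>M borel). \<forall>j. \<exists>M. \<forall>m\<ge>M. \<forall>n\<ge>M. dist (h m (fst z) (snd z)) (h n (fst z) (snd z)) < inverse (real (Suc j))} \<in> sets (?C \<Otimes>\<^sub>M borel)"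
      by measurable
    then show ?thesis unfolding K_def metric_Cauchy_iff2 .
  qed
  define cv where "cv v s = (if (v, s) \<in> K then lim (\<lambda>n. h n v s) else undefined)" for v s
  have conv: "convergent (\<lambda>n. h n (fst z) (snd z))" if "z \<in> K" for z
    using that compact_imp_complete[OF cpt] unfolding K_def complete_def convergent_def by blast
  have "(\<lambda>z. if z \<in> K then lim (\<lambda>n. h n (fst z) (snd z)) else undefined) \<in> borel_measurable (?C \<Otimes>\<^sub>M borel)"
  proof (rule borel_measurable_LIMSEQ_metric)
    show "(\<lambda>z. if z \<in> K then h n (fst z) (snd z) else undefined) \<in> borel_measurable (?C \<Otimes>\<^sub>M borel)" for n
      using K by measurable
    show "(\<lambda>n. if z \<in> K then h n (fst z) (snd z) else undefined) \<longlonglongrightarrow> (if z \<in> K then lim (\<lambda>n. h n (fst z) (snd z)) else undefined)" for z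
      using conv[of z] by (auto simp: convergent_LIMSEQ_iff)
  qed
  then have cv: "(\<lambda>(w, s). cv w s) \<in> borel_measurable (?C \<Otimes>\<^sub>M borel)"
    by (simp add: cv_def case_prod_beta')
  moreover have "AE s in lebesgue. s \<in> {t..T} --> cv w s = w s" if w: "w \<in> space ?C" for w
  proof -
    define A where "A n = {s \<in> {t..T}. dist (w s) (h n w s) > (1/2)^n}" for n
    have hc: "h n w \<in> space ?C" for n by (simp add: h_def qc)
    have Am: "A n \<in> lmeasurable" for n unfolding A_def by (rule discrep_set_measurable[OF cpt w hc])
    have An: "measure lebesgue (A n) \<le> (1/2)^n" for n
      using hn[OF w, of n] by (simp add: A_def discrep_def)
    have "AE s in lebesgue. eventually (\<lambda>n. s \<in> space lebesgue - A n) sequentially"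
    proof (rule borel_cantelli_AE1)
      show "A n \<in> sets lebesgue" for n using Am by (rule fmeasurableD)
      show "emeasure lebesgue (A n) < \<infinity>" for n using fmeasurableD2[OF Am, of n] by (simp only: infinity_ennreal_def less_top not_False_eq_True)
      show "summable (\<lambda>n. measure lebesgue (A n))"
        by (rule summable_comparison_test[where g="\<lambda>n. (1/2)^n"]) (use An in "auto intro!: exI[of _ 0] summable_geometric")
    qed
    then show ?thesis
    proof eventually_elim
      case (elim s)
      show ?case
      proof
        assume s: "s \<in> {t..T}"
        have "eventually (\<lambda>n. dist (h n w s) (w s) \<le> dist ((1/2::real)^n) 0) sequentially"
          using elim by eventually_elim (use s in "auto simp: A_def dist_commute dist_real_def")
        moreover have "(\<lambda>n. (1/2::real)^n) \<longlonglongrightarrow> 0" by (rule LIMSEQ_power_zero) simp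
        ultimately have l: "(\<lambda>n. h n w s) \<longlonglongrightarrow> w s"
          by (rule metric_tendsto_imp_tendsto[rotated])
        then have "(w, s) \<in> K" using w LIMSEQ_imp_Cauchy by (auto simp: K_def space_pair_measure)
        then show "cv w s = w s" using l by (simp add: cv_def limI)
      qed
    qed
  qed
  ultimately show ?thesis by (rule that)
qed

section \<open>Almost everywhere agreement and the controlled differential equation\<close>

text \<open>The interval is half-open so that agreement on adjacent intervals can be joined.\<close>

definition agree :: "real => real => (real => 'a) => (real => 'a) => bool" where
  "agree a b u v \<longleftrightarrow> (AE s in lebesgue. s \<in> {a..<b} --> u s = v s)"

lemma agree_refl [simp]: "agree a b u u" by (simp add: agree_def)

lemma agree_sym: "agree a b u v ==> agree a b v u"
  unfolding agree_def by (auto elim: eventually_mono)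

lemma agree_trans:
  assumes "agree a b u v" "agree a b v w" shows "agree a b u w"
  using assms unfolding agree_def by eventually_elim auto

lemma agree_subset: "agree a b u v ==> a \<le> c ==> d \<le> b ==> agree c d u v"
  unfolding agree_def by (auto elim!: eventually_mono)

lemma agree_join:
  assumes "agree a b u v" "agree b c u v" shows "agree a c u v"
  using assms unfolding agree_def by eventually_elim (auto simp: not_less)

lemma agree_cong:
  "(\<And>s. a \<le> s ==> s < b ==> u s = u' s) ==> (\<And>s. a \<le> s ==> s < b ==> v s = v' s) ==> agree a b u v = agree a b u' v'"
  unfolding agree_def by (intro AE_cong) auto

lemma agreeI: "(\<And>s. a \<le> s ==> s < b ==> u s = v s) ==> agree a b u v"
  unfolding agree_def by (rule AE_I2) auto

lemma agree_negligible:
  assumes "agree a b u v"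
  obtains N where "negligible N" "\<And>s. s \<in> {a..b} - N ==> u s = v s"
proof -
  obtain N where "N \<in> null_sets lebesgue" "{s \<in> space lebesgue. \<not> (s \<in> {a..<b} --> u s = v s)} \<subseteq> N"
    using assms unfolding agree_def eventually_ae_filter by (elim bexE)
  then have N: "negligible N" "{s. \<not> (s \<in> {a..<b} --> u s = v s)} \<subseteq> N"
    by (simp_all add: negligible_iff_null_sets)
  show ?thesis
  proof (rule that[of "insert b N"])
    show "negligible (insert b N)" using N(1) by simp
    show "u s = v s" if "s \<in> {a..b} - insert b N" for s
      using that subsetD[OF N(2), of s] by fastforce
  qed
qed

lemma agree_iff_AE_lebesgue_on: "agree a b u v \<longleftrightarrow> (AE s in lebesgue_on {a..b}. u s = v s)"
proof -
  have "AE s in lebesgue. s \<noteq> b"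
    by (rule AE_I'[of "{b}"]) (auto simp: negligible_iff_null_sets[symmetric])
  then have "(AE s in lebesgue. s \<in> {a..<b} --> u s = v s) \<longleftrightarrow> (AE s in lebesgue. s \<in> {a..b} --> u s = v s)"
    by (auto elim!: eventually_elim2)
  then show ?thesis unfolding agree_def by (subst AE_restrict_space_iff) auto
qed

text \<open>The weight \<open>exp (2 L (r - t))\<close> turns the integral operator of an \<open>L\<close>-Lipschitz field into a
  contraction by the factor \<open>1/2\<close> on the whole interval. Both the convergence of the Picard iteration
  and the stability of solutions come from this.\<close>

lemma weighted_integral_bound:
  fixes h :: "real => 'b::euclidean_space"
  assumes h: "h integrable_on {t..s}" and L: "L > 0" and K: "K \<ge> 0" and ts: "t \<le> s"
    and le: "\<And>r. r \<in> {t..s} ==> norm (h r) \<le> L * K * exp (2 * L * (r - t))"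
  shows "norm (integral {t..s} h) \<le> K / 2 * exp (2 * L * (s - t))"
proof -
  have "((\<lambda>r. L * K * exp (2 * L * (r - t))) has_integral
      (K / 2 * exp (2 * L * (s - t)) - K / 2 * exp (2 * L * (t - t)))) {t..s}"
    by (rule fundamental_theorem_of_calculus[OF ts])
      (auto simp flip: has_real_derivative_iff_has_vector_derivative intro!: derivative_eq_intros)
  then have "norm (integral {t..s} h) \<le> K / 2 * exp (2 * L * (s - t)) - K / 2 * exp (2 * L * (t - t))"
    using integral_norm_bound_integral[OF h _ le] by (metis has_integral_integrable_integral)
  then show ?thesis using K by simp
qed

text \<open>A Gronwall estimate: the weighted supremum \<open>K\<close> of the distance satisfies \<open>K \<le> a + K / 2\<close>.\<close>

lemma exp_weight_Gronwall:
  fixes X Y :: "real => 'b::real_normed_vector"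
  assumes bdd: "\<And>s. s \<in> {t..T} ==> norm (X s - Y s) \<le> B" and tT: "t \<le> T" and L: "L > 0" and a: "a \<ge> 0"
    and step: "\<And>s K. s \<in> {t..T} ==> K \<ge> 0 ==>
      (\<And>r. r \<in> {t..s} ==> norm (X r - Y r) \<le> K * exp (2 * L * (r - t))) ==>
      norm (X s - Y s) \<le> a + K / 2 * exp (2 * L * (s - t))"
    and s: "s \<in> {t..T}"
  shows "norm (X s - Y s) \<le> 2 * a * exp (2 * L * (s - t))"
proof -
  define w where "w r = norm (X r - Y r) / exp (2 * L * (r - t))" for r
  define K where "K = (SUP r\<in>{t..T}. w r)"
  have e1: "exp (2 * L * (r - t)) \<ge> 1" if "r \<in> {t..T}" for r using that L by auto
  have wB: "w r \<le> B" if "r \<in> {t..T}" for r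
  proof -
    have "w r \<le> norm (X r - Y r) / 1" unfolding w_def
      using e1[OF that] by (intro divide_left_mono) auto
    then show ?thesis using bdd[OF that] by simp
  qed
  have bd: "bdd_above (w ` {t..T})" using wB by (intro bdd_aboveI2)
  have wK: "w r \<le> K" if "r \<in> {t..T}" for r unfolding K_def by (rule cSUP_upper[OF that bd])
  have K0: "K \<ge> 0" using wK[OF s] by (rule order_trans[rotated]) (simp add: w_def)
  have XK: "norm (X r - Y r) \<le> K * exp (2 * L * (r - t))" if "r \<in> {t..T}" for r
    using wK[OF that] by (simp add: w_def field_simps)
  have "w r \<le> a + K / 2" if r: "r \<in> {t..T}" for r
  proof -
    have "norm (X r - Y r) \<le> a + K / 2 * exp (2 * L * (r - t))"
      by (rule step[OF r K0 XK]) (use r in auto)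
    also have "\<dots> \<le> a * exp (2 * L * (r - t)) + K / 2 * exp (2 * L * (r - t))"
      using a e1[OF r] mult_left_mono[OF e1[OF r] a] by simp
    finally show ?thesis by (simp add: w_def field_simps)
  qed
  then have "K \<le> a + K / 2" unfolding K_def using tT by (intro cSUP_least) auto
  then have "w s \<le> 2 * a" using wK[OF s] by linarith
  then show ?thesis by (simp add: w_def field_simps)
qed

locale controlled_system =
  fixes f :: "real^'n => 'u::metric_space => 'v::metric_space => real^'n" and C L :: real
  assumes compact_U: "compact (UNIV :: 'u set)" and compact_V: "compact (UNIV :: 'v set)"
    and L_pos: "L > 0"
    and f_bound: "norm (f x u v) \<le> C"
    and f_cont: "continuous_on UNIV (\<lambda>(u, v). f x u v)"
    and f_lip: "norm (f x u v - f y u v) \<le> L * norm (x - y)"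
begin

lemma C_nonneg: "C \<ge> 0" using f_bound norm_ge_zero order_trans by blast

text \<open>The Lipschitz bound in \<open>x\<close> and continuity in \<open>(u, v)\<close> give joint continuity.\<close>

lemma f_measurable:
  assumes X: "X \<in> borel_measurable M" and u: "u \<in> borel_measurable M" and v: "v \<in> borel_measurable M"
  shows "(\<lambda>z. f (X z) (u z) (v z)) \<in> borel_measurable M"
proof -
  have "continuous_on UNIV (\<lambda>(x, u, v). f x u v)"
  proof (clarsimp simp: continuous_on_def split_beta')
    fix x u v
    have 1: "((\<lambda>z. f x (fst z) (snd z)) \<longlongrightarrow> f x u v) (at (u, v))"
      using f_cont[of x] by (auto simp: continuous_on_def split_beta')
    have f_iso: "isCont (\<lambda>z. f x (fst z) (snd z)) (u, v)"
      using f_cont[of x] by (simp add: continuous_on_eq_continuous_at split_beta')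
    have "((\<lambda>z. f x (fst (snd z)) (snd (snd z))) \<longlongrightarrow> f x u v) (at (x, u, v))"
      using isCont_tendsto_compose[OF f_iso, of snd "at (x, u, v)"] tendsto_snd[OF tendsto_ident_at, of "(x,u,v)" UNIV]
      by simp
    moreover have "((\<lambda>z. f (fst z) (fst (snd z)) (snd (snd z)) - f x (fst (snd z)) (snd (snd z))) \<longlongrightarrow> 0) (at (x, u, v))"
    proof (rule Lim_null_comparison)
      show "\<forall>\<^sub>F z in at (x, u, v). norm (f (fst z) (fst (snd z)) (snd (snd z)) - f x (fst (snd z)) (snd (snd z))) \<le> L * norm (fst z - x)"
        by (simp add: f_lip)
      have "((\<lambda>z. L * norm (fst z - x)) \<longlongrightarrow> L * norm (fst (x, u, v) - x)) (at (x, u, v))"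
        by (intro tendsto_intros)
      then show "((\<lambda>z. L * norm (fst z - x)) \<longlongrightarrow> 0) (at (x, u, v))" by simp
    qed
    ultimately show "((\<lambda>z. f (fst z) (fst (snd z)) (snd (snd z))) \<longlongrightarrow> f x u v) (at (x, u, v))"
      using tendsto_add by fastforce
  qed
  moreover have "(\<lambda>z. (X z, u z, v z)) \<in> borel_measurable M"
  proof -
    obtain A :: "'u set set" where A: "countable A" "topological_basis A"
      using compact_countable_basis[OF compact_U] by blast
    obtain B :: "'v set set" where B: "countable B" "topological_basis B"
      using compact_countable_basis[OF compact_V] by blast
    obtain D :: "(real^'n) set set" where D: "countable D" "topological_basis D"
      using ex_countable_basis by blast
    let ?AB = "(\<lambda>(a, b). a \<times> b) ` (A \<times> B)"
    have "countable ?AB" using A B by simp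
    then show ?thesis
      by (rule borel_measurable_Pair_basis[OF D _ topological_basis_prod[OF A(2) B(2)] X
          borel_measurable_Pair_compact[OF compact_U compact_V u v]])
  qed
  ultimately have "(\<lambda>z. (\<lambda>(x, u, v). f x u v) (X z, u z, v z)) \<in> borel_measurable M"
    by (rule borel_measurable_continuous_on)
  then show ?thesis by simp
qed

lemma f_integrable:
  assumes u: "u \<in> ctrls t T" and v: "v \<in> ctrls t T"
    and X: "X \<in> borel_measurable (lebesgue_on {t..T})" and "t \<le> a" "b \<le> T"
  shows "(\<lambda>r. f (X r) (u r) (v r)) absolutely_integrable_on {a..b}"
proof -
  have "(\<lambda>r. f (X r) (u r) (v r)) absolutely_integrable_on {t..T}"
  proof (rule measurable_bounded_by_integrable_imp_absolutely_integrable)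
    show "(\<lambda>r. f (X r) (u r) (v r)) \<in> borel_measurable (lebesgue_on {t..T})"
      using u v X by (intro f_measurable) (auto simp: space_ctrl)
    show "(\<lambda>r. C) integrable_on {t..T}" by (rule integrable_const_ivl)
  qed (auto simp: f_bound)
  then show ?thesis by (rule absolutely_integrable_on_subinterval) (use assms(4,5) in auto)
qed

lemma integrable_f:
  assumes "u \<in> ctrls t T" "v \<in> ctrls t T"
    "X \<in> borel_measurable (lebesgue_on {t..T})" "t \<le> a" "b \<le> T"
  shows "(\<lambda>r. f (X r) (u r) (v r)) integrable_on {a..b}"
  by (rule set_lebesgue_integral_eq_integral(1)[OF f_integrable[OF assms]])

lemma solves_iff:
  assumes u: "u \<in> ctrls t T" and v: "v \<in> ctrls t T"
  shows "solves f t T x u v X \<longleftrightarrow> X \<in> borel_measurable (lebesgue_on {t..T}) \<and>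
    (\<forall>s\<in>{t..T}. X s = x + integral {t..s} (\<lambda>r. f (X r) (u r) (v r)))"
proof
  assume s: "solves f t T x u v X"
  then have ai: "(\<lambda>r. f (X r) (u r) (v r)) absolutely_integrable_on {t..T}"
    and eq: "\<And>s. s \<in> {t..T} ==> X s = x + (LINT r:{t..s}|lebesgue. f (X r) (u r) (v r))"
    by (auto simp: solves_def)
  have eq2: "X s = x + integral {t..s} (\<lambda>r. f (X r) (u r) (v r))" if "s \<in> {t..T}" for s
    unfolding eq[OF that]
    by (subst set_lebesgue_integral_eq_integral(2)) (use that in "auto intro: absolutely_integrable_on_subinterval[OF ai]")
  have "continuous_on {t..T} (\<lambda>s. x + integral {t..s} (\<lambda>r. f (X r) (u r) (v r)))"
    using set_lebesgue_integral_eq_integral(1)[OF ai]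
    by (intro continuous_intros indefinite_integral_continuous_1)
  then have "continuous_on {t..T} X" 
    by (rule continuous_on_eq) (simp add: eq2)
  then have "X \<in> borel_measurable (lebesgue_on {t..T})"
    by (intro continuous_imp_measurable_on_sets_lebesgue) auto
  with eq2 show "X \<in> borel_measurable (lebesgue_on {t..T}) \<and>
    (\<forall>s\<in>{t..T}. X s = x + integral {t..s} (\<lambda>r. f (X r) (u r) (v r)))" by blast
next
  assume *: "X \<in> borel_measurable (lebesgue_on {t..T}) \<and>
    (\<forall>s\<in>{t..T}. X s = x + integral {t..s} (\<lambda>r. f (X r) (u r) (v r)))"
  have ai: "(\<lambda>r. f (X r) (u r) (v r)) absolutely_integrable_on {t..b}" if "b \<le> T" for b
    using f_integrable[OF u v, of X t b] * that by simp
  show "solves f t T x u v X" unfolding solves_def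
  proof (intro conjI ballI)
    show "(\<lambda>r. f (X r) (u r) (v r)) absolutely_integrable_on {t..T}" by (rule ai) simp
    fix s assume s: "s \<in> {t..T}"
    then have "(LINT r:{t..s}|lebesgue. f (X r) (u r) (v r)) = integral {t..s} (\<lambda>r. f (X r) (u r) (v r))"
      by (intro set_lebesgue_integral_eq_integral(2) ai) auto
    then show "X s = x + (LINT r:{t..s}|lebesgue. f (X r) (u r) (v r))" using * s by simp
  qed
qed

lemma integral_f_bound:
  assumes "a \<le> b" "(\<lambda>r. f (X r) (u r) (v r)) integrable_on {a..b}"
  shows "norm (integral {a..b} (\<lambda>r. f (X r) (u r) (v r))) \<le> C * (b - a)"
  using integral_norm_bound_integral[OF assms(2) integrable_const_ivl[of C a b] f_bound] assms(1)
  by (simp add: mult.commute)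

lemma solution_stable:
  assumes u: "u \<in> ctrls t T" and v: "v \<in> ctrls t T"
    and X: "solves f t T x u v X" and Y: "solves f t T y u v Y" and s: "s \<in> {t..T}"
  shows "norm (X s - Y s) \<le> 2 * norm (x - y) * exp (2 * L * (s - t))"
proof (rule exp_weight_Gronwall[OF _ _ L_pos norm_ge_zero _ s])
  show "t \<le> T" using s by simp
  have Xm: "X \<in> borel_measurable (lebesgue_on {t..T})" and Xe: "\<And>s. s \<in> {t..T} ==> X s = x + integral {t..s} (\<lambda>r. f (X r) (u r) (v r))"
    using X by (auto simp: solves_iff[OF u v])
  have Ym: "Y \<in> borel_measurable (lebesgue_on {t..T})" and Ye: "\<And>s. s \<in> {t..T} ==> Y s = y + integral {t..s} (\<lambda>r. f (Y r) (u r) (v r))"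
    using Y by (auto simp: solves_iff[OF u v])
  have diff: "X s - Y s = (x - y) + integral {t..s} (\<lambda>r. f (X r) (u r) (v r) - f (Y r) (u r) (v r))" if "s \<in> {t..T}" for s
    using that by (subst Xe[OF that], subst Ye[OF that], subst Henstock_Kurzweil_Integration.integral_diff)
      (auto intro!: integrable_f[OF u v] Xm Ym)
  show "norm (X r - Y r) \<le> norm (x - y) + 2 * C * (T - t)" if r: "r \<in> {t..T}" for r
  proof -
    let ?I = "integral {t..r} (\<lambda>r. f (X r) (u r) (v r))" and ?J = "integral {t..r} (\<lambda>r. f (Y r) (u r) (v r))"
    have n: "norm ?I \<le> C * (r - t)" "norm ?J \<le> C * (r - t)"
      using r by (auto intro!: integral_f_bound integrable_f[OF u v] Xm Ym)
    have "X r - Y r = (x - y) + (?I - ?J)" using Xe[OF r] Ye[OF r] by simp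
    then have "norm (X r - Y r) \<le> norm (x - y) + norm (?I - ?J)" by (simp only: norm_triangle_ineq)
    moreover have "norm (?I - ?J) \<le> norm ?I + norm ?J" by (rule norm_triangle_ineq4)
    moreover have "C * (r - t) \<le> C * (T - t)" using r C_nonneg by (intro mult_left_mono) auto
    ultimately show ?thesis using n by linarith
  qed
  fix s K assume s: "s \<in> {t..T}" and K: "K \<ge> (0::real)"
    and le: "\<And>r. r \<in> {t..s} ==> norm (X r - Y r) \<le> K * exp (2 * L * (r - t))"
  have "norm (integral {t..s} (\<lambda>r. f (X r) (u r) (v r) - f (Y r) (u r) (v r))) \<le> K / 2 * exp (2 * L * (s - t))"
  proof (rule weighted_integral_bound[OF _ L_pos K])
    show "(\<lambda>r. f (X r) (u r) (v r) - f (Y r) (u r) (v r)) integrable_on {t..s}"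
      using s by (intro integrable_diff integrable_f[OF u v] Xm Ym) auto
    show "t \<le> s" using s by simp
    fix r assume r: "r \<in> {t..s}"
    have "norm (f (X r) (u r) (v r) - f (Y r) (u r) (v r)) \<le> L * norm (X r - Y r)" by (rule f_lip)
    also have "\<dots> \<le> L * (K * exp (2 * L * (r - t)))" using le[OF r] L_pos by (intro mult_left_mono) auto
    finally show "norm (f (X r) (u r) (v r) - f (Y r) (u r) (v r)) \<le> L * K * exp (2 * L * (r - t))" by (simp add: mult.assoc)
  qed
  then show "norm (X s - Y s) \<le> norm (x - y) + K / 2 * exp (2 * L * (s - t))"
    unfolding diff[OF s] by (rule order_trans[OF norm_triangle_ineq add_left_mono])
qed

end

context controlled_system
begin

text \<open>The Picard iteration is stopped at \<open>T\<close> so that it is defined for all times; its explicit form is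
  what makes solutions measurable in parameters.\<close>

primrec picard :: "real => real => real^'n => (real => 'u) => (real => 'v) => nat => real => real^'n" where
  "picard t T x u v 0 = (\<lambda>s. x)"
| "picard t T x u v (Suc k) = (\<lambda>s. x + integral {t..min s T} (\<lambda>r. f (picard t T x u v k r) (u r) (v r)))"

lemma picard_measurable:
  assumes "u \<in> ctrls t T" "v \<in> ctrls t T"
  shows "picard t T x u v k \<in> borel_measurable (lebesgue_on {t..T})"
proof (induction k)
  case (Suc k)
  have "continuous_on {t..T} (\<lambda>s. x + integral {t..s} (\<lambda>r. f (picard t T x u v k r) (u r) (v r)))"
    by (intro continuous_intros indefinite_integral_continuous_1 integrable_f[OF assms] Suc) auto
  then have "continuous_on {t..T} (picard t T x u v (Suc k))"
    by (rule continuous_on_eq) (simp add: min_def)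
  then show ?case by (rule continuous_imp_measurable_on_sets_lebesgue) auto
qed simp

lemma picard_step:
  assumes u: "u \<in> ctrls t T" and v: "v \<in> ctrls t T" and s: "s \<in> {t..T}"
  shows "norm (picard t T x u v (Suc k) s - picard t T x u v k s) \<le> C * (T - t) * (1/2)^k * exp (2 * L * (s - t))"
  using s
proof (induction k arbitrary: s)
  case 0
  have "norm (picard t T x u v (Suc 0) s - picard t T x u v 0 s) \<le> C * (s - t)"
    using 0 by (simp add: min_def) (intro integral_f_bound integrable_f[OF u v], auto)
  also have "\<dots> \<le> C * (T - t)" using 0 C_nonneg by (intro mult_left_mono) auto
  also have "\<dots> = C * (T - t) * 1" by simp
  also have "\<dots> \<le> C * (T - t) * exp (2 * L * (s - t))"
    using 0 C_nonneg L_pos by (intro mult_left_mono) auto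
  finally show ?case by simp
next
  case (Suc k)
  let ?p = "picard t T x u v"
  have int: "(\<lambda>r. f (?p k r) (u r) (v r)) integrable_on {t..s}" for k
    using Suc.prems by (intro integrable_f[OF u v] picard_measurable[OF u v]) auto
  have "?p (Suc (Suc k)) s - ?p (Suc k) s
      = integral {t..s} (\<lambda>r. f (?p (Suc k) r) (u r) (v r)) - integral {t..s} (\<lambda>r. f (?p k r) (u r) (v r))"
    using Suc.prems by (simp add: min_def)
  also have "\<dots> = integral {t..s} (\<lambda>r. f (?p (Suc k) r) (u r) (v r) - f (?p k r) (u r) (v r))"
    by (rule Henstock_Kurzweil_Integration.integral_diff[symmetric, OF int int])
  also have "norm \<dots> \<le> (C * (T - t) * (1/2)^k) / 2 * exp (2 * L * (s - t))"
  proof (rule weighted_integral_bound[OF integrable_diff[OF int int] L_pos])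
    show "t \<le> s" using Suc.prems by simp
    show "0 \<le> C * (T - t) * (1 / 2) ^ k" using C_nonneg Suc.prems by simp
    fix r assume r: "r \<in> {t..s}"
    have "norm (f (?p (Suc k) r) (u r) (v r) - f (?p k r) (u r) (v r)) \<le> L * norm (?p (Suc k) r - ?p k r)" by (rule f_lip)
    also have "\<dots> \<le> L * (C * (T - t) * (1/2)^k * exp (2 * L * (r - t)))"
      using Suc.IH[of r] r Suc.prems L_pos by (intro mult_left_mono) auto
    finally show "norm (f (?p (Suc k) r) (u r) (v r) - f (?p k r) (u r) (v r)) \<le> L * (C * (T - t) * (1 / 2) ^ k) * exp (2 * L * (r - t))"
      by (simp only: mult.assoc)
  qed
  finally show ?case by simp
qed

lemma picard_converges:
  assumes u: "u \<in> ctrls t T" and v: "v \<in> ctrls t T" and s: "s \<in> {t..T}"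
  shows "norm (lim (\<lambda>k. picard t T x u v k s) - picard t T x u v k s) \<le> C * (T - t) * exp (2 * L * (T - t)) * 2 * (1/2)^k"
    and "(\<lambda>k. picard t T x u v k s) \<longlonglongrightarrow> lim (\<lambda>k. picard t T x u v k s)"
proof -
  let ?p = "\<lambda>k. picard t T x u v k s"
  define D where "D = C * (T - t) * exp (2 * L * (T - t))"
  define a where "a k = ?p (Suc k) - ?p k" for k
  have an: "norm (a k) \<le> D * (1/2)^k" for k
  proof -
    have "norm (a k) \<le> C * (T - t) * (1/2)^k * exp (2 * L * (s - t))"
      unfolding a_def by (rule picard_step[OF u v s])
    also have "\<dots> \<le> C * (T - t) * (1/2)^k * exp (2 * L * (T - t))"
      using s C_nonneg L_pos by (intro mult_left_mono) auto
    finally show ?thesis by (simp add: D_def mult_ac)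
  qed
  have gs: "summable (\<lambda>k. D * (1/2::real)^k)" by (intro summable_mult summable_geometric) simp
  have sa: "summable a" by (rule summable_comparison_test[OF _ gs]) (use an in auto)
  have tel: "?p k = x + sum a {..<k}" for k
    by (induction k) (simp_all add: a_def del: picard.simps(2))
  have "(\<lambda>k. x + sum a {..<k}) \<longlonglongrightarrow> x + suminf a" using summable_LIMSEQ[OF sa] by (intro tendsto_intros)
  then have lim: "?p \<longlonglongrightarrow> x + suminf a" unfolding tel[symmetric] .
  then have leq: "lim ?p = x + suminf a" by (rule limI)
  show "?p \<longlonglongrightarrow> lim ?p" using lim leq by simp
  have "lim ?p - ?p k = suminf (\<lambda>j. a (j + k))"
    unfolding leq tel[of k] suminf_minus_initial_segment[OF sa] by simp
  also have "norm \<dots> \<le> (\<Sum>j. D * (1/2)^k * (1/2)^j)"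
  proof (rule norm_suminf_le)
    show "norm (a (j + k)) \<le> D * (1/2)^k * (1/2)^j" for j using an[of "j + k"] by (simp add: power_add mult_ac)
    show "summable (\<lambda>j. D * (1/2)^k * (1/2::real)^j)" by (intro summable_mult summable_geometric) simp
  qed
  also have "\<dots> = D * (1/2)^k * 2" by (subst suminf_mult) (simp_all add: suminf_geometric)
  finally show "norm (lim ?p - ?p k) \<le> C * (T - t) * exp (2 * L * (T - t)) * 2 * (1/2)^k" by (simp add: D_def mult_ac)
qed

lemma picard_solves:
  assumes u: "u \<in> ctrls t T" and v: "v \<in> ctrls t T"
  shows "solves f t T x u v (\<lambda>s. lim (\<lambda>k. picard t T x u v k s))" (is "solves f t T x u v ?X")
  unfolding solves_iff[OF u v]
proof (intro conjI ballI)
  let ?p = "picard t T x u v"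
  show Xm: "?X \<in> borel_measurable (lebesgue_on {t..T})"
  proof (rule borel_measurable_LIMSEQ_metric)
    show "?p k \<in> borel_measurable (lebesgue_on {t..T})" for k by (rule picard_measurable[OF u v])
    show "(\<lambda>k. ?p k s) \<longlonglongrightarrow> ?X s" if "s \<in> space (lebesgue_on {t..T})" for s
      using that by (intro picard_converges(2)[OF u v]) simp
  qed
  fix s assume s: "s \<in> {t..T}"
  define D where "D = C * (T - t) * exp (2 * L * (T - t)) * 2"
  have D: "norm (?X r - ?p k r) \<le> D * (1/2)^k" if "r \<in> {t..T}" for r k
    using picard_converges(1)[OF u v that] by (simp add: D_def)
  have D0: "D \<ge> 0" using s C_nonneg by (simp add: D_def)
  define e where "e = x + integral {t..s} (\<lambda>r. f (?X r) (u r) (v r))"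
  have le: "norm (?p (Suc k) s - e) \<le> (L * D * (T - t)) * (1/2)^k" for k
  proof -
    have i1: "(\<lambda>r. f (?p k r) (u r) (v r)) integrable_on {t..s}"
      using s by (intro integrable_f[OF u v] picard_measurable[OF u v]) auto
    have i2: "(\<lambda>r. f (?X r) (u r) (v r)) integrable_on {t..s}"
      using s by (intro integrable_f[OF u v] Xm) auto
    have "?p (Suc k) s - e = integral {t..s} (\<lambda>r. f (?p k r) (u r) (v r) - f (?X r) (u r) (v r))"
      using s by (simp add: e_def min_def Henstock_Kurzweil_Integration.integral_diff[OF i1 i2])
    also have "norm \<dots> \<le> integral {t..s} (\<lambda>r. L * (D * (1/2)^k))"
    proof (rule integral_norm_bound_integral[OF integrable_diff[OF i1 i2] integrable_const_ivl])
      fix r assume r: "r \<in> {t..s}"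
      have "norm (f (?p k r) (u r) (v r) - f (?X r) (u r) (v r)) \<le> L * norm (?p k r - ?X r)" by (rule f_lip)
      also have "\<dots> \<le> L * (D * (1/2)^k)"
        using D[of r k] r s L_pos by (intro mult_left_mono) (auto simp: norm_minus_commute)
      finally show "norm (f (?p k r) (u r) (v r) - f (?X r) (u r) (v r)) \<le> L * (D * (1/2)^k)" .
    qed
    also have "\<dots> = L * D * (1/2)^k * (s - t)" using s by simp
    also have "\<dots> \<le> L * D * (1/2)^k * (T - t)" using s D0 L_pos by (intro mult_left_mono) auto
    finally show ?thesis by (simp add: mult_ac)
  qed
  have "(\<lambda>k. (L * D * (T - t)) * (1/2::real)^k) \<longlonglongrightarrow> (L * D * (T - t)) * 0"
    by (intro tendsto_mult tendsto_const LIMSEQ_power_zero) simp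
  then have "(\<lambda>k. (L * D * (T - t)) * (1/2::real)^k) \<longlonglongrightarrow> 0" by simp
  from Lim_null_comparison[OF always_eventually[OF allI[OF le]] this]
  have lim_e: "(\<lambda>k. ?p (Suc k) s) \<longlonglongrightarrow> e" by (rule LIM_zero_cancel)
  have lim_X: "(\<lambda>k. ?p (Suc k) s) \<longlonglongrightarrow> ?X s" by (rule LIMSEQ_Suc[OF picard_converges(2)[OF u v s]])
  show "?X s = x + integral {t..s} (\<lambda>r. f (?X r) (u r) (v r))"
    using LIMSEQ_unique[OF lim_X lim_e] unfolding e_def .
qed

lemma solves_unique:
  assumes "u \<in> ctrls t T" "v \<in> ctrls t T"
    "solves f t T x u v X" "solves f t T x u v Y" "s \<in> {t..T}"
  shows "X s = Y s"
proof -
  have "norm (X s - Y s) \<le> 2 * norm (x - x) * exp (2 * L * (s - t))" by (rule solution_stable[OF assms])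
  also have "\<dots> = 0" by simp
  finally show ?thesis by (simp only: norm_le_zero_iff right_minus_eq)
qed

lemma solves_cong:
  assumes "\<And>s. s \<in> {t..T} ==> X s = Y s" "solves f t T x u v X"
  shows "solves f t T x u v Y"
proof -
  have "set_integrable lebesgue {t..T} (\<lambda>r. f (X r) (u r) (v r)) \<longleftrightarrow> set_integrable lebesgue {t..T} (\<lambda>r. f (Y r) (u r) (v r))"
    using assms(1) by (intro set_integrable_cong) auto
  moreover have "(LINT r:{t..s}|lebesgue. f (X r) (u r) (v r)) = (LINT r:{t..s}|lebesgue. f (Y r) (u r) (v r))" if "s \<in> {t..T}" for s
    using assms(1) that by (intro set_lebesgue_integral_cong) auto
  ultimately show ?thesis using assms unfolding solves_def by auto
qed

lemma traj_solves:
  assumes u: "u \<in> ctrls t T" and v: "v \<in> ctrls t T"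
  shows "solves f t T x u v (traj f t T x u v)"
proof -
  define Y where "Y = restrict (\<lambda>s. lim (\<lambda>k. picard t T x u v k s)) {t..T}"
  have Y: "solves f t T x u v Y" unfolding Y_def by (rule solves_cong[OF _ picard_solves[OF u v]]) simp
  have Ye: "Y \<in> extensional {t..T}" by (simp add: Y_def)
  have "\<exists>!X. X \<in> extensional {t..T} \<and> solves f t T x u v X"
  proof (rule ex1I[of _ Y], rule conjI[OF Ye Y], elim conjE)
    fix Z assume Z: "Z \<in> extensional {t..T}" "solves f t T x u v Z"
    show "Z = Y" by (rule extensionalityI[OF Z(1) Ye]) (rule solves_unique[OF u v Z(2) Y])
  qed
  from theI'[OF this] show ?thesis unfolding traj_def by (rule conjunct2)
qed

lemma traj_eqI:
  assumes "u \<in> ctrls t T" "v \<in> ctrls t T" "solves f t T x u v X" "s \<in> {t..T}"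
  shows "traj f t T x u v s = X s"
  by (rule solves_unique[OF assms(1,2) traj_solves[OF assms(1,2)] assms(3,4)])

lemma ctrl_sub:
  assumes "u \<in> ctrls t T" "t \<le> t'" "T' \<le> T"
  shows "u \<in> ctrls t' T'"
  using assms unfolding space_ctrl by (intro measurable_restrict_mono[of u _ "{t..T}" _ "{t'..T'}"]) auto

end

context controlled_system
begin

lemma
  assumes u: "u \<in> ctrls t T" and v: "v \<in> ctrls t T"
  shows traj_measurable: "traj f t T x u v \<in> borel_measurable (lebesgue_on {t..T})"
    and traj_integral: "s \<in> {t..T} ==> traj f t T x u v s = x + integral {t..s} (\<lambda>r. f (traj f t T x u v r) (u r) (v r))"
  using traj_solves[OF u v, of x] unfolding solves_iff[OF u v] by auto

lemma traj_initial:
  assumes "u \<in> ctrls t T" "v \<in> ctrls t T" "t \<le> T"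
  shows "traj f t T x u v t = x"
  by (subst traj_integral[OF assms(1,2)]) (use assms(3) in auto)

lemma traj_increment:
  assumes u: "u \<in> ctrls t T" and v: "v \<in> ctrls t T"
    and "t \<le> a" "a \<le> b" "b \<le> T"
  shows "traj f t T x u v b = traj f t T x u v a + integral {a..b} (\<lambda>r. f (traj f t T x u v r) (u r) (v r))"
proof -
  let ?h = "\<lambda>r. f (traj f t T x u v r) (u r) (v r)"
  have "?h integrable_on {t..b}" using assms by (intro integrable_f[OF u v] traj_measurable[OF u v]) auto
  from Henstock_Kurzweil_Integration.integral_combine[OF assms(3,4) this]
  have "integral {t..b} ?h = integral {t..a} ?h + integral {a..b} ?h" by simp
  moreover have "traj f t T x u v b = x + integral {t..b} ?h" using assms by (intro traj_integral[OF u v]) auto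
  moreover have "traj f t T x u v a = x + integral {t..a} ?h" using assms by (intro traj_integral[OF u v]) auto
  ultimately show ?thesis by (simp only: add.assoc)
qed

lemma traj_speed:
  assumes u: "u \<in> ctrls t T" and v: "v \<in> ctrls t T"
    and "t \<le> a" "a \<le> b" "b \<le> T"
  shows "norm (traj f t T x u v b - traj f t T x u v a) \<le> C * (b - a)"
proof -
  have "(\<lambda>r. f (traj f t T x u v r) (u r) (v r)) integrable_on {a..b}"
    using assms by (intro integrable_f[OF u v] traj_measurable[OF u v]) auto
  from integral_f_bound[OF assms(4) this] show ?thesis
    unfolding traj_increment[OF assms] by simp
qed

lemma traj_flow:
  assumes u: "u \<in> ctrls t T" and v: "v \<in> ctrls t T"
    and "t \<le> t'" "t' \<le> s" "s \<le> T"
  shows "traj f t T x u v s = traj f t' T (traj f t T x u v t') u v s"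
proof -
  have u': "u \<in> ctrls t' T" and v': "v \<in> ctrls t' T"
    using u v assms(3) by (auto intro: ctrl_sub)
  have "solves f t' T (traj f t T x u v t') u v (traj f t T x u v)"
    unfolding solves_iff[OF u' v']
  proof (intro conjI ballI)
    show "traj f t T x u v \<in> borel_measurable (lebesgue_on {t'..T})"
      by (rule measurable_restrict_mono[OF traj_measurable[OF u v]]) (use assms(3) in auto)
    show "traj f t T x u v s = traj f t T x u v t' + integral {t'..s} (\<lambda>r. f (traj f t T x u v r) (u r) (v r))"
      if "s \<in> {t'..T}" for s
      using that assms(3) by (intro traj_increment[OF u v]) auto
  qed
  from traj_eqI[OF u' v' this, of s] assms show ?thesis by simp
qed

lemma traj_restrict:
  assumes u: "u \<in> ctrls t T" and v: "v \<in> ctrls t T"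
    and "t \<le> s" "s \<le> t'" "t' \<le> T"
  shows "traj f t T x u v s = traj f t t' x u v s"
proof -
  have u': "u \<in> ctrls t t'" and v': "v \<in> ctrls t t'"
    using u v assms(5) by (auto intro: ctrl_sub)
  have "solves f t t' x u v (traj f t T x u v)"
    unfolding solves_iff[OF u' v']
  proof (intro conjI ballI)
    show "traj f t T x u v \<in> borel_measurable (lebesgue_on {t..t'})"
      by (rule measurable_restrict_mono[OF traj_measurable[OF u v]]) (use assms(5) in auto)
    show "traj f t T x u v s = x + integral {t..s} (\<lambda>r. f (traj f t T x u v r) (u r) (v r))"
      if "s \<in> {t..t'}" for s
      using that assms(5) by (intro traj_integral[OF u v]) auto
  qed
  from traj_eqI[OF u' v' this, of s] assms show ?thesis by simp
qed

lemma traj_cong: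
  assumes u: "u \<in> ctrls t T" and v: "v \<in> ctrls t T"
    and u': "u' \<in> ctrls t T" and v': "v' \<in> ctrls t T"
    and "agree t T u u'" "agree t T v v'" and s: "s \<in> {t..T}"
  shows "traj f t T x u v s = traj f t T x u' v' s"
proof -
  obtain N where N: "negligible N" "\<And>r. r \<in> {t..T} - N ==> u r = u' r" by (rule agree_negligible[OF assms(5)]) blast
  obtain N' where N': "negligible N'" "\<And>r. r \<in> {t..T} - N' ==> v r = v' r" by (rule agree_negligible[OF assms(6)]) blast
  have "solves f t T x u' v' (traj f t T x u v)"
    unfolding solves_iff[OF u' v']
  proof (intro conjI ballI traj_measurable[OF u v])
    fix s assume s: "s \<in> {t..T}"
    have "integral {t..s} (\<lambda>r. f (traj f t T x u v r) (u r) (v r)) = integral {t..s} (\<lambda>r. f (traj f t T x u v r) (u' r) (v' r))"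
      by (rule integral_spike[of "N \<union> N'"]) (use N N' s in auto)
    then show "traj f t T x u v s = x + integral {t..s} (\<lambda>r. f (traj f t T x u v r) (u' r) (v' r))"
      using traj_integral[OF u v s, of x] by simp
  qed
  from traj_eqI[OF u' v' this s] show ?thesis by simp
qed

lemma traj_cong_upto:
  assumes "u \<in> ctrls t T" "v \<in> ctrls t T"
    "u' \<in> ctrls t T" "v' \<in> ctrls t T"
    and "agree t s u u'" "agree t s v v'" and "t \<le> s" "s \<le> T"
  shows "traj f t T x u v s = traj f t T x u' v' s"
proof -
  have "traj f t s x u v s = traj f t s x u' v' s"
    using assms by (intro traj_cong) (auto intro: ctrl_sub)
  then show ?thesis
    using traj_restrict[OF assms(1,2,7) order_refl assms(8)] traj_restrict[OF assms(3,4,7) order_refl assms(8)] by simp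
qed

lemma traj_stable:
  assumes "u \<in> ctrls t T" "v \<in> ctrls t T" "s \<in> {t..T}"
  shows "norm (traj f t T x u v s - traj f t T y u v s) \<le> 2 * norm (x - y) * exp (2 * L * (s - t))"
  by (rule solution_stable[OF assms(1,2) traj_solves[OF assms(1,2)] traj_solves[OF assms(1,2)] assms(3)])

lemma borel_section:
  "(\<lambda>(y, s). h y s) \<in> borel_measurable (M \<Otimes>\<^sub>M borel) ==> y \<in> space M ==> h y \<in> borel_measurable borel"
  using measurable_compose[OF measurable_Pair1', of y M "\<lambda>(y, s). h y s" borel borel] by simp

lemma picard_joint_measurable:
  fixes \<xi> :: "'m => real^'n"
  assumes \<xi>: "\<xi> \<in> borel_measurable M"
    and u: "(\<lambda>(y, s). u y s) \<in> borel_measurable (M \<Otimes>\<^sub>M borel)"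
    and v: "(\<lambda>(y, s). v y s) \<in> borel_measurable (M \<Otimes>\<^sub>M borel)"
  shows "(\<lambda>(y, s). picard t T (\<xi> y) (u y) (v y) k s) \<in> borel_measurable (M \<Otimes>\<^sub>M borel)"
proof (induction k)
  case 0
  show ?case using \<xi> by (simp add: case_prod_beta')
next
  case (Suc k)
  define h where "h y r = f (picard t T (\<xi> y) (u y) (v y) k r) (u y r) (v y r)" for y r
  have hm: "(\<lambda>z. h (fst z) (snd z)) \<in> borel_measurable (M \<Otimes>\<^sub>M borel)"
    unfolding h_def using Suc u v by (intro f_measurable) (auto simp: case_prod_beta')
  have hn: "norm (h y r) \<le> C" for y r by (simp add: h_def f_bound)
  have eq: "integral {t..min s T} (h y) = (LINT r|lborel. indicator {t..min s T} r *\<^sub>R h y r)" if y: "y \<in> space M" for y s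
  proof -
    have hb[measurable]: "h y \<in> borel_measurable borel" using borel_section[OF _ y, of h] hm by (simp add: case_prod_beta')
    have "set_integrable lborel {t..min s T} (h y)"
      unfolding set_integrable_def
    proof (rule Bochner_Integration.integrable_bound)
      show "integrable lborel (\<lambda>r. indicator {t..min s T} r *\<^sub>R C)"
        by (intro integrable_scaleR_left integrable_real_indicator) (simp_all add: emeasure_lborel_Icc_eq)
      show "AE r in lborel. norm (indicator {t..min s T} r *\<^sub>R h y r) \<le> norm (indicator {t..min s T} r *\<^sub>R C)"
        using hn order_trans[OF hn abs_ge_self] by (intro AE_I2) (auto simp: indicator_def)
    qed measurable
    from set_borel_integral_eq_integral(2)[OF this] show ?thesis
      by (simp add: set_lebesgue_integral_def)
  qed
  have "(\<lambda>z. \<xi> (fst z) + (LINT r|lborel. indicator {t..min (snd z) T} r *\<^sub>R h (fst z) r)) \<in> borel_measurable (M \<Otimes>\<^sub>M borel)"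
  proof (intro borel_measurable_add lborel.borel_measurable_lebesgue_integral)
    show "(\<lambda>z. \<xi> (fst z)) \<in> borel_measurable (M \<Otimes>\<^sub>M borel)" using \<xi> by measurable
    have "(\<lambda>p. h (fst (fst p)) (snd p)) \<in> borel_measurable ((M \<Otimes>\<^sub>M borel) \<Otimes>\<^sub>M lborel)"
      using measurable_compose[OF _ hm, of "\<lambda>p. (fst (fst p), snd p)" "(M \<Otimes>\<^sub>M borel) \<Otimes>\<^sub>M lborel"] by simp
    then have "(\<lambda>p. (if t \<le> snd p \<and> snd p \<le> min (snd (fst p)) T then h (fst (fst p)) (snd p) else 0)) \<in> borel_measurable ((M \<Otimes>\<^sub>M borel) \<Otimes>\<^sub>M lborel)"
      by measurable
    moreover have "(\<lambda>p. (if t \<le> snd p \<and> snd p \<le> min (snd (fst p)) T then h (fst (fst p)) (snd p) else 0))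
        = (\<lambda>(z, r). indicator {t..min (snd z) T} r *\<^sub>R h (fst z) r)"
      by (auto simp: indicator_def fun_eq_iff)
    ultimately show "(\<lambda>(z, r). indicator {t..min (snd z) T} r *\<^sub>R h (fst z) r) \<in> borel_measurable ((M \<Otimes>\<^sub>M borel) \<Otimes>\<^sub>M lborel)"
      by simp
  qed
  then show ?case
    by (subst measurable_cong[where g="\<lambda>z. \<xi> (fst z) + (LINT r|lborel. indicator {t..min (snd z) T} r *\<^sub>R h (fst z) r)"])
      (auto simp: space_pair_measure eq h_def[symmetric])
qed

text \<open>The trajectory is the pointwise limit of the Picard iterates, each of which is jointly
  measurable by Fubini's theorem.\<close>

lemma traj_param_measurable:
  fixes \<xi> :: "'m => real^'n"
  assumes \<xi>: "\<xi> \<in> borel_measurable M"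
    and u: "(\<lambda>(y, s). u y s) \<in> borel_measurable (M \<Otimes>\<^sub>M borel)"
    and v: "(\<lambda>(y, s). v y s) \<in> borel_measurable (M \<Otimes>\<^sub>M borel)"
    and s: "s \<in> {t..T}"
  shows "(\<lambda>y. traj f t T (\<xi> y) (u y) (v y) s) \<in> borel_measurable M"
proof (rule borel_measurable_LIMSEQ_metric)
  show "(\<lambda>y. picard t T (\<xi> y) (u y) (v y) k s) \<in> borel_measurable M" for k
    using measurable_compose[OF measurable_Pair2'[of s borel M] picard_joint_measurable[OF \<xi> u v, of t T k]] by simp
  show "(\<lambda>k. picard t T (\<xi> y) (u y) (v y) k s) \<longlonglongrightarrow> traj f t T (\<xi> y) (u y) (v y) s" if y: "y \<in> space M" for y
  proof -
    have uc: "u y \<in> ctrls t T" by (rule borel_in_ctrl[OF borel_section[OF u y]])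
    have vc: "v y \<in> ctrls t T" by (rule borel_in_ctrl[OF borel_section[OF v y]])
    show ?thesis
      unfolding traj_eqI[OF uc vc picard_solves[OF uc vc] s] by (rule picard_converges(2)[OF uc vc s])
  qed
qed

end

section \<open>The game on a noise sequence\<close>

text \<open>Seen from the initial time, only the variables \<open>\<zeta>\<close> from the current cell onwards matter, and
  they are independent and uniform. So the game is played on an infinite sequence \<open>y\<close> of such
  variables, of which finitely many are used. The infinite sequence has the advantage that fixing the
  past and forgetting it lead back to the same measure: \<open>comb_seq j y z\<close> follows \<open>y\<close> for \<open>j\<close> steps
  and then \<open>z\<close>.\<close>

type_synonym noise_seq = "nat => real \<times> real"
type_synonym 'a noise_control = "noise_seq => real => 'a"

text \<open>\<open>'b\<close> is the control space of the opponent.\<close>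

type_synonym ('b, 'a) noise_strategy = "noise_seq => (real => 'b) => real => 'a"
type_synonym ('b, 'a) sample_strategy = "sample => (real => 'b) => real => 'a"

definition unif2 :: "(real \<times> real) measure" where
  "unif2 = uniform_measure lborel {0..1} \<Otimes>\<^sub>M uniform_measure lborel {0..1}"

definition noise :: "noise_seq measure" where
  "noise = Pi\<^sub>M UNIV (\<lambda>_. unif2)"

abbreviation play_space :: "real => real => (noise_seq \<times> (real => 'b::metric_space) \<times> real) measure" where
  "play_space t T \<equiv> noise \<Otimes>\<^sub>M (ctrl_space t T \<Otimes>\<^sub>M borel)"

abbreviation noise_avg :: "nat => (noise_seq => real) => noise_seq => real" where
  "noise_avg m H y \<equiv> (\<integral>z. H (comb_seq m y z) \<partial>noise)"

lemma prob_unif: "prob_space (uniform_measure lborel {0..1::real})"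
  by (rule prob_space_uniform_measure) auto

lemma prob_unif2: "prob_space unif2"
  unfolding unif2_def by (intro prob_space_pair prob_unif)

interpretation noise: sequence_space unif2
  by (intro sequence_space.intro product_prob_space.intro product_sigma_finite.intro product_prob_space_axioms.intro
      prob_unif2 prob_space_imp_sigma_finite)

interpretation noise_prob: prob_space noise
  unfolding noise_def by (rule noise.prob_space_axioms)

lemma sets_unif2 [measurable_cong, simp]: "sets unif2 = sets borel"
proof -
  have "sets unif2 = sets (borel \<Otimes>\<^sub>M borel :: (real \<times> real) measure)"
    unfolding unif2_def by (rule sets_pair_measure_cong) simp_all
  then show ?thesis by (simp only: borel_prod)
qed

lemma space_unif2 [simp]: "space unif2 = UNIV"
  using sets_eq_imp_space_eq[OF sets_unif2] by simp

lemma space_noise [simp]: "space noise = UNIV"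
  by (simp add: noise_def space_PiM)

lemma sets_noise [measurable_cong]: "sets noise = sets (Pi\<^sub>M UNIV (\<lambda>_. borel))"
  unfolding noise_def by (rule sets_PiM_cong) simp_all

lemma comb_seq_measurable [measurable]:
  assumes "g \<in> measurable M noise" "h \<in> measurable M noise"
  shows "(\<lambda>x. comb_seq m (g x) (h x)) \<in> measurable M noise"
  using assms unfolding noise_def by measurable

lemma shift_measurable [measurable]:
  assumes "g \<in> measurable M noise"
  shows "(\<lambda>x. (\<lambda>j. g x (m + j))) \<in> measurable M noise"
  unfolding noise_def
proof (rule measurable_PiM_single')
  show "(\<lambda>x. g x (m + j)) \<in> measurable M unif2" for j
    using assms unfolding noise_def by measurable
qed simp

lemma noise_split:
  fixes H :: "noise_seq => real"
  assumes H[measurable]: "H \<in> borel_measurable noise" and B: "\<And>y. \<bar>H y\<bar> \<le> B"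
  shows "(\<lambda>y. \<integral>z. H (comb_seq m y z) \<partial>noise) \<in> borel_measurable noise"
    and "(\<integral>y. H y \<partial>noise) = (\<integral>y. (noise_avg m H y) \<partial>noise)"
proof -
  interpret pair_prob_space noise noise ..
  show "(\<lambda>y. \<integral>z. H (comb_seq m y z) \<partial>noise) \<in> borel_measurable noise" by measurable
  have "(\<integral>y. H y \<partial>noise) = (\<integral>y. H y \<partial>distr (noise \<Otimes>\<^sub>M noise) noise (\<lambda>(y, z). comb_seq m y z))"
    using noise.PiM_comb_seq[of m] by (simp add: noise_def)
  also have "\<dots> = (\<integral>p. H (comb_seq m (fst p) (snd p)) \<partial>(noise \<Otimes>\<^sub>M noise))"
    by (subst integral_distr) (auto simp: case_prod_beta')
  also have "\<dots> = (\<integral>y. (noise_avg m H y) \<partial>noise)"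
  proof -
    have "integrable (noise \<Otimes>\<^sub>M noise) (\<lambda>p. H (comb_seq m (fst p) (snd p)))"
      by (rule P.integrable_const_bound[where B=B]) (use B in auto)
    from integral_fst'[OF this] show ?thesis by simp
  qed
  finally show "(\<integral>y. H y \<partial>noise) = (\<integral>y. (noise_avg m H y) \<partial>noise)" .
qed

lemma bounded_integrable_noise:
  fixes H :: "noise_seq => real"
  assumes "H \<in> borel_measurable noise" "\<And>y. \<bar>H y\<bar> \<le> B"
  shows "integrable noise H"
  by (rule noise_prob.integrable_const_bound[where B=B]) (use assms in auto)

text \<open>What the player who observes \<open>sel\<close> has seen at the beginning of stage \<open>j\<close> (the stages count
  from \<open>0\<close>): all earlier pairs, and the own component of the current one.\<close>

definition same_signal :: "(real \<times> real => real) => nat => noise_seq => noise_seq => bool" where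
  "same_signal sel j y y' \<longleftrightarrow> (\<forall>i<j. y i = y' i) \<and> sel (y j) = sel (y' j)"

text \<open>The times \<open>ts 0, \<dots>, ts n\<close> delimit the stages.\<close>

definition grid :: "nat => (nat => real) => bool" where
  "grid n ts \<longleftrightarrow> 1 \<le> n \<and> (\<forall>j<n. ts j < ts (Suc j))"

lemma grid_strict: "grid n ts ==> i < j ==> j \<le> n ==> ts i < ts j"
proof (induction j)
  case (Suc j)
  then have "ts j < ts (Suc j)" by (simp add: grid_def)
  then show ?case using Suc by (cases "i = j") auto
qed simp

lemma grid_mono: "grid n ts ==> i \<le> j ==> j \<le> n ==> ts i \<le> ts j"
  using grid_strict[of n ts i j] by (cases "i = j") auto

lemma grid_cell:
  assumes "grid n ts" "ts 0 \<le> s" "s < ts n"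
  obtains j where "j < n" "ts j \<le> s" "s < ts (Suc j)"
proof -
  define j where "j = (LEAST j. s < ts (Suc j))"
  have ex: "s < ts (Suc (n - 1))" using assms by (simp add: grid_def)
  have 1: "s < ts (Suc j)" unfolding j_def using ex by (rule LeastI)
  have "j \<le> n - 1" unfolding j_def using ex by (rule Least_le)
  then have 2: "j < n" using assms(1) unfolding grid_def by linarith
  have "ts j \<le> s"
  proof (cases j)
    case (Suc i)
    then have "\<not> s < ts (Suc i)" using not_less_Least[of i "\<lambda>j. s < ts (Suc j)"] by (simp add: j_def)
    then show ?thesis using Suc by simp
  qed (use assms(2) in simp)
  with 1 2 show ?thesis using that by blast
qed

text \<open>Random controls and nonanticipative strategies on a grid. As functions of the whole noise
  sequence they need no separate type for the signal of each stage.\<close>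

definition rctrl :: "(real \<times> real => real) => nat => (nat => real) => 'a::metric_space noise_control set" where
  "rctrl sel n ts = {u. (\<lambda>(y, s). u y s) \<in> borel_measurable (noise \<Otimes>\<^sub>M borel) \<and>
     (\<forall>j<n. \<forall>y y'. same_signal sel j y y' --> (\<forall>s\<in>{ts j..<ts (Suc j)}. u y s = u y' s))}"

definition rstrat :: "(real \<times> real => real) => nat => (nat => real) =>
    ('b::metric_space, 'a::metric_space) noise_strategy set" where
  "rstrat sel n ts = {a. (\<lambda>(y, w, s). a y w s) \<in> borel_measurable (play_space (ts 0) (ts n)) \<and>
     (\<forall>j<n. \<forall>y y'. same_signal sel j y y' -->
        (\<forall>w\<in>ctrls (ts 0) (ts n). \<forall>s\<in>{ts j..<ts (Suc j)}. a y w s = a y' w s)) \<and>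
     (\<forall>j<n. \<forall>w\<in>ctrls (ts 0) (ts n). \<forall>w'\<in>ctrls (ts 0) (ts n).
        agree (ts 0) (ts j) w w' --> (\<forall>y. agree (ts j) (ts (Suc j)) (a y w) (a y w')))}"

definition plays :: "real => real => ((real => 'v::metric_space) => real => 'u::metric_space) =>
    ((real => 'u) => real => 'v) => (real => 'u) => (real => 'v) => bool" where
  "plays t T a b u v \<longleftrightarrow> u \<in> ctrls t T \<and> v \<in> ctrls t T \<and>
     agree t T (a v) u \<and> agree t T (b u) v"

lemma rctrl_measurable: "u \<in> rctrl sel n ts ==> (\<lambda>(y, s). u y s) \<in> borel_measurable (noise \<Otimes>\<^sub>M borel)"
  by (simp add: rctrl_def)

lemma rctrl_section: "u \<in> rctrl sel n ts ==> u y \<in> borel_measurable borel"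
  using measurable_compose[OF measurable_Pair1'[of y noise borel], of "\<lambda>(y, s). u y s" borel]
  by (simp add: rctrl_def)

lemma rctrl_ctrl: "u \<in> rctrl sel n ts ==> u y \<in> ctrls t T"
  by (rule borel_in_ctrl[OF rctrl_section])

lemma rctrl_signal: "u \<in> rctrl sel n ts ==> j < n ==> same_signal sel j y y' ==> ts j \<le> s ==> s < ts (Suc j) ==> u y s = u y' s"
  unfolding rctrl_def by auto

lemma rstrat_nonanticipating:
  "a \<in> rstrat sel n ts ==> j < n ==> w \<in> ctrls (ts 0) (ts n) ==> w' \<in> ctrls (ts 0) (ts n) ==>
   agree (ts 0) (ts j) w w' ==> agree (ts j) (ts (Suc j)) (a y w) (a y w')"
  unfolding rstrat_def by auto

lemma rstrat_signal:
  "a \<in> rstrat sel n ts ==> j < n ==> same_signal sel j y y' ==> w \<in> ctrls (ts 0) (ts n) ==>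
   ts j \<le> s ==> s < ts (Suc j) ==> a y w s = a y' w s"
  unfolding rstrat_def by auto

lemma rstrat_measurable:
  "a \<in> rstrat sel n ts ==> (\<lambda>(y, w, s). a y w s) \<in> borel_measurable (play_space (ts 0) (ts n))"
  by (simp add: rstrat_def)

lemma rstrat_compose_measurable:
  assumes a: "a \<in> rstrat sel n ts" and h: "h \<in> measurable M noise"
    and w: "w \<in> measurable M (ctrl_space (ts 0) (ts n))" and s: "s \<in> borel_measurable M"
  shows "(\<lambda>x. a (h x) (w x) (s x)) \<in> borel_measurable M"
  using measurable_compose[OF measurable_Pair[OF h measurable_Pair[OF w s]] rstrat_measurable[OF a]] by simp

text \<open>Two plays against the same strategy \<open>b\<close> coincide as long as the opponents' reactions agree on
  one of them: since neither side anticipates, this follows stage by stage.\<close>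

lemma plays_unique_upto:
  assumes g: "grid n ts" and a: "a \<in> rstrat s1 n ts" and b: "b \<in> rstrat s2 n ts" and J: "J \<le> n"
    and aa': "agree (ts 0) (ts J) (a y v') (a' v')"
    and p: "plays (ts 0) (ts n) (a y) (b y) u v" and p': "plays (ts 0) (ts n) a' (b y) u' v'"
  shows "agree (ts 0) (ts J) u u' \<and> agree (ts 0) (ts J) v v'"
proof -
  have "agree (ts 0) (ts j) u u' \<and> agree (ts 0) (ts j) v v'" if "j \<le> J" for j
    using that
  proof (induction j)
    case 0
    show ?case by (simp add: agree_def)
  next
    case (Suc j)
    then have IH: "agree (ts 0) (ts j) u u'" "agree (ts 0) (ts j) v v'" and j: "j < n" using J by auto
    have le: "ts 0 \<le> ts j" "ts (Suc j) \<le> ts n" "ts (Suc j) \<le> ts J" using Suc.prems J by (auto intro: grid_mono[OF g])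
    note pp = p[unfolded plays_def] and pp' = p'[unfolded plays_def]
    have "agree (ts j) (ts (Suc j)) (a y v) (a y v')"
      using pp pp' IH(2) by (intro rstrat_nonanticipating[OF a j]) auto
    moreover have "agree (ts j) (ts (Suc j)) (a y v') (a' v')" using aa' le by (auto intro: agree_subset)
    moreover have "agree (ts j) (ts (Suc j)) (a y v) u" "agree (ts j) (ts (Suc j)) (a' v') u'"
      using pp pp' le by (auto intro: agree_subset)
    ultimately have u: "agree (ts j) (ts (Suc j)) u u'"
      by (meson agree_sym agree_trans)
    have "agree (ts j) (ts (Suc j)) (b y u) (b y u')"
      using pp pp' IH(1) by (intro rstrat_nonanticipating[OF b j]) auto
    moreover have "agree (ts j) (ts (Suc j)) (b y u) v" "agree (ts j) (ts (Suc j)) (b y u') v'"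
      using pp pp' le by (auto intro: agree_subset)
    ultimately have "agree (ts j) (ts (Suc j)) v v'"
      by (meson agree_sym agree_trans)
    with u IH show ?case by (auto intro: agree_join)
  qed
  then show ?thesis by simp
qed

lemma plays_unique:
  assumes g: "grid n ts" and a: "a \<in> rstrat s1 n ts" and b: "b \<in> rstrat s2 n ts"
    and p: "plays (ts 0) (ts n) (a y) (b y) u v" and p': "plays (ts 0) (ts n) (a y) (b y) u' v'"
  shows "agree (ts 0) (ts n) u u' \<and> agree (ts 0) (ts n) v v'"
  by (rule plays_unique_upto[OF g a b order_refl agree_refl p p'])

context controlled_system
begin

text \<open>The play is built stage by stage: \<open>stage ts a b j\<close> is correct before \<open>ts j\<close>, and in stage \<open>j\<close>
  each side answers to what the other has done so far.\<close>

primrec stage :: "(nat => real) => ('v, 'u) noise_strategy =>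
    ('u, 'v) noise_strategy => nat =>
    'u noise_control \<times> 'v noise_control" where
  "stage ts a b 0 = (\<lambda>y s. undefined, \<lambda>y s. undefined)"
| "stage ts a b (Suc j) =
    (\<lambda>y s. if ts j \<le> s \<and> s < ts (Suc j) then a y (snd (stage ts a b j) y) s else fst (stage ts a b j) y s,
     \<lambda>y s. if ts j \<le> s \<and> s < ts (Suc j) then b y (fst (stage ts a b j) y) s else snd (stage ts a b j) y s)"

lemma stage_measurable:
  assumes a: "a \<in> rstrat s1 n ts" and b: "b \<in> rstrat s2 n ts"
  shows "(\<lambda>(y, s). fst (stage ts a b j) y s) \<in> borel_measurable (noise \<Otimes>\<^sub>M borel) \<and>
         (\<lambda>(y, s). snd (stage ts a b j) y s) \<in> borel_measurable (noise \<Otimes>\<^sub>M borel)"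
proof (induction j)
  case (Suc j)
  have u: "(\<lambda>z. fst (stage ts a b j) (fst z) (snd z)) \<in> borel_measurable (noise \<Otimes>\<^sub>M borel)"
    and v: "(\<lambda>z. snd (stage ts a b j) (fst z) (snd z)) \<in> borel_measurable (noise \<Otimes>\<^sub>M borel)"
    using Suc by (auto simp: case_prod_beta')
  have "(\<lambda>z. a (fst z) (snd (stage ts a b j) (fst z)) (snd z)) \<in> borel_measurable (noise \<Otimes>\<^sub>M borel)"
    by (rule rstrat_compose_measurable[OF a measurable_fst
          measurable_compose[OF measurable_fst measurable_ctrl_valued[OF compact_V conjunct2[OF Suc]]] measurable_snd])
  moreover have "(\<lambda>z. b (fst z) (fst (stage ts a b j) (fst z)) (snd z)) \<in> borel_measurable (noise \<Otimes>\<^sub>M borel)"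
    by (rule rstrat_compose_measurable[OF b measurable_fst
          measurable_compose[OF measurable_fst measurable_ctrl_valued[OF compact_U conjunct1[OF Suc]]] measurable_snd])
  moreover have "Measurable.pred (noise \<Otimes>\<^sub>M borel) (\<lambda>z. ts j \<le> snd z \<and> snd z < ts (Suc j))" by measurable
  ultimately show ?case using u v by (simp add: case_prod_beta' measurable_If)
qed simp

lemma stage_ctrl:
  assumes a: "a \<in> rstrat s1 n ts" and b: "b \<in> rstrat s2 n ts"
  shows "fst (stage ts a b j) y \<in> ctrls t T" "snd (stage ts a b j) y \<in> ctrls t T"
  using stage_measurable[OF a b, of j] by (auto intro!: borel_in_ctrl borel_section[of _ noise])

lemma stage_stable:
  assumes g: "grid n ts" and "i \<le> j" "j \<le> n" "s < ts i"
  shows "fst (stage ts a b j) y s = fst (stage ts a b i) y s" "snd (stage ts a b j) y s = snd (stage ts a b i) y s"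
  using assms(2,3)
proof (induction j)
  case (Suc j)
  { case 1 then show ?case using Suc.IH(1) grid_mono[OF g, of i j] assms(4) by (cases "i = Suc j") auto }
  { case 2 then show ?case using Suc.IH(2) grid_mono[OF g, of i j] assms(4) by (cases "i = Suc j") auto }
qed simp_all

lemma stage_signal:
  assumes a: "a \<in> rstrat s1 n ts" and b: "b \<in> rstrat s2 n ts" and "j \<le> n" "\<And>i. i < j ==> y i = y' i"
  shows "fst (stage ts a b j) y = fst (stage ts a b j) y' \<and> snd (stage ts a b j) y = snd (stage ts a b j) y'"
  using assms(3,4)
proof (induction j)
  case (Suc j)
  have IH: "fst (stage ts a b j) y = fst (stage ts a b j) y'" "snd (stage ts a b j) y = snd (stage ts a b j) y'"
    using Suc by auto
  have ss: "same_signal sel j y y'" for sel using Suc.prems by (auto simp: same_signal_def)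
  have j: "j < n" using Suc.prems by simp
  show ?case
    using IH rstrat_signal[OF a j ss stage_ctrl(2)[OF a b]] rstrat_signal[OF b j ss stage_ctrl(1)[OF a b]]
    by (auto simp: fun_eq_iff)
qed simp

lemma plays_exists:
  fixes a :: "('v, 'u) noise_strategy"
    and b :: "('u, 'v) noise_strategy"
  assumes g: "grid n ts" and a: "a \<in> rstrat s1 n ts" and b: "b \<in> rstrat s2 n ts"
  obtains u v where "u \<in> rctrl s1 n ts" "v \<in> rctrl s2 n ts" "\<And>y. plays (ts 0) (ts n) (a y) (b y) (u y) (v y)"
proof -
  define u where "u = fst (stage ts a b n)"
  define v where "v = snd (stage ts a b n)"
  have u: "u y s = a y (snd (stage ts a b j) y) s" and v: "v y s = b y (fst (stage ts a b j) y) s"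
    if "j < n" "ts j \<le> s" "s < ts (Suc j)" for j y s
    using stage_stable[OF g, of "Suc j" n s a b y] that by (auto simp: u_def v_def)
  have um: "u y \<in> ctrls t T" and vm: "v y \<in> ctrls t T" for y t T
    unfolding u_def v_def by (rule stage_ctrl[OF a b])+
  have "u \<in> rctrl s1 n ts"
    unfolding rctrl_def
  proof (intro CollectI conjI allI impI ballI)
    show "(\<lambda>(y, s). u y s) \<in> borel_measurable (noise \<Otimes>\<^sub>M borel)" unfolding u_def using stage_measurable[OF a b] by simp
    fix j y y' s assume *: "j < n" "same_signal s1 j y y'" "s \<in> {ts j..<ts (Suc j)}"
    have "snd (stage ts a b j) y = snd (stage ts a b j) y'"
      using stage_signal[OF a b, of j y y'] * by (auto simp: same_signal_def)
    then show "u y s = u y' s" using * u rstrat_signal[OF a *(1,2) stage_ctrl(2)[OF a b]] by simp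
  qed
  moreover have "v \<in> rctrl s2 n ts"
    unfolding rctrl_def
  proof (intro CollectI conjI allI impI ballI)
    show "(\<lambda>(y, s). v y s) \<in> borel_measurable (noise \<Otimes>\<^sub>M borel)" unfolding v_def using stage_measurable[OF a b] by simp
    fix j y y' s assume *: "j < n" "same_signal s2 j y y'" "s \<in> {ts j..<ts (Suc j)}"
    have "fst (stage ts a b j) y = fst (stage ts a b j) y'"
      using stage_signal[OF a b, of j y y'] * by (auto simp: same_signal_def)
    then show "v y s = v y' s" using * v rstrat_signal[OF b *(1,2) stage_ctrl(1)[OF a b]] by simp
  qed
  moreover have "plays (ts 0) (ts n) (a y) (b y) (u y) (v y)" for y
    unfolding plays_def
  proof (intro conjI um vm)
    have cells: "agree (ts 0) (ts j) (a y (v y)) (u y) \<and> agree (ts 0) (ts j) (b y (u y)) (v y)" if "j \<le> n" for j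
      using that
    proof (induction j)
      case 0 show ?case by (simp add: agree_def)
    next
      case (Suc j)
      then have j: "j < n" by simp
      have "agree (ts j) (ts (Suc j)) (a y (v y)) (a y (snd (stage ts a b j) y))"
        using stage_stable(2)[OF g, of j n _ a b y] j
        by (intro rstrat_nonanticipating[OF a j] vm stage_ctrl[OF a b] agreeI) (auto simp: v_def)
      then have 1: "agree (ts j) (ts (Suc j)) (a y (v y)) (u y)"
        by (rule agree_trans) (rule agreeI, rule u[OF j, symmetric])
      have "agree (ts j) (ts (Suc j)) (b y (u y)) (b y (fst (stage ts a b j) y))"
        using stage_stable(1)[OF g, of j n _ a b y] j
        by (intro rstrat_nonanticipating[OF b j] um stage_ctrl[OF a b] agreeI) (auto simp: u_def)
      then have 2: "agree (ts j) (ts (Suc j)) (b y (u y)) (v y)"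
        by (rule agree_trans) (rule agreeI, rule v[OF j, symmetric])
      from Suc 1 2 show ?case by (auto intro: agree_join)
    qed
    show "agree (ts 0) (ts n) (a y (v y)) (u y)" "agree (ts 0) (ts n) (b y (u y)) (v y)" using cells[of n] by auto
  qed
  ultimately show ?thesis by (rule that)
qed

end

section \<open>Restarting and switching strategies\<close>

definition splice :: "real => (real => 'a) => (real => 'a) => real => 'a" where
  "splice \<theta> u w = (\<lambda>s. if s < \<theta> then u s else w s)"

lemma splice_ctrl:
  fixes u w :: "real => 'a::metric_space"
  assumes "u \<in> ctrls t T" "w \<in> ctrls \<theta> T" "t \<le> \<theta>" "\<theta> \<le> T"
  shows "splice \<theta> u w \<in> ctrls t T"
proof -
  have "{t..T} \<inter> {s. s < \<theta>} = {t..<\<theta>}" "{t..T} \<inter> - {s. s < \<theta>} = {\<theta>..T}" using assms by auto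
  moreover have "{s. t \<le> s \<and> s \<le> T \<and> s < \<theta>} \<in> sets (lebesgue_on {t..T})"
  proof -
    have "{s. t \<le> s \<and> s \<le> T \<and> s < \<theta>} = {t..T} \<inter> {..<\<theta>}" by auto
    then show ?thesis by (simp add: sets_restrict_space_iff)
  qed
  ultimately show ?thesis using assms unfolding space_ctrl splice_def
    by (intro measurable_If_restrict_space_iff[THEN iffD2] conjI)
      (auto simp: restrict_restrict_space pred_def intro: measurable_restrict_mono)
qed

lemma splice_measurable:
  fixes u :: "real => 'a::metric_space"
  assumes u: "u \<in> ctrls t T" and "t \<le> \<theta>" "\<theta> \<le> T"
  shows "splice \<theta> u \<in> measurable (ctrl_space \<theta> T) (ctrl_space t T)"
proof (rule ctrl_nonexpansive_measurable)
  show "splice \<theta> u w \<in> ctrls t T" if "w \<in> ctrls \<theta> T" for w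
    by (rule splice_ctrl[OF u that assms(2,3)])
  show "discrep t T (splice \<theta> u v) (splice \<theta> u w) e \<le> discrep \<theta> T v w e" if "e > 0" for v w e
  proof -
    have "{s \<in> {t..T}. e < dist (splice \<theta> u v s) (splice \<theta> u w s)} = {s \<in> {\<theta>..T}. e < dist (v s) (w s)}"
      using that assms(2,3) by (auto simp: splice_def)
    then show ?thesis by (simp add: discrep_def)
  qed
qed

lemma ctrl_inclusion_measurable:
  assumes cpt: "compact (UNIV :: 'a::metric_space set)" and "t \<le> \<theta>"
  shows "(\<lambda>w. w) \<in> measurable (ctrl_space t T :: (real => 'a) measure) (ctrl_space \<theta> T)"
proof (rule ctrl_nonexpansive_measurable)
  show inc: "w \<in> ctrls \<theta> T" if "w \<in> ctrls t T" for w :: "real => 'a"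
    using that assms(2) unfolding space_ctrl by (intro measurable_restrict_mono[of w _ "{t..T}" _ "{\<theta>..T}"]) auto
  show "discrep \<theta> T v w e \<le> discrep t T v w e" if "v \<in> ctrls t T" "w \<in> ctrls t T" for v w :: "real => 'a" and e
    unfolding discrep_def
    by (rule measure_mono_fmeasurable[OF _ discrep_set_sets[OF cpt inc[OF that(1)] inc[OF that(2)]] discrep_set_measurable[OF cpt that]])
      (use assms(2) in auto)
qed

text \<open>The grid of the game that starts at \<open>\<theta>\<close> within stage \<open>m\<close>.\<close>

definition subgrid :: "nat => real => (nat => real) => nat => real" where
  "subgrid m \<theta> ts j = (if j = 0 then \<theta> else ts (m + j))"

lemma subgrid_0 [simp]: "subgrid m \<theta> ts 0 = \<theta>" by (simp add: subgrid_def)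

lemma subgrid_last [simp]: "m < n ==> subgrid m \<theta> ts (n - m) = ts n" by (simp add: subgrid_def)

lemma subgrid_grid:
  assumes "grid n ts" "m < n" "ts m \<le> \<theta>" "\<theta> < ts (Suc m)"
  shows "grid (n - m) (subgrid m \<theta> ts)"
  using assms unfolding grid_def subgrid_def by auto

lemma rstrat_cong_agree:
  assumes g: "grid n ts" and a: "a \<in> rstrat sel n ts" and w: "w \<in> ctrls (ts 0) (ts n)"
    and w': "w' \<in> ctrls (ts 0) (ts n)" and ag: "agree (ts 0) (ts n) w w'"
  shows "agree (ts 0) (ts n) (a y w) (a y w')"
proof -
  have "agree (ts 0) (ts j) (a y w) (a y w')" if "j \<le> n" for j
    using that
  proof (induction j)
    case 0 show ?case by (simp add: agree_def)
  next
    case (Suc j)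
    have "agree (ts 0) (ts j) w w'" 
      by (rule agree_subset[OF ag]) (use Suc.prems in "auto intro: grid_mono[OF g]")
    then have "agree (ts j) (ts (Suc j)) (a y w) (a y w')"
      using Suc.prems by (intro rstrat_nonanticipating[OF a _ w w']) auto
    then show ?case using Suc by (auto intro: agree_join)
  qed
  then show ?thesis by simp
qed

text \<open>The strategy that an opponent using \<open>b\<close> follows from time \<open>\<theta>\<close> on, once the first \<open>m\<close> noise pairs
  \<open>y\<close> and the control \<open>u\<close> played before \<open>\<theta>\<close> are fixed.\<close>

definition continuation :: "nat => real => noise_seq => (real => 'b) =>
    ('b, 'a) noise_strategy => ('b, 'a) noise_strategy" where
  "continuation m \<theta> y u b = (\<lambda>z w. b (comb_seq m y z) (splice \<theta> u w))"

lemma continuation_rstrat: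
  fixes b :: "('b::metric_space, 'a::metric_space) noise_strategy"
  assumes g: "grid n ts" and m: "m < n" and \<theta>: "ts m \<le> \<theta>" "\<theta> < ts (Suc m)"
    and b: "b \<in> rstrat sel n ts" and u: "u \<in> ctrls (ts 0) (ts n)"
  shows "continuation m \<theta> y u b \<in> rstrat sel (n - m) (subgrid m \<theta> ts)"
proof -
  have t0: "ts 0 \<le> \<theta>" using grid_mono[OF g, of 0 m] m \<theta> by auto
  have tn: "\<theta> \<le> ts n" using grid_mono[OF g, of "Suc m" n] m \<theta> by auto
  have sp: "splice \<theta> u w \<in> ctrls (ts 0) (ts n)" if "w \<in> ctrls \<theta> (ts n)" for w
    by (rule splice_ctrl[OF u that t0 tn])
  have cell: "ts (m + j) \<le> s \<and> s < ts (Suc (m + j))" if "s \<in> {subgrid m \<theta> ts j..<subgrid m \<theta> ts (Suc j)}" for s j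
    using that \<theta> by (auto simp: subgrid_def split: if_splits)
  show ?thesis
    unfolding rstrat_def subgrid_last[OF m] subgrid_0
  proof (intro CollectI conjI allI ballI impI)
    have "(\<lambda>p. b (comb_seq m y (fst p)) (splice \<theta> u (fst (snd p))) (snd (snd p)))
        \<in> borel_measurable (play_space \<theta> (ts n))"
    proof (rule rstrat_compose_measurable[OF b])
      show "(\<lambda>p. comb_seq m y (fst p)) \<in> measurable (play_space \<theta> (ts n)) noise"
        by (intro comb_seq_measurable) auto
      show "(\<lambda>p. splice \<theta> u (fst (snd p))) \<in> measurable (play_space \<theta> (ts n)) (ctrl_space (ts 0) (ts n))"
        by (rule measurable_compose[OF _ splice_measurable[OF u t0 tn]]) simp
    qed simp
    then show "(\<lambda>(z, w, s). continuation m \<theta> y u b z w s) \<in> borel_measurable (play_space \<theta> (ts n))"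
      by (simp add: continuation_def case_prod_beta')
  next
    fix j z z' and w :: "real => 'b" and s assume *: "j < n - m" "same_signal sel j z z'" "w \<in> ctrls \<theta> (ts n)"
      "s \<in> {subgrid m \<theta> ts j..<subgrid m \<theta> ts (Suc j)}"
    have "same_signal sel (m + j) (comb_seq m y z) (comb_seq m y z')"
      using *(2) by (auto simp: same_signal_def comb_seq_def)
    then show "continuation m \<theta> y u b z w s = continuation m \<theta> y u b z' w s"
      unfolding continuation_def using *(1) cell[OF *(4)] by (intro rstrat_signal[OF b _ _ sp[OF *(3)]]) auto
  next
    fix j and w w' :: "real => 'b" and z assume *: "j < n - m" "w \<in> ctrls \<theta> (ts n)" "w' \<in> ctrls \<theta> (ts n)"
      "agree \<theta> (subgrid m \<theta> ts j) w w'"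
    have 1: "agree (ts 0) \<theta> (splice \<theta> u w) (splice \<theta> u w')" by (rule agreeI) (simp add: splice_def)
    have 2: "agree \<theta> (subgrid m \<theta> ts j) (splice \<theta> u w) (splice \<theta> u w')"
      using *(4) by (subst agree_cong[where u'=w and v'=w']) (auto simp: splice_def)
    have "agree (ts 0) (ts (m + j)) (splice \<theta> u w) (splice \<theta> u w')"
      by (rule agree_subset[OF agree_join[OF 1 2]]) (use \<theta> in "auto simp: subgrid_def")
    then have "agree (ts (m + j)) (ts (Suc (m + j))) (b (comb_seq m y z) (splice \<theta> u w)) (b (comb_seq m y z) (splice \<theta> u w'))"
      using *(1) by (intro rstrat_nonanticipating[OF b _ sp[OF *(2)] sp[OF *(3)]]) auto
    then show "agree (subgrid m \<theta> ts j) (subgrid m \<theta> ts (Suc j)) (continuation m \<theta> y u b z w) (continuation m \<theta> y u b z w')"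
      unfolding continuation_def by (rule agree_subset) (use \<theta> in "auto simp: subgrid_def")
  qed
qed

text \<open>Follow \<open>a\<close>; if the event \<open>K\<close> has occurred by the beginning of stage \<open>m\<close>, play from \<open>\<theta>\<close> on the
  strategy \<open>\<Gamma>\<close> that belongs to the state \<open>\<xi>\<close> and sees the noise from stage \<open>m\<close> on.\<close>

definition switch :: "nat => real => (noise_seq => (real => 'b) => bool) =>
    (noise_seq => (real => 'b) => 'x) =>
    ('x => ('b, 'a) noise_strategy) =>
    ('b, 'a) noise_strategy => ('b, 'a) noise_strategy" where
  "switch m \<theta> K \<xi> \<Gamma> a = (\<lambda>y w s. if \<theta> \<le> s \<and> K y w then \<Gamma> (\<xi> y w) (\<lambda>j. y (m + j)) w s else a y w s)"

text \<open>The assumption \<open>past\<close> says that event and state are known when the switch takes place.\<close>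

lemma switch_rstrat:
  fixes a :: "('b::metric_space, 'a::metric_space) noise_strategy"
    and \<xi> :: "noise_seq => (real => 'b) => 'x::topological_space"
  assumes cpt: "compact (UNIV :: 'b set)"
    and g: "grid n ts" and m: "m < n" and \<theta>: "ts m \<le> \<theta>" "\<theta> < ts (Suc m)"
    and a: "a \<in> rstrat sel n ts"
    and K: "{p \<in> space (noise \<Otimes>\<^sub>M ctrl_space (ts 0) (ts n)). K (fst p) (snd p)} \<in> sets (noise \<Otimes>\<^sub>M ctrl_space (ts 0) (ts n))"
    and \<xi>: "(\<lambda>p. \<xi> (fst p) (snd p)) \<in> borel_measurable (noise \<Otimes>\<^sub>M ctrl_space (ts 0) (ts n))"
    and past: "\<And>y y' w w'. (\<And>i. i < m ==> y i = y' i) ==> w \<in> ctrls (ts 0) (ts n) ==>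
       w' \<in> ctrls (ts 0) (ts n) ==> agree (ts 0) (ts m) w w' ==> K y w = K y' w' \<and> (K y w --> \<xi> y w = \<xi> y' w')"
    and \<Gamma>: "\<And>x. \<Gamma> x \<in> rstrat sel (n - m) (subgrid m \<theta> ts)"
    and \<Gamma>m: "(\<lambda>(x, z, w, s). \<Gamma> x z w s) \<in> borel_measurable (borel \<Otimes>\<^sub>M (play_space \<theta> (ts n)))"
  shows "switch m \<theta> K \<xi> \<Gamma> a \<in> rstrat sel n ts"
proof -
  let ?C = "ctrl_space (ts 0) (ts n) :: (real => 'b) measure"
  have t0: "ts 0 \<le> \<theta>" using grid_mono[OF g, of 0 m] m \<theta> by auto
  have sub: "w \<in> ctrls \<theta> (ts n)" if "w \<in> space ?C" for w
    using measurable_space[OF ctrl_inclusion_measurable[OF cpt t0] that] .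
  have later: "m \<le> j" if "\<theta> \<le> s" "s < ts (Suc j)" "j < n" for s j
  proof (rule ccontr)
    assume "\<not> m \<le> j"
    then have "ts (Suc j) \<le> ts m" using m by (intro grid_mono[OF g]) auto
    with that \<theta> show False by auto
  qed
  have cell: "subgrid m \<theta> ts (j - m) \<le> s \<and> s < subgrid m \<theta> ts (Suc (j - m))"
    if "ts j \<le> s" "s < ts (Suc j)" "\<theta> \<le> s" "m \<le> j" for s j
    using that by (auto simp: subgrid_def)
  show ?thesis
    unfolding rstrat_def
  proof (intro CollectI conjI allI ballI impI)
    let ?M = "noise \<Otimes>\<^sub>M (?C \<Otimes>\<^sub>M borel) :: (noise_seq \<times> (real => 'b) \<times> real) measure"
    have yw: "(\<lambda>p. (fst p, fst (snd p))) \<in> measurable ?M (noise \<Otimes>\<^sub>M ?C)" by measurable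
    have "{p \<in> space ?M. K (fst p) (fst (snd p))} = (\<lambda>p. (fst p, fst (snd p))) -` {p \<in> space (noise \<Otimes>\<^sub>M ?C). K (fst p) (snd p)} \<inter> space ?M"
      by (auto simp: space_pair_measure)
    also have "\<dots> \<in> sets ?M" by (rule measurable_sets[OF yw K])
    finally have 1: "Measurable.pred ?M (\<lambda>p. K (fst p) (fst (snd p)))" by (simp add: pred_def)
    have 2: "(\<lambda>p. \<xi> (fst p) (fst (snd p))) \<in> borel_measurable ?M"
      using measurable_compose[OF yw \<xi>] by simp
    have 3: "(\<lambda>p. fst (snd p)) \<in> measurable ?M (ctrl_space \<theta> (ts n))"
      by (rule measurable_compose[OF _ ctrl_inclusion_measurable[OF cpt t0]]) simp
    have 4: "(\<lambda>p. (\<lambda>j. fst p (m + j))) \<in> measurable ?M noise" by (intro shift_measurable) simp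
    have 5: "(\<lambda>p. \<Gamma> (\<xi> (fst p) (fst (snd p))) (\<lambda>j. fst p (m + j)) (fst (snd p)) (snd (snd p))) \<in> borel_measurable ?M"
      using measurable_compose[OF measurable_Pair[OF 2 measurable_Pair[OF 4 measurable_Pair[OF 3, of "\<lambda>p. snd (snd p)"]]] \<Gamma>m]
      by (simp add: case_prod_beta')
    have 6: "(\<lambda>p. a (fst p) (fst (snd p)) (snd (snd p))) \<in> borel_measurable ?M"
      using rstrat_measurable[OF a] by (simp add: case_prod_beta')
    have 7: "Measurable.pred ?M (\<lambda>p. \<theta> \<le> snd (snd p))" by measurable
    have "(\<lambda>p. if \<theta> \<le> snd (snd p) \<and> K (fst p) (fst (snd p))
          then \<Gamma> (\<xi> (fst p) (fst (snd p))) (\<lambda>j. fst p (m + j)) (fst (snd p)) (snd (snd p))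
          else a (fst p) (fst (snd p)) (snd (snd p))) \<in> borel_measurable ?M"
      by (rule measurable_If[OF 5 6]) (use pred_intros_logic(3)[OF 7 1] in "simp add: pred_def")
    then show "(\<lambda>(y, w, s). switch m \<theta> K \<xi> \<Gamma> a y w s) \<in> borel_measurable ?M"
      by (simp add: switch_def case_prod_beta')
  next
    fix j y y' w s assume *: "j < n" "same_signal sel j y y'" "w \<in> space ?C" "s \<in> {ts j..<ts (Suc j)}"
    have aeq: "a y w s = a y' w s" using * by (intro rstrat_signal[OF a]) auto
    show "switch m \<theta> K \<xi> \<Gamma> a y w s = switch m \<theta> K \<xi> \<Gamma> a y' w s"
    proof (cases "\<theta> \<le> s")
      case True
      then have mj: "m \<le> j" using later * by auto
      then have pa: "K y w = K y' w \<and> (K y w --> \<xi> y w = \<xi> y' w)"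
        using * by (intro past) (auto simp: same_signal_def)
      have "same_signal sel (j - m) (\<lambda>j. y (m + j)) (\<lambda>j. y' (m + j))"
        using *(2) mj by (auto simp: same_signal_def)
      then have "\<Gamma> x (\<lambda>j. y (m + j)) w s = \<Gamma> x (\<lambda>j. y' (m + j)) w s" for x
        using * mj cell[of j s] True sub by (intro rstrat_signal[OF \<Gamma>, of "j - m"]) (auto simp: subgrid_last[OF m])
      then show ?thesis using pa aeq by (auto simp: switch_def)
    qed (simp add: switch_def aeq)
  next
    fix j w w' y assume *: "j < n" "w \<in> space ?C" "w' \<in> space ?C" "agree (ts 0) (ts j) w w'"
    have aag: "agree (ts j) (ts (Suc j)) (a y w) (a y w')" by (rule rstrat_nonanticipating[OF a *])
    show "agree (ts j) (ts (Suc j)) (switch m \<theta> K \<xi> \<Gamma> a y w) (switch m \<theta> K \<xi> \<Gamma> a y w')"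
    proof (cases "m \<le> j")
      case False
      have "\<not> \<theta> \<le> s" if "s < ts (Suc j)" for s using False later that *(1) by blast
      then show ?thesis using aag by (subst agree_cong[where u'="a y w" and v'="a y w'"]) (auto simp: switch_def)
    next
      case mj: True
      have ag: "agree (ts 0) (ts m) w w'" by (rule agree_subset[OF *(4)]) (use mj * in "auto intro: grid_mono[OF g]")
      have pa: "K y w = K y w' \<and> (K y w --> \<xi> y w = \<xi> y w')" by (rule past[OF refl *(2,3) ag])
      have "agree \<theta> (subgrid m \<theta> ts (j - m)) w w'"
      proof (cases "j = m")
        case True then show ?thesis by (simp add: agree_def)
      next
        case False
        then have "subgrid m \<theta> ts (j - m) = ts j" using mj by (simp add: subgrid_def)
        then show ?thesis using agree_subset[OF *(4) t0 order_refl] by simp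
      qed
      then have "agree (subgrid m \<theta> ts (j - m)) (subgrid m \<theta> ts (Suc (j - m))) (\<Gamma> x (\<lambda>j. y (m + j)) w) (\<Gamma> x (\<lambda>j. y (m + j)) w')" for x
        using *(1) mj sub[OF *(2)] sub[OF *(3)] m by (intro rstrat_nonanticipating[OF \<Gamma>]) auto
      from this[of "\<xi> y w"] have "AE s in lebesgue. s \<in> {subgrid m \<theta> ts (j - m)..<subgrid m \<theta> ts (Suc (j - m))} -->
           \<Gamma> (\<xi> y w) (\<lambda>j. y (m + j)) w s = \<Gamma> (\<xi> y w) (\<lambda>j. y (m + j)) w' s"
        unfolding agree_def .
      with aag show ?thesis unfolding agree_def
      proof eventually_elim
        case (elim s)
        show ?case
          using elim pa cell[of j s] mj by (auto simp: switch_def)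
      qed
    qed
  qed
qed

section \<open>Payoffs and what a player can secure\<close>

lemma noise_measure_UNIV [simp]: "measure noise UNIV = 1"
  using noise_prob.prob_space by simp

lemma noise_split_inner:
  fixes H :: "noise_seq => real"
  assumes H: "H \<in> borel_measurable noise" and B: "\<And>y. \<bar>H y\<bar> \<le> B"
  shows "integrable noise (\<lambda>z. H (comb_seq m y z))"
    and "\<bar>\<integral>z. H (comb_seq m y z) \<partial>noise\<bar> \<le> B"
    and "integrable noise (\<lambda>y. \<integral>z. H (comb_seq m y z) \<partial>noise)"
proof -
  have cm: "(\<lambda>z. comb_seq m y z) \<in> measurable noise noise" for y by measurable
  show 1: "integrable noise (\<lambda>z. H (comb_seq m y z))" for y
    by (rule bounded_integrable_noise[OF measurable_compose[OF cm H] B])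
  show 2: "\<bar>\<integral>z. H (comb_seq m y z) \<partial>noise\<bar> \<le> B" for y
  proof -
    have "(noise_avg m H y) \<le> B" "(\<integral>z. - H (comb_seq m y z) \<partial>noise) \<le> B"
      using B by (intro noise_prob.integral_le_const integrable_minus 1 AE_I2; simp add: abs_le_iff)+
    then show ?thesis by simp
  qed
  show "integrable noise (\<lambda>y. \<integral>z. H (comb_seq m y z) \<partial>noise)"
    by (rule bounded_integrable_noise[OF noise_split(1)[OF H B] 2])
qed

lemma plays_swap: "plays t T a b u v \<longleftrightarrow> plays t T b a v u"
  unfolding plays_def by auto

lemma const_rstrat: "(\<lambda>y w s. c) \<in> rstrat sel n ts"
  by (simp add: rstrat_def)

definition payoff_function :: "real => real => ('x::real_normed_vector => real) => bool" where
  "payoff_function B K g \<longleftrightarrow> K \<ge> 0 \<and> (\<forall>x. \<bar>g x\<bar> \<le> B) \<and> (\<forall>x y. \<bar>g x - g y\<bar> \<le> K * norm (x - y))"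

lemma payoff_function_uminus: "payoff_function B K g ==> payoff_function B K (\<lambda>x. - g x)"
  unfolding payoff_function_def by (simp add: abs_minus_commute)

lemma payoff_function_measurable:
  fixes g :: "'x::euclidean_space => real"
  assumes "payoff_function B K g"
  shows "g \<in> borel_measurable borel"
proof -
  have "K-lipschitz_on UNIV g"
    using assms by (intro lipschitz_onI) (auto simp: payoff_function_def dist_norm)
  then show ?thesis by (intro borel_measurable_continuous_onI lipschitz_on_continuous_on)
qed

text \<open>Every notion below is defined for player I, who maximizes; exchanging the players and the sign of
  the payoff gives the corresponding statement for player II.\<close>

locale noise_game = controlled_system f C L
  for f :: "real^'n => 'u::metric_space => 'v::metric_space => real^'n" and C L :: real +
  fixes s1 s2 :: "real \<times> real => real"
begin

lemma swapped: "noise_game (\<lambda>x v u. f x u v) C L"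
proof (unfold noise_game_def, unfold_locales)
  have "continuous_on UNIV (\<lambda>z::'v \<times> 'u. (\<lambda>(u, v). f x u v) (snd z, fst z))" for x
    by (rule continuous_on_compose2[OF f_cont]) (auto intro!: continuous_intros)
  then show "continuous_on UNIV (\<lambda>(v, u). f x u v)" for x by (simp add: case_prod_beta')
qed (rule compact_U compact_V L_pos f_bound f_lip)+

lemma traj_swap: "traj (\<lambda>x v u. f x u v) t T x v u = traj f t T x u v"
  by (simp add: traj_def solves_def)

text \<open>A play is determined up to almost everywhere equality only, so one of them is chosen;
  \<open>rpay_eq\<close> frees the payoff from this choice.\<close>

definition outcome :: "nat => (nat => real) => ('v, 'u) noise_strategy =>
    ('u, 'v) noise_strategy =>
    'u noise_control \<times> 'v noise_control" where
  "outcome n ts a b = (SOME uv. fst uv \<in> rctrl s1 n ts \<and> snd uv \<in> rctrl s2 n ts \<and>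
     (\<forall>y. plays (ts 0) (ts n) (a y) (b y) (fst uv y) (snd uv y)))"

definition rpay :: "nat => (nat => real) => (real^'n => real) => real^'n =>
    ('v, 'u) noise_strategy =>
    ('u, 'v) noise_strategy => real" where
  "rpay n ts g x a b = (\<integral>y. g (traj f (ts 0) (ts n) x (fst (outcome n ts a b) y) (snd (outcome n ts a b) y) (ts n)) \<partial>noise)"

lemma outcome:
  assumes "grid n ts" "a \<in> rstrat s1 n ts" "b \<in> rstrat s2 n ts"
  shows "fst (outcome n ts a b) \<in> rctrl s1 n ts" "snd (outcome n ts a b) \<in> rctrl s2 n ts"
    "plays (ts 0) (ts n) (a y) (b y) (fst (outcome n ts a b) y) (snd (outcome n ts a b) y)"
proof -
  obtain u v where uv: "u \<in> rctrl s1 n ts" "v \<in> rctrl s2 n ts" "\<And>y. plays (ts 0) (ts n) (a y) (b y) (u y) (v y)"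
    by (rule plays_exists[OF assms]) blast
  have "\<exists>uv. fst uv \<in> rctrl s1 n ts \<and> snd uv \<in> rctrl s2 n ts \<and>
     (\<forall>y. plays (ts 0) (ts n) (a y) (b y) (fst uv y) (snd uv y))"
    by (rule exI[of _ "(u, v)"]) (simp add: uv)
  from someI_ex[OF this] show "fst (outcome n ts a b) \<in> rctrl s1 n ts" "snd (outcome n ts a b) \<in> rctrl s2 n ts"
    "plays (ts 0) (ts n) (a y) (b y) (fst (outcome n ts a b) y) (snd (outcome n ts a b) y)"
    unfolding outcome_def by blast+
qed

lemma rpay_eq:
  assumes g: "grid n ts" and a: "a \<in> rstrat s1 n ts" and b: "b \<in> rstrat s2 n ts"
    and p: "\<And>y. plays (ts 0) (ts n) (a y) (b y) (u y) (v y)"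
  shows "rpay n ts g x a b = (\<integral>y. g (traj f (ts 0) (ts n) x (u y) (v y) (ts n)) \<partial>noise)"
proof -
  have "traj f (ts 0) (ts n) x (fst (outcome n ts a b) y) (snd (outcome n ts a b) y) (ts n) = traj f (ts 0) (ts n) x (u y) (v y) (ts n)" for y
  proof (rule traj_cong)
    note o = outcome(3)[OF g a b, of y]
    from plays_unique[OF g a b o p]
    show "agree (ts 0) (ts n) (fst (outcome n ts a b) y) (u y)" "agree (ts 0) (ts n) (snd (outcome n ts a b) y) (v y)" by auto
    show "ts n \<in> {ts 0..ts n}" using grid_mono[OF g, of 0 n] by simp
  qed (use outcome(3)[OF g a b, of y] p[of y] in "auto simp: plays_def")
  then show ?thesis by (simp add: rpay_def)
qed

lemma rpay_swap:
  assumes g: "grid n ts" and a: "a \<in> rstrat s1 n ts" and b: "b \<in> rstrat s2 n ts"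
  shows "noise_game.rpay (\<lambda>x v u. f x u v) s2 s1 n ts g x b a = rpay n ts g x a b"
proof -
  interpret sw: noise_game "\<lambda>x v u. f x u v" C L s2 s1 by (rule swapped)
  have "sw.rpay n ts g x b a = (\<integral>y. g (traj (\<lambda>x v u. f x u v) (ts 0) (ts n) x (snd (outcome n ts a b) y) (fst (outcome n ts a b) y) (ts n)) \<partial>noise)"
    by (rule sw.rpay_eq[OF g b a]) (rule plays_swap[THEN iffD1, OF outcome(3)[OF g a b]])
  then show ?thesis by (simp add: rpay_def traj_swap)
qed

lemma final_measurable:
  assumes "u \<in> rctrl sel n ts" "v \<in> rctrl sel' n ts" "s \<in> {t..T}"
  shows "(\<lambda>y. traj f t T x (u y) (v y) s) \<in> borel_measurable noise"
  by (rule traj_param_measurable[OF measurable_const rctrl_measurable[OF assms(1)] rctrl_measurable[OF assms(2)] assms(3)]) simp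

lemma final_payoff_measurable:
  assumes "payoff_function B K g" "u \<in> rctrl sel n ts" "v \<in> rctrl sel' n ts" "s \<in> {t..T}"
  shows "(\<lambda>y. g (traj f t T x (u y) (v y) s)) \<in> borel_measurable noise"
  using measurable_compose[OF final_measurable[OF assms(2-4)] payoff_function_measurable[OF assms(1)]] by simp

lemma sub_plays:
  assumes g: "grid n ts" and m: "m < n" and \<theta>: "ts m \<le> \<theta>" "\<theta> < ts (Suc m)"
    and b: "b \<in> rstrat s2 n ts" and p: "plays (ts 0) (ts n) A (b (comb_seq m y z)) u v"
    and u0: "u0 \<in> ctrls (ts 0) (ts n)" "agree (ts 0) \<theta> u u0" and \<gamma>: "agree \<theta> (ts n) (A v) (\<gamma> v)"
  shows "plays \<theta> (ts n) \<gamma> (continuation m \<theta> y u0 b z) u v"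
proof -
  have t0: "ts 0 \<le> \<theta>" using grid_mono[OF g, of 0 m] m \<theta> by auto
  have tn: "\<theta> \<le> ts n" using grid_mono[OF g, of "Suc m" n] m \<theta> by auto
  note pp = p[unfolded plays_def]
  have uc: "u \<in> ctrls \<theta> (ts n)" "v \<in> ctrls \<theta> (ts n)" using pp t0 by (auto intro: ctrl_sub)
  have "agree \<theta> (ts n) (A v) u" "agree \<theta> (ts n) (b (comb_seq m y z) u) v" using pp t0 by (auto intro: agree_subset)
  then have 1: "agree \<theta> (ts n) (\<gamma> v) u" using \<gamma> agree_sym agree_trans by blast
  have sp: "splice \<theta> u0 u \<in> ctrls (ts 0) (ts n)" by (rule splice_ctrl[OF u0(1) uc(1) t0 tn])
  have "agree (ts 0) \<theta> (splice \<theta> u0 u) u"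
    using agree_sym[OF u0(2)] by (subst agree_cong[where u'=u0 and v'=u]) (auto simp: splice_def)
  moreover have "agree \<theta> (ts n) (splice \<theta> u0 u) u" by (rule agreeI) (simp add: splice_def)
  ultimately have "agree (ts 0) (ts n) (splice \<theta> u0 u) u" by (rule agree_join)
  then have "agree (ts 0) (ts n) (b (comb_seq m y z) (splice \<theta> u0 u)) (b (comb_seq m y z) u)"
    using pp by (intro rstrat_cong_agree[OF g b sp]) auto
  then have "agree \<theta> (ts n) (b (comb_seq m y z) (splice \<theta> u0 u)) (b (comb_seq m y z) u)"
    using t0 by (rule agree_subset) simp
  then have "agree \<theta> (ts n) (continuation m \<theta> y u0 b z u) v"
    unfolding continuation_def by (rule agree_trans) fact
  with 1 uc show ?thesis by (simp add: plays_def)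
qed

text \<open>Conditionally on the first \<open>m\<close> noise pairs, what remains of the game after \<open>\<theta>\<close> is again a game on
  a grid, played against the continuation of the opponent's strategy.\<close>

lemma continuation_payoff:
  assumes g: "grid n ts" and m: "m < n" and \<theta>: "ts m \<le> \<theta>" "\<theta> < ts (Suc m)"
    and b: "b \<in> rstrat s2 n ts" and p: "\<And>y. plays (ts 0) (ts n) (a y) (b y) (u y) (v y)"
    and u0: "u0 \<in> ctrls (ts 0) (ts n)" "\<And>z. agree (ts 0) \<theta> (u (comb_seq m y z)) u0"
    and \<gamma>: "\<gamma> \<in> rstrat s1 (n - m) (subgrid m \<theta> ts)"
    and ag: "\<And>z. agree \<theta> (ts n) (a (comb_seq m y z) (v (comb_seq m y z))) (\<gamma> z (v (comb_seq m y z)))"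
  shows "rpay (n - m) (subgrid m \<theta> ts) g x \<gamma> (continuation m \<theta> y u0 b)
    = (\<integral>z. g (traj f \<theta> (ts n) x (u (comb_seq m y z)) (v (comb_seq m y z)) (ts n)) \<partial>noise)"
proof -
  have sp: "plays \<theta> (ts n) (\<gamma> z) (continuation m \<theta> y u0 b z) (u (comb_seq m y z)) (v (comb_seq m y z))" for z
    by (rule sub_plays[OF g m \<theta> b p u0(1) u0(2)]) (rule ag)
  have "plays (subgrid m \<theta> ts 0) (subgrid m \<theta> ts (n - m)) (\<gamma> z) (continuation m \<theta> y u0 b z) (u (comb_seq m y z)) (v (comb_seq m y z))" for z
    using sp m by simp
  from rpay_eq[OF subgrid_grid[OF g m \<theta>] \<gamma> continuation_rstrat[OF g m \<theta> b u0(1)] this] show ?thesis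
    using m by simp
qed

definition secures :: "nat => (nat => real) => (real^'n => real) => real^'n => real => bool" where
  "secures n ts g x c \<longleftrightarrow> (\<exists>a\<in>rstrat s1 n ts. \<forall>b\<in>rstrat s2 n ts. c \<le> rpay n ts g x a b)"

definition holds_down :: "nat => (nat => real) => (real^'n => real) => real^'n => real => bool" where
  "holds_down n ts g x c \<longleftrightarrow> (\<exists>b\<in>rstrat s2 n ts. \<forall>a\<in>rstrat s1 n ts. rpay n ts g x a b \<le> c)"

lemma rpay_uminus: "rpay n ts (\<lambda>x. - g x) x a b = - rpay n ts g x a b"
  by (simp add: rpay_def)

lemma holds_down_swap:
  assumes g: "grid n ts"
  shows "noise_game.secures (\<lambda>x v u. f x u v) s2 s1 n ts (\<lambda>x. - g x) x (- c) \<longleftrightarrow> holds_down n ts g x c"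
    and "noise_game.holds_down (\<lambda>x v u. f x u v) s2 s1 n ts (\<lambda>x. - g x) x (- c) \<longleftrightarrow> secures n ts g x c"
proof -
  interpret sw: noise_game "\<lambda>x v u. f x u v" C L s2 s1 by (rule swapped)
  show "sw.secures n ts (\<lambda>x. - g x) x (- c) \<longleftrightarrow> holds_down n ts g x c"
    unfolding sw.secures_def holds_down_def using rpay_swap[OF g] by (auto simp: sw.rpay_uminus)
  show "sw.holds_down n ts (\<lambda>x. - g x) x (- c) \<longleftrightarrow> secures n ts g x c"
    unfolding sw.holds_down_def secures_def using rpay_swap[OF g] by (auto simp: sw.rpay_uminus)
qed

text \<open>The constant in the dependence of the state on its initial value over a time of length \<open>T\<close>.\<close>

definition stab :: "real => real" where "stab T = 2 * exp (2 * L * T)"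

lemma stab_ge:
  assumes "T \<ge> 0" shows "stab T \<ge> 1"
proof -
  have "exp (2 * L * T) \<ge> 1" using assms L_pos by simp
  then show ?thesis unfolding stab_def by linarith
qed

lemma payoff_stable:
  assumes pf: "payoff_function B K g" and u: "u \<in> ctrls t T'" and v: "v \<in> ctrls t T'"
    and t: "t \<le> T'" "T' - t \<le> T"
  shows "\<bar>g (traj f t T' x u v T') - g (traj f t T' x' u v T')\<bar> \<le> K * stab T * norm (x - x')"
proof -
  have K: "K \<ge> 0" using pf by (simp add: payoff_function_def)
  have "\<bar>g (traj f t T' x u v T') - g (traj f t T' x' u v T')\<bar> \<le> K * norm (traj f t T' x u v T' - traj f t T' x' u v T')"
    using pf by (simp add: payoff_function_def)
  also have "\<dots> \<le> K * (2 * norm (x - x') * exp (2 * L * (T' - t)))"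
    using t by (intro mult_left_mono traj_stable[OF u v] K) auto
  also have "\<dots> \<le> K * (2 * norm (x - x') * exp (2 * L * T))"
    using t L_pos K by (intro mult_left_mono) auto
  finally show ?thesis by (simp add: stab_def mult_ac)
qed

lemma rpay_stable:
  assumes pf: "payoff_function B K g" and gr: "grid n ts" and a: "a \<in> rstrat s1 n ts" and b: "b \<in> rstrat s2 n ts"
    and T: "ts n - ts 0 \<le> T"
  shows "rpay n ts g x' a b \<ge> rpay n ts g x a b - K * stab T * norm (x - x')"
proof -
  define u where "u = fst (outcome n ts a b)"
  define v where "v = snd (outcome n ts a b)"
  have u: "u \<in> rctrl s1 n ts" and v: "v \<in> rctrl s2 n ts" unfolding u_def v_def by (rule outcome[OF gr a b])+
  have t: "ts 0 \<le> ts n" using grid_mono[OF gr, of 0 n] by simp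
  have B: "\<And>x. \<bar>g x\<bar> \<le> B" using pf by (simp add: payoff_function_def)
  have int: "integrable noise (\<lambda>y. g (traj f (ts 0) (ts n) x (u y) (v y) (ts n)))" for x
    by (rule bounded_integrable_noise[OF final_payoff_measurable[OF pf u v] B]) (use t in simp)
  have "rpay n ts g x a b - K * stab T * norm (x - x')
      = (\<integral>y. g (traj f (ts 0) (ts n) x (u y) (v y) (ts n)) - K * stab T * norm (x - x') \<partial>noise)"
    unfolding rpay_def u_def[symmetric] v_def[symmetric] using int by simp
  also have "\<dots> \<le> (\<integral>y. g (traj f (ts 0) (ts n) x' (u y) (v y) (ts n)) \<partial>noise)"
  proof (rule integral_mono)
    show "g (traj f (ts 0) (ts n) x (u y) (v y) (ts n)) - K * stab T * norm (x - x') \<le> g (traj f (ts 0) (ts n) x' (u y) (v y) (ts n))" for y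
      using payoff_stable[OF pf rctrl_ctrl[OF u] rctrl_ctrl[OF v] t T, of x y y x'] by linarith
  qed (use int in auto)
  finally show ?thesis by (simp add: rpay_def u_def v_def)
qed

text \<open>Before \<open>\<theta>\<close> player I plays a constant control and ignores the signals; the state moves by at most
  \<open>C * (\<theta> - ts 0)\<close> in the meantime, whatever the opponent does.\<close>

lemma secures_earlier:
  assumes pf: "payoff_function B K g" and gr: "grid n ts" and m: "m < n" and \<theta>: "ts m \<le> \<theta>" "\<theta> < ts (Suc m)"
    and T: "ts n - ts 0 \<le> T"
    and sec: "secures (n - m) (subgrid m \<theta> ts) g x' c"
  shows "secures n ts g x (c - K * stab T * (norm (x - x') + C * (\<theta> - ts 0)))"
proof -
  obtain \<gamma> where \<gamma>: "\<gamma> \<in> rstrat s1 (n - m) (subgrid m \<theta> ts)"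
    "\<And>b. b \<in> rstrat s2 (n - m) (subgrid m \<theta> ts) ==> c \<le> rpay (n - m) (subgrid m \<theta> ts) g x' \<gamma> b"
    using sec unfolding secures_def by blast
  have t0: "ts 0 \<le> \<theta>" using grid_mono[OF gr, of 0 m] m \<theta> by auto
  have tn: "\<theta> \<le> ts n" using grid_mono[OF gr, of "Suc m" n] m \<theta> by auto
  have K: "K \<ge> 0" and B: "\<And>x. \<bar>g x\<bar> \<le> B" using pf by (auto simp: payoff_function_def)
  define a where "a = switch m \<theta> (\<lambda>y w. True) (\<lambda>y w. 0::real) (\<lambda>x. \<gamma>) (\<lambda>y w s. undefined)"
  have a: "a \<in> rstrat s1 n ts"
    unfolding a_def
  proof (rule switch_rstrat[OF compact_V gr m \<theta> const_rstrat _ _ _ \<gamma>(1)])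
    have "(\<lambda>(z, w, s). \<gamma> z w s) \<in> borel_measurable (play_space \<theta> (ts n))"
      using rstrat_measurable[OF \<gamma>(1)] m by simp
    from measurable_compose[OF measurable_snd this]
    show "(\<lambda>(x::real, z, w, s). \<gamma> z w s) \<in> borel_measurable (borel \<Otimes>\<^sub>M (play_space \<theta> (ts n)))"
      by (simp add: case_prod_beta')
  qed auto
  have "c - K * stab T * (norm (x - x') + C * (\<theta> - ts 0)) \<le> rpay n ts g x a b" if b: "b \<in> rstrat s2 n ts" for b
  proof -
    obtain u v where u: "u \<in> rctrl s1 n ts" and v: "v \<in> rctrl s2 n ts"
      and p: "\<And>y. plays (ts 0) (ts n) (a y) (b y) (u y) (v y)"
      by (rule plays_exists[OF gr a b]) blast
    define H where "H y = g (traj f (ts 0) (ts n) x (u y) (v y) (ts n))" for y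
    have Hm: "H \<in> borel_measurable noise" unfolding H_def
      by (rule final_payoff_measurable[OF pf u v]) (use t0 tn in simp)
    have HB: "\<bar>H y\<bar> \<le> B" for y by (simp add: H_def B)
    have "c - K * stab T * (norm (x - x') + C * (\<theta> - ts 0)) \<le> (noise_avg m H y)" for y
    proof -
      define u0 where "u0 = (\<lambda>s::real. undefined :: 'u)"
      have u0: "u0 \<in> ctrls (ts 0) (ts n)" unfolding u0_def by (rule borel_in_ctrl) simp
      let ?G = "\<lambda>z. g (traj f \<theta> (ts n) x' (u (comb_seq m y z)) (v (comb_seq m y z)) (ts n))"
      have ag: "agree (ts 0) \<theta> (u (comb_seq m y z)) u0" for z
      proof (rule agree_sym, rule agree_trans)
        show "agree (ts 0) \<theta> (a (comb_seq m y z) (v (comb_seq m y z))) (u (comb_seq m y z))"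
          using p[of "comb_seq m y z"] tn unfolding plays_def by (auto intro: agree_subset)
      qed (rule agreeI, simp add: u0_def a_def switch_def)
      have ag2: "agree \<theta> (ts n) (a (comb_seq m y z) (v (comb_seq m y z))) (\<gamma> z (v (comb_seq m y z)))" for z
        by (rule agreeI) (simp add: a_def switch_def comb_seq_def)
      have "c \<le> rpay (n - m) (subgrid m \<theta> ts) g x' \<gamma> (continuation m \<theta> y u0 b)"
        by (rule \<gamma>(2)[OF continuation_rstrat[OF gr m \<theta> b u0]])
      also have "\<dots> = (\<integral>z. ?G z \<partial>noise)"
        by (rule continuation_payoff[OF gr m \<theta> b p u0 ag \<gamma>(1) ag2])
      finally have c: "c \<le> (\<integral>z. ?G z \<partial>noise)" .
      have cm: "(\<lambda>z. comb_seq m y z) \<in> measurable noise noise" by measurable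
      have Gm: "integrable noise ?G"
        by (rule bounded_integrable_noise[OF measurable_compose[OF cm final_payoff_measurable[OF pf u v]] B]) (use tn in simp)
      have Hi: "integrable noise (\<lambda>z. H (comb_seq m y z))"
        by (rule bounded_integrable_noise[OF measurable_compose[OF cm Hm] HB])
      have pw: "?G z - K * stab T * (norm (x - x') + C * (\<theta> - ts 0)) \<le> H (comb_seq m y z)" for z
      proof -
        let ?u = "u (comb_seq m y z)" and ?v = "v (comb_seq m y z)"
        let ?X = "traj f (ts 0) (ts n) x ?u ?v \<theta>"
        note uc = rctrl_ctrl[OF u] and vc = rctrl_ctrl[OF v]
        have flow: "traj f (ts 0) (ts n) x ?u ?v (ts n) = traj f \<theta> (ts n) ?X ?u ?v (ts n)"
          by (rule traj_flow[OF uc vc t0 tn order_refl])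
        have "\<bar>g (traj f \<theta> (ts n) ?X ?u ?v (ts n)) - ?G z\<bar> \<le> K * stab T * norm (?X - x')"
          by (rule payoff_stable[OF pf uc vc tn]) (use T t0 in simp)
        moreover have "norm (?X - x') \<le> norm (x - x') + C * (\<theta> - ts 0)"
        proof -
          have "norm (?X - x) \<le> C * (\<theta> - ts 0)"
            using traj_speed[OF uc vc order_refl t0 tn, of x "comb_seq m y z" "comb_seq m y z"]
              traj_initial[OF uc vc order_trans[OF t0 tn], of x "comb_seq m y z" "comb_seq m y z"] by simp
          then show ?thesis using norm_triangle_ineq[of "?X - x" "x - x'"] by simp
        qed
        moreover have "K * stab T * norm (?X - x') \<le> K * stab T * (norm (x - x') + C * (\<theta> - ts 0))"
          using calculation(2) K by (intro mult_left_mono) (auto simp: stab_def)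
        ultimately show ?thesis unfolding H_def by (subst flow) linarith
      qed
      have "c - K * stab T * (norm (x - x') + C * (\<theta> - ts 0)) \<le> (\<integral>z. ?G z - K * stab T * (norm (x - x') + C * (\<theta> - ts 0)) \<partial>noise)"
        using c Gm by simp
      also have "\<dots> \<le> (noise_avg m H y)"
        by (rule integral_mono) (use Gm Hi pw in auto)
      finally show ?thesis .
    qed
    then have "c - K * stab T * (norm (x - x') + C * (\<theta> - ts 0)) \<le> (\<integral>y. (noise_avg m H y) \<partial>noise)"
      by (rule noise_prob.integral_ge_const[OF noise_split_inner(3)[OF Hm HB] AE_I2])
    also have "\<dots> = rpay n ts g x a b"
      using noise_split(2)[OF Hm HB, of m] rpay_eq[OF gr a b p, of g x] by (simp add: H_def)
    finally show ?thesis .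
  qed
  then show ?thesis unfolding secures_def using a by blast
qed

end

definition fgrid :: "real => real => real => nat => (nat => real) => bool" where
  "fgrid T \<delta> t n ts \<longleftrightarrow> grid n ts \<and> ts 0 = t \<and> ts n = T \<and> (\<forall>j<n. ts (Suc j) - ts j < \<delta>)"

lemma fgrid_mono:
  assumes "fgrid T \<delta> t n ts" "\<delta> \<le> \<delta>'"
  shows "fgrid T \<delta>' t n ts"
proof -
  have "ts (Suc j) - ts j < \<delta>'" if "j < n" for j
    using assms(1) less_le_trans[OF _ assms(2), of "ts (Suc j) - ts j"] that by (simp add: fgrid_def)
  then show ?thesis using assms(1) by (simp add: fgrid_def)
qed

text \<open>The filter of fine grids lets statements that hold below different bounds on the steps be combined
  without naming the bounds.\<close>

definition fine_grids :: "real => real => (nat \<times> (nat => real)) filter" where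
  "fine_grids T t = (INF \<delta>\<in>{0<..}. principal {(n, ts). fgrid T \<delta> t n ts})"

lemma eventually_INF_principal_mono:
  fixes A :: "real => 'a set"
  assumes "\<And>a b. a \<le> b ==> A a \<subseteq> A b"
  shows "eventually Q (INF \<delta>\<in>{0<..}. principal (A \<delta>)) \<longleftrightarrow> (\<exists>\<delta>>0. \<forall>z\<in>A \<delta>. Q z)"
proof (subst eventually_INF_base)
  fix a b :: real assume "a \<in> {0<..}" "b \<in> {0<..}"
  then show "\<exists>x\<in>{0<..}. principal (A x) \<le> principal (A a) \<sqinter> principal (A b)"
    using assms[of "min a b" a] assms[of "min a b" b] by (intro bexI[of _ "min a b"]) auto
qed (auto simp: eventually_principal)

lemma eventually_fine_grids:
  "(\<forall>\<^sub>F (n, ts) in fine_grids T t. Q n ts) \<longleftrightarrow> (\<exists>\<delta>>0. \<forall>n ts. fgrid T \<delta> t n ts --> Q n ts)"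
  unfolding fine_grids_def by (subst eventually_INF_principal_mono) (auto intro: fgrid_mono)

lemma eventually_fgrid: "\<forall>\<^sub>F (n, ts) in fine_grids T t. fgrid T 1 t n ts"
  unfolding eventually_fine_grids by (auto intro: exI[of _ 1])

lemma fgrid_exists:
  assumes "t < T" "\<delta> > 0"
  obtains n ts where "fgrid T \<delta> t n ts"
proof -
  obtain k where k: "(T - t) / \<delta> < real k" using reals_Archimedean2 by blast
  let ?n = "Suc k"
  have s: "(T - t) / real ?n < \<delta>"
  proof -
    have "T - t < real k * \<delta>" using k assms(2) by (simp add: field_simps)
    also have "\<dots> \<le> real ?n * \<delta>" using assms(2) by (intro mult_right_mono) auto
    finally show ?thesis by (simp add: field_simps)
  qed
  define h where "h = (T - t) / real ?n"
  have h: "0 < h" "h < \<delta>" "real ?n * h = T - t" using assms(1) s by (simp_all add: h_def)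
  have step: "(t + real (Suc j) * h) - (t + real j * h) = h" for j by (simp add: algebra_simps)
  have "fgrid T \<delta> t ?n (\<lambda>j. t + real j * h)"
    unfolding fgrid_def grid_def
  proof (intro conjI allI impI)
    show "t + real j * h < t + real (Suc j) * h" for j using step[of j] h(1) by linarith
    show "(t + real (Suc j) * h) - (t + real j * h) < \<delta>" for j unfolding step by (rule h(2))
    show "t + real ?n * h = T" using h(3) by linarith
  qed simp_all
  then show ?thesis by (rule that)
qed

lemma fgrid_subgrid:
  assumes f: "fgrid T \<delta> t n ts" and t: "t \<le> t'" "t' < T"
  obtains m where "m < n" "ts m \<le> t'" "t' < ts (Suc m)" "fgrid T \<delta> t' (n - m) (subgrid m t' ts)"
proof -
  have g: "grid n ts" using f by (simp add: fgrid_def)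
  obtain m where m: "m < n" "ts m \<le> t'" "t' < ts (Suc m)"
    using grid_cell[OF g, of t'] f t unfolding fgrid_def by metis
  have "subgrid m t' ts (Suc j) - subgrid m t' ts j < \<delta>" if "j < n - m" for j
  proof -
    have "ts (Suc (m + j)) - ts (m + j) < \<delta>" using f that by (simp add: fgrid_def)
    then show ?thesis using m by (cases j) (auto simp: subgrid_def)
  qed
  then have "fgrid T \<delta> t' (n - m) (subgrid m t' ts)"
    using subgrid_grid[OF g m] m f by (simp add: fgrid_def)
  with m show ?thesis by (rule that)
qed

context noise_game
begin

text \<open>The value enters the argument only through this consequence of its definition as a limit: on fine
  grids each side can keep the payoff on its side of the value, up to \<open>\<epsilon>\<close>.\<close>

definition game_value :: "(real^'n => real) => real => (real => real^'n => real) => bool" where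
  "game_value g T U \<longleftrightarrow> (\<forall>x. U T x = g x) \<and>
     (\<forall>t\<in>{0..<T}. \<forall>x. \<forall>\<epsilon>>0. \<exists>\<delta>>0. \<forall>n ts. fgrid T \<delta> t n ts -->
        secures n ts g x (U t x - \<epsilon>) \<and> holds_down n ts g x (U t x + \<epsilon>))"

lemma game_valueE:
  assumes "game_value g T U" "0 \<le> t" "t < T" "\<epsilon> > 0"
  obtains \<delta> where "\<delta> > 0" "\<And>n ts. fgrid T \<delta> t n ts ==> secures n ts g x (U t x - \<epsilon>)"
    "\<And>n ts. fgrid T \<delta> t n ts ==> holds_down n ts g x (U t x + \<epsilon>)"
proof -
  have "\<exists>\<delta>>0. \<forall>n ts. fgrid T \<delta> t n ts -->
        secures n ts g x (U t x - \<epsilon>) \<and> holds_down n ts g x (U t x + \<epsilon>)"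
    using assms by (simp add: game_value_def)
  then obtain \<delta> where d: "\<delta> > 0" "\<forall>n ts. fgrid T \<delta> t n ts -->
        secures n ts g x (U t x - \<epsilon>) \<and> holds_down n ts g x (U t x + \<epsilon>)" by (elim exE conjE)
  show ?thesis
    by (rule that[OF d(1)]) (simp_all only: d(2)[rule_format])
qed

lemma game_value_swap:
  assumes "game_value g T U"
  shows "noise_game.game_value (\<lambda>x v u. f x u v) s2 s1 (\<lambda>x. - g x) T (\<lambda>t x. - U t x)"
proof -
  interpret sw: noise_game "\<lambda>x v u. f x u v" C L s2 s1 by (rule swapped)
  have gr: "grid n ts" if "fgrid T \<delta> t n ts" for \<delta> t n ts using that by (simp add: fgrid_def)
  have "sw.secures n ts (\<lambda>x. - g x) x (- U t x - \<epsilon>) \<longleftrightarrow> holds_down n ts g x (U t x + \<epsilon>)"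
    "sw.holds_down n ts (\<lambda>x. - g x) x (- U t x + \<epsilon>) \<longleftrightarrow> secures n ts g x (U t x - \<epsilon>)"
    if "fgrid T \<delta> t' n ts" for \<delta> t' t n ts x \<epsilon>
    using holds_down_swap[OF gr[OF that], of g x "U t x + \<epsilon>"] holds_down_swap[OF gr[OF that], of g x "U t x - \<epsilon>"] by auto
  then show ?thesis using assms unfolding game_value_def sw.game_value_def by (simp add: conj_commute)
qed

lemma rpay_short:
  assumes pf: "payoff_function B K g" and gr: "grid n ts" and a: "a \<in> rstrat s1 n ts" and b: "b \<in> rstrat s2 n ts"
  shows "rpay n ts g x a b \<ge> g x - K * C * (ts n - ts 0)"
proof -
  define u where "u = fst (outcome n ts a b)"
  define v where "v = snd (outcome n ts a b)"
  have u: "u \<in> rctrl s1 n ts" and v: "v \<in> rctrl s2 n ts" unfolding u_def v_def by (rule outcome[OF gr a b])+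
  have t: "ts 0 \<le> ts n" using grid_mono[OF gr, of 0 n] by simp
  have B: "\<And>x. \<bar>g x\<bar> \<le> B" and K: "K \<ge> 0" using pf by (auto simp: payoff_function_def)
  have int: "integrable noise (\<lambda>y. g (traj f (ts 0) (ts n) x (u y) (v y) (ts n)))"
    by (rule bounded_integrable_noise[OF final_payoff_measurable[OF pf u v] B]) (use t in simp)
  have le: "g x - K * C * (ts n - ts 0) \<le> g (traj f (ts 0) (ts n) x (u y) (v y) (ts n))" for y
  proof -
    let ?X = "traj f (ts 0) (ts n) x (u y) (v y)"
    have "norm (?X (ts n) - x) \<le> C * (ts n - ts 0)"
      using traj_speed[OF rctrl_ctrl[OF u] rctrl_ctrl[OF v] order_refl t order_refl, of x y y]
        traj_initial[OF rctrl_ctrl[OF u] rctrl_ctrl[OF v] t, of x y y] by simp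
    then have "K * norm (?X (ts n) - x) \<le> K * (C * (ts n - ts 0))" using K by (rule mult_left_mono)
    moreover have "\<bar>g (?X (ts n)) - g x\<bar> \<le> K * norm (?X (ts n) - x)" using pf by (simp add: payoff_function_def)
    ultimately show ?thesis by (simp add: mult.assoc)
  qed
  show ?thesis unfolding rpay_def u_def[symmetric] v_def[symmetric]
    by (rule noise_prob.integral_ge_const[OF int AE_I2[OF le]])
qed

text \<open>On a common fine grid, one side secures almost \<open>U t' x'\<close> from the later time on, hence almost the
  lower bound from \<open>t\<close> on, and the other side holds the payoff down to almost \<open>U t x\<close>.\<close>

lemma value_lower:
  assumes pf: "payoff_function B K g" and gv: "game_value g T U" and t: "0 \<le> t" "t \<le> t'" "t' \<le> T"
  shows "U t' x' - K * stab T * (norm (x - x') + C * (t' - t)) \<le> U t x"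
proof -
  have K: "K \<ge> 0" using pf by (simp add: payoff_function_def)
  have st: "stab T \<ge> 1" using t by (intro stab_ge) simp
  have KK: "K \<le> K * stab T" using mult_left_mono[OF st K] by simp
  have tm: "U T x = g x" for x using gv by (simp add: game_value_def)
  have "\<bar>g x' - g x\<bar> \<le> K * norm (x - x')"
    using pf unfolding payoff_function_def by (simp only: norm_minus_commute[of x x'])
  also have "\<dots> \<le> K * stab T * norm (x - x')" using KK by (rule mult_right_mono) simp
  finally have gx: "g x' \<le> g x + K * stab T * norm (x - x')" by simp
  consider "t = T" | "t < T" "t' < T" | "t < T" "t' = T" using t by linarith
  then show ?thesis
  proof cases
    case 1
    then have "t' = T" using t by simp
    show ?thesis using gx 1 \<open>t' = T\<close> by (simp add: tm)
  next
    case 2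
    show ?thesis
    proof (rule field_le_epsilon)
      fix e :: real assume "e > 0"
      then have e: "e / 2 > 0" by simp
      obtain d where d: "d > 0" "\<And>n ts. fgrid T d t n ts ==> holds_down n ts g x (U t x + e / 2)"
        by (rule game_valueE[OF gv t(1) 2(1) e, of x]) blast
      obtain d' where d': "d' > 0" "\<And>n ts. fgrid T d' t' n ts ==> secures n ts g x' (U t' x' - e / 2)"
        by (rule game_valueE[OF gv order_trans[OF t(1,2)] 2(2) e, of x']) blast
      have "min d d' > 0" using d(1) d'(1) by simp
      then obtain n ts where f: "fgrid T (min d d') t n ts" using fgrid_exists[OF 2(1)] by blast
      obtain m where m: "m < n" "ts m \<le> t'" "t' < ts (Suc m)" and fm: "fgrid T (min d d') t' (n - m) (subgrid m t' ts)"
        using fgrid_subgrid[OF f t(2) 2(2)] by blast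
      have gr: "grid n ts" and ends: "ts 0 = t" "ts n = T" using f by (auto simp: fgrid_def)
      have "secures (n - m) (subgrid m t' ts) g x' (U t' x' - e / 2)"
        by (rule d'(2)[OF fgrid_mono[OF fm]]) simp
      from secures_earlier[OF pf gr m _ this, of T x] ends t
      have "secures n ts g x (U t' x' - e / 2 - K * stab T * (norm (x - x') + C * (t' - t)))" by simp
      then obtain a where a: "a \<in> rstrat s1 n ts"
        "\<And>b. b \<in> rstrat s2 n ts ==> U t' x' - e / 2 - K * stab T * (norm (x - x') + C * (t' - t)) \<le> rpay n ts g x a b"
        unfolding secures_def by blast
      have "holds_down n ts g x (U t x + e / 2)" by (rule d(2)[OF fgrid_mono[OF f]]) simp
      then obtain b where b: "b \<in> rstrat s2 n ts" "\<And>a. a \<in> rstrat s1 n ts ==> rpay n ts g x a b \<le> U t x + e / 2"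
        unfolding holds_down_def by blast
      show "U t' x' - K * stab T * (norm (x - x') + C * (t' - t)) \<le> U t x + e"
        using a(2)[OF b(1)] b(2)[OF a(1)] by linarith
    qed
  next
    case 3
    show ?thesis
    proof (rule field_le_epsilon)
      fix e :: real assume e: "e > 0"
      obtain d where d: "d > 0" "\<And>n ts. fgrid T d t n ts ==> holds_down n ts g x (U t x + e)"
        by (rule game_valueE[OF gv t(1) 3(1) e, of x]) blast
      obtain n ts where f: "fgrid T d t n ts" using fgrid_exists[OF 3(1) d(1)] by blast
      have gr: "grid n ts" and ends: "ts 0 = t" "ts n = T" using f by (auto simp: fgrid_def)
      obtain b where b: "b \<in> rstrat s2 n ts" "\<And>a. a \<in> rstrat s1 n ts ==> rpay n ts g x a b \<le> U t x + e"
        using d(2)[OF f] unfolding holds_down_def by blast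
      have "g x - K * C * (T - t) \<le> rpay n ts g x (\<lambda>y w s. undefined) b"
        using rpay_short[OF pf gr const_rstrat b(1), of x] ends by simp
      also have "\<dots> \<le> U t x + e" by (rule b(2)[OF const_rstrat])
      finally have 1: "g x - K * C * (T - t) \<le> U t x + e" .
      have "K * (C * (T - t)) \<le> K * stab T * (C * (T - t))" using KK C_nonneg t 3 by (intro mult_right_mono) auto
      then show "U t' x' - K * stab T * (norm (x - x') + C * (t' - t)) \<le> U t x + e"
        using 1 gx 3 by (simp add: tm algebra_simps)
    qed
  qed
qed

lemma value_lipschitz:
  assumes pf: "payoff_function B K g" and gv: "game_value g T U" and t: "0 \<le> t" "t \<le> t'" "t' \<le> T"
  shows "\<bar>U t x - U t' x'\<bar> \<le> K * stab T * (norm (x - x') + C * (t' - t))"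
proof -
  interpret sw: noise_game "\<lambda>x v u. f x u v" C L s2 s1 by (rule swapped)
  have "- U t' x' - K * stab T * (norm (x - x') + C * (t' - t)) \<le> - U t x"
    using sw.value_lower[OF payoff_function_uminus[OF pf] game_value_swap[OF gv] t, of x' x]
    by (simp add: sw.stab_def stab_def)
  moreover have "U t' x' - K * stab T * (norm (x - x') + C * (t' - t)) \<le> U t x" by (rule value_lower[OF pf gv t])
  ultimately show ?thesis by linarith
qed

lemma value_measurable:
  assumes pf: "payoff_function B K g" and gv: "game_value g T U" and t: "0 \<le> t" "t \<le> T"
  shows "U t \<in> borel_measurable borel"
proof -
  have "(K * stab T)-lipschitz_on UNIV (U t)"
    using value_lipschitz[OF pf gv t(1) order_refl t(2)] pf
    by (intro lipschitz_onI) (auto simp: dist_norm payoff_function_def stab_def)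
  then show ?thesis by (intro borel_measurable_continuous_onI lipschitz_on_continuous_on)
qed

text \<open>The mesh required in \<open>game_value\<close> depends on the position. It can be chosen uniformly on bounded
  sets: finitely many positions, the multiples of \<open>\<eta>\<close> in time and an \<open>\<eta>\<close>-net of the ball, serve all
  others by \<open>secures_earlier\<close>, and within \<open>\<eta>\<close> of \<open>T\<close> any strategy will do.\<close>

lemma uniformly_secures:
  assumes pf: "payoff_function B K g" and gv: "game_value g T U" and \<epsilon>: "\<epsilon> > 0"
  obtains \<delta> where "\<delta> > 0"
    "\<And>t x n ts. 0 \<le> t ==> t < T ==> norm x \<le> R ==> fgrid T \<delta> t n ts ==> secures n ts g x (U t x - \<epsilon>)"
proof -
  have K: "K \<ge> 0" using pf by (simp add: payoff_function_def)
  define M where "M = K * stab T * (1 + C) + K * C"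
  have M: "M \<ge> 0" using K C_nonneg by (simp add: M_def stab_def)
  define \<eta> where "\<eta> = (\<epsilon> / 4) / (M + 1)"
  have \<eta>: "\<eta> > 0" using \<epsilon> M by (simp add: \<eta>_def)
  have M\<eta>: "M * \<eta> \<le> \<epsilon> / 4"
  proof -
    have "M * \<eta> \<le> (M + 1) * \<eta>" using \<eta> by simp
    also have "\<dots> = \<epsilon> / 4"
    proof -
      have "M + 1 \<noteq> 0" using M by linarith
      then show ?thesis
        unfolding \<eta>_def times_divide_eq_right[of "M + 1" "\<epsilon> / 4" "M + 1"]
        by (rule nonzero_mult_div_cancel_left)
    qed
    finally show ?thesis .
  qed
  have cov: "cball (0::real^'n) R \<subseteq> (\<Union>x\<in>UNIV. ball x \<eta>)"
  proof
    fix x :: "real^'n" show "x \<in> (\<Union>x\<in>UNIV. ball x \<eta>)" by (rule UN_I[of x]) (use \<eta> in auto)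
  qed
  obtain X where "X \<subseteq> (UNIV :: (real^'n) set)" and X: "finite X" "cball (0::real^'n) R \<subseteq> (\<Union>x\<in>X. ball x \<eta>)"
    by (rule compactE_image[OF compact_cball[of "0::real^'n" R] open_ball cov])
  define I where "I = {i::nat. real i * \<eta> < T}"
  have finI: "finite I"
  proof -
    obtain k where k: "T / \<eta> < real k" using reals_Archimedean2 by blast
    have "I \<subseteq> {..k}"
    proof
      fix i assume "i \<in> I"
      then have "real i < T / \<eta>" using \<eta> by (simp add: I_def field_simps)
      then show "i \<in> {..k}" using k by simp
    qed
    then show ?thesis by (rule finite_subset) simp
  qed
  have "\<exists>d>0. \<forall>n ts. fgrid T d (real i * \<eta>) n ts --> secures n ts g x (U (real i * \<eta>) x - \<epsilon> / 4)" if "i \<in> I" for i x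
  proof -
    have "0 \<le> real i * \<eta>" "real i * \<eta> < T" "\<epsilon> / 4 > 0" using that \<eta> \<epsilon> by (simp_all add: I_def)
    from game_valueE[OF gv this, of x] show ?thesis by metis
  qed
  then have "\<forall>i x. \<exists>d. i \<in> I --> d > 0 \<and> (\<forall>n ts. fgrid T d (real i * \<eta>) n ts --> secures n ts g x (U (real i * \<eta>) x - \<epsilon> / 4))" by blast
  then obtain D where D: "\<And>i x. i \<in> I ==> D i x > 0"
    "\<And>i x n ts. i \<in> I ==> fgrid T (D i x) (real i * \<eta>) n ts ==> secures n ts g x (U (real i * \<eta>) x - \<epsilon> / 4)" by metis
  define \<delta> where "\<delta> = Min (insert 1 ((\<lambda>(i, x). D i x) ` (I \<times> X)))"
  have fin: "finite (insert 1 ((\<lambda>(i, x). D i x) ` (I \<times> X)))" using finI X(1) by simp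
  have \<delta>: "\<delta> > 0" unfolding \<delta>_def using fin D(1) by (subst Min_gr_iff) auto
  have \<delta>D: "\<delta> \<le> D i x" if "i \<in> I" "x \<in> X" for i x
    unfolding \<delta>_def using that by (intro Min_le[OF fin]) auto
  show ?thesis
  proof (rule that[OF \<delta>])
    fix t n ts and x :: "real^'n" assume t: "0 \<le> t" "t < T" and x: "norm x \<le> R" and f: "fgrid T \<delta> t n ts"
    have gr: "grid n ts" and ends: "ts 0 = t" "ts n = T" using f by (auto simp: fgrid_def)
    define i where "i = nat \<lceil>t / \<eta>\<rceil>"
    have i1: "t \<le> real i * \<eta>" and i2: "real i * \<eta> < t + \<eta>"
    proof -
      have r: "real i = of_int \<lceil>t / \<eta>\<rceil>" using t \<eta> by (simp add: i_def)
      have a: "t / \<eta> \<le> of_int \<lceil>t / \<eta>\<rceil>" and b: "of_int \<lceil>t / \<eta>\<rceil> < t / \<eta> + 1" by linarith+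
      show "t \<le> real i * \<eta>" unfolding r using a by (simp only: pos_divide_le_eq[OF \<eta>])
      have "real i * \<eta> < (t / \<eta> + 1) * \<eta>" unfolding r by (rule mult_strict_right_mono[OF b \<eta>])
      then show "real i * \<eta> < t + \<eta>" using \<eta> by (simp add: distrib_right)
    qed
    show "secures n ts g x (U t x - \<epsilon>)"
    proof (cases "real i * \<eta> < T")
      case True
      let ?t = "real i * \<eta>"
      have iI: "i \<in> I" using True by (simp add: I_def)
      have "x \<in> cball 0 R" using x by simp
      then have "x \<in> (\<Union>x\<in>X. ball x \<eta>)" by (rule subsetD[OF X(2)])
      then obtain x' where x': "x' \<in> X" "norm (x - x') < \<eta>" by (auto simp: dist_norm norm_minus_commute)
      obtain m where m: "m < n" "ts m \<le> ?t" "?t < ts (Suc m)" and fm: "fgrid T \<delta> ?t (n - m) (subgrid m ?t ts)"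
        using fgrid_subgrid[OF f i1 True] by blast
      have "secures (n - m) (subgrid m ?t ts) g x' (U ?t x' - \<epsilon> / 4)"
        by (rule D(2)[OF iI fgrid_mono[OF fm \<delta>D[OF iI x'(1)]]])
      from secures_earlier[OF pf gr m _ this, of T x] ends t
      have s: "secures n ts g x (U ?t x' - \<epsilon> / 4 - K * stab T * (norm (x - x') + C * (?t - t)))" by simp
      have "C * (?t - t) \<le> C * \<eta>" using i2 C_nonneg by (intro mult_left_mono) auto
      then have "norm (x - x') + C * (?t - t) \<le> (1 + C) * \<eta>" using x'(2) by (simp add: distrib_right)
      then have "K * stab T * (norm (x - x') + C * (?t - t)) \<le> K * stab T * ((1 + C) * \<eta>)"
        using K by (intro mult_left_mono) (auto simp: stab_def)
      also have "\<dots> \<le> M * \<eta>" using K C_nonneg \<eta> by (simp add: M_def algebra_simps)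
      finally have e: "K * stab T * (norm (x - x') + C * (?t - t)) \<le> \<epsilon> / 4" using M\<eta> by simp
      have "\<bar>U t x - U ?t x'\<bar> \<le> K * stab T * (norm (x - x') + C * (?t - t))"
        using True by (intro value_lipschitz[OF pf gv t(1) i1]) auto
      then have "U t x - \<epsilon> \<le> U ?t x' - \<epsilon> / 4 - K * stab T * (norm (x - x') + C * (?t - t))" using e \<epsilon> by linarith
      then show ?thesis using s unfolding secures_def by (meson order_trans)
    next
      case False
      then have Tt: "T - t < \<eta>" using i2 by simp
      have KC: "K * C * (T - t) \<le> M * \<eta>"
      proof -
        have "K * C * (T - t) \<le> K * C * \<eta>" using Tt K C_nonneg by (intro mult_left_mono) auto
        also have "\<dots> \<le> M * \<eta>" using K C_nonneg \<eta> by (intro mult_right_mono) (auto simp: M_def stab_def)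
        finally show ?thesis .
      qed
      have "K * stab T * (C * (T - t)) \<le> M * \<eta>"
      proof -
        have "K * stab T * (C * (T - t)) \<le> K * stab T * (C * \<eta>)" using Tt K C_nonneg by (intro mult_left_mono) (auto simp: stab_def)
        also have "\<dots> \<le> M * \<eta>" using K C_nonneg \<eta> by (simp add: M_def algebra_simps stab_def)
        finally show ?thesis .
      qed
      moreover have "\<bar>U t x - U T x\<bar> \<le> K * stab T * (norm (x - x) + C * (T - t))"
        using t by (intro value_lipschitz[OF pf gv t(1)]) auto
      moreover have "U T x = g x" using gv by (simp add: game_value_def)
      ultimately have *: "U t x - \<epsilon> \<le> g x - K * C * (T - t)" using M\<eta> KC \<epsilon> by simp
      show ?thesis unfolding secures_def
      proof (intro bexI[OF _ const_rstrat] ballI)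
        fix b :: "('u, 'v) noise_strategy"
        assume "b \<in> rstrat s2 n ts"
        from rpay_short[OF pf gr const_rstrat[of undefined] this, of x] ends *
        show "U t x - \<epsilon> \<le> rpay n ts g x (\<lambda>y w s. undefined) b" by simp
      qed
    qed
  qed
qed

text \<open>A strategy good for one of countably many dense states is good for the states near by, so the
  choice of the strategy can be made to depend measurably on the state.\<close>

lemma measurable_secure_selection:
  assumes pf: "payoff_function B K g" and gr: "grid n ts" and T: "ts n - ts 0 \<le> T"
    and V: "\<And>x y. \<bar>V x - V y\<bar> \<le> K' * norm (x - y)" and K': "K' \<ge> 0"
    and sec: "\<And>x. norm x \<le> R + 1 ==> secures n ts g x (V x - \<epsilon>)" and \<epsilon>: "\<epsilon> > 0"
  obtains \<Gamma> where "\<And>x. \<Gamma> x \<in> rstrat s1 n ts"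
    "(\<lambda>(x, z, w, s). \<Gamma> x z w s) \<in> borel_measurable (borel \<Otimes>\<^sub>M (play_space (ts 0) (ts n)))"
    "\<And>x b. norm x \<le> R ==> b \<in> rstrat s2 n ts ==> V x - 2 * \<epsilon> \<le> rpay n ts g x (\<Gamma> x) b"
proof -
  have K: "K \<ge> 0" using pf by (simp add: payoff_function_def)
  define M where "M = K * stab T + K'"
  have M: "M \<ge> 0" using K K' by (simp add: M_def stab_def)
  define \<eta> where "\<eta> = min 1 (\<epsilon> / (M + 1))"
  have \<eta>: "\<eta> > 0" "\<eta> \<le> 1" using \<epsilon> M by (auto simp: \<eta>_def)
  have M\<eta>: "M * \<eta> \<le> \<epsilon>"
  proof -
    have "M * \<eta> \<le> M * (\<epsilon> / (M + 1))" using M by (intro mult_left_mono) (auto simp: \<eta>_def)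
    also have "\<dots> \<le> \<epsilon>" using M \<epsilon> by (simp add: field_simps)
    finally show ?thesis .
  qed
  obtain D :: "(real^'n) set" where D: "countable D" "\<And>X. open X ==> X \<noteq> {} ==> \<exists>d\<in>D. d \<in> X"
    using countable_dense_setE by blast
  have D0: "D \<noteq> {}" using D(2)[OF open_UNIV] by auto
  define d where "d = from_nat_into D"
  have d: "\<exists>i. dist (d i) x < \<eta>" for x
  proof -
    obtain x' where "x' \<in> D" "x' \<in> ball x \<eta>" using D(2)[of "ball x \<eta>"] \<eta> by auto
    then show ?thesis using from_nat_into_surj[OF D(1)] unfolding d_def by (metis dist_commute mem_ball)
  qed
  define q where "q x = (LEAST i. dist (d i) x < \<eta>)" for x
  have q: "dist (d (q x)) x < \<eta>" for x unfolding q_def using d by (rule LeastI_ex)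
  have "\<forall>i. \<exists>a\<in>rstrat s1 n ts. norm (d i) \<le> R + 1 --> (\<forall>b\<in>rstrat s2 n ts. V (d i) - \<epsilon> \<le> rpay n ts g (d i) a b)"
  proof
    fix i
    show "\<exists>a\<in>rstrat s1 n ts. norm (d i) \<le> R + 1 --> (\<forall>b\<in>rstrat s2 n ts. V (d i) - \<epsilon> \<le> rpay n ts g (d i) a b)"
    proof (cases "norm (d i) \<le> R + 1")
      case True
      then show ?thesis using sec[OF True] unfolding secures_def by blast
    next
      case False
      then show ?thesis using const_rstrat by blast
    qed
  qed
  then obtain G where G: "\<And>i. G i \<in> rstrat s1 n ts"
    "\<And>i b. norm (d i) \<le> R + 1 ==> b \<in> rstrat s2 n ts ==> V (d i) - \<epsilon> \<le> rpay n ts g (d i) (G i) b" by metis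
  show ?thesis
  proof (rule that[of "\<lambda>x. G (q x)"])
    show "G (q x) \<in> rstrat s1 n ts" for x by (rule G(1))
    let ?M = "borel \<Otimes>\<^sub>M (play_space (ts 0) (ts n)) :: ((real^'n) \<times> noise_seq \<times> (real => 'v) \<times> real) measure"
    have 1: "(\<lambda>p. q (fst p)) \<in> measurable ?M (count_space UNIV)" unfolding q_def by measurable
    have 2: "(\<lambda>p. G i (fst (snd p)) (fst (snd (snd p))) (snd (snd (snd p)))) \<in> borel_measurable ?M" for i
      using measurable_compose[OF measurable_snd rstrat_measurable[OF G(1)[of i]]] by (simp add: case_prod_beta')
    show "(\<lambda>(x, z, w, s). G (q x) z w s) \<in> borel_measurable ?M"
      using measurable_compose_countable[OF 2 1] by (simp add: case_prod_beta')
    show "V x - 2 * \<epsilon> \<le> rpay n ts g x (G (q x)) b" if x: "norm x \<le> R" and b: "b \<in> rstrat s2 n ts" for x b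
    proof -
      have nx: "norm (d (q x) - x) < \<eta>" using q[of x] by (simp add: dist_norm)
      have "norm (d (q x)) \<le> norm x + norm (d (q x) - x)" using norm_triangle_ineq[of x "d (q x) - x"] by simp
      then have "norm (d (q x)) \<le> R + 1" using x nx \<eta>(2) by linarith
      then have 1: "V (d (q x)) - \<epsilon> \<le> rpay n ts g (d (q x)) (G (q x)) b" using b by (rule G(2))
      have 2: "rpay n ts g (d (q x)) (G (q x)) b - K * stab T * norm (d (q x) - x) \<le> rpay n ts g x (G (q x)) b"
        by (rule rpay_stable[OF pf gr G(1) b T])
      have 3: "V x - K' * norm (d (q x) - x) \<le> V (d (q x))" using V[of x "d (q x)"] by (simp add: norm_minus_commute)
      have "(K * stab T + K') * norm (d (q x) - x) \<le> M * \<eta>" unfolding M_def[symmetric] using nx M by (intro mult_left_mono) auto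
      then have "K * stab T * norm (d (q x) - x) + K' * norm (d (q x) - x) \<le> \<epsilon>" using M\<eta> by (simp add: distrib_right)
      with 1 2 3 show ?thesis by linarith
    qed
  qed
qed

end

section \<open>Along an equilibrium no player falls below the value\<close>

lemma rctrl_past:
  assumes g: "grid n ts" and u: "u \<in> rctrl sel n ts" and "j \<le> n" "\<And>i. i < j ==> y i = y' i" "ts 0 \<le> s" "s < ts j"
  shows "u y s = u y' s"
proof -
  have "j \<noteq> 0" using assms(5,6) by (intro notI) simp
  then have "grid j ts" using g assms(3) by (auto simp: grid_def)
  from grid_cell[OF this assms(5,6)] obtain i where i: "i < j" "ts i \<le> s" "s < ts (Suc i)" .
  then show ?thesis using assms(3,4) by (intro rctrl_signal[OF u, of i]) (auto simp: same_signal_def)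
qed

lemma comb_seq_past: "i < j ==> comb_seq j y z i = y i"
  by (simp add: comb_seq_def)

lemma comb_seq_eqI: "(\<And>i. i < j ==> y i = y' i) ==> comb_seq j y z = comb_seq j y' z"
  by (auto simp: comb_seq_def)

lemma comb_seq_shift: "(\<lambda>i. comb_seq j y z (j + i)) = z"
  by (auto simp: comb_seq_def)

context noise_game
begin

text \<open>The expected payoff of the play \<open>(u, v)\<close> given the first \<open>j\<close> noise pairs.\<close>

definition cpay :: "nat => (nat => real) => (real^'n => real) => real^'n => 'u noise_control =>
    'v noise_control => nat => noise_seq => real" where
  "cpay n ts g x u v j y = (\<integral>z. g (traj f (ts 0) (ts n) x (u (comb_seq j y z)) (v (comb_seq j y z)) (ts n)) \<partial>noise)"

text \<open>The condition of the characterization for one player, with \<open>cpay\<close> in the role of the conditional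
  expectation.\<close>

definition continues :: "nat => (nat => real) => (real^'n => real) => (real => real^'n => real) => real^'n => real =>
    'u noise_control => 'v noise_control => bool" where
  "continues n ts g V x \<epsilon> u v \<longleftrightarrow> (\<forall>j<n. measure noise
     {y. V (ts j) (traj f (ts 0) (ts n) x (u y) (v y) (ts j)) - \<epsilon> \<le> cpay n ts g x u v j y} \<ge> 1 - \<epsilon>)"

lemma traj_past:
  assumes g: "grid n ts" and u: "u \<in> rctrl sel n ts" and v: "v \<in> rctrl sel' n ts" and j: "j \<le> n"
    and past: "\<And>i. i < j ==> y i = y' i"
  shows "traj f (ts 0) (ts n) x (u y) (v y) (ts j) = traj f (ts 0) (ts n) x (u y') (v y') (ts j)"
proof (rule traj_cong_upto)
  show "agree (ts 0) (ts j) (u y) (u y')" by (rule agreeI, rule rctrl_past[OF g u j past])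
  show "agree (ts 0) (ts j) (v y) (v y')" by (rule agreeI, rule rctrl_past[OF g v j past])
  show "ts 0 \<le> ts j" "ts j \<le> ts n" using j by (auto intro: grid_mono[OF g])
qed (rule rctrl_ctrl[OF u] rctrl_ctrl[OF v])+

lemma traj_radius:
  assumes "grid n ts" "u \<in> ctrls (ts 0) (ts n)" "v \<in> ctrls (ts 0) (ts n)" "j \<le> n"
  shows "norm (traj f (ts 0) (ts n) x u v (ts j)) \<le> norm x + C * (ts n - ts 0)"
proof -
  have le: "ts 0 \<le> ts j" "ts j \<le> ts n" "ts 0 \<le> ts n" using assms by (auto intro: grid_mono)
  have "norm (traj f (ts 0) (ts n) x u v (ts j) - x) \<le> C * (ts j - ts 0)"
    using traj_speed[OF assms(2,3) order_refl le(1,2), of x] traj_initial[OF assms(2,3) le(3), of x] by simp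
  also have "\<dots> \<le> C * (ts n - ts 0)" using le C_nonneg by (intro mult_left_mono) auto
  finally show ?thesis using norm_triangle_sub[of "traj f (ts 0) (ts n) x u v (ts j)" x] by linarith
qed

lemma fgrid_tail:
  assumes "fgrid T \<delta> t n ts" "j < n"
  shows "grid n ts" "ts 0 = t" "ts n = T" "t \<le> ts j" "ts j < T" "ts j < ts (Suc j)"
    "grid (n - j) (subgrid j (ts j) ts)" "fgrid T \<delta> (ts j) (n - j) (subgrid j (ts j) ts)"
proof -
  show gr: "grid n ts" and 0: "ts 0 = t" and T: "ts n = T" using assms by (auto simp: fgrid_def)
  show "t \<le> ts j" using grid_mono[OF gr, of 0 j] assms(2) 0 by simp
  show "ts j < T" using grid_strict[OF gr, of j n] assms(2) T by simp
  show s: "ts j < ts (Suc j)" using gr assms(2) by (simp add: grid_def)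
  show sg: "grid (n - j) (subgrid j (ts j) ts)" by (rule subgrid_grid[OF gr assms(2) order_refl s])
  have "subgrid j (ts j) ts (Suc i) - subgrid j (ts j) ts i < \<delta>" if "i < n - j" for i
  proof -
    have "ts (Suc (j + i)) - ts (j + i) < \<delta>" using assms(1) that by (simp add: fgrid_def)
    then show ?thesis by (cases i) (simp_all add: subgrid_def)
  qed
  then show "fgrid T \<delta> (ts j) (n - j) (subgrid j (ts j) ts)"
    using sg assms(2) T by (simp add: fgrid_def)
qed

lemma cpay_measurable:
  assumes pf: "payoff_function B K g" and gr: "grid n ts" and u: "u \<in> rctrl sel n ts" and v: "v \<in> rctrl sel' n ts"
  shows "cpay n ts g x u v j \<in> borel_measurable noise" "\<bar>cpay n ts g x u v j y\<bar> \<le> B"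
    "(\<integral>y. cpay n ts g x u v j y \<partial>noise) = (\<integral>y. g (traj f (ts 0) (ts n) x (u y) (v y) (ts n)) \<partial>noise)"
proof -
  let ?H = "\<lambda>y. g (traj f (ts 0) (ts n) x (u y) (v y) (ts n))"
  have Hm: "?H \<in> borel_measurable noise"
    by (rule final_payoff_measurable[OF pf u v]) (use grid_mono[OF gr, of 0 n] in simp)
  have HB: "\<bar>?H y\<bar> \<le> B" for y using pf by (simp add: payoff_function_def)
  show "cpay n ts g x u v j \<in> borel_measurable noise" unfolding cpay_def by (rule noise_split(1)[OF Hm HB])
  show "\<bar>cpay n ts g x u v j y\<bar> \<le> B" unfolding cpay_def by (rule noise_split_inner(2)[OF Hm HB])
  show "(\<integral>y. cpay n ts g x u v j y \<partial>noise) = (\<integral>y. ?H y \<partial>noise)"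
    unfolding cpay_def by (rule noise_split(2)[OF Hm HB, symmetric])
qed

text \<open>Let \<open>A\<close> be the event that after \<open>j\<close> stages the expected payoff of player I is below the value of
  the current state by more than \<open>\<epsilon>\<close>. It is known at the beginning of stage \<open>j\<close>, so player I can
  deviate exactly on \<open>A\<close>, to a strategy that secures the value of the current state up to \<open>\<epsilon>/2\<close>. The
  gain is at least \<open>\<epsilon>/2\<close> times the probability of \<open>A\<close>; since it is at most \<open>\<epsilon>\<^sup>2/2\<close>, that probability
  is at most \<open>\<epsilon>\<close>.\<close>

lemma equilibrium_continues:
  assumes pf: "payoff_function B K g" and gv: "game_value g T U" and t: "0 \<le> t" "t < T" and \<epsilon>: "\<epsilon> > 0"
  shows "\<forall>\<^sub>F (n, ts) in fine_grids T t. \<forall>a\<in>rstrat s1 n ts. \<forall>b\<in>rstrat s2 n ts. \<forall>u\<in>rctrl s1 n ts. \<forall>v\<in>rctrl s2 n ts.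
    (\<forall>y. plays (ts 0) (ts n) (a y) (b y) (u y) (v y)) -->
    (\<forall>a'\<in>rstrat s1 n ts. rpay n ts g x a' b \<le> rpay n ts g x a b + \<epsilon>\<^sup>2 / 2) --> continues n ts g U x \<epsilon> u v"
proof -
  define R where "R = norm x + C * (T - t)"
  \<comment> \<open>The measurable selection doubles the error, to \<open>\<epsilon>/2\<close>.\<close>
  obtain \<delta> where \<delta>: "\<delta> > 0" "\<And>t x n ts. 0 \<le> t ==> t < T ==> norm x \<le> R + 1 ==> fgrid T \<delta> t n ts ==> secures n ts g x (U t x - \<epsilon> / 4)"
    using uniformly_secures[OF pf gv, of "\<epsilon>/4" "R + 1"] \<epsilon> by auto
  show ?thesis
    unfolding eventually_fine_grids continues_def
  proof (intro exI[of _ \<delta>] conjI \<delta>(1) allI impI ballI)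
    fix n ts a b u v j
    assume fg: "fgrid T \<delta> t n ts" and a: "a \<in> rstrat s1 n ts" and b: "b \<in> rstrat s2 n ts"
      and u: "u \<in> rctrl s1 n ts" and v: "v \<in> rctrl s2 n ts" and p': "\<forall>y. plays (ts 0) (ts n) (a y) (b y) (u y) (v y)"
      and nash: "\<forall>a'\<in>rstrat s1 n ts. rpay n ts g x a' b \<le> rpay n ts g x a b + \<epsilon>\<^sup>2 / 2" and j: "j < n"
    have p: "plays t T (a y) (b y) (u y) (v y)" for y using p' fg by (simp add: fgrid_def)
    note ft = fgrid_tail[OF fg j]
    note gr = ft(1)
    define \<sigma> where "\<sigma> = subgrid j (ts j) ts"
    have \<sigma>: "grid (n - j) \<sigma>" "fgrid T \<delta> (ts j) (n - j) \<sigma>" "\<sigma> 0 = ts j" "\<sigma> (n - j) = T"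
      using ft j by (auto simp: \<sigma>_def)
    define \<xi> where "\<xi> y = traj f t T x (u y) (v y) (ts j)" for y
    define H where "H y = g (traj f t T x (u y) (v y) T)" for y
    define A where "A = {y. cpay n ts g x u v j y < U (ts j) (\<xi> y) - \<epsilon>}"
    have tj: "0 \<le> ts j" "ts j \<le> T" "t \<le> T" using ft t by auto
    have stK: "K * stab T \<ge> 0" using pf by (simp add: payoff_function_def stab_def)
    have \<xi>m[measurable]: "\<xi> \<in> borel_measurable noise" unfolding \<xi>_def by (rule final_measurable[OF u v]) (use ft in simp)
    have Um[measurable]: "U (ts j) \<in> borel_measurable borel" by (rule value_measurable[OF pf gv tj(1,2)])
    have cm[measurable]: "cpay n ts g x u v j \<in> borel_measurable noise" by (rule cpay_measurable(1)[OF pf gr u v])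
    have "{y \<in> space noise. cpay n ts g x u v j y < U (ts j) (\<xi> y) - \<epsilon>} \<in> sets noise" by measurable
    then have Am: "A \<in> sets noise" by (simp add: A_def)
    have past\<xi>: "\<xi> y = \<xi> y'" if "\<And>i. i < j ==> y i = y' i" for y y'
      using traj_past[OF gr u v, of j y y' x] that j ft(2,3) by (simp add: \<xi>_def)
    have pastc: "cpay n ts g x u v j y = cpay n ts g x u v j y'" if "\<And>i. i < j ==> y i = y' i" for y y'
      using comb_seq_eqI[OF that] by (simp add: cpay_def)
    have pastA: "y \<in> A \<longleftrightarrow> y' \<in> A" if "\<And>i. i < j ==> y i = y' i" for y y'
      using past\<xi>[OF that] pastc[OF that] by (simp add: A_def)
    have V: "\<bar>U (ts j) z - U (ts j) z'\<bar> \<le> K * stab T * norm (z - z')" for z z'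
      using value_lipschitz[OF pf gv tj(1) order_refl tj(2), of z z'] by simp
    have T0: "\<sigma> (n - j) - \<sigma> 0 \<le> T" using \<sigma> tj by simp
    obtain \<Gamma> where \<Gamma>: "\<And>z. \<Gamma> z \<in> rstrat s1 (n - j) \<sigma>"
      "(\<lambda>(x, z, w, s). \<Gamma> x z w s) \<in> borel_measurable (borel \<Otimes>\<^sub>M (noise \<Otimes>\<^sub>M (ctrl_space (\<sigma> 0) (\<sigma> (n - j)) \<Otimes>\<^sub>M borel)))"
      "\<And>z b. norm z \<le> R ==> b \<in> rstrat s2 (n - j) \<sigma> ==> U (ts j) z - 2 * (\<epsilon> / 4) \<le> rpay (n - j) \<sigma> g z (\<Gamma> z) b"
      by (rule measurable_secure_selection[OF pf \<sigma>(1) T0 V stK \<delta>(2)[OF tj(1) ft(5) _ \<sigma>(2)]]) (use \<epsilon> in auto)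
    define a' where "a' = switch j (ts j) (\<lambda>y w. y \<in> A) (\<lambda>y w. \<xi> y) \<Gamma> a"
    have a': "a' \<in> rstrat s1 n ts"
      unfolding a'_def
    proof (rule switch_rstrat[OF compact_V gr j order_refl ft(6) a])
      let ?M = "noise \<Otimes>\<^sub>M ctrl_space (ts 0) (ts n) :: (noise_seq \<times> (real => 'v)) measure"
      have "fst -` A \<inter> space ?M \<in> sets ?M" by (rule measurable_sets[OF measurable_fst Am])
      moreover have "fst -` A \<inter> space ?M = {p \<in> space ?M. fst p \<in> A}" by auto
      ultimately show "{p \<in> space ?M. fst p \<in> A} \<in> sets ?M" by simp
      show "(\<lambda>p. \<xi> (fst p)) \<in> borel_measurable ?M" by measurable
      show "(\<lambda>(x, z, w, s). \<Gamma> x z w s) \<in> borel_measurable (borel \<Otimes>\<^sub>M (play_space (ts j) (ts n)))"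
        using \<Gamma>(2) \<sigma>(3,4) ft(3) by simp
      show "\<Gamma> z \<in> rstrat s1 (n - j) (subgrid j (ts j) ts)" for z using \<Gamma>(1) by (simp add: \<sigma>_def)
      fix y y' :: noise_seq assume "\<And>i. i < j ==> y i = y' i"
      then show "(y \<in> A) = (y' \<in> A) \<and> (y \<in> A --> \<xi> y = \<xi> y')"
        by (intro conjI impI pastA past\<xi>)
    qed
    obtain u' v' where u': "u' \<in> rctrl s1 n ts" and v': "v' \<in> rctrl s2 n ts"
      and p'': "\<And>y. plays (ts 0) (ts n) (a' y) (b y) (u' y) (v' y)"
      by (rule plays_exists[OF gr a' b]) blast
    have p': "plays t T (a' y) (b y) (u' y) (v' y)" for y using p'' ft(2,3) by simp
    define H' where "H' y = g (traj f t T x (u' y) (v' y) T)" for y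
    have B: "\<bar>g z\<bar> \<le> B" for z using pf by (simp add: payoff_function_def)
    have Hm: "H \<in> borel_measurable noise" unfolding H_def by (rule final_payoff_measurable[OF pf u v]) (use tj in simp)
    have Hm': "H' \<in> borel_measurable noise" unfolding H'_def by (rule final_payoff_measurable[OF pf u' v']) (use tj in simp)
    have HB: "\<bar>H y\<bar> \<le> B" "\<bar>H' y\<bar> \<le> B" for y by (simp_all add: H_def H'_def B)
    have cpay_H: "cpay n ts g x u v j y = (noise_avg j H y)" for y
      by (simp add: cpay_def H_def ft(2,3))
    have uc: "u y \<in> ctrls t T" "v y \<in> ctrls t T" "u' y \<in> ctrls t T" "v' y \<in> ctrls t T" for y
      by (auto intro: rctrl_ctrl u v u' v')
    have gain: "cpay n ts g x u v j y + (\<epsilon> / 2) * indicator A y \<le> (noise_avg j H' y)" for y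
    proof (cases "y \<in> A")
      case False
      have "H' (comb_seq j y z) = H (comb_seq j y z)" for z
      proof -
        let ?y = "comb_seq j y z"
        have "?y \<notin> A" using False pastA[of ?y y] by (simp add: comb_seq_past)
        then have "a' ?y = a ?y" by (auto simp: a'_def switch_def fun_eq_iff)
        then have "agree (ts 0) (ts n) (u ?y) (u' ?y) \<and> agree (ts 0) (ts n) (v ?y) (v' ?y)"
          using p[of ?y] p'[of ?y] ft(2,3) by (intro plays_unique[OF gr a b, of ?y]) auto
        then show ?thesis unfolding H_def H'_def
          using traj_cong[OF uc(1)[of ?y] uc(2)[of ?y] uc(3)[of ?y] uc(4)[of ?y], of T x] tj ft(2,3) by simp
      qed
      then show ?thesis using False by (simp add: cpay_H)
    next
      case True
      have inA: "comb_seq j y z \<in> A" and \<xi>eq: "\<xi> (comb_seq j y z) = \<xi> y" for z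
        using True pastA[of "comb_seq j y z" y] past\<xi>[of "comb_seq j y z" y] by (simp_all add: comb_seq_past)
      have ag: "agree t (ts j) (u' (comb_seq j y z)) (u y) \<and> agree t (ts j) (v' (comb_seq j y z)) (v y)" for z
      proof -
        let ?y = "comb_seq j y z"
        have "agree (ts 0) (ts j) (a ?y (v' ?y)) (a' ?y (v' ?y))" by (rule agreeI) (simp add: a'_def switch_def)
        then have "agree (ts 0) (ts j) (u ?y) (u' ?y) \<and> agree (ts 0) (ts j) (v ?y) (v' ?y)"
          using p[of ?y] p'[of ?y] ft(2,3) j by (intro plays_unique_upto[OF gr a b, of j ?y "v' ?y" "a' ?y"]) auto
        moreover have "agree (ts 0) (ts j) (u ?y) (u y)" "agree (ts 0) (ts j) (v ?y) (v y)"
          using j by (auto intro!: agreeI rctrl_past[OF gr u, of j] rctrl_past[OF gr v, of j] simp: comb_seq_past)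
        ultimately show ?thesis unfolding ft(2) by (meson agree_sym agree_trans)
      qed
      have "U (ts j) (\<xi> y) - 2 * (\<epsilon> / 4) \<le> rpay (n - j) \<sigma> g (\<xi> y) (\<Gamma> (\<xi> y)) (continuation j (ts j) y (u y) b)"
      proof (rule \<Gamma>(3))
        show "norm (\<xi> y) \<le> R" using traj_radius[OF gr, of "u y" "v y" j x] uc j ft(2,3) by (simp add: \<xi>_def R_def)
        show "continuation j (ts j) y (u y) b \<in> rstrat s2 (n - j) \<sigma>"
          unfolding \<sigma>_def by (rule continuation_rstrat[OF gr j order_refl ft(6) b rctrl_ctrl[OF u]])
      qed
      also have "\<dots> = (\<integral>z. g (traj f (ts j) (ts n) (\<xi> y) (u' (comb_seq j y z)) (v' (comb_seq j y z)) (ts n)) \<partial>noise)"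
        unfolding \<sigma>_def
      proof (rule continuation_payoff[OF gr j order_refl ft(6) b p'' rctrl_ctrl[OF u]])
        show "agree (ts 0) (ts j) (u' (comb_seq j y z)) (u y)" for z using ag ft(2) by simp
        show "\<Gamma> (\<xi> y) \<in> rstrat s1 (n - j) (subgrid j (ts j) ts)" using \<Gamma>(1) by (simp add: \<sigma>_def)
        show "agree (ts j) (ts n) (a' (comb_seq j y z) (v' (comb_seq j y z))) (\<Gamma> (\<xi> y) z (v' (comb_seq j y z)))" for z
          by (rule agreeI) (simp add: a'_def switch_def inA \<xi>eq comb_seq_shift)
      qed
      also have "\<dots> = (noise_avg j H' y)"
      proof (rule Bochner_Integration.integral_cong[OF refl])
        fix z
        let ?y = "comb_seq j y z"
        have "traj f t T x (u' ?y) (v' ?y) T = traj f (ts j) T (traj f t T x (u' ?y) (v' ?y) (ts j)) (u' ?y) (v' ?y) T"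
          by (rule traj_flow[OF uc(3,4) ft(4) tj(2) order_refl])
        moreover have "traj f t T x (u' ?y) (v' ?y) (ts j) = \<xi> y"
          unfolding \<xi>_def using ag[of z] by (intro traj_cong_upto[OF uc(3,4) uc(1,2) _ _ ft(4) tj(2)]) auto
        ultimately show "g (traj f (ts j) (ts n) (\<xi> y) (u' ?y) (v' ?y) (ts n)) = H' ?y" by (simp add: H'_def ft(3))
      qed
      finally show ?thesis using True by (simp add: A_def)
    qed
    have ci: "integrable noise (cpay n ts g x u v j)" by (rule bounded_integrable_noise[OF cpay_measurable(1,2)[OF pf gr u v]])
    have ii: "integrable noise (\<lambda>y. (\<epsilon> / 2) * indicator A y :: real)"
      by (rule bounded_integrable_noise[where B="\<epsilon> / 2"]) (use Am \<epsilon> in "auto simp: indicator_def")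
    have "rpay n ts g x a b = (\<integral>y. H y \<partial>noise)" using rpay_eq[OF gr a b, of u v g x] p ft(2,3) by (simp add: H_def)
    also have "\<dots> = (\<integral>y. cpay n ts g x u v j y \<partial>noise)" using cpay_measurable(3)[OF pf gr u v, of x j] by (simp add: H_def ft(2,3))
    finally have "rpay n ts g x a b + (\<epsilon> / 2) * measure noise A = (\<integral>y. cpay n ts g x u v j y + (\<epsilon> / 2) * indicator A y \<partial>noise)"
      using Am by (simp only: Bochner_Integration.integral_add[OF ci ii]) simp
    also have "\<dots> \<le> (\<integral>y. (noise_avg j H' y) \<partial>noise)"
      by (rule integral_mono[OF Bochner_Integration.integrable_add[OF ci ii] noise_split_inner(3)[OF Hm' HB(2)] gain])
    also have "\<dots> = rpay n ts g x a' b"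
      using noise_split(2)[OF Hm' HB(2), of j] rpay_eq[OF gr a' b p'', of g x] ft(2,3) by (simp add: H'_def)
    also have "\<dots> \<le> rpay n ts g x a b + \<epsilon>\<^sup>2 / 2" by (rule nash[rule_format, OF a'])
    finally have "\<epsilon> * measure noise A \<le> \<epsilon> * \<epsilon>" by (simp add: power2_eq_square)
    then have "measure noise A \<le> \<epsilon>" using \<epsilon> by simp
    moreover have "{y. U (ts j) (\<xi> y) - \<epsilon> \<le> cpay n ts g x u v j y} = space noise - A" by (auto simp: A_def)
    ultimately show "measure noise {y. U (ts j) (traj f (ts 0) (ts n) x (u y) (v y) (ts j)) - \<epsilon> \<le> cpay n ts g x u v j y} \<ge> 1 - \<epsilon>"
      using noise_prob.prob_compl[OF Am] ft(2,3) by (simp add: \<xi>_def)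
  qed
qed

end

section \<open>Punishing a deviation\<close>

lemma agree_measurable:
  fixes w v :: "'m => real => 'a::metric_space"
  assumes cpt: "compact (UNIV :: 'a set)"
    and w: "(\<lambda>(x, s). w x s) \<in> borel_measurable (M \<Otimes>\<^sub>M borel)"
    and v: "(\<lambda>(x, s). v x s) \<in> borel_measurable (M \<Otimes>\<^sub>M borel)"
  shows "{x \<in> space M. agree a b (w x) (v x)} \<in> sets M"
proof -
  let ?Q = "{z \<in> space (M \<Otimes>\<^sub>M lborel). snd z \<in> {a..<b} \<and> dist (w (fst z) (snd z)) (v (fst z) (snd z)) > 0}"
  have [measurable]: "(\<lambda>z. dist (w (fst z) (snd z)) (v (fst z) (snd z))) \<in> borel_measurable (M \<Otimes>\<^sub>M lborel)"
    using w v by (intro borel_measurable_dist_compact[OF cpt]) (auto simp: case_prod_beta' cong: measurable_cong_sets)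
  have Q: "?Q \<in> sets (M \<Otimes>\<^sub>M lborel)" by measurable
  have [measurable]: "(\<lambda>x. emeasure lborel (Pair x -` ?Q)) \<in> borel_measurable M"
    by (rule lborel.measurable_emeasure_Pair[OF Q])
  have "agree a b (w x) (v x) \<longleftrightarrow> emeasure lborel (Pair x -` ?Q) = 0" if x: "x \<in> space M" for x
  proof -
    have eq: "Pair x -` ?Q = {s \<in> space lborel. \<not> (s \<in> {a..<b} --> w x s = v x s)}"
      using x by (auto simp: space_pair_measure)
    have "Pair x -` ?Q \<in> sets lborel" using Q by (rule sets_Pair1)
    then have "{s \<in> space lborel. \<not> (s \<in> {a..<b} --> w x s = v x s)} \<in> sets lborel" unfolding eq .
    from AE_iff_measurable[OF this refl] show ?thesis
      unfolding agree_def eq AE_completion_iff .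
  qed
  then have "{x \<in> space M. agree a b (w x) (v x)} = {x \<in> space M. emeasure lborel (Pair x -` ?Q) = 0}" by blast
  also have "\<dots> \<in> sets M" by measurable
  finally show ?thesis .
qed

lemma first_index_cong:
  fixes n j :: nat
  assumes "\<And>i. 1 \<le> i ==> i \<le> n ==> \<not> (P (i - 1) \<and> \<not> P i)" "P 0" "j \<le> n"
  shows "P j"
  using assms(3)
proof (induction j)
  case (Suc j)
  then show ?case using assms(1)[of "Suc j"] by auto
next
  case 0
  show ?case by (rule assms(2))
qed

context noise_game
begin

text \<open>The control \<open>w\<close> leaves \<open>v y\<close> during stage \<open>i - 1\<close>, which is noticed at time \<open>ts i\<close>.\<close>

definition deviates :: "(nat => real) => 'v noise_control => nat => noise_seq => (real => 'v) => bool" where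
  "deviates ts v i y w \<longleftrightarrow> agree (ts 0) (ts (i - 1)) w (v y) \<and> \<not> agree (ts 0) (ts i) w (v y)"

text \<open>Play \<open>u\<close> as long as the opponent plays \<open>v\<close>; when a deviation is noticed at \<open>ts i\<close>, use \<open>\<Gamma> i\<close> at the
  state \<open>\<xi> i\<close> from then on. The last argument bounds the times at which deviations are punished.\<close>

primrec punish :: "(nat => real) => 'v noise_control =>
    (nat => noise_seq => (real => 'v) => real^'n) =>
    (nat => real^'n => ('v, 'u) noise_strategy) =>
    'u noise_control => nat => ('v, 'u) noise_strategy" where
  "punish ts v \<xi> \<Gamma> u 0 = (\<lambda>y w. u y)"
| "punish ts v \<xi> \<Gamma> u (Suc i) =
    switch (Suc i) (ts (Suc i)) (deviates ts v (Suc i)) (\<xi> (Suc i)) (\<Gamma> (Suc i)) (punish ts v \<xi> \<Gamma> u i)"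

lemma deviates_unique:
  assumes g: "grid n ts" and "i \<le> n" "j \<le> n" "i < j" "deviates ts v i y w"
  shows "\<not> deviates ts v j y w"
proof
  assume "deviates ts v j y w"
  then have "agree (ts 0) (ts (j - 1)) w (v y)" by (simp add: deviates_def)
  then have "agree (ts 0) (ts i) w (v y)" by (rule agree_subset) (use assms in "auto intro: grid_mono[OF g]")
  then show False using assms(5) by (simp add: deviates_def)
qed

lemma punish_no_deviation:
  assumes "\<And>i. 1 \<le> i ==> i \<le> k ==> \<not> deviates ts v i y w"
  shows "punish ts v \<xi> \<Gamma> u k y w = u y"
  using assms
proof (induction k)
  case (Suc k)
  have "\<not> deviates ts v (Suc k) y w" by (rule Suc.prems) auto
  moreover have "punish ts v \<xi> \<Gamma> u k y w = u y" by (rule Suc.IH) (rule Suc.prems, auto)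
  ultimately show ?case by (auto simp: switch_def fun_eq_iff)
qed simp

lemma punish_deviation:
  assumes g: "grid n ts" and i: "1 \<le> i" "i \<le> k" "k < n" and d: "deviates ts v i y w"
  shows "punish ts v \<xi> \<Gamma> u k y w s = (if ts i \<le> s then \<Gamma> i (\<xi> i y w) (\<lambda>j. y (i + j)) w s else u y s)"
  using i(2,3)
proof (induction k)
  case (Suc k)
  show ?case
  proof (cases "i = Suc k")
    case True
    have "punish ts v \<xi> \<Gamma> u k y w = u y"
    proof (rule punish_no_deviation)
      fix j assume "1 \<le> j" "j \<le> k"
      then show "\<not> deviates ts v j y w" using deviates_unique[OF g, of j i v y w] d True Suc.prems by auto
    qed
    then show ?thesis using d True by (simp add: switch_def)
  next
    case False
    then have "\<not> deviates ts v (Suc k) y w" using deviates_unique[OF g _ _ _ d, of "Suc k"] Suc.prems by auto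
    then show ?thesis using Suc False by (simp add: switch_def)
  qed
qed (use i(1) in simp)

text \<open>The state at \<open>ts i\<close> is computed from the canonical representative \<open>cv w\<close> of the observed control,
  which makes it measurable.\<close>

lemma punish_rstrat:
  assumes g: "grid n ts" and u: "u \<in> rctrl s1 n ts" and v: "v \<in> rctrl s2 n ts" and k: "k < n"
    and cv: "(\<lambda>(w, s). cv w s) \<in> borel_measurable (ctrl_space (ts 0) (ts n) \<Otimes>\<^sub>M borel)"
      "\<And>w. w \<in> ctrls (ts 0) (ts n) ==> agree (ts 0) (ts n) (cv w) w"
    and \<xi>: "\<And>i y w. \<xi> i y w = traj f (ts 0) (ts n) x (u y) (cv w) (ts i)"
    and \<Gamma>: "\<And>i z. 1 \<le> i ==> i < n ==> \<Gamma> i z \<in> rstrat s1 (n - i) (subgrid i (ts i) ts)"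
      "\<And>i. 1 \<le> i ==> i < n ==> (\<lambda>(x, z, w, s). \<Gamma> i x z w s) \<in> borel_measurable (borel \<Otimes>\<^sub>M (play_space (ts i) (ts n)))"
  shows "punish ts v \<xi> \<Gamma> u k \<in> rstrat s1 n ts"
  using k
proof (induction k)
  case 0
  have "(\<lambda>p. u (fst p) (snd (snd p))) \<in> borel_measurable (play_space (ts 0) (ts n))"
    using measurable_compose[OF _ rctrl_measurable[OF u], of "\<lambda>p. (fst p, snd (snd p))" "noise \<Otimes>\<^sub>M (ctrl_space (ts 0) (ts n) \<Otimes>\<^sub>M borel)"] by simp
  then show ?case using rctrl_signal[OF u] by (auto simp: rstrat_def case_prod_beta')
next
  case (Suc k)
  let ?i = "Suc k"
  let ?C = "ctrl_space (ts 0) (ts n) :: (real => 'v) measure"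
  have i: "1 \<le> ?i" "?i < n" using Suc.prems by auto
  have le: "ts 0 \<le> ts ?i" "ts ?i \<le> ts n" "ts k \<le> ts ?i" using i by (auto intro: grid_mono[OF g])
  have wev: "(\<lambda>(p, s). cv (snd p) s) \<in> borel_measurable ((noise \<Otimes>\<^sub>M ?C) \<Otimes>\<^sub>M borel)"
    using measurable_compose[OF _ cv(1), of "\<lambda>p. (snd (fst p), snd p)" "(noise \<Otimes>\<^sub>M ?C) \<Otimes>\<^sub>M borel"] by (simp add: case_prod_beta')
  have wv: "(\<lambda>(p, s). v (fst p) s) \<in> borel_measurable ((noise \<Otimes>\<^sub>M ?C) \<Otimes>\<^sub>M borel)"
    using measurable_compose[OF _ rctrl_measurable[OF v], of "\<lambda>p. (fst (fst p), snd p)" "(noise \<Otimes>\<^sub>M ?C) \<Otimes>\<^sub>M borel"] by (simp add: case_prod_beta')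
  have wu: "(\<lambda>(p, s). u (fst p) s) \<in> borel_measurable ((noise \<Otimes>\<^sub>M ?C) \<Otimes>\<^sub>M borel)"
    using measurable_compose[OF _ rctrl_measurable[OF u], of "\<lambda>p. (fst (fst p), snd p)" "(noise \<Otimes>\<^sub>M ?C) \<Otimes>\<^sub>M borel"] by (simp add: case_prod_beta')
  have cv_ctrl: "cv w \<in> space ?C" if "w \<in> space ?C" for w
    by (rule borel_in_ctrl[OF borel_section[OF cv(1) that]])
  have cv_agree: "agree (ts 0) (ts j) (cv w) z \<longleftrightarrow> agree (ts 0) (ts j) w z" if "w \<in> space ?C" "j \<le> n" for w j z
  proof -
    have "agree (ts 0) (ts j) (cv w) w" by (rule agree_subset[OF cv(2)[OF that(1)] order_refl]) (use that in "auto intro: grid_mono[OF g]")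
    then show ?thesis using agree_sym agree_trans by blast
  qed
  show ?case
    unfolding punish.simps
  proof (rule switch_rstrat[OF compact_V g i(2) order_refl _ Suc.IH])
    show "k < n" "ts ?i < ts (Suc ?i)" using i g by (auto simp: grid_def)
    have "{p \<in> space (noise \<Otimes>\<^sub>M ?C). agree (ts 0) (ts j) (cv (snd p)) (v (fst p))} \<in> sets (noise \<Otimes>\<^sub>M ?C)" for j
      by (rule agree_measurable[OF compact_V wev wv])
    then have "{p \<in> space (noise \<Otimes>\<^sub>M ?C). agree (ts 0) (ts k) (cv (snd p)) (v (fst p))} -
        {p \<in> space (noise \<Otimes>\<^sub>M ?C). agree (ts 0) (ts ?i) (cv (snd p)) (v (fst p))} \<in> sets (noise \<Otimes>\<^sub>M ?C)"
      by (intro sets.Diff)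
    moreover have "{p \<in> space (noise \<Otimes>\<^sub>M ?C). deviates ts v ?i (fst p) (snd p)} =
      {p \<in> space (noise \<Otimes>\<^sub>M ?C). agree (ts 0) (ts k) (cv (snd p)) (v (fst p))} -
        {p \<in> space (noise \<Otimes>\<^sub>M ?C). agree (ts 0) (ts ?i) (cv (snd p)) (v (fst p))}"
      using i cv_agree by (auto simp: deviates_def space_pair_measure)
    ultimately show "{p \<in> space (noise \<Otimes>\<^sub>M ?C). deviates ts v ?i (fst p) (snd p)} \<in> sets (noise \<Otimes>\<^sub>M ?C)" by simp
    show "(\<lambda>p. \<xi> ?i (fst p) (snd p)) \<in> borel_measurable (noise \<Otimes>\<^sub>M ?C)"
      unfolding \<xi> by (rule traj_param_measurable[OF measurable_const wu wev]) (use le in auto)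
    show "\<Gamma> ?i z \<in> rstrat s1 (n - ?i) (subgrid ?i (ts ?i) ts)" for z by (rule \<Gamma>(1)[OF i])
    show "(\<lambda>(x, z, w, s). \<Gamma> ?i x z w s) \<in> borel_measurable (borel \<Otimes>\<^sub>M (play_space (ts ?i) (ts n)))"
      by (rule \<Gamma>(2)[OF i])
    fix y y' :: noise_seq and w w' :: "real => 'v"
    assume past: "\<And>l. l < ?i ==> y l = y' l" and w: "w \<in> space ?C" "w' \<in> space ?C" and ag: "agree (ts 0) (ts ?i) w w'"
    have vy: "agree (ts 0) (ts ?i) (v y) (v y')" by (rule agreeI, rule rctrl_past[OF g v less_imp_le[OF i(2)] past])
    have uy: "agree (ts 0) (ts ?i) (u y) (u y')" by (rule agreeI, rule rctrl_past[OF g u less_imp_le[OF i(2)] past])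
    have "agree (ts 0) (ts j) w (v y) \<longleftrightarrow> agree (ts 0) (ts j) w' (v y')" if "ts j \<le> ts ?i" for j
    proof -
      have "agree (ts 0) (ts j) w w'" "agree (ts 0) (ts j) (v y) (v y')"
        using agree_subset[OF ag order_refl that] agree_subset[OF vy order_refl that] by auto
      then show ?thesis by (meson agree_sym agree_trans)
    qed
    then have "deviates ts v ?i y w = deviates ts v ?i y' w'" using le(3) by (simp add: deviates_def)
    moreover have "\<xi> ?i y w = \<xi> ?i y' w'"
      unfolding \<xi>
    proof (rule traj_cong_upto[OF rctrl_ctrl[OF u] cv_ctrl[OF w(1)] rctrl_ctrl[OF u] cv_ctrl[OF w(2)] uy _ le(1,2)])
      have "agree (ts 0) (ts ?i) (cv w) w" "agree (ts 0) (ts ?i) (cv w') w'"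
        using cv_agree[OF w(1), of ?i w] cv_agree[OF w(2), of ?i w'] i by auto
      then show "agree (ts 0) (ts ?i) (cv w) (cv w')" using ag by (meson agree_sym agree_trans)
    qed
    ultimately show "deviates ts v ?i y w = deviates ts v ?i y' w' \<and> (deviates ts v ?i y w --> \<xi> ?i y w = \<xi> ?i y' w')" by simp
  qed
qed

end

text \<open>The grid may have arbitrarily many times, and at each of them the condition on the payoffs may fail
  with probability \<open>\<epsilon>'\<close>. So it is used only at \<open>M + 1\<close> grid times, \<open>M\<close> depending on \<open>\<eta>\<close> only: after
  any grid time one of them follows soon.\<close>

lemma coarse_times:
  assumes fg: "fgrid T \<delta> t n ts" and t: "0 \<le> t" and \<eta>: "\<eta> > 0" and \<delta>: "\<delta> > 0"
  obtains c where "\<And>q. c q \<le> n"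
    "\<And>i. i \<le> n ==> \<exists>q\<le>nat \<lceil>T / \<eta>\<rceil>. i \<le> c q \<and> ts (c q) - ts i \<le> \<eta> + \<delta>"
proof -
  have gr: "grid n ts" and ends: "ts 0 = t" "ts n = T" using fg by (auto simp: fgrid_def)
  define P where "P q j \<longleftrightarrow> j = n \<or> real q * \<eta> \<le> ts j" for q j
  define c where "c q = (LEAST j. P q j)" for q
  have cn: "c q \<le> n" for q unfolding c_def by (rule Least_le) (simp add: P_def)
  have cP: "P q (c q)" for q unfolding c_def by (rule LeastI[of _ n]) (simp add: P_def)
  have "\<exists>q\<le>nat \<lceil>T / \<eta>\<rceil>. i \<le> c q \<and> ts (c q) - ts i \<le> \<eta> + \<delta>" if i: "i \<le> n" for i
  proof -
    define q where "q = nat \<lceil>ts i / \<eta>\<rceil>"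
    have ti: "0 \<le> ts i" "ts i \<le> T" using grid_mono[OF gr, of 0 i] grid_mono[OF gr, of i n] i t ends by auto
    have r: "real q = of_int \<lceil>ts i / \<eta>\<rceil>" using ti \<eta> by (simp add: q_def)
    have a: "ts i / \<eta> \<le> of_int \<lceil>ts i / \<eta>\<rceil>" and b: "of_int \<lceil>ts i / \<eta>\<rceil> < ts i / \<eta> + 1" by linarith+
    have q1: "ts i \<le> real q * \<eta>" unfolding r using a by (simp only: pos_divide_le_eq[OF \<eta>])
    have "real q * \<eta> < (ts i / \<eta> + 1) * \<eta>" unfolding r by (rule mult_strict_right_mono[OF b \<eta>])
    then have q2: "real q * \<eta> < ts i + \<eta>" using \<eta> by (simp add: distrib_right)
    have ic: "i \<le> c q"
    proof (rule ccontr)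
      assume "\<not> i \<le> c q"
      then have "ts (c q) < ts i" using grid_strict[OF gr, of "c q" i] i by simp
      then show False using cP[of q] q1 \<open>\<not> i \<le> c q\<close> i by (auto simp: P_def)
    qed
    have "ts (c q) - ts i \<le> \<eta> + \<delta>"
    proof (cases "c q = i")
      case False
      then obtain k where k: "c q = Suc k" "i \<le> k" using ic by (cases "c q") auto
      have "\<not> P q k" using not_less_Least[of k "P q"] k(1) by (simp add: c_def)
      then have "ts k < real q * \<eta>" by (simp add: P_def)
      moreover have "ts (Suc k) - ts k < \<delta>" using fg k(1) cn[of q] by (simp add: fgrid_def)
      ultimately show ?thesis using q2 k(1) by simp
    qed (use \<eta> \<delta> in simp)
    moreover have "q \<le> nat \<lceil>T / \<eta>\<rceil>"
      unfolding q_def using ti \<eta> by (intro nat_mono ceiling_mono divide_right_mono) auto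
    ultimately show ?thesis using ic by blast
  qed
  with cn show ?thesis by (rule that)
qed

lemma sum_indicator_unique:
  fixes z :: real
  assumes "finite I" "\<And>i j. i \<in> I ==> j \<in> I ==> y \<in> D i ==> y \<in> D j ==> i = j"
  shows "(\<Sum>i\<in>I. indicator (D i) y * z) = (if \<exists>i\<in>I. y \<in> D i then z else 0)"
proof (cases "\<exists>i\<in>I. y \<in> D i")
  case True
  then obtain i where i: "i \<in> I" "y \<in> D i" by blast
  have "(\<Sum>j\<in>I. indicator (D j) y * z) = (\<Sum>j\<in>I. if j = i then z else 0)"
    by (rule sum.cong[OF refl]) (use i assms(2) in "auto simp: indicator_def")
  then show ?thesis using True i assms(1) by simp
next
  case False
  have "(\<Sum>j\<in>I. indicator (D j) y * z) = (\<Sum>j\<in>I. 0)"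
    by (rule sum.cong[OF refl]) (use False in "auto simp: indicator_def")
  then show ?thesis using False by simp
qed

text \<open>The payoff \<open>H'\<close> of a deviation is compared with \<open>H\<close> separately on the events that the deviation is
  noticed after \<open>i\<close> stages. On each of them \<open>H'\<close> is averaged from that stage on, and \<open>H\<close> only from the
  next of the selected times on, where it can be controlled outside \<open>E\<close>; both averages keep the
  integral, since the event belongs to the past.\<close>

lemma deviation_loss:
  fixes H H' :: "noise_seq => real" and n :: nat
  assumes H: "H \<in> borel_measurable noise" "\<And>y. \<bar>H y\<bar> \<le> B" and H': "H' \<in> borel_measurable noise" "\<And>y. \<bar>H' y\<bar> \<le> B"
    and D: "\<And>i. D i \<in> sets noise" "\<And>i y y'. i \<le> n ==> (\<And>l. l < i ==> y l = y' l) ==> y \<in> D i \<longleftrightarrow> y' \<in> D i"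
      "\<And>i j y. i \<in> {1..n} ==> j \<in> {1..n} ==> y \<in> D i ==> y \<in> D j ==> i = j"
    and off: "\<And>y. \<not> (\<exists>i\<in>{1..n}. y \<in> D i) ==> H' y = H y"
    and E: "E \<in> sets noise" and c0: "c0 \<ge> 0"
    and le: "\<And>i. i \<in> {1..n} ==> \<exists>c\<ge>i. \<forall>y\<in>D i - E.
      (noise_avg c H y) - c0 \<le> (noise_avg i H' y)"
  shows "(\<integral>y. H y \<partial>noise) - c0 - 2 * B * measure noise E \<le> (\<integral>y. H' y \<partial>noise)"
proof -
  have B0: "B \<ge> 0" using H(2)[of undefined] by linarith
  have iD: "integrable noise (\<lambda>y. indicator (D i) y * G y)" if "integrable noise G" for i and G :: "noise_seq => real"
    using integrable_mult_indicator[OF D(1) that, of i] by simp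
  have Hi: "integrable noise H" "integrable noise H'"
    by (rule bounded_integrable_noise[OF H], rule bounded_integrable_noise[OF H'])
  have part: "(\<integral>y. indicator (D i) y * G y \<partial>noise) = (\<integral>y. indicator (D i) y * (noise_avg j G y) \<partial>noise)"
    if G: "G \<in> borel_measurable noise" "\<And>y. \<bar>G y\<bar> \<le> B" and ij: "i \<le> j" "i \<le> n" for G i j
  proof -
    have "indicator (D i) (comb_seq j y z) = (indicator (D i) y :: real)" for y z
      using D(2)[of i "comb_seq j y z" y] ij by (simp add: comb_seq_past indicator_def)
    moreover have "(\<lambda>y. indicator (D i) y * G y) \<in> borel_measurable noise" using G(1) D(1) by measurable
    moreover have "\<bar>indicator (D i) y * G y\<bar> \<le> B" for y using G(2)[of y] B0 by (simp add: indicator_def)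
    ultimately show ?thesis by (subst noise_split(2)[where B=B and m=j]) simp_all
  qed
  define F where "F y = c0 + 2 * B * indicator E y" for y
  have F0: "F y \<ge> 0" for y using c0 B0 by (simp add: F_def)
  have Fi: "integrable noise F"
    unfolding F_def by (rule bounded_integrable_noise[where B="c0 + 2 * B"]) (use E B0 c0 in "auto simp: indicator_def")
  have key: "(\<integral>y. indicator (D i) y * (H y - H' y) \<partial>noise) \<le> (\<integral>y. indicator (D i) y * F y \<partial>noise)" if i: "i \<in> {1..n}" for i
  proof -
    obtain c where c: "i \<le> c" and h: "\<And>y. y \<in> D i ==> y \<notin> E ==>
      (noise_avg c H y) - c0 \<le> (noise_avg i H' y)" using le[OF i] by auto
    have in': "i \<le> n" using i by simp
    note k = noise_split_inner(3)[OF H, of c] and k' = noise_split_inner(3)[OF H', of i]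
    have "(\<integral>y. indicator (D i) y * (H y - H' y) \<partial>noise) = (\<integral>y. indicator (D i) y * H y \<partial>noise) - (\<integral>y. indicator (D i) y * H' y \<partial>noise)"
      unfolding right_diff_distrib by (rule Bochner_Integration.integral_diff[OF iD[OF Hi(1)] iD[OF Hi(2)]])
    also have "\<dots> = (\<integral>y. indicator (D i) y * (noise_avg c H y) - indicator (D i) y * (noise_avg i H' y) \<partial>noise)"
      unfolding part[OF H c in'] part[OF H' order_refl in'] by (rule Bochner_Integration.integral_diff[OF iD[OF k] iD[OF k'], symmetric])
    also have "\<dots> \<le> (\<integral>y. indicator (D i) y * F y \<partial>noise)"
    proof (rule integral_mono[OF Bochner_Integration.integrable_diff[OF iD[OF k] iD[OF k']] iD[OF Fi]])
      fix y
      show "indicator (D i) y * (noise_avg c H y) - indicator (D i) y * (noise_avg i H' y) \<le> indicator (D i) y * F y"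
        using h[of y] noise_split_inner(2)[OF H, of c y] noise_split_inner(2)[OF H', of i y] c0
        by (cases "y \<in> D i"; cases "y \<in> E") (simp_all add: F_def abs_le_iff)
    qed
    finally show ?thesis .
  qed
  have "(\<integral>y. H y \<partial>noise) - (\<integral>y. H' y \<partial>noise) = (\<integral>y. H y - H' y \<partial>noise)"
    by (rule Bochner_Integration.integral_diff[OF Hi, symmetric])
  also have "\<dots> = (\<integral>y. (\<Sum>i\<in>{1..n}. indicator (D i) y * (H y - H' y)) \<partial>noise)"
  proof (rule Bochner_Integration.integral_cong[OF refl])
    show "H y - H' y = (\<Sum>i\<in>{1..n}. indicator (D i) y * (H y - H' y))" for y
      by (subst sum_indicator_unique[OF _ D(3)]) (use off[of y] in auto)
  qed
  also have "\<dots> = (\<Sum>i\<in>{1..n}. \<integral>y. indicator (D i) y * (H y - H' y) \<partial>noise)"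
    by (rule Bochner_Integration.integral_sum) (rule iD[OF Bochner_Integration.integrable_diff[OF Hi]])
  also have "\<dots> \<le> (\<Sum>i\<in>{1..n}. \<integral>y. indicator (D i) y * F y \<partial>noise)" by (rule sum_mono) (rule key)
  also have "\<dots> = (\<integral>y. (\<Sum>i\<in>{1..n}. indicator (D i) y * F y) \<partial>noise)"
    by (rule Bochner_Integration.integral_sum[symmetric]) (rule iD[OF Fi])
  also have "\<dots> \<le> (\<integral>y. F y \<partial>noise)"
  proof (rule integral_mono[OF Bochner_Integration.integrable_sum[OF iD[OF Fi]] Fi])
    show "(\<Sum>i\<in>{1..n}. indicator (D i) y * F y) \<le> F y" for y
      by (subst sum_indicator_unique[OF _ D(3)]) (use F0[of y] in auto)
  qed
  also have "\<dots> = c0 + 2 * B * measure noise E" unfolding F_def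
    by (subst Bochner_Integration.integral_add) (use E in "auto simp: noise_prob.prob_space noise_prob.emeasure_eq_measure")
  finally show ?thesis by linarith
qed

context noise_game
begin

text \<open>Until the deviation is noticed, at the end of the stage, the states drift apart only little.\<close>

lemma punishment_loss:
  assumes pf: "payoff_function B K g" and fg: "fgrid T \<delta> t n ts" and t: "0 \<le> t" "t < T"
    and u: "u \<in> rctrl s1 n ts" and v: "v \<in> rctrl s2 n ts" and u': "u' \<in> rctrl s1 n ts" and v': "v' \<in> rctrl s2 n ts"
    and i: "1 \<le> i" "i \<le> n" and d: "deviates ts v i y (v' y)" and uu: "agree t (ts i) (u' y) (u y)"
  shows "norm (traj f t T x (u' y) (v' y) (ts i) - traj f t T x (u y) (v y) (ts i)) \<le> 2 * C * \<delta>"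
proof -
  have gr: "grid n ts" and ends: "ts 0 = t" "ts n = T" using fg by (auto simp: fgrid_def)
  obtain k where k: "i = Suc k" using i(1) by (cases i) auto
  have le: "t \<le> ts k" "ts k \<le> ts i" "ts i \<le> T" using grid_mono[OF gr, of 0 k] grid_mono[OF gr, of k i] grid_mono[OF gr, of i n] i k ends by auto
  have uc: "u y \<in> ctrls t T" "v y \<in> ctrls t T" "u' y \<in> ctrls t T" "v' y \<in> ctrls t T"
    by (auto intro: rctrl_ctrl u v u' v')
  let ?X = "traj f t T x (u y) (v y)" and ?X' = "traj f t T x (u' y) (v' y)"
  have eq: "?X' (ts k) = ?X (ts k)"
  proof (rule traj_cong_upto[OF uc(3,4,1,2)])
    show "agree t (ts k) (u' y) (u y)" by (rule agree_subset[OF uu order_refl le(2)])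
    show "agree t (ts k) (v' y) (v y)" using d k ends by (simp add: deviates_def)
  qed (use le in auto)
  have "C * (ts i - ts k) \<le> C * \<delta>"
    using fg i k C_nonneg by (intro mult_left_mono) (auto simp: fgrid_def less_imp_le)
  then have "norm (?X' (ts i) - ?X' (ts k)) \<le> C * \<delta>" "norm (?X (ts i) - ?X (ts k)) \<le> C * \<delta>"
    using traj_speed[OF uc(3,4) le, of x] traj_speed[OF uc(1,2) le, of x] by auto
  moreover have "?X' (ts i) - ?X (ts i) = (?X' (ts i) - ?X' (ts k)) - (?X (ts i) - ?X (ts k))" by (simp add: eq)
  ultimately show ?thesis
    using norm_triangle_ineq4[of "?X' (ts i) - ?X' (ts k)" "?X (ts i) - ?X (ts k)"] by simp
qed

lemma deviates_past:
  assumes gr: "grid n ts" and v: "v \<in> rctrl s2 n ts" and v': "v' \<in> rctrl s2 n ts"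
    and i: "i \<le> n" and past: "\<And>l. l < i ==> y l = y' l"
  shows "deviates ts v i y (v' y) \<longleftrightarrow> deviates ts v i y' (v' y')"
proof -
  have vv: "agree (ts 0) (ts i) (v y) (v y')" by (rule agreeI, rule rctrl_past[OF gr v i past])
  have vv': "agree (ts 0) (ts i) (v' y) (v' y')" by (rule agreeI, rule rctrl_past[OF gr v' i past])
  have "agree (ts 0) (ts j) (v' y) (v y) \<longleftrightarrow> agree (ts 0) (ts j) (v' y') (v y')" if "ts j \<le> ts i" for j
    using agree_subset[OF vv order_refl that] agree_subset[OF vv' order_refl that]
    by (meson agree_sym agree_trans)
  moreover have "ts (i - 1) \<le> ts i" using i by (intro grid_mono[OF gr]) auto
  ultimately show ?thesis by (simp add: deviates_def)
qed

lemma deviates_measurable: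
  assumes v: "v \<in> rctrl s2 n ts" and v': "v' \<in> rctrl s2 n ts"
  shows "{y. deviates ts v i y (v' y)} \<in> sets noise"
proof -
  have "{y \<in> space noise. agree (ts 0) s (v' y) (v y)} \<in> sets noise" for s
    by (rule agree_measurable[OF compact_V rctrl_measurable[OF v'] rctrl_measurable[OF v]])
  then have "{y \<in> space noise. agree (ts 0) (ts (i - 1)) (v' y) (v y)} - {y \<in> space noise. agree (ts 0) (ts i) (v' y) (v y)} \<in> sets noise"
    by (intro sets.Diff)
  moreover have "{y. deviates ts v i y (v' y)} = {y \<in> space noise. agree (ts 0) (ts (i - 1)) (v' y) (v y)} - {y \<in> space noise. agree (ts 0) (ts i) (v' y) (v y)}"
    by (auto simp: deviates_def)
  ultimately show ?thesis by simp
qed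

lemma deviates_index_unique:
  assumes "grid n ts" "i \<in> {1..n}" "j \<in> {1..n}" "deviates ts v i y w" "deviates ts v j y w"
  shows "i = j"
  using deviates_unique[OF assms(1), of i j v y w] deviates_unique[OF assms(1), of j i v y w] assms(2-5)
  by (cases i j rule: linorder_cases) auto

text \<open>The strategy punishes with near-optimal strategies of the remaining games, selected measurably in
  the state. After the last stage nothing remains to be played, and the value is the payoff itself.\<close>

lemma punishing_strategy:
  assumes pf: "payoff_function B K g" and gv: "game_value g T U" and fg: "fgrid T \<delta> t n ts" and t: "0 \<le> t" "t < T"
    and u: "u \<in> rctrl s1 n ts" and v: "v \<in> rctrl s2 n ts" and \<epsilon>: "\<epsilon> > 0"
    and sec: "\<And>i z. i < n ==> norm z \<le> norm x + C * (T - t) + 1 ==>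
      secures (n - i) (subgrid i (ts i) ts) g z (U (ts i) z - \<epsilon>)"
  obtains a where "a \<in> rstrat s1 n ts" "\<And>y w. agree t T w (v y) ==> a y w = u y"
    "\<And>b u' v' i y. b \<in> rstrat s2 n ts ==> u' \<in> rctrl s1 n ts ==> v' \<in> rctrl s2 n ts ==>
      (\<And>y. plays t T (a y) (b y) (u' y) (v' y)) ==> i \<in> {1..n} ==> deviates ts v i y (v' y) ==>
      agree t (ts i) (u' y) (u y) \<and> U (ts i) (traj f t T x (u' y) (v' y) (ts i)) - 2 * \<epsilon>
        \<le> (\<integral>z. g (traj f t T x (u' (comb_seq i y z)) (v' (comb_seq i y z)) T) \<partial>noise)"
proof -
  define S where "S = K * stab T"
  have S: "S \<ge> 0" using pf by (simp add: S_def stab_def payoff_function_def)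
  define R where "R = norm x + C * (T - t)"
  have gr: "grid n ts" and ends: "ts 0 = t" "ts n = T" using fg by (auto simp: fgrid_def)
  have n1: "1 \<le> n" using gr by (simp add: grid_def)
  have tle: "t \<le> ts i" "ts i \<le> T" "0 \<le> ts i" if "i \<le> n" for i
    using grid_mono[OF gr, of 0 i] grid_mono[OF gr, of i n] that ends t by auto
  define guards where "guards i G \<longleftrightarrow> (\<forall>z. G z \<in> rstrat s1 (n - i) (subgrid i (ts i) ts)) \<and>
      (\<lambda>(x, z, w, s). G x z w s) \<in> borel_measurable (borel \<Otimes>\<^sub>M (play_space (ts i) (ts n))) \<and>
      (\<forall>z b. norm z \<le> R --> b \<in> rstrat s2 (n - i) (subgrid i (ts i) ts) -->
         U (ts i) z - 2 * \<epsilon> \<le> rpay (n - i) (subgrid i (ts i) ts) g z (G z) b)" for i G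
  have guards_ex: "\<exists>G. guards i G" if i: "i < n" for i
  proof -
      note ft = fgrid_tail[OF fg i]
      have V: "\<bar>U (ts i) z - U (ts i) z'\<bar> \<le> S * norm (z - z')" for z z'
        using value_lipschitz[OF pf gv tle(3) order_refl tle(2), of i z z'] i by (simp add: S_def)
      have T0: "subgrid i (ts i) ts (n - i) - subgrid i (ts i) ts 0 \<le> T" using i ends tle[of i] by simp
      obtain G where "\<And>z. G z \<in> rstrat s1 (n - i) (subgrid i (ts i) ts)"
        "(\<lambda>(x, z, w, s). G x z w s) \<in> borel_measurable (borel \<Otimes>\<^sub>M (noise \<Otimes>\<^sub>M (ctrl_space (subgrid i (ts i) ts 0) (subgrid i (ts i) ts (n - i)) \<Otimes>\<^sub>M borel)))"
        "\<And>z b. norm z \<le> R ==> b \<in> rstrat s2 (n - i) (subgrid i (ts i) ts) ==>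
           U (ts i) z - 2 * \<epsilon> \<le> rpay (n - i) (subgrid i (ts i) ts) g z (G z) b"
        by (rule measurable_secure_selection[OF pf ft(7) T0 V S sec[OF i, folded R_def] \<epsilon>]) auto
      then have "guards i G" unfolding guards_def using i by (simp only: subgrid_0 subgrid_last) simp
      then show ?thesis by (intro exI[of _ G])
  qed
  define \<Gamma> where "\<Gamma> i = (SOME G. guards i G)" for i
  have "guards i (\<Gamma> i)" if "i < n" for i unfolding \<Gamma>_def using guards_ex[OF that] by (rule someI_ex)
  then have \<Gamma>: "\<And>i z. i < n ==> \<Gamma> i z \<in> rstrat s1 (n - i) (subgrid i (ts i) ts)"
    "\<And>i. i < n ==> (\<lambda>(x, z, w, s). \<Gamma> i x z w s) \<in> borel_measurable (borel \<Otimes>\<^sub>M (play_space (ts i) (ts n)))"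
    "\<And>i z b. i < n ==> norm z \<le> R ==> b \<in> rstrat s2 (n - i) (subgrid i (ts i) ts) ==>
         U (ts i) z - 2 * \<epsilon> \<le> rpay (n - i) (subgrid i (ts i) ts) g z (\<Gamma> i z) b"
    unfolding guards_def by simp_all
  obtain cv :: "(real => 'v) => real => 'v" where cv: "(\<lambda>(w, s). cv w s) \<in> borel_measurable (ctrl_space t T \<Otimes>\<^sub>M borel)"
    "\<And>w. w \<in> ctrls t T ==> AE s in lebesgue. s \<in> {t..T} --> cv w s = w s"
    by (rule canonical_control[OF compact_V]) blast
  have cva: "agree t T (cv w) w" if "w \<in> ctrls t T" for w
    using cv(2)[OF that] unfolding agree_def by eventually_elim auto
  define \<xi> where "\<xi> i y w = traj f (ts 0) (ts n) x (u y) (cv w) (ts i)" for i :: nat and y w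
  define a where "a = punish ts v \<xi> \<Gamma> u (n - 1)"
  have a: "a \<in> rstrat s1 n ts"
    unfolding a_def
  proof (rule punish_rstrat[OF gr u v])
    show "n - 1 < n" using n1 by simp
    show "(\<lambda>(w, s). cv w s) \<in> borel_measurable (ctrl_space (ts 0) (ts n) \<Otimes>\<^sub>M borel)" using cv(1) ends by simp
    show "agree (ts 0) (ts n) (cv w) w" if "w \<in> ctrls (ts 0) (ts n)" for w using cva that ends by simp
    show "\<Gamma> i z \<in> rstrat s1 (n - i) (subgrid i (ts i) ts)" if "1 \<le> i" "i < n" for i z by (rule \<Gamma>(1)[OF that(2)])
    show "(\<lambda>(x, z, w, s). \<Gamma> i x z w s) \<in> borel_measurable (borel \<Otimes>\<^sub>M (play_space (ts i) (ts n)))"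
      if "1 \<le> i" "i < n" for i by (rule \<Gamma>(2)[OF that(2)])
  qed (rule \<xi>_def)
  have follow: "a y w = u y" if "agree t T w (v y)" for y w
    unfolding a_def
  proof (rule punish_no_deviation)
    fix i assume "1 \<le> i" "i \<le> n - 1"
    then have "agree (ts 0) (ts i) w (v y)" using that ends tle[of i] by (auto intro: agree_subset)
    then show "\<not> deviates ts v i y w" by (simp add: deviates_def)
  qed
  show ?thesis
  proof (rule that[OF a follow])
    fix b u' v' i y
    assume b: "b \<in> rstrat s2 n ts" and u': "u' \<in> rctrl s1 n ts" and v': "v' \<in> rctrl s2 n ts"
      and p': "\<And>y. plays t T (a y) (b y) (u' y) (v' y)" and i: "i \<in> {1..n}" and d: "deviates ts v i y (v' y)"
    have p'': "plays (ts 0) (ts n) (a y) (b y) (u' y) (v' y)" for y using p' ends by simp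
    have uc: "u y \<in> ctrls t T" "v y \<in> ctrls t T" "u' y \<in> ctrls t T" "v' y \<in> ctrls t T" for y
      by (auto intro: rctrl_ctrl u v u' v')
    have i1: "1 \<le> i" "i \<le> n" using i by auto
    have uu: "agree t (ts i) (u' y) (u y)" if d: "deviates ts v i y (v' y)" for y
    proof -
      have "a y (v' y) s = u y s" if "s < ts i" for s
      proof (cases "i < n")
        case True
        then show ?thesis unfolding a_def
          using punish_deviation[OF gr i1(1) _ _ d, of "n - 1" \<xi> \<Gamma> u s] that n1 by simp
      next
        case False
        have "a y (v' y) = u y" unfolding a_def
        proof (rule punish_no_deviation)
          fix j assume j: "1 \<le> j" "j \<le> n - 1"
          have "j \<in> {1..n}" "j \<noteq> i" using j i False n1 by auto
          then show "\<not> deviates ts v j y (v' y)" using deviates_index_unique[OF gr i _ d] by auto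
        qed
        then show ?thesis by simp
      qed
      then have "agree t (ts i) (a y (v' y)) (u y)" by (intro agreeI) simp
      moreover have "agree t (ts i) (a y (v' y)) (u' y)"
        using p'[of y] tle(2)[OF i1(2)] unfolding plays_def by (auto intro: agree_subset)
      ultimately show ?thesis using agree_sym agree_trans by blast
    qed
    define X' where "X' = traj f t T x (u' y) (v' y) (ts i)"
    let ?y = "comb_seq i y"
    have inD: "deviates ts v i (?y z) (v' (?y z))" for z
      using d deviates_past[OF gr v v' i1(2), of "?y z" y] by (simp add: comb_seq_past)
    have ucomb: "agree t (ts i) (u' (?y z)) (u y)" for z
    proof -
      have "agree (ts 0) (ts i) (u (?y z)) (u y)"
        by (rule agreeI, rule rctrl_past[OF gr u i1(2)]) (simp_all add: comb_seq_past)
      then show ?thesis using uu[OF inD[of z]] ends by (metis agree_trans)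
    qed
    have Xc: "traj f t T x (u' (?y z)) (v' (?y z)) (ts i) = X'" for z
      using traj_past[OF gr u' v' i1(2), of "?y z" y x] by (simp add: X'_def ends comb_seq_past)
    have "U (ts i) X' - 2 * \<epsilon> \<le> (\<integral>z. g (traj f t T x (u' (?y z)) (v' (?y z)) T) \<partial>noise)"
    proof (cases "i < n")
      case False
      then have "i = n" using i by simp
      then have "(\<integral>z. g (traj f t T x (u' (?y z)) (v' (?y z)) T) \<partial>noise) = g X'" using Xc ends by simp
      moreover have "U (ts i) X' = g X'" using gv \<open>i = n\<close> ends by (simp add: game_value_def)
      ultimately show ?thesis using \<epsilon> by simp
    next
      case True
      note ft = fgrid_tail[OF fg True]
      have \<xi>c: "\<xi> i (?y z) (v' (?y z)) = X'" for z
      proof -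
        have "traj f t T x (u (?y z)) (cv (v' (?y z))) (ts i) = traj f t T x (u' (?y z)) (v' (?y z)) (ts i)"
        proof (rule traj_cong_upto[OF uc(1) borel_in_ctrl[OF borel_section[OF cv(1) uc(4)]] uc(3,4)])
          show "agree t (ts i) (u (?y z)) (u' (?y z))" using uu[OF inD] by (rule agree_sym)
          show "agree t (ts i) (cv (v' (?y z))) (v' (?y z))" by (rule agree_subset[OF cva[OF uc(4)] order_refl tle(2)[OF i1(2)]])
        qed (use tle[OF i1(2)] in auto)
        then show ?thesis using Xc by (simp add: \<xi>_def ends)
      qed
      have "U (ts i) X' - 2 * \<epsilon> \<le> rpay (n - i) (subgrid i (ts i) ts) g X' (\<Gamma> i X') (continuation i (ts i) y (u y) b)"
      proof (rule \<Gamma>(3)[OF True])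
        show "norm X' \<le> R" using traj_radius[OF gr, of "u' y" "v' y" i x] uc i1 ends by (simp add: X'_def R_def)
        show "continuation i (ts i) y (u y) b \<in> rstrat s2 (n - i) (subgrid i (ts i) ts)"
          by (rule continuation_rstrat[OF gr True order_refl ft(6) b rctrl_ctrl[OF u]])
      qed
      also have "\<dots> = (\<integral>z. g (traj f (ts i) (ts n) X' (u' (?y z)) (v' (?y z)) (ts n)) \<partial>noise)"
      proof (rule continuation_payoff[OF gr True order_refl ft(6) b p'' rctrl_ctrl[OF u]])
        show "agree (ts 0) (ts i) (u' (?y z)) (u y)" for z using ucomb ends by simp
        show "\<Gamma> i X' \<in> rstrat s1 (n - i) (subgrid i (ts i) ts)" by (rule \<Gamma>(1)[OF True])
        show "agree (ts i) (ts n) (a (?y z) (v' (?y z))) (\<Gamma> i X' z (v' (?y z)))" for z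
        proof (rule agreeI)
          fix s assume "ts i \<le> s"
          then show "a (?y z) (v' (?y z)) s = \<Gamma> i X' z (v' (?y z)) s"
            unfolding a_def using inD[of z] True n1
            by (subst punish_deviation[OF gr i1(1)]) (simp_all add: \<xi>c comb_seq_shift)
        qed
      qed
      also have "\<dots> = (\<integral>z. g (traj f t T x (u' (?y z)) (v' (?y z)) T) \<partial>noise)"
        using traj_flow[OF uc(3,4) tle(1,2)[OF i1(2)] order_refl, of x "?y z" "?y z" for z] Xc ends by simp
      finally show ?thesis .
    qed
    then show "agree t (ts i) (u' y) (u y) \<and> U (ts i) (traj f t T x (u' y) (v' y) (ts i)) - 2 * \<epsilon>
        \<le> (\<integral>z. g (traj f t T x (u' (?y z)) (v' (?y z)) T) \<partial>noise)" using uu[OF d] by (simp add: X'_def)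
  qed
qed

text \<open>Player I has a strategy that makes the play \<open>(u, v)\<close> stable: it follows \<open>u\<close> as long as the opponent
  follows \<open>v\<close>, and deviations of the opponent cost player I at most \<open>\<epsilon>\<close>.\<close>

definition enforceable :: "nat => (nat => real) => (real^'n => real) => real^'n => real =>
    'u noise_control => 'v noise_control => bool" where
  "enforceable n ts g x \<epsilon> u v \<longleftrightarrow> (\<exists>a\<in>rstrat s1 n ts.
     (\<forall>y. \<forall>w\<in>ctrls (ts 0) (ts n). agree (ts 0) (ts n) w (v y) --> a y w = u y) \<and>
     (\<forall>b\<in>rstrat s2 n ts. (\<integral>y. g (traj f (ts 0) (ts n) x (u y) (v y) (ts n)) \<partial>noise) - \<epsilon> \<le> rpay n ts g x a b))"

text \<open>If along the play \<open>(u, v)\<close> the expected payoff of the \<open>g\<close>-maximizer never exceeds the value, then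
  threatening to hold on to the value after any deviation of the opponent keeps the payoff at least at
  its level without deviation, up to \<open>\<epsilon>\<close>: the punisher loses at most during the stage before the
  deviation is noticed, and on the event \<open>Es\<close> that the condition fails at one of the selected
  times.\<close>

lemma punishment:
  assumes pf: "payoff_function B K g" and gv: "game_value g T U" and t: "0 \<le> t" "t < T" and \<epsilon>: "\<epsilon> > 0"
  obtains \<epsilon>' where "\<epsilon>' > 0"
    "\<forall>\<^sub>F (n, ts) in fine_grids T t. \<forall>u\<in>rctrl s1 n ts. \<forall>v\<in>rctrl s2 n ts.
      (\<forall>j<n. measure noise {y. cpay n ts g x u v j y \<le> U (ts j) (traj f (ts 0) (ts n) x (u y) (v y) (ts j)) + \<epsilon>'} \<ge> 1 - \<epsilon>') -->
      enforceable n ts g x \<epsilon> u v"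
proof -
  define S where "S = K * stab T"
  have K: "K \<ge> 0" and B: "\<And>z. \<bar>g z\<bar> \<le> B" using pf by (auto simp: payoff_function_def)
  have B0: "B \<ge> 0" using B[of 0] by linarith
  have S: "S \<ge> 0" using K by (simp add: S_def stab_def)
  define R where "R = norm x + C * (T - t)"
  obtain \<delta>0 where \<delta>0: "\<delta>0 > 0" "\<And>t x n ts. 0 \<le> t ==> t < T ==> norm x \<le> R + 1 ==> fgrid T \<delta>0 t n ts ==> secures n ts g x (U t x - \<epsilon> / 10)"
    using uniformly_secures[OF pf gv, of "\<epsilon>/10" "R + 1"] \<epsilon> by auto
  have small: "\<exists>d>0. M * d \<le> \<epsilon> / 10" if "M \<ge> 0" for M
  proof (intro exI conjI)
    show "\<epsilon> / 10 / (M + 1) > 0" using \<epsilon> that by simp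
    have "M * (\<epsilon> / 10 / (M + 1)) \<le> (M + 1) * (\<epsilon> / 10 / (M + 1))" using \<epsilon> that by (intro mult_right_mono) auto
    also have "\<dots> = \<epsilon> / 10"
      unfolding times_divide_eq_right[of "M + 1" "\<epsilon> / 10" "M + 1"]
      by (rule nonzero_mult_div_cancel_left) (use that in linarith)
    finally show "M * (\<epsilon> / 10 / (M + 1)) \<le> \<epsilon> / 10" .
  qed
  obtain \<eta> where \<eta>: "\<eta> > 0" "(2 * S * C) * \<eta> \<le> \<epsilon> / 10" using small[of "2 * S * C"] S C_nonneg by auto
  obtain \<delta>1 where \<delta>1: "\<delta>1 > 0" "(4 * S * C) * \<delta>1 \<le> \<epsilon> / 10" using small[of "4 * S * C"] S C_nonneg by auto
  define M where "M = nat \<lceil>T / \<eta>\<rceil>"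
  obtain \<epsilon>' where \<epsilon>': "\<epsilon>' > 0" "(1 + 2 * B * (real M + 1)) * \<epsilon>' \<le> \<epsilon> / 10" using small[of "1 + 2 * B * (real M + 1)"] B0 by auto
  define \<delta> where "\<delta> = min \<delta>0 \<delta>1"
  have \<delta>: "\<delta> > 0" "\<delta> \<le> \<delta>0" using \<delta>0 \<delta>1 by (auto simp: \<delta>_def)
  have "(4 * S * C) * \<delta> \<le> (4 * S * C) * \<delta>1" using S C_nonneg by (intro mult_left_mono) (auto simp: \<delta>_def)
  then have \<delta>S: "(4 * S * C) * \<delta> \<le> \<epsilon> / 10" using \<delta>1(2) by linarith
  \<comment> \<open>The selection of a punishing strategy costs \<open>2 * (\<epsilon> / 10)\<close>, the stage before it starts lets the states drift
    apart by \<open>2 * C * \<delta>\<close>, and the value is compared with that at a selected time, at most \<open>\<eta> + \<delta>\<close> later.\<close>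
  define e1 where "e1 = 2 * (\<epsilon> / 10) + S * (2 * C * \<delta>) + S * (C * (\<eta> + \<delta>)) + S * (C * (\<eta> + \<delta>))"
  have e1: "e1 \<ge> 0" using \<epsilon> S C_nonneg \<eta> \<delta> by (simp add: e1_def)
  have total: "e1 + \<epsilon>' + 2 * B * ((real M + 1) * \<epsilon>') \<le> \<epsilon>"
  proof -
    have "e1 + \<epsilon>' + 2 * B * ((real M + 1) * \<epsilon>') = 2 * (\<epsilon> / 10) + (2 * S * C) * \<eta> + (4 * S * C) * \<delta> + (1 + 2 * B * (real M + 1)) * \<epsilon>'"
      by (simp add: e1_def algebra_simps)
    then show ?thesis using \<eta>(2) \<delta>S \<epsilon>'(2) \<epsilon> by linarith
  qed
  show ?thesis
  proof (rule that[OF \<epsilon>'(1)], unfold eventually_fine_grids, intro exI[of _ \<delta>] conjI \<delta>(1) allI impI ballI)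
    fix n ts u v
    assume fg: "fgrid T \<delta> t n ts" and u: "u \<in> rctrl s1 n ts" and v: "v \<in> rctrl s2 n ts"
      and cond: "\<forall>j<n. measure noise {y. cpay n ts g x u v j y \<le> U (ts j) (traj f (ts 0) (ts n) x (u y) (v y) (ts j)) + \<epsilon>'} \<ge> 1 - \<epsilon>'"
    have gr: "grid n ts" and ends: "ts 0 = t" "ts n = T" using fg by (auto simp: fgrid_def)
    have tle: "t \<le> ts i" "ts i \<le> T" "0 \<le> ts i" if "i \<le> n" for i
      using grid_mono[OF gr, of 0 i] grid_mono[OF gr, of i n] that ends t by auto
    obtain cc where cc: "\<And>q. cc q \<le> n" "\<And>i. i \<le> n ==> \<exists>q\<le>M. i \<le> cc q \<and> ts (cc q) - ts i \<le> \<eta> + \<delta>"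
      unfolding M_def by (rule coarse_times[OF fg t(1) \<eta>(1) \<delta>(1)]) blast
    define X where "X i y = traj f t T x (u y) (v y) (ts i)" for i y
    define H where "H y = g (traj f t T x (u y) (v y) T)" for y
    define E where "E j = {y. U (ts j) (X j y) + \<epsilon>' < cpay n ts g x u v j y}" for j
    have Xm[measurable]: "X j \<in> borel_measurable noise" if "j \<le> n" for j
      unfolding X_def by (rule final_measurable[OF u v]) (use tle[OF that] in simp)
    have Um[measurable]: "U (ts j) \<in> borel_measurable borel" if "j \<le> n" for j by (rule value_measurable[OF pf gv tle(3,2)[OF that]])
    have cm[measurable]: "cpay n ts g x u v j \<in> borel_measurable noise" for j by (rule cpay_measurable(1)[OF pf gr u v])
    have Em: "E j \<in> sets noise" if "j \<le> n" for j
    proof -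
      have "{y \<in> space noise. U (ts j) (X j y) + \<epsilon>' < cpay n ts g x u v j y} \<in> sets noise"
        using Xm[OF that] Um[OF that] by measurable
      then show ?thesis by (simp add: E_def)
    qed
    have Elt: "measure noise (E j) \<le> \<epsilon>'" if "j \<le> n" for j
    proof (cases "j < n")
      case True
      have "{y. cpay n ts g x u v j y \<le> U (ts j) (traj f t T x (u y) (v y) (ts j)) + \<epsilon>'} = space noise - E j"
        by (auto simp: E_def X_def)
      then show ?thesis using cond[rule_format, OF True, unfolded ends] noise_prob.prob_compl[OF Em[OF that]] by simp
    next
      case False
      then have "j = n" using that by simp
      have "cpay n ts g x u v n y = g (X n y)" for y
      proof -
        have "traj f t T x (u (comb_seq n y z)) (v (comb_seq n y z)) T = X n y" for z
          using traj_past[OF gr u v order_refl, of "comb_seq n y z" y x] by (simp add: X_def ends comb_seq_past)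
        then show ?thesis by (simp add: cpay_def ends)
      qed
      moreover have "U (ts n) z = g z" for z using gv ends by (simp add: game_value_def)
      ultimately have "E j = {}" using \<epsilon>'(1) \<open>j = n\<close> by (simp add: E_def)
      then show ?thesis using \<epsilon>'(1) by simp
    qed
    have sec: "secures (n - i) (subgrid i (ts i) ts) g z (U (ts i) z - \<epsilon> / 10)"
      if i: "i < n" and z: "norm z \<le> norm x + C * (T - t) + 1" for i z
      by (rule \<delta>0(2)[OF tle(3) fgrid_tail(5)[OF fg i] _ fgrid_mono[OF fgrid_tail(8)[OF fg i] \<delta>(2)]]) (use i z in "simp_all add: R_def")
    have e10: "\<epsilon> / 10 > 0" using \<epsilon> by simp
    show "enforceable n ts g x \<epsilon> u v"
    proof (rule punishing_strategy[OF pf gv fg t u v e10 sec])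
      fix a assume a: "a \<in> rstrat s1 n ts" and follow: "\<And>y w. agree t T w (v y) ==> a y w = u y"
        and punishes: "\<And>b u' v' i y. b \<in> rstrat s2 n ts ==> u' \<in> rctrl s1 n ts ==> v' \<in> rctrl s2 n ts ==>
        (\<And>y. plays t T (a y) (b y) (u' y) (v' y)) ==> i \<in> {1..n} ==> deviates ts v i y (v' y) ==>
        agree t (ts i) (u' y) (u y) \<and> U (ts i) (traj f t T x (u' y) (v' y) (ts i)) - 2 * (\<epsilon> / 10)
          \<le> (\<integral>z. g (traj f t T x (u' (comb_seq i y z)) (v' (comb_seq i y z)) T) \<partial>noise)"
      have "(\<integral>y. H y \<partial>noise) - \<epsilon> \<le> rpay n ts g x a b" if b: "b \<in> rstrat s2 n ts" for b
      proof -
        obtain u' v' where u': "u' \<in> rctrl s1 n ts" and v': "v' \<in> rctrl s2 n ts"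
          and p'': "\<And>y. plays (ts 0) (ts n) (a y) (b y) (u' y) (v' y)"
          by (rule plays_exists[OF gr a b]) blast
        have p': "plays t T (a y) (b y) (u' y) (v' y)" for y using p'' ends by simp
        define H' where "H' y = g (traj f t T x (u' y) (v' y) T)" for y
        have Hm: "H \<in> borel_measurable noise" unfolding H_def by (rule final_payoff_measurable[OF pf u v]) (use t in simp)
        have Hm': "H' \<in> borel_measurable noise" unfolding H'_def by (rule final_payoff_measurable[OF pf u' v']) (use t in simp)
        have HB: "\<bar>H y\<bar> \<le> B" "\<bar>H' y\<bar> \<le> B" for y by (simp_all add: H_def H'_def B)
        have cpay_H: "cpay n ts g x u v j y = (noise_avg j H y)" for j y
          by (simp add: cpay_def H_def ends)
        have uc: "u y \<in> ctrls t T" "v y \<in> ctrls t T" "u' y \<in> ctrls t T" "v' y \<in> ctrls t T" for y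
          by (auto intro: rctrl_ctrl u v u' v')
        define D where "D i = {y. deviates ts v i y (v' y)}" for i
        have D: "D i \<in> sets noise" for i unfolding D_def by (rule deviates_measurable[OF v v'])
        have Dpast: "y \<in> D i \<longleftrightarrow> y' \<in> D i" if "i \<le> n" "\<And>l. l < i ==> y l = y' l" for y y' i
          unfolding D_def mem_Collect_eq by (rule deviates_past[OF gr v v' that])
        have Dunique: "i = j" if "i \<in> {1..n}" "j \<in> {1..n}" "y \<in> D i" "y \<in> D j" for i j y
          by (rule deviates_index_unique[OF gr that(1,2)]) (use that(3,4) in "simp_all add: D_def")
        have pun: "agree t (ts i) (u' y) (u y)" "U (ts i) (traj f t T x (u' y) (v' y) (ts i)) - 2 * (\<epsilon> / 10) \<le> (noise_avg i H' y)"
          if "i \<in> {1..n}" "y \<in> D i" for i y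
          using punishes[OF b u' v' p' that(1), of y] that(2) by (simp_all add: D_def H'_def)
        have nodev: "H' y = H y" if "\<not> (\<exists>i\<in>{1..n}. y \<in> D i)" for y
        proof -
          have "agree (ts 0) (ts n) (v' y) (v y)"
            by (rule first_index_cong[of n "\<lambda>i. agree (ts 0) (ts i) (v' y) (v y)" n])
              (use that in \<open>auto simp: D_def deviates_def agree_def[of "ts 0" "ts 0"]\<close>)
          then have va: "agree t T (v' y) (v y)" using ends by simp
          have "agree t T (u y) (u' y)" using p'[of y] follow[OF va] by (simp add: plays_def)
          then show ?thesis unfolding H_def H'_def
            using traj_cong[OF uc(3,4,1,2)[of y] _ va, of T x] t by (simp add: agree_sym)
        qed
        define Es where "Es = (\<Union>q\<le>M. E (cc q))"
        have Esm: "Es \<in> sets noise" unfolding Es_def using Em cc(1) by (intro sets.finite_UN) auto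
        have Es: "measure noise Es \<le> (real M + 1) * \<epsilon>'"
        proof -
          have "measure noise Es \<le> (\<Sum>q\<le>M. measure noise (E (cc q)))"
            unfolding Es_def using Em cc(1) by (intro noise_prob.finite_measure_subadditive_finite) auto
          also have "\<dots> \<le> (\<Sum>q\<le>M. \<epsilon>')" by (rule sum_mono) (rule Elt[OF cc(1)])
          also have "\<dots> = (real M + 1) * \<epsilon>'" by simp
          finally show ?thesis .
        qed
        have "\<exists>c\<ge>i. \<forall>y\<in>D i - Es. (noise_avg c H y) - (e1 + \<epsilon>') \<le> (noise_avg i H' y)"
          if i: "i \<in> {1..n}" for i
        proof -
          have i1: "1 \<le> i" "i \<le> n" using i by auto
          obtain q where q: "q \<le> M" "i \<le> cc q" "ts (cc q) - ts i \<le> \<eta> + \<delta>" using cc(2)[OF i1(2)] by blast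
          define c where "c = cc q"
          have c: "i \<le> c" "c \<le> n" "ts c - ts i \<le> \<eta> + \<delta>" "ts i \<le> ts c" using q cc(1) grid_mono[OF gr, of i c] by (auto simp: c_def)
          have "(noise_avg c H y) - (e1 + \<epsilon>') \<le> (noise_avg i H' y)" if y: "y \<in> D i" "y \<notin> Es" for y
          proof -
            define X' where "X' = traj f t T x (u' y) (v' y) (ts i)"
            have loss: "norm (X' - X i y) \<le> 2 * C * \<delta>"
              unfolding X_def X'_def by (rule punishment_loss[OF pf fg t u v u' v' i1 _ pun(1)[OF i y(1)]]) (use y(1) in "simp add: D_def")
            have "\<bar>U (ts i) X' - U (ts c) (X c y)\<bar> \<le> S * (norm (X' - X c y) + C * (ts c - ts i))"
              unfolding S_def by (rule value_lipschitz[OF pf gv tle(3)[OF i1(2)] c(4) tle(2)[OF c(2)]])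
            also have "\<dots> \<le> S * ((2 * C * \<delta> + C * (\<eta> + \<delta>)) + C * (\<eta> + \<delta>))"
            proof (rule mult_left_mono[OF add_mono S])
              have Cle: "C * (ts c - ts i) \<le> C * (\<eta> + \<delta>)" using c(3) C_nonneg by (rule mult_left_mono)
              then show "C * (ts c - ts i) \<le> C * (\<eta> + \<delta>)" .
              have "norm (X c y - X i y) \<le> C * (\<eta> + \<delta>)"
                using traj_speed[OF uc(1,2) tle(1)[OF i1(2)] c(4) tle(2)[OF c(2)], of x y y] Cle by (simp add: X_def)
              moreover have "norm (X' - X i y) \<le> 2 * C * \<delta>" by (rule loss)
              moreover have "X' - X c y = (X' - X i y) - (X c y - X i y)" by simp
              ultimately show "norm (X' - X c y) \<le> 2 * C * \<delta> + C * (\<eta> + \<delta>)"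
                using norm_triangle_ineq4[of "X' - X i y" "X c y - X i y"] by simp
            qed
            also have "\<dots> = e1 - 2 * (\<epsilon> / 10)" by (simp add: e1_def algebra_simps)
            finally have "U (ts c) (X c y) - e1 \<le> (noise_avg i H' y)" using pun(2)[OF i y(1)] unfolding X'_def by linarith
            moreover have "cpay n ts g x u v c y \<le> U (ts c) (X c y) + \<epsilon>'" using y(2) q(1) by (auto simp: Es_def E_def c_def not_less)
            ultimately show ?thesis unfolding cpay_H by linarith
          qed
          then show ?thesis using c(1) by blast
        qed
        then have "(\<integral>y. H y \<partial>noise) - (e1 + \<epsilon>') - 2 * B * measure noise Es \<le> (\<integral>y. H' y \<partial>noise)"
          using e1 \<epsilon>'(1) by (intro deviation_loss[OF Hm HB(1) Hm' HB(2) D Dpast Dunique nodev Esm]) auto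
        moreover have "(\<integral>y. H' y \<partial>noise) = rpay n ts g x a b" using rpay_eq[OF gr a b p'', of g x] ends by (simp add: H'_def)
        moreover have "2 * B * measure noise Es \<le> 2 * B * ((real M + 1) * \<epsilon>')" using Es B0 by (intro mult_left_mono) auto
        ultimately show ?thesis using total by linarith
      qed
      then show "enforceable n ts g x \<epsilon> u v"
        using a follow unfolding enforceable_def H_def ends by (intro bexI[of _ a]) auto
    qed
  qed
qed

end

section \<open>Normal quantiles\<close>

abbreviation std_normal :: "real measure" where
  "std_normal \<equiv> density lborel (\<lambda>x. ennreal (std_normal_density x))"

lemma real_distribution_std_normal: "real_distribution std_normal"
  by (intro real_distribution.intro real_distribution_axioms.intro prob_space_normal_density) simp_all

lemma Phi01_strict_mono: "x < y ==> Phi01 x < Phi01 y"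
proof -
  assume xy: "x < y"
  interpret G: real_distribution std_normal by (rule real_distribution_std_normal)
  have "{x<..y} \<notin> null_sets std_normal"
  proof
    assume "{x<..y} \<in> null_sets std_normal"
    then have "AE z in lborel. z \<in> {x<..y} --> ennreal (std_normal_density z) = 0"
      by (subst (asm) null_sets_density_iff) auto
    then have "AE z in lborel. z \<notin> {x<..y}"
      by eventually_elim (use normal_density_pos[of 1 0] in "force simp: less_le")
    then have "{x<..y} \<in> null_sets lborel" by (simp add: AE_iff_null_sets)
    then show False using xy by (simp add: null_sets_def)
  qed
  then have "measure std_normal {x<..y} \<noteq> 0" by (simp add: null_sets_def G.emeasure_eq_measure)
  then have "measure std_normal {x<..y} > 0" by (simp add: zero_less_measure_iff)
  then show ?thesis using G.cdf_diff_eq[OF xy] by (simp add: Phi01_def)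
qed

text \<open>A continuous distribution function transforms its law into the uniform one. The two distribution
  functions are compared pointwise: an interior level \<open>c\<close> is attained at some \<open>z\<close>, and by strict
  monotonicity the values up to \<open>c\<close> are those of the arguments up to \<open>z\<close>.\<close>

lemma Phi01_uniform: "distr std_normal borel Phi01 = uniform_measure lborel {0..1}"
proof -
  interpret G: real_distribution std_normal by (rule real_distribution_std_normal)
  have Phim: "Phi01 \<in> borel_measurable borel"
    by (rule borel_measurable_mono) (use G.cdf_nondecreasing in "auto simp: mono_def Phi01_def")
  have cont: "isCont Phi01 x" for x
  proof -
    have "AE z in lborel. z \<in> {x} --> ennreal (std_normal_density z) = 0"
      using AE_lborel_singleton[of x] by eventually_elim simp
    then have "{x} \<in> null_sets std_normal"
      by (subst null_sets_density_iff) auto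
    then have "measure std_normal {x} = 0" by (simp add: null_sets_def measure_def)
    then show ?thesis unfolding Phi01_def by (simp add: G.isCont_cdf)
  qed
  have pos: "Phi01 x > 0" for x
    using Phi01_strict_mono[of "x - 1" x] G.cdf_nonneg[of "x - 1"] by (simp add: Phi01_def)
  have lt1: "Phi01 x < 1" for x
    using Phi01_strict_mono[of x "x + 1"] G.cdf_bounded_prob[of "x + 1"] by (simp add: Phi01_def)
  have D: "real_distribution (distr std_normal borel Phi01)"
    by (intro real_distribution.intro real_distribution_axioms.intro G.prob_space_distr) (use Phim in auto)
  have U: "real_distribution (uniform_measure lborel {0..1::real})"
    by (intro real_distribution.intro real_distribution_axioms.intro prob_unif) auto
  have "cdf (distr std_normal borel Phi01) c = cdf (uniform_measure lborel {0..1}) c" for c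
  proof -
    have L: "cdf (distr std_normal borel Phi01) c = measure std_normal {x. Phi01 x \<le> c}"
      unfolding cdf_def by (subst measure_distr) (use Phim in "auto simp: vimage_def")
    have R: "cdf (uniform_measure lborel {0..1}) c = measure lborel ({0..1} \<inter> {..c})"
      unfolding cdf_def by (subst measure_uniform_measure) auto
    consider "c \<le> 0" | "0 < c" "c < 1" | "1 \<le> c" by linarith
    then show ?thesis
    proof cases
      case 1
      have "{x. Phi01 x \<le> c} = {}" using pos 1 by (auto simp: not_le intro: le_less_trans)
      moreover have "measure lborel ({0..1} \<inter> {..c}) = 0"
      proof -
        have "{0..1} \<inter> {..c} = {} \<or> {0..1} \<inter> {..c} = {0}" using 1 by auto
        then show ?thesis by auto
      qed
      ultimately show ?thesis unfolding L R by simp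
    next
      case 2
      have "eventually (\<lambda>x. Phi01 x < c) at_bot"
        using order_tendstoD(2)[OF G.cdf_lim_at_bot 2(1)] by (simp add: Phi01_def)
      then obtain a where a: "Phi01 a < c" using eventually_happens'[OF trivial_limit_at_bot_linorder] by blast
      have "eventually (\<lambda>x. c < Phi01 x) at_top"
        using order_tendstoD(1)[OF G.cdf_lim_at_top_prob 2(2)] by (simp add: Phi01_def)
      then obtain b where b: "c < Phi01 b" using eventually_happens'[OF trivial_limit_at_top_linorder] by blast
      have ab: "a \<le> b" using Phi01_strict_mono[of b a] a b by (cases "a \<le> b") auto
      obtain z where z: "Phi01 z = c" using IVT[of Phi01 a c b] a b ab cont by auto
      have "Phi01 x \<le> c \<longleftrightarrow> x \<le> z" for x
        using Phi01_strict_mono[of x z] Phi01_strict_mono[of z x] z by (cases x z rule: linorder_cases) auto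
      then have "measure std_normal {x. Phi01 x \<le> c} = c" using z by (simp add: Phi01_def cdf_def atMost_def)
      moreover have "{0..1} \<inter> {..c} = {0..c}" using 2 by auto
      ultimately show ?thesis unfolding L R using 2 by simp
    next
      case 3
      have "{x. Phi01 x \<le> c} = UNIV" using lt1 3 by (auto intro: order_trans less_imp_le)
      moreover have "{0..1} \<inter> {..c} = {0..1}" using 3 by auto
      ultimately show ?thesis unfolding L R using G.prob_space by simp
    qed
  qed
  then have "cdf (distr std_normal borel Phi01) = cdf (uniform_measure lborel {0..1})" by (rule ext)
  from cdf_unique[OF D U this] show ?thesis .
qed

lemma Phi01_measurable [measurable]: "Phi01 \<in> borel_measurable borel"
proof -
  interpret G: real_distribution std_normal by (rule real_distribution_std_normal)
  show ?thesis by (rule borel_measurable_mono) (use G.cdf_nondecreasing in "auto simp: mono_def Phi01_def")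
qed

lemma Phi01_normal:
  assumes "\<sigma> > 0"
  shows "distr (density lborel (\<lambda>x. ennreal (normal_density 0 \<sigma> x))) borel (\<lambda>x. Phi01 (x / \<sigma>)) = uniform_measure lborel {0..1}"
proof -
  let ?N = "density lborel (\<lambda>x. ennreal (normal_density 0 \<sigma> x))"
  interpret N: prob_space ?N by (rule prob_space_normal_density[OF assms])
  have "distributed ?N lborel (\<lambda>x. x) (\<lambda>x. ennreal (normal_density 0 \<sigma> x))"
    unfolding distributed_def by (auto simp: distr_id2)
  then have "distributed ?N lborel (\<lambda>x. (x - 0) / \<sigma>) (\<lambda>x. ennreal (std_normal_density x))"
    using N.normal_standard_normal_convert[OF assms, of "\<lambda>x. x" 0] by simp
  then have 1: "distr ?N lborel (\<lambda>x. x / \<sigma>) = std_normal" by (simp add: distributed_def)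
  have "distr ?N borel (\<lambda>x. Phi01 (x / \<sigma>)) = distr (distr ?N lborel (\<lambda>x. x / \<sigma>)) borel Phi01"
    by (subst distr_distr) (auto simp: comp_def)
  then show ?thesis unfolding 1 Phi01_uniform .
qed

text \<open>The two components are independent because the density is a product, so their quantiles are
  independent, too.\<close>

lemma Phi01_pair_law:
  assumes "\<sigma> > 0" and X: "distributed M lborel X (\<lambda>(a, b). ennreal (normal_density 0 \<sigma> a * normal_density 0 \<sigma> b))"
    and A: "A \<in> sets borel"
  shows "emeasure M {w \<in> space M. (Phi01 (fst (X w) / \<sigma>), Phi01 (snd (X w) / \<sigma>)) \<in> A} = emeasure unif2 A"
proof -
  let ?N = "density lborel (\<lambda>x. ennreal (normal_density 0 \<sigma> x))"
  let ?\<phi> = "\<lambda>x. Phi01 (x / \<sigma>)"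
  interpret N: prob_space ?N by (rule prob_space_normal_density[OF assms(1)])
  have sN: "sigma_finite_measure ?N" by unfold_locales
  have Xm: "X \<in> measurable M borel" using distributed_measurable[OF X] by simp
  have "distr M lborel X = density lborel (\<lambda>(a, b). ennreal (normal_density 0 \<sigma> a * normal_density 0 \<sigma> b))"
    by (rule distributed_distr_eq_density[OF X])
  also have "\<dots> = density (lborel \<Otimes>\<^sub>M lborel) (\<lambda>(a, b). ennreal (normal_density 0 \<sigma> a) * ennreal (normal_density 0 \<sigma> b))"
    by (simp add: lborel_prod ennreal_mult' case_prod_beta')
  also have "\<dots> = ?N \<Otimes>\<^sub>M ?N"
    by (subst pair_measure_density[OF _ _ _ sN]) (auto intro: lborel.sigma_finite_measure_axioms)
  finally have dX: "distr M lborel X = ?N \<Otimes>\<^sub>M ?N" .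
  have u: "unif2 = distr (?N \<Otimes>\<^sub>M ?N) (borel \<Otimes>\<^sub>M borel) (\<lambda>(a, b). (?\<phi> a, ?\<phi> b))"
    unfolding unif2_def Phi01_normal[OF assms(1), symmetric]
    by (rule pair_measure_distr) (auto simp: Phi01_normal[OF assms(1)] intro!: prob_space_imp_sigma_finite prob_unif)
  have Am: "A \<in> sets (borel \<Otimes>\<^sub>M borel)" using A by (simp only: borel_prod)
  have fm: "(\<lambda>(a, b). (?\<phi> a, ?\<phi> b)) \<in> measurable (?N \<Otimes>\<^sub>M ?N) (borel \<Otimes>\<^sub>M borel)" by measurable
  have fm': "(\<lambda>(a, b). (?\<phi> a, ?\<phi> b)) \<in> measurable borel (borel \<Otimes>\<^sub>M borel)"
    unfolding borel_prod[symmetric] by measurable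
  have "emeasure unif2 A = emeasure (distr M lborel X) ((\<lambda>(a, b). (?\<phi> a, ?\<phi> b)) -` A \<inter> space (?N \<Otimes>\<^sub>M ?N))"
    unfolding u dX by (rule emeasure_distr[OF fm Am])
  also have "space (?N \<Otimes>\<^sub>M ?N) = UNIV" by (simp add: space_pair_measure)
  also have "emeasure (distr M lborel X) ((\<lambda>(a, b). (?\<phi> a, ?\<phi> b)) -` A \<inter> UNIV)
      = emeasure M (X -` ((\<lambda>(a, b). (?\<phi> a, ?\<phi> b)) -` A \<inter> UNIV) \<inter> space M)"
    using Xm measurable_sets[OF fm' Am] by (intro emeasure_distr) auto
  also have "X -` ((\<lambda>(a, b). (?\<phi> a, ?\<phi> b)) -` A \<inter> UNIV) \<inter> space M = {w \<in> space M. (?\<phi> (fst (X w)), ?\<phi> (snd (X w))) \<in> A}"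
    by (auto simp: case_prod_beta')
  finally show ?thesis by simp
qed

section \<open>Brownian increments as noise\<close>

text \<open>The noise of a stage is the pair of quantiles of the two components of a Brownian increment.\<close>

definition quantile_pair :: "(nat => real) => nat => real \<times> real => real \<times> real" where
  "quantile_pair p j x = (Phi01 (fst x / sqrt (p j - p (j - 1))), Phi01 (snd x / sqrt (p j - p (j - 1))))"

lemma quantile_pair_measurable [measurable]: "quantile_pair p j \<in> borel_measurable borel"
proof -
  have "(\<lambda>x :: real \<times> real. (Phi01 (fst x / sqrt (p j - p (j - 1))), Phi01 (snd x / sqrt (p j - p (j - 1))))) \<in> borel_measurable borel"
    by (intro borel_measurable_Pair measurable_compose[OF _ Phi01_measurable] borel_measurable_divide)
      (auto intro!: borel_measurable_continuous_onI continuous_intros)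
  then show ?thesis by (simp add: quantile_pair_def[abs_def])
qed

lemma zeta_quantile: "1 \<le> j ==> zeta p j \<omega> = quantile_pair p j (fst \<omega> (p j) - fst \<omega> (p (j - 1)))"
  by (simp add: zeta_def quantile_pair_def BM_def)

lemma partition_strict:
  assumes "time_partition T N p" "i < j" "j \<le> N" shows "p i < p j"
proof -
  have "strict_mono_on {..N} p" using assms(1) by (simp add: time_partition_def)
  from strict_mono_onD[OF this _ _ assms(2)] show ?thesis using assms(2,3) by simp
qed

lemma partition_mono: "time_partition T N p ==> i \<le> j ==> j \<le> N ==> p i \<le> p j"
  using partition_strict[of T N p i j] by (cases "i = j") auto

lemma partition_range: "time_partition T N p ==> j \<le> N ==> p j \<in> {0..T}"
  using partition_mono[of T N p 0 j] partition_mono[of T N p j N] by (simp add: time_partition_def)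

lemma sets_Collect_in: "h \<in> measurable M M' ==> A \<in> sets M' ==> {x \<in> space M. h x \<in> A} \<in> sets M"
  using measurable_sets[of h M M' A] by (simp add: vimage_def Int_def conj_commute)

locale wiener =
  fixes T :: real and W :: "(real => real \<times> real) measure"
  assumes wiener: "wiener_measure T W" and T_pos: "T > 0"
begin

sublocale W: prob_space W using wiener by (simp add: wiener_measure_def)

lemma space_W: "space W = paths T" using wiener by (simp add: wiener_measure_def)

lemma coordinate_measurable [measurable]:
  assumes "r \<in> {0..T}"
  shows "(\<lambda>w. w r) \<in> borel_measurable W"
proof -
  have "sets W = sets (restrict_space (Pi\<^sub>M {0..T} (\<lambda>_. borel)) (paths T))"
    using wiener by (simp add: wiener_measure_def)
  moreover have "(\<lambda>w. w r) \<in> borel_measurable (restrict_space (Pi\<^sub>M {0..T} (\<lambda>_. borel :: (real \<times> real) measure)) (paths T))"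
    by (intro measurable_restrict_space1 measurable_component_singleton assms)
  ultimately show ?thesis by (simp cong: measurable_cong_sets)
qed

lemma start_0: "AE w in W. w 0 = 0" using wiener by (simp add: wiener_measure_def)

lemma increment_law:
  "0 \<le> s ==> s < r ==> r \<le> T ==> distributed W lborel (\<lambda>w. w r - w s)
     (\<lambda>(a, b). ennreal (normal_density 0 (sqrt (r - s)) a * normal_density 0 (sqrt (r - s)) b))"
  using wiener by (simp add: wiener_measure_def)

lemma increments_indep:
  "mono_on {..n} ts ==> ts ` {..n} \<subseteq> {0..T} ==> W.indep_vars (\<lambda>_. borel) (\<lambda>j w. w (ts (Suc j)) - w (ts j)) {..<n}"
  using wiener by (simp add: wiener_measure_def)

lemma quantile_law:
  assumes tp: "time_partition T N p" and j: "1 \<le> j" "j \<le> N" and A: "A \<in> sets borel"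
  shows "measure W {w \<in> space W. quantile_pair p j (w (p j) - w (p (j - 1))) \<in> A} = measure unif2 A"
proof -
  have lt: "p (j - 1) < p j" using j by (intro partition_strict[OF tp]) auto
  have r: "0 \<le> p (j - 1)" "p j \<le> T" using partition_range[OF tp, of "j - 1"] partition_range[OF tp, of j] j by auto
  have "emeasure W {w \<in> space W. quantile_pair p j (w (p j) - w (p (j - 1))) \<in> A} = emeasure unif2 A"
    unfolding quantile_pair_def using lt
    by (intro Phi01_pair_law[OF _ increment_law[OF r(1) lt r(2)] A]) simp
  then show ?thesis by (simp add: measure_def)
qed

lemma quantiles_independent:
  assumes tp: "time_partition T N p" and m: "1 \<le> m" "m \<le> N" and A: "\<And>j. j \<in> {m..<N} ==> A j \<in> sets borel"
  shows "measure W {w \<in> space W. \<forall>j\<in>{m..<N}. quantile_pair p j (w (p j) - w (p (j - 1))) \<in> A j}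
    = (\<Prod>j\<in>{m..<N}. measure unif2 (A j))"
proof (cases "m = N")
  case True then show ?thesis by (simp add: W.prob_space)
next
  case False
  obtain m' N' where MN: "m = Suc m'" "N = Suc N'" using m by (cases m; cases N) auto
  have all_Suc: "(\<forall>j\<in>{m..<N}. R j) \<longleftrightarrow> (\<forall>j\<in>{m'..<N'}. R (Suc j))" for R
    unfolding MN image_Suc_atLeastLessThan[symmetric] by blast
  let ?X = "\<lambda>j w. w (p (Suc j)) - w (p j)" and ?A = "\<lambda>j. quantile_pair p (Suc j) -` A (Suc j)"
  have "mono_on {..N} p" using partition_mono[OF tp] by (auto intro!: mono_onI)
  moreover have "p ` {..N} \<subseteq> {0..T}" using partition_range[OF tp] by blast
  ultimately have ind: "W.indep_vars (\<lambda>_. borel) ?X {..<N}" by (rule increments_indep)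
  have "?A j \<in> sets borel" if "j \<in> {m'..<N'}" for j
    using measurable_sets[OF quantile_pair_measurable[of p "Suc j"] A[of "Suc j"]] that MN by simp
  then have "measure W (\<Inter>j\<in>{m'..<N'}. ?X j -` ?A j \<inter> space W) = (\<Prod>j\<in>{m'..<N'}. measure W (?X j -` ?A j \<inter> space W))"
    using False m MN by (intro W.indep_varsD[OF ind]) auto
  also have "\<dots> = (\<Prod>j\<in>{m'..<N'}. measure unif2 (A (Suc j)))"
  proof (rule prod.cong[OF refl])
    fix j assume j: "j \<in> {m'..<N'}"
    have "?X j -` ?A j \<inter> space W = {w \<in> space W. quantile_pair p (Suc j) (w (p (Suc j)) - w (p (Suc j - 1))) \<in> A (Suc j)}" by auto
    then show "measure W (?X j -` ?A j \<inter> space W) = measure unif2 (A (Suc j))"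
      using quantile_law[OF tp _ _ A, of "Suc j"] j MN by simp
  qed
  also have "(\<Inter>j\<in>{m'..<N'}. ?X j -` ?A j \<inter> space W)
    = {w \<in> space W. \<forall>j\<in>{m..<N}. quantile_pair p j (w (p j) - w (p (j - 1))) \<in> A j}"
    unfolding all_Suc using False m MN by auto
  finally show ?thesis unfolding MN by (simp only: prod.shift_bounds_Suc_ivl)
qed

text \<open>The wanted independence concerns a path at the finitely many times of \<open>F\<close> on the one hand and the
  later increments along the partition on the other. Both are functions of increments along one increasing
  sequence of times: that of \<open>F\<close>, preceded by \<open>0\<close> and continued by the partition. The values on \<open>F\<close> are
  partial sums of the increments, because paths start in \<open>0\<close>.\<close>

lemma past_future_W:
  assumes tp: "time_partition T N p" and m: "1 \<le> m" "m \<le> N"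
    and F: "finite F" "F \<subseteq> {0..p (m - 1)}" and Cb: "\<And>r. r \<in> F ==> C r \<in> sets borel"
    and A: "\<And>j. j \<in> {m..<N} ==> A j \<in> sets borel"
  shows "{w \<in> space W. \<forall>r\<in>F. w r \<in> C r} \<in> sets W"
    "{w \<in> space W. \<forall>j\<in>{m..<N}. quantile_pair p j (w (p j) - w (p (j - 1))) \<in> A j} \<in> sets W"
    "measure W ({w \<in> space W. \<forall>r\<in>F. w r \<in> C r} \<inter> {w \<in> space W. \<forall>j\<in>{m..<N}. quantile_pair p j (w (p j) - w (p (j - 1))) \<in> A j})
      = measure W {w \<in> space W. \<forall>r\<in>F. w r \<in> C r} * (\<Prod>j\<in>{m..<N}. measure unif2 (A j))"
proof -
  let ?past = "{w \<in> space W. \<forall>r\<in>F. w r \<in> C r}"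
  let ?fut = "{w \<in> space W. \<forall>j\<in>{m..<N}. quantile_pair p j (w (p j) - w (p (j - 1))) \<in> A j}"
  have pm: "p (m - 1) \<in> {0..T}" using partition_range[OF tp, of "m - 1"] m by simp
  show past: "?past \<in> sets W"
    using F pm by (intro sets.sets_Collect_finite_All sets_Collect_in[OF coordinate_measurable Cb]) auto
  define L where "L = sorted_list_of_set (insert 0 F)"
  define q where "q = length L"
  have L: "sorted L" "set L = insert 0 F" unfolding L_def
    by (rule sorted_sorted_list_of_set, rule set_sorted_list_of_set) (use F(1) in simp)
  have Lr: "0 \<le> L ! i" "L ! i \<le> p (m - 1)" if "i < q" for i
    using nth_mem[of i L] that L(2) F(2) pm by (auto simp: q_def)
  have q1: "1 \<le> q" using L(2) by (cases L) (auto simp: q_def)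
  have L0: "L ! 0 = 0"
  proof -
    obtain i where i: "i < q" "L ! i = 0" using L(2) by (metis in_set_conv_nth insertI1 q_def)
    have "L ! 0 \<le> L ! i" using sorted_nth_mono[OF L(1), of 0 i] i by (simp add: q_def)
    then show ?thesis using Lr(1)[of 0] i q1 by auto
  qed
  define ts where "ts i = (if i < q then L ! i else p (m - 1 + (i - q)))" for i
  define n where "n = q + (N - m)"
  have mono: "mono_on {..n} ts"
  proof (rule mono_onI)
    fix i j assume ij: "i \<in> {..n}" "j \<in> {..n}" "i \<le> j"
    consider "j < q" | "i < q" "q \<le> j" | "q \<le> i" using ij by linarith
    then show "ts i \<le> ts j"
    proof cases
      case 1 then show ?thesis using ij sorted_nth_mono[OF L(1)] by (simp add: ts_def q_def)
    next
      case 2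
      have "p (m - 1) \<le> p (m - 1 + (j - q))" using ij 2 m by (intro partition_mono[OF tp]) (auto simp: n_def)
      then show ?thesis using Lr(2)[of i] 2 by (simp add: ts_def)
    next
      case 3
      then show ?thesis using ij m unfolding ts_def n_def by (auto intro!: partition_mono[OF tp])
    qed
  qed
  have range: "ts i \<in> {0..T}" if "i \<le> n" for i
    using Lr[of i] partition_range[OF tp, of "m - 1 + (i - q)"] that m pm by (auto simp: ts_def n_def)
  define X where "X i w = w (ts (Suc i)) - w (ts i)" for i and w :: "real => real \<times> real"
  have ind: "W.indep_vars (\<lambda>_. borel) X {..<n}"
    unfolding X_def[abs_def] by (rule increments_indep[OF mono]) (use range in auto)
  have Xm: "X i \<in> borel_measurable W" if "i < n" for i
    unfolding X_def using that by (intro borel_measurable_diff coordinate_measurable range) auto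
  \<comment> \<open>The increment number \<open>q - 1\<close>, which leads from \<open>F\<close> to the partition, belongs to neither block.\<close>
  define I where "I = {..<q - 1}"
  define J where "J = {q..<n}"
  have IJ: "W.indep_var (PiM I (\<lambda>_. borel)) (\<lambda>w. restrict (\<lambda>i. X i w) I) (PiM J (\<lambda>_. borel)) (\<lambda>w. restrict (\<lambda>i. X i w) J)"
    by (rule W.indep_var_restrict[OF ind]) (auto simp: I_def J_def n_def)
  define C' where "C' r = (if r \<in> F then C r else UNIV)" for r
  have C'b: "C' r \<in> sets borel" for r using Cb by (simp add: C'_def)
  define SI where "SI = {x \<in> space (PiM I (\<lambda>_. borel :: (real \<times> real) measure)). \<forall>i\<in>{..<q}. (\<Sum>l<i. x l) \<in> C' (L ! i)}"
  define SJ where "SJ = {x \<in> space (PiM J (\<lambda>_. borel :: (real \<times> real) measure)). \<forall>j\<in>{m..<N}. quantile_pair p j (x (q + (j - m))) \<in> A j}"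
  have SI: "SI \<in> sets (PiM I (\<lambda>_. borel))"
    unfolding SI_def
    by (intro sets.sets_Collect_finite_All sets_Collect_in[OF _ C'b] borel_measurable_sum measurable_component_singleton) (auto simp: I_def)
  have SJ: "SJ \<in> sets (PiM J (\<lambda>_. borel))"
    unfolding SJ_def
    by (intro sets.sets_Collect_finite_All sets_Collect_in[OF _ A] measurable_compose[OF _ quantile_pair_measurable] measurable_component_singleton)
      (use m in "auto simp: J_def n_def")
  let ?E = "(\<lambda>w. restrict (\<lambda>i. X i w) I) -` SI \<inter> space W"
  let ?Z = "(\<lambda>w. restrict (\<lambda>i. X i w) J) -` SJ \<inter> space W"
  have Z: "?Z = ?fut"
  proof -
    have "X (q + (j - m)) w = w (p j) - w (p (j - 1))" if "j \<in> {m..<N}" for j w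
      using that m by (auto simp: X_def ts_def Suc_diff_le)
    moreover have "q + (j - m) \<in> J" if "j \<in> {m..<N}" for j using that m by (auto simp: J_def n_def)
    ultimately show ?thesis by (auto simp: SJ_def space_PiM)
  qed
  have E_iff: "w \<in> ?E \<longleftrightarrow> w \<in> ?past" if w0: "w 0 = 0" and w: "w \<in> space W" for w
  proof -
    have "(\<Sum>l<i. restrict (\<lambda>i. X i w) I l) = w (L ! i)" if i: "i < q" for i
    proof -
      have "(\<Sum>l<i. restrict (\<lambda>i. X i w) I l) = (\<Sum>l<i. w (ts (Suc l)) - w (ts l))"
        using i by (intro sum.cong) (auto simp: I_def X_def)
      also have "\<dots> = w (ts i) - w (ts 0)" by (rule sum_lessThan_telescope)
      finally show ?thesis using i q1 L0 w0 by (simp add: ts_def)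
    qed
    then have "w \<in> ?E \<longleftrightarrow> (\<forall>i<q. w (L ! i) \<in> C' (L ! i))" using w by (auto simp: SI_def space_PiM)
    also have "\<dots> \<longleftrightarrow> (\<forall>r\<in>set L. w r \<in> C' r)" by (simp add: all_set_conv_all_nth q_def)
    also have "\<dots> \<longleftrightarrow> (\<forall>r\<in>F. w r \<in> C r)" using L(2) by (auto simp: C'_def)
    finally show ?thesis using w by simp
  qed
  have Im: "(\<lambda>w. restrict (\<lambda>i. X i w) I) \<in> measurable W (PiM I (\<lambda>_. borel))"
    and Jm: "(\<lambda>w. restrict (\<lambda>i. X i w) J) \<in> measurable W (PiM J (\<lambda>_. borel))"
    by (intro measurable_restrict Xm, auto simp: I_def J_def n_def)+
  have E: "?E \<in> sets W" by (rule measurable_sets[OF Im SI])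
  show fut: "?fut \<in> sets W" unfolding Z[symmetric] by (rule measurable_sets[OF Jm SJ])
  have eq: "measure W (?past \<inter> S) = measure W (?E \<inter> S)" if S: "S \<in> sets W" for S
  proof (rule W.finite_measure_eq_AE)
    show "AE w in W. w \<in> ?past \<inter> S \<longleftrightarrow> w \<in> ?E \<inter> S"
      using start_0 AE_space
    proof eventually_elim
      case (elim w)
      from E_iff[OF elim] show ?case by (simp only: Int_iff)
    qed
  qed (use past E S in auto)
  have "(\<lambda>w. (restrict (\<lambda>i. X i w) I, restrict (\<lambda>i. X i w) J)) -` (SI \<times> SJ) \<inter> space W = ?E \<inter> ?Z" by auto
  with W.indep_varD[OF IJ SI SJ] have "measure W (?E \<inter> ?Z) = measure W ?E * measure W ?Z" by (simp only:)
  moreover have "measure W ?past = measure W ?E" using eq[OF sets.top] past E by (simp add: Int_absorb2 sets.sets_into_space)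
  ultimately show "measure W (?past \<inter> ?fut) = measure W ?past * (\<Prod>j\<in>{m..<N}. measure unif2 (A j))"
    unfolding eq[OF fut] by (simp only: Z quantiles_independent[OF tp m A])
qed

end

text \<open>Given any event of the intersection-stable family \<open>\<E>\<close> the block \<open>Z\<close> has the law of independent uniform
  pairs. So it is independent of the \<open>\<sigma>\<close>-field that \<open>\<E>\<close> generates, in particular of \<open>F\<close>. This is expressed
  by the map \<open>\<omega> \<mapsto> (\<omega>, Z \<omega>)\<close>: with \<open>\<omega>\<close> observed through \<open>F\<close> only, its law is a product, which is the form
  that Fubini's theorem needs.\<close>

lemma independent_block:
  fixes P :: "'a measure" and Z :: "'a => nat => real \<times> real"
  assumes P: "prob_space P" and E: "Int_stable \<E>" "\<E> \<subseteq> sets P" "space P \<in> \<E>" and I: "finite I"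
    and Z: "\<And>j. j \<in> I ==> (\<lambda>\<omega>. Z \<omega> j) \<in> borel_measurable P"
    and rect: "\<And>E A. E \<in> \<E> ==> (\<And>j. j \<in> I ==> A j \<in> sets borel) ==>
      measure P (E \<inter> {\<omega>\<in>space P. \<forall>j\<in>I. Z \<omega> j \<in> A j}) = measure P E * (\<Prod>j\<in>I. measure unif2 (A j))"
    and F: "subalgebra P F" "sets F \<subseteq> sigma_sets (space P) \<E>"
  shows "distr P (restr_to_subalg P F \<Otimes>\<^sub>M PiM I (\<lambda>_. unif2)) (\<lambda>\<omega>. (\<omega>, \<lambda>j\<in>I. Z \<omega> j))
    = restr_to_subalg P F \<Otimes>\<^sub>M PiM I (\<lambda>_. unif2)"
proof -
  interpret P: prob_space P by fact
  let ?X = "\<lambda>\<omega>. \<lambda>j\<in>I. Z \<omega> j"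
  let ?N = "PiM I (\<lambda>_. unif2)"
  interpret N: prob_space ?N by (intro prob_space_PiM prob_unif2)
  have X: "?X \<in> measurable P ?N" by (intro measurable_restrict) (use Z in simp)
  have box: "?X -` PiE I A \<inter> space P = {\<omega>\<in>space P. \<forall>j\<in>I. Z \<omega> j \<in> A j}" for A by (auto simp: PiE_iff)
  have law: "distr P ?N ?X = ?N"
  proof (rule noise.PiM_eqI[OF I])
    show "sets (distr P ?N ?X) = sets ?N" by simp
    fix A :: "nat => (real \<times> real) set" assume A: "\<And>i. i \<in> I ==> A i \<in> sets unif2"
    have "PiE I A \<in> sets ?N" using I A by (intro sets_PiM_I_finite) auto
    then have "emeasure (distr P ?N ?X) (PiE I A) = emeasure P {\<omega>\<in>space P. \<forall>j\<in>I. Z \<omega> j \<in> A j}"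
      by (simp add: emeasure_distr[OF X] box)
    also have "\<dots> = measure P (space P \<inter> {\<omega>\<in>space P. \<forall>j\<in>I. Z \<omega> j \<in> A j})"
      by (simp add: P.emeasure_eq_measure Int_absorb1)
    also have "\<dots> = (\<Prod>j\<in>I. ennreal (measure unif2 (A j)))"
      using rect[OF E(3), of A] A by (simp add: P.prob_space prod_ennreal)
    finally show "emeasure (distr P ?N ?X) (PiE I A) = (\<Prod>i\<in>I. emeasure unif2 (A i))"
      using prob_space.axioms(1)[OF prob_unif2] by (simp add: finite_measure.emeasure_eq_measure)
  qed
  define \<R> where "\<R> = {?X -` B \<inter> space P | B. B \<in> prod_algebra I (\<lambda>_. unif2)}"
  have RI: "R \<in> \<R> ==> \<exists>A. (\<forall>j\<in>I. A j \<in> sets borel) \<and> R = {\<omega>\<in>space P. \<forall>j\<in>I. Z \<omega> j \<in> A j}" for R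
  proof -
    assume "R \<in> \<R>"
    then obtain B where B: "R = ?X -` B \<inter> space P" "B \<in> prod_algebra I (\<lambda>_. unif2)" unfolding \<R>_def by (elim CollectE exE conjE)
    from B(2) obtain A where A: "B = PiE I A" "A \<in> (\<Pi> j\<in>I. sets unif2)"
      unfolding prod_algebra_eq_finite[OF I] by (elim CollectE exE conjE)
    have "\<forall>j\<in>I. A j \<in> sets borel" using A(2) by (simp add: Pi_iff)
    moreover have "R = {\<omega>\<in>space P. \<forall>j\<in>I. Z \<omega> j \<in> A j}" unfolding B(1) A(1) by (rule box)
    ultimately show ?thesis by (intro exI[of _ A] conjI)
  qed
  have XR: "?X -` B \<inter> space P \<in> sigma_sets (space P) \<R>" if B: "B \<in> sets ?N" for B
  proof -
    have "?X -` B \<inter> space P \<in> {?X -` B \<inter> space P | B. B \<in> sigma_sets (PiE I (\<lambda>_. space unif2)) (prod_algebra I (\<lambda>_. unif2))}"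
      using B unfolding sets_PiM by (intro CollectI exI[of _ B] conjI refl)
    moreover have "?X \<in> space P \<rightarrow> PiE I (\<lambda>_. space unif2)" by simp
    ultimately show ?thesis unfolding \<R>_def by (simp only: sigma_sets_vimage_commute)
  qed
  have R: "\<R> \<subseteq> sets P"
  proof
    fix R assume "R \<in> \<R>"
    then obtain B where B: "R = ?X -` B \<inter> space P" "B \<in> prod_algebra I (\<lambda>_. unif2)" unfolding \<R>_def by (elim CollectE exE conjE)
    then have "B \<in> sets ?N" unfolding sets_PiM by (intro sigma_sets.Basic)
    then show "R \<in> sets P" unfolding B(1) by (rule measurable_sets[OF X])
  qed
  have ind: "P.indep_set (sigma_sets (space P) \<E>) (sigma_sets (space P) \<R>)"
  proof (rule P.indep_set_sigma_sets[OF P.indep_setI[OF E(2) R] E(1)])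
    fix a b assume a: "a \<in> \<E>" and b: "b \<in> \<R>"
    from RI[OF b] obtain A where A: "\<forall>j\<in>I. A j \<in> sets borel" "b = {\<omega>\<in>space P. \<forall>j\<in>I. Z \<omega> j \<in> A j}" by (elim exE conjE)
    have "measure P b = (\<Prod>j\<in>I. measure unif2 (A j))"
    proof -
      have "space P \<inter> b = b" unfolding A(2) by auto
      then show ?thesis using rect[OF E(3), of A] A(1) unfolding A(2)[symmetric] P.prob_space by simp
    qed
    then show "P.prob (a \<inter> b) = P.prob a * P.prob b"
      using rect[OF a, of A] A(1) unfolding A(2)[symmetric] by simp
  next
    show "Int_stable \<R>"
    proof (rule Int_stableI)
      fix a b assume "a \<in> \<R>" "b \<in> \<R>"
      then obtain a' b' where "a' \<in> prod_algebra I (\<lambda>_. unif2)" "a = ?X -` a' \<inter> space P"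
        "b' \<in> prod_algebra I (\<lambda>_. unif2)" "b = ?X -` b' \<inter> space P" unfolding \<R>_def by (elim CollectE exE conjE)
      moreover from this have "a' \<inter> b' \<in> prod_algebra I (\<lambda>_. unif2)"
        by (intro Int_stableD[OF Int_stable_prod_algebra])
      ultimately show "a \<inter> b \<in> \<R>" unfolding \<R>_def by (intro CollectI exI[of _ "a' \<inter> b'"]) auto
    qed
  qed
  have idm: "(\<lambda>\<omega>. \<omega>) \<in> measurable P (restr_to_subalg P F)"
  proof (rule measurableI)
    fix A assume "A \<in> sets (restr_to_subalg P F)"
    then have A: "A \<in> sets F" by (simp add: sets_restr_to_subalg[OF F(1)])
    then have "A \<in> sets P" using F(1) by (auto simp: subalgebra_def)
    then show "(\<lambda>\<omega>. \<omega>) -` A \<inter> space P \<in> sets P" by simp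
  qed (simp add: space_restr_to_subalg)
  have Xm: "(\<lambda>\<omega>. (\<omega>, ?X \<omega>)) \<in> measurable P (restr_to_subalg P F \<Otimes>\<^sub>M ?N)"
    by (rule measurable_Pair[OF idm X])
  interpret R: prob_space "restr_to_subalg P F" by (rule prob_space_restr_to_subalg[OF F(1) P])
  show ?thesis
  proof (rule pair_measure_eqI[symmetric])
    fix A B assume A: "A \<in> sets (restr_to_subalg P F)" and B: "B \<in> sets ?N"
    then have AF: "A \<in> sets F" by (simp add: sets_restr_to_subalg[OF F(1)])
    have "A \<subseteq> space P" using AF F(1) sets.sets_into_space[OF AF] by (simp add: subalgebra_def)
    then have "(\<lambda>\<omega>. (\<omega>, ?X \<omega>)) -` (A \<times> B) \<inter> space P = A \<inter> (?X -` B \<inter> space P)" by auto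
    then have "emeasure (distr P (restr_to_subalg P F \<Otimes>\<^sub>M ?N) (\<lambda>\<omega>. (\<omega>, ?X \<omega>))) (A \<times> B) = emeasure P (A \<inter> (?X -` B \<inter> space P))"
      using A B by (subst emeasure_distr[OF Xm]) auto
    also have "\<dots> = measure P A * measure P (?X -` B \<inter> space P)"
      using P.indep_setD[OF ind _ XR[OF B], of A] AF F(2) by (simp add: P.emeasure_eq_measure subset_iff)
    also have "\<dots> = emeasure P A * emeasure P (?X -` B \<inter> space P)"
      by (simp add: P.emeasure_eq_measure ennreal_mult)
    also have "emeasure P (?X -` B \<inter> space P) = emeasure (distr P ?N ?X) B" by (rule emeasure_distr[OF X B, symmetric])
    also have "\<dots> = emeasure ?N B" unfolding law ..
    finally show "emeasure (restr_to_subalg P F) A * emeasure ?N B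
      = emeasure (distr P (restr_to_subalg P F \<Otimes>\<^sub>M ?N) (\<lambda>\<omega>. (\<omega>, ?X \<omega>))) (A \<times> B)"
      unfolding emeasure_restr_to_subalg[OF F(1) AF] by (rule sym)
  qed (use R.sigma_finite_measure_axioms N.sigma_finite_measure_axioms in auto)
qed

text \<open>A block with indices from \<open>m\<close> to \<open>N - 1\<close>, shifted to \<open>0\<close> and continued by \<open>0\<close>, is the beginning of a noise
  sequence.\<close>

lemma noise_block_measurable:
  "(\<lambda>x i. if i < N - m then x (m + i) else 0) \<in> measurable (PiM {m..<N} (\<lambda>_. unif2)) noise"
  unfolding noise_def
proof (rule measurable_PiM_single')
  fix i :: nat
  show "(\<lambda>x. if i < N - m then x (m + i) else 0) \<in> measurable (PiM {m..<N} (\<lambda>_. unif2)) unif2"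
  proof (cases "i < N - m")
    case True
    then have "m + i \<in> {m..<N}" by auto
    from measurable_component_singleton[OF this, of "\<lambda>_. unif2"] show ?thesis using True by (simp del: sets_unif2)
  next
    case False then show ?thesis by simp
  qed
qed simp

lemma noise_block:
  fixes H :: "noise_seq => real"
  assumes H: "H \<in> borel_measurable noise" and dep: "\<And>y y'. (\<And>i. i < N - m ==> y i = y' i) ==> H y = H y'"
  shows "(\<integral>x. H (\<lambda>i. if i < N - m then x (m + i) else 0) \<partial>PiM {m..<N} (\<lambda>_. unif2)) = (\<integral>z. H z \<partial>noise)"
proof -
  let ?N = "PiM {m..<N} (\<lambda>_. unif2)"
  let ?q = "\<lambda>y :: nat => real \<times> real. \<lambda>i\<in>{m..<N}. y (i - m)"
  have qm: "?q \<in> measurable noise ?N"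
    unfolding noise_def by (intro measurable_restrict measurable_component_singleton) simp
  have "distr noise ?N ?q = ?N"
    unfolding noise_def by (rule distr_PiM_reindex) (auto simp: prob_unif2 inj_on_def)
  then have "(\<integral>x. H (\<lambda>i. if i < N - m then x (m + i) else 0) \<partial>?N) = (\<integral>x. H (\<lambda>i. if i < N - m then x (m + i) else 0) \<partial>distr noise ?N ?q)"
    by simp
  also have "\<dots> = (\<integral>y. H (\<lambda>i. if i < N - m then ?q y (m + i) else 0) \<partial>noise)"
    by (rule integral_distr[OF qm measurable_compose[OF noise_block_measurable H]])
  also have "\<dots> = (\<integral>z. H z \<partial>noise)"
  proof (rule Bochner_Integration.integral_cong[OF refl dep])
    fix y :: noise_seq and i assume "i < N - m"
    then show "(if i < N - m then ?q y (m + i) else 0) = y i" by auto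
  qed
  finally show ?thesis .
qed

text \<open>The first \<open>j\<close> entries of \<open>Y\<close> are known to \<open>F\<close>, the next \<open>N - m\<close> form a block independent of \<open>F\<close>, and \<open>H\<close>
  depends on no others. By Fubini's theorem for the product law of \<open>\<omega>\<close> and the block, the conditional
  expectation is obtained by fixing the known entries and averaging over the others.\<close>

lemma cond_exp_of_block:
  fixes P :: "'a measure" and Y :: "'a => nat => real \<times> real" and H :: "noise_seq => real"
  assumes P: "prob_space P" and F: "subalgebra P F"
    and block: "distr P (restr_to_subalg P F \<Otimes>\<^sub>M PiM {m..<N} (\<lambda>_. unif2)) (\<lambda>\<omega>. (\<omega>, \<lambda>i\<in>{m..<N}. Y \<omega> (j + (i - m))))
      = restr_to_subalg P F \<Otimes>\<^sub>M PiM {m..<N} (\<lambda>_. unif2)"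
    and fut: "\<And>i. i < N - m ==> (\<lambda>\<omega>. Y \<omega> (j + i)) \<in> borel_measurable P"
    and past: "\<And>l. l < j ==> (\<lambda>\<omega>. Y \<omega> l) \<in> borel_measurable F"
    and H: "H \<in> borel_measurable noise" and B: "\<And>y. \<bar>H y\<bar> \<le> B"
    and dep: "\<And>y y'. (\<And>i. i < j + (N - m) ==> y i = y' i) ==> H y = H y'"
  shows "AE \<omega> in P. real_cond_exp P F (\<lambda>\<omega>. H (Y \<omega>)) \<omega> = (noise_avg j H (Y \<omega>))"
    and "(\<integral>\<omega>. H (Y \<omega>) \<partial>P) = (\<integral>\<omega>. (noise_avg j H (Y \<omega>)) \<partial>P)"
proof -
  interpret P: prob_space P by fact
  let ?N = "PiM {m..<N} (\<lambda>_. unif2)"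
  let ?R = "restr_to_subalg P F"
  interpret N: prob_space ?N by (intro prob_space_PiM prob_unif2)
  interpret R: prob_space ?R by (rule prob_space_restr_to_subalg[OF F P])
  interpret RN: pair_prob_space ?R ?N ..
  interpret fin: finite_measure_subalgebra P F by unfold_locales (rule F)
  let ?s = "\<lambda>x i. if i < N - m then x (m + i) else 0"
  define X where "X \<omega> = (\<lambda>i\<in>{m..<N}. Y \<omega> (j + (i - m)))" for \<omega>
  define Y0 where "Y0 \<omega> l = (if l < j then Y \<omega> l else 0)" for \<omega> l
  have sR: "sets ?R = sets F" "space ?R = space F" 
    using F by (simp_all add: sets_restr_to_subalg space_restr_to_subalg subalgebra_def)
  have FR: "measurable ?R M = measurable F M" for M :: "'c measure" using sR(1) by (rule measurable_cong_sets) simp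
  have Y0: "Y0 \<in> measurable F noise"
    unfolding noise_def
  proof (rule measurable_PiM_single')
    fix i
    show "(\<lambda>\<omega>. Y0 \<omega> i) \<in> measurable F unif2" using past[of i] by (cases "i < j") (simp_all add: Y0_def)
  qed simp
  have Y0R: "(\<lambda>p. Y0 (fst p)) \<in> measurable (?R \<Otimes>\<^sub>M ?N) noise"
    by (rule measurable_compose[OF measurable_fst]) (simp only: FR Y0)
  have sR': "(\<lambda>p. ?s (snd p)) \<in> measurable (?R \<Otimes>\<^sub>M ?N) noise"
    by (rule measurable_compose[OF measurable_snd noise_block_measurable])
  define h where "h \<omega> = (noise_avg j H (Y \<omega>))" for \<omega>
  have h_past: "h \<omega> = (noise_avg j H (Y0 \<omega>))" for \<omega>
  proof -
    have "comb_seq j (Y \<omega>) = comb_seq j (Y0 \<omega>)" by (rule ext, rule comb_seq_eqI) (simp add: Y0_def)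
    then show ?thesis by (simp add: h_def)
  qed
  have hF: "h \<in> borel_measurable F"
    unfolding h_past[abs_def] by (rule measurable_compose[OF Y0 noise_split(1)[OF H B]])
  have hB: "\<bar>h \<omega>\<bar> \<le> B" for \<omega>
  proof -
    have i: "integrable noise (\<lambda>z. H (comb_seq j (Y \<omega>) z))"
      by (rule bounded_integrable_noise[OF measurable_compose[OF comb_seq_measurable H] B]) (auto simp: space_noise)
    have "(noise_avg j H (Y \<omega>)) \<le> B" "-B \<le> (noise_avg j H (Y \<omega>))"
      using B by (auto intro!: noise_prob.integral_le_const[OF i] noise_prob.integral_ge_const[OF i] simp: abs_le_iff minus_le_iff)
    then show ?thesis by (simp add: h_def)
  qed
  have Y_eq: "H (Y \<omega>) = H (comb_seq j (Y0 \<omega>) (?s (X \<omega>)))" for \<omega>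
  proof (rule dep)
    fix i assume i: "i < j + (N - m)"
    show "Y \<omega> i = comb_seq j (Y0 \<omega>) (?s (X \<omega>)) i"
    proof (cases "i < j")
      case True then show ?thesis by (simp add: comb_seq_def Y0_def)
    next
      case False
      then have "m + (i - j) \<in> {m..<N}" "i - j < N - m" using i by auto
      then show ?thesis using False by (simp add: comb_seq_def X_def)
    qed
  qed
  have FP: "A \<in> sets F ==> A \<in> sets P" for A using F by (auto simp: subalgebra_def)
  have idm: "(\<lambda>\<omega>. \<omega>) \<in> measurable P ?R"
    using F FP by (intro measurableI) (auto simp: sR subalgebra_def sets.sets_into_space Int_absorb2)
  have Xm: "X \<in> measurable P ?N"
    unfolding X_def
  proof (rule measurable_restrict)
    fix i assume "i \<in> {m..<N}"
    then show "(\<lambda>\<omega>. Y \<omega> (j + (i - m))) \<in> measurable P unif2" using fut[of "i - m"] by auto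
  qed
  have key: "(\<integral>\<omega>. indicator E \<omega> * H (Y \<omega>) \<partial>P) = (\<integral>\<omega>. indicator E \<omega> * h \<omega> \<partial>P)" if E: "E \<in> sets F" for E
  proof -
    define G where "G p = indicator E (fst p) * H (comb_seq j (Y0 (fst p)) (?s (snd p)))" for p :: "'a \<times> noise_seq"
    have G: "G \<in> borel_measurable (?R \<Otimes>\<^sub>M ?N)"
      unfolding G_def
      by (intro borel_measurable_times measurable_compose[OF comb_seq_measurable[OF Y0R sR'] H]
          measurable_compose[OF measurable_fst borel_measurable_indicator]) (simp add: sR E)
    have GB: "\<bar>G p\<bar> \<le> B" for p
      using B[of "comb_seq j (Y0 (fst p)) (?s (snd p))"] by (auto simp: G_def indicator_def)
    have "(\<integral>\<omega>. indicator E \<omega> * H (Y \<omega>) \<partial>P) = (\<integral>\<omega>. G (\<omega>, X \<omega>) \<partial>P)"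
      by (rule Bochner_Integration.integral_cong[OF refl]) (simp only: G_def fst_conv snd_conv Y_eq)
    also have "\<dots> = (\<integral>p. G p \<partial>distr P (?R \<Otimes>\<^sub>M ?N) (\<lambda>\<omega>. (\<omega>, X \<omega>)))"
      by (rule integral_distr[OF measurable_Pair[OF idm Xm] G, symmetric])
    also have "\<dots> = (\<integral>p. G p \<partial>(?R \<Otimes>\<^sub>M ?N))" using block by (simp only: X_def)
    also have "\<dots> = (\<integral>\<omega>. (\<integral>x. G (\<omega>, x) \<partial>?N) \<partial>?R)"
      by (rule RN.integral_fst'[symmetric]) (rule RN.P.integrable_const_bound[where B=B], use GB G in auto)
    also have "\<dots> = (\<integral>\<omega>. indicator E \<omega> * h \<omega> \<partial>?R)"
    proof (rule Bochner_Integration.integral_cong[OF refl])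
      fix \<omega>
      have "(\<integral>x. H (comb_seq j (Y0 \<omega>) (?s x)) \<partial>?N) = h \<omega>"
        unfolding h_past
      proof (rule noise_block)
        show "(\<lambda>z. H (comb_seq j (Y0 \<omega>) z)) \<in> borel_measurable noise"
          by (rule measurable_compose[OF comb_seq_measurable H]) auto
        show "H (comb_seq j (Y0 \<omega>) z) = H (comb_seq j (Y0 \<omega>) z')" if "\<And>i. i < N - m ==> z i = z' i" for z z'
          by (rule dep) (use that in "auto simp: comb_seq_def")
      qed
      then show "(\<integral>x. G (\<omega>, x) \<partial>?N) = indicator E \<omega> * h \<omega>"
        unfolding G_def fst_conv snd_conv by simp
    qed
    also have "\<dots> = (\<integral>\<omega>. indicator E \<omega> * h \<omega> \<partial>P)"
      by (rule integral_subalgebra2[OF F]) (use hF E in simp)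
    finally show ?thesis .
  qed
  have HY: "(\<lambda>\<omega>. H (Y \<omega>)) \<in> borel_measurable P"
    unfolding Y_eq
    by (rule measurable_compose[OF comb_seq_measurable H])
      (auto intro: measurable_from_subalg[OF F Y0] measurable_compose[OF Xm noise_block_measurable])
  have "AE \<omega> in P. real_cond_exp P F (\<lambda>\<omega>. H (Y \<omega>)) \<omega> = h \<omega>"
  proof (rule fin.real_cond_exp_charact)
    show "(\<integral>x\<in>A. H (Y x) \<partial>P) = (\<integral>x\<in>A. h x \<partial>P)" if "A \<in> sets F" for A
      using key[OF that] by (simp add: set_lebesgue_integral_def)
    show "integrable P (\<lambda>\<omega>. H (Y \<omega>))" by (rule P.integrable_const_bound[where B=B]) (use B HY in auto)
    show "integrable P h" 
      by (rule P.integrable_const_bound[where B=B]) (use hB measurable_from_subalg[OF F hF] in auto)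
  qed (rule hF)
  then show "AE \<omega> in P. real_cond_exp P F (\<lambda>\<omega>. H (Y \<omega>)) \<omega> = (noise_avg j H (Y \<omega>))"
    by (simp only: h_def)
  have "(\<integral>\<omega>. indicator (space P) \<omega> * H (Y \<omega>) \<partial>P) = (\<integral>\<omega>. indicator (space P) \<omega> * h \<omega> \<partial>P)"
  proof (rule key)
    have "space F = space P" using F by (simp add: subalgebra_def)
    then show "space P \<in> sets F" using sets.top[of F] by (simp only:)
  qed
  moreover have "(\<integral>\<omega>. indicator (space P) \<omega> * g \<omega> \<partial>P) = (\<integral>\<omega>. g \<omega> \<partial>P)" for g :: "'a => real"
    by (rule Bochner_Integration.integral_cong[OF refl]) simp
  ultimately show "(\<integral>\<omega>. H (Y \<omega>) \<partial>P) = (\<integral>\<omega>. (noise_avg j H (Y \<omega>)) \<partial>P)"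
    by (simp only: h_def)
qed

section \<open>Conditioning on the past\<close>

text \<open>The noise sequence seen from cell \<open>k\<close>, with \<open>0\<close> in place of the signals after the last cell.\<close>

definition signals :: "(nat => real) => nat => nat => sample => nat => real \<times> real" where
  "signals p k N \<omega> l = (if l < N + 1 - k then zeta p (k - 1 + l) \<omega> else 0)"

context wiener
begin

abbreviation P where "P \<equiv> wiener_ext W"

lemma P_completion: "P = completion (W \<Otimes>\<^sub>M unif2)"
  by (simp add: wiener_ext_def unif2_def)

sublocale WU: pair_prob_space W unif2
  by (intro pair_prob_space.intro pair_sigma_finite.intro prob_space_imp_sigma_finite prob_unif2 W.prob_space_axioms)

sublocale P: prob_space P
  unfolding P_completion by (rule WU.P.prob_space_completion)

lemma space_P: "space P = Omega T"
  by (simp add: P_completion space_pair_measure space_W Omega_def)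

lemma measurable_P: "X \<in> measurable (W \<Otimes>\<^sub>M unif2) M ==> X \<in> measurable P M"
  unfolding P_completion by (rule measurable_completion)

lemma snd_measurable_P: "snd \<in> borel_measurable P"
  by (intro measurable_P) (simp add: measurable_snd cong: measurable_cong_sets)

lemma BM_measurable: "r \<in> {0..T} ==> BM r \<in> borel_measurable P"
  unfolding BM_def[abs_def] by (intro measurable_P measurable_compose[OF measurable_fst coordinate_measurable])

lemma zeta_BM: "1 \<le> j ==> zeta p j \<omega> = quantile_pair p j (BM (p j) \<omega> - BM (p (j - 1)) \<omega>)"
  by (simp add: zeta_quantile BM_def)

lemma zeta_measurable:
  assumes "time_partition T N p" "j \<le> N"
  shows "zeta p j \<in> borel_measurable P"
proof (cases "j = 0")
  case True
  then have "zeta p j = snd" by (simp add: zeta_def fun_eq_iff)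
  then show ?thesis using snd_measurable_P by simp
next
  case False
  then have "zeta p j = (\<lambda>\<omega>. quantile_pair p j (BM (p j) \<omega> - BM (p (j - 1)) \<omega>))" by (simp add: zeta_BM fun_eq_iff)
  moreover have "(\<lambda>\<omega>. quantile_pair p j (BM (p j) \<omega> - BM (p (j - 1)) \<omega>)) \<in> borel_measurable P"
    using assms by (intro measurable_compose[OF _ quantile_pair_measurable] borel_measurable_diff BM_measurable partition_range[OF assms(1)]) auto
  ultimately show ?thesis by simp
qed

lemma measure_rectangle:
  assumes "A \<in> sets W" "B \<in> sets borel"
  shows "measure P {\<omega>\<in>space P. fst \<omega> \<in> A \<and> snd \<omega> \<in> B} = measure W A * measure unif2 B"
proof -
  have "{\<omega>\<in>space P. fst \<omega> \<in> A \<and> snd \<omega> \<in> B} = A \<times> B"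
    using sets.sets_into_space[OF assms(1)] by (auto simp: P_completion space_pair_measure)
  moreover have "A \<times> B \<in> sets (W \<Otimes>\<^sub>M unif2)" using assms by (intro pair_measureI) auto
  ultimately have "measure P {\<omega>\<in>space P. fst \<omega> \<in> A \<and> snd \<omega> \<in> B} = measure (W \<Otimes>\<^sub>M unif2) (A \<times> B)"
    unfolding P_completion by simp
  also have "\<dots> = measure W A * measure unif2 B"
    using sigma_finite_measure.emeasure_pair_measure_Times[OF prob_space_imp_sigma_finite[OF prob_unif2], of A W B] assms by (simp add: measure_def enn2real_mult)
  finally show ?thesis .
qed

text \<open>Events about the initial variables and finitely many values of the path up to time \<open>s\<close>. With the null
  sets they generate the \<open>\<sigma>\<close>-field of the past, and they are closed under intersections. Before the signal
  number \<open>0\<close> nothing is known, hence the case \<open>m = 0\<close>.\<close>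

definition cylinder :: "(real \<times> real) set => real set => (real => (real \<times> real) set) => sample set" where
  "cylinder A F C = {\<omega>\<in>space P. snd \<omega> \<in> A \<and> (\<forall>r\<in>F. fst \<omega> r \<in> C r)}"

definition cylinders :: "real => sample set set" where
  "cylinders s = {cylinder A F C | A F C. A \<in> sets borel \<and> finite F \<and> F \<subseteq> {0..s} \<and> (\<forall>r\<in>F. C r \<in> sets borel)}"

definition past_sets :: "(nat => real) => nat => sample set set" where
  "past_sets p m = (if m = 0 then {space P} else cylinders (p (m - 1))) \<union> null_sets P"

lemma cylindersI:
  assumes "A \<in> sets borel" "finite F" "F \<subseteq> {0..s}" "\<And>r. r \<in> F ==> C r \<in> sets borel"
  shows "cylinder A F C \<in> cylinders s"
  unfolding cylinders_def using assms by (intro CollectI exI[of _ A] exI[of _ F] exI[of _ C]) simp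

lemma space_cylinder: "space P = cylinder UNIV {} C" by (simp add: cylinder_def)

lemma cylinder_sets:
  assumes "s \<le> T" "E \<in> cylinders s" shows "E \<in> sets P"
proof -
  obtain A F C where E: "E = cylinder A F C" and A: "A \<in> sets borel" and F: "finite F" "F \<subseteq> {0..s}" and C: "\<forall>r\<in>F. C r \<in> sets borel"
    using assms(2) unfolding cylinders_def by (elim CollectE exE conjE)
  have "{\<omega>\<in>space P. \<forall>r\<in>F. fst \<omega> r \<in> C r} \<in> sets P"
    using F assms(1) C unfolding BM_def[symmetric]
    by (intro sets.sets_Collect_finite_All sets_Collect_in[OF BM_measurable]) auto
  with sets_Collect_in[OF snd_measurable_P A] have "{\<omega>\<in>space P. snd \<omega> \<in> A} \<inter> {\<omega>\<in>space P. \<forall>r\<in>F. fst \<omega> r \<in> C r} \<in> sets P"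
    by (rule sets.Int)
  moreover have "{\<omega>\<in>space P. snd \<omega> \<in> A} \<inter> {\<omega>\<in>space P. \<forall>r\<in>F. fst \<omega> r \<in> C r} = E"
    unfolding E cylinder_def by auto
  ultimately show ?thesis by simp
qed

lemma past_sets_events:
  assumes "time_partition T N p" "m \<le> N" shows "past_sets p m \<subseteq> sets P"
  using cylinder_sets[of "p (m - 1)"] partition_range[OF assms(1), of "m - 1"] assms(2)
  by (auto simp: past_sets_def split: if_splits)

lemma space_past_sets: "space P \<in> past_sets p m"
  using cylindersI[of UNIV "{}" "p (m - 1)"] space_cylinder by (simp add: past_sets_def)

lemma cylinder_Int:
  "cylinder A F C \<inter> cylinder A' F' C' = cylinder (A \<inter> A') (F \<union> F') (\<lambda>r. (if r \<in> F then C r else UNIV) \<inter> (if r \<in> F' then C' r else UNIV))"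
proof (rule set_eqI)
  fix \<omega>
  show "\<omega> \<in> cylinder A F C \<inter> cylinder A' F' C' \<longleftrightarrow>
    \<omega> \<in> cylinder (A \<inter> A') (F \<union> F') (\<lambda>r. (if r \<in> F then C r else UNIV) \<inter> (if r \<in> F' then C' r else UNIV))"
    unfolding cylinder_def by (auto split: if_splits)
qed

lemma past_sets_Int_stable:
  assumes "time_partition T N p" "m \<le> N" shows "Int_stable (past_sets p m)"
proof (rule Int_stableI)
  fix a b assume a: "a \<in> past_sets p m" and b: "b \<in> past_sets p m"
  note ev = past_sets_events[OF assms]
  consider "a \<in> null_sets P" | "b \<in> null_sets P" | "a \<notin> null_sets P" "b \<notin> null_sets P" by fast
  then show "a \<inter> b \<in> past_sets p m"
  proof cases
    case 1 then show ?thesis using null_set_Int2[of a P b] b ev by (auto simp: past_sets_def)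
  next
    case 2 then show ?thesis using null_set_Int1[of b P a] a ev by (auto simp: past_sets_def)
  next
    case 3
    show ?thesis
    proof (cases "m = 0")
      case True then show ?thesis using a b 3 by (simp add: past_sets_def)
    next
      case False
      then have "a \<in> cylinders (p (m - 1))" "b \<in> cylinders (p (m - 1))" using a b 3 by (auto simp: past_sets_def)
      then obtain A F C A' F' C' where a: "a = cylinder A F C" "A \<in> sets borel" "finite F" "F \<subseteq> {0..p (m - 1)}" "\<forall>r\<in>F. C r \<in> sets borel"
        and b: "b = cylinder A' F' C'" "A' \<in> sets borel" "finite F'" "F' \<subseteq> {0..p (m - 1)}" "\<forall>r\<in>F'. C' r \<in> sets borel"
        unfolding cylinders_def by (elim CollectE exE conjE)
      have "a \<inter> b \<in> cylinders (p (m - 1))" unfolding a(1) b(1) cylinder_Int using a b by (intro cylindersI) auto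
      then show ?thesis using False by (simp add: past_sets_def)
    qed
  qed
qed

text \<open>The path is treated by \<open>past_future_W\<close>, and the initial variables are independent of it by
  construction. They belong to the future for \<open>m = 0\<close> and to the past otherwise.\<close>

lemma past_independent:
  assumes tp: "time_partition T N p" and m: "m \<le> N" and E: "E \<in> past_sets p m"
    and A: "\<And>j. j \<in> {m..<N} ==> A j \<in> sets borel"
  shows "measure P (E \<inter> {\<omega>\<in>space P. \<forall>j\<in>{m..<N}. zeta p j \<omega> \<in> A j}) = measure P E * (\<Prod>j\<in>{m..<N}. measure unif2 (A j))"
proof (cases "E \<in> null_sets P")
  case True
  have "{\<omega>\<in>space P. \<forall>j\<in>{m..<N}. zeta p j \<omega> \<in> A j} \<in> sets P"
    by (intro sets.sets_Collect_finite_All sets_Collect_in[OF zeta_measurable[OF tp] A]) auto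
  from null_set_Int2[OF True this] True show ?thesis by (simp add: null_sets_def measure_def)
next
  case False
  have pathW: "fst \<omega> \<in> space W" if "\<omega> \<in> space P" for \<omega>
    using that by (auto simp: P_completion space_pair_measure)
  let ?fut = "\<lambda>m. {w \<in> space W. \<forall>j\<in>{m..<N}. quantile_pair p j (w (p j) - w (p (j - 1))) \<in> A j}"
  show ?thesis
  proof (cases "m = 0")
    case True
    then have E: "E = space P" using E False by (simp add: past_sets_def)
    have N: "1 \<le> N" using tp by (simp add: time_partition_def)
    have A': "A j \<in> sets borel" if "j \<in> {1..<N}" for j using A True that by simp
    have fut1: "?fut 1 \<in> sets W"
      by (rule past_future_W(2)[OF tp order_refl N _ _ _ A', of "{}" "\<lambda>_. UNIV"]) simp_all
    have "E \<inter> {\<omega>\<in>space P. \<forall>j\<in>{m..<N}. zeta p j \<omega> \<in> A j} = {\<omega>\<in>space P. fst \<omega> \<in> ?fut 1 \<and> snd \<omega> \<in> A 0}"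
    proof -
      have "(\<forall>j\<in>{0..<N}. zeta p j \<omega> \<in> A j) \<longleftrightarrow> zeta p 0 \<omega> \<in> A 0 \<and> (\<forall>j\<in>{1..<N}. zeta p j \<omega> \<in> A j)" for \<omega>
      proof -
        have "{0..<N} = insert 0 {1..<N}" using N by auto
        then show ?thesis by simp
      qed
      then show ?thesis unfolding True E using pathW by (auto simp: zeta_quantile zeta_def[of p 0])
    qed
    then have "measure P (E \<inter> {\<omega>\<in>space P. \<forall>j\<in>{m..<N}. zeta p j \<omega> \<in> A j}) = measure W (?fut 1) * measure unif2 (A 0)"
      using fut1 A[of 0] True N by (simp only: measure_rectangle atLeastLessThan_iff order.refl zero_le less_eq_Suc_le One_nat_def)
    also note quantiles_independent[OF tp order_refl N A']
    finally show ?thesis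
      using N by (simp add: E P.prob_space True prod.atLeast_Suc_lessThan[of 0 N] mult.commute)
  next
    case m0: False
    then have "E \<in> cylinders (p (m - 1))" using E False by (simp add: past_sets_def)
    then obtain B F C where E: "E = cylinder B F C" and B: "B \<in> sets borel" and F: "finite F" "F \<subseteq> {0..p (m - 1)}" and C: "\<forall>r\<in>F. C r \<in> sets borel"
      unfolding cylinders_def by (elim CollectE exE conjE)
    let ?past = "{w \<in> space W. \<forall>r\<in>F. w r \<in> C r}"
    have pf: "?past \<in> sets W" "?fut m \<in> sets W" "measure W (?past \<inter> ?fut m) = measure W ?past * (\<Prod>j\<in>{m..<N}. measure unif2 (A j))"
      by (rule past_future_W[OF tp _ m F, of C A]; use m0 C A in simp)+
    have 1: "E = {\<omega>\<in>space P. fst \<omega> \<in> ?past \<and> snd \<omega> \<in> B}"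
      unfolding E cylinder_def using pathW by auto
    have 2: "E \<inter> {\<omega>\<in>space P. \<forall>j\<in>{m..<N}. zeta p j \<omega> \<in> A j} = {\<omega>\<in>space P. fst \<omega> \<in> ?past \<inter> ?fut m \<and> snd \<omega> \<in> B}"
      unfolding 1 using pathW m0 by (auto simp: zeta_quantile)
    have "measure P E = measure W ?past * measure unif2 B"
      unfolding 1 by (rule measure_rectangle[OF pf(1) B])
    moreover have "measure P (E \<inter> {\<omega>\<in>space P. \<forall>j\<in>{m..<N}. zeta p j \<omega> \<in> A j}) = measure W (?past \<inter> ?fut m) * measure unif2 B"
      unfolding 2 by (rule measure_rectangle[OF sets.Int[OF pf(1,2)] B])
    ultimately show ?thesis by (simp only: pf(3) mult_ac)
  qed
qed

lemma Fil_idx_eq: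
  assumes "1 \<le> k" "k \<le> i"
  shows "Fil_idx P p (int k - 2) (int i - 2) =
    (if 2 \<le> k then Fil P (p (k - 2)) (p (i - 2)) else if 2 \<le> i then Fil0 P (p (i - 2)) else sigma (space P) (null_sets P))"
proof -
  have "nat (int j - 2) = j - 2" for j by arith
  then show ?thesis by (simp add: Fil_idx_def)
qed

text \<open>The \<open>\<sigma>\<close>-field with the time indices \<open>k - 2\<close> and \<open>i - 2\<close> is contained in the past of the signal number
  \<open>i - 1\<close>, whether it is given by increments, by the path and the initial variables, or trivial; and it
  contains the signals received from number \<open>k - 1\<close> on.\<close>

lemma Fil_idx_past:
  assumes tp: "time_partition T N p" and k: "1 \<le> k" "k \<le> i" "i \<le> N"
  shows "space (Fil_idx P p (int k - 2) (int i - 2)) = space P"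
    and "sets (Fil_idx P p (int k - 2) (int i - 2)) \<subseteq> sigma_sets (space P) (past_sets p (i - 1))"
    and "subalgebra P (Fil_idx P p (int k - 2) (int i - 2))"
proof -
  let ?S = "sigma (space P) (past_sets p (i - 1))"
  have ev: "past_sets p (i - 1) \<subseteq> sets P" by (rule past_sets_events[OF tp]) (use k in simp)
  then have "past_sets p (i - 1) \<subseteq> Pow (space P)" using sets.sets_into_space by blast
  then have S: "sets ?S = sigma_sets (space P) (past_sets p (i - 1))" "space ?S = space P" by simp_all
  have null: "null_sets P \<subseteq> sets ?S" unfolding S by (auto simp: past_sets_def)
  have snd: "snd \<in> borel_measurable ?S" if "2 \<le> i"
  proof (rule measurableI)
    fix A :: "(real \<times> real) set" assume A: "A \<in> sets borel"
    have "snd -` A \<inter> space ?S = cylinder A {} (\<lambda>_. UNIV)" unfolding S cylinder_def by auto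
    also have "\<dots> \<in> past_sets p (i - 1)" using that A by (auto simp: past_sets_def intro!: cylindersI)
    finally show "snd -` A \<inter> space ?S \<in> sets ?S" unfolding S(1) by (rule sigma_sets.Basic)
  qed simp
  have BM: "BM r \<in> borel_measurable ?S" if "2 \<le> i" "r \<in> {0..p (i - 2)}" for r
  proof (rule measurableI)
    fix A :: "(real \<times> real) set" assume A: "A \<in> sets borel"
    have i: "i - 1 - 1 = i - 2" using that(1) by simp
    have "BM r -` A \<inter> space ?S = cylinder UNIV {r} (\<lambda>_. A)" unfolding S cylinder_def by (auto simp: BM_def)
    also have "\<dots> \<in> cylinders (p (i - 1 - 1))" unfolding i using that A by (intro cylindersI) auto
    also have "\<dots> \<subseteq> past_sets p (i - 1)" using that(1) by (auto simp: past_sets_def)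
    finally show "BM r -` A \<inter> space ?S \<in> sets ?S" unfolding S(1) by (rule sigma_sets.Basic)
  qed simp
  have gen: "space (sigma (space P) \<G>) = space P \<and> sets (sigma (space P) \<G>) \<subseteq> sets ?S" if "\<G> \<subseteq> sets ?S" for \<G>
  proof -
    have "\<G> \<subseteq> Pow (space P)" using that sets.sets_into_space[of _ ?S] S(2) by blast
    moreover have "sigma_sets (space ?S) \<G> \<subseteq> sets ?S" using that by (rule sets.sigma_sets_subset)
    ultimately show ?thesis using S(2) by simp
  qed
  have main: "space (Fil_idx P p (int k - 2) (int i - 2)) = space P \<and> sets (Fil_idx P p (int k - 2) (int i - 2)) \<subseteq> sets ?S"
  proof -
    consider "2 \<le> k" | "k = 1" "2 \<le> i" | "k = 1" "i = 1" using k by linarith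
    then show ?thesis
    proof cases
      case 1
      then have i: "2 \<le> i" using k by simp
      have k0: "0 \<le> p (k - 2)" "p (k - 2) \<le> p (i - 2)"
        using partition_range[OF tp, of "k - 2"] partition_mono[OF tp, of "k - 2" "i - 2"] k by auto
      have "(\<lambda>\<omega>. BM r \<omega> - BM (p (k - 2)) \<omega>) -` A \<inter> space P \<in> sets ?S" if "r \<in> {p (k - 2)..p (i - 2)}" "A \<in> sets borel" for r A
      proof -
        have "(\<lambda>\<omega>. BM r \<omega> - BM (p (k - 2)) \<omega>) \<in> borel_measurable ?S"
          using that(1) k0 by (intro borel_measurable_diff BM[OF i]) auto
        from measurable_sets[OF this that(2)] show ?thesis by (simp only: S(2))
      qed
      then show ?thesis using 1 null by (simp only: Fil_idx_eq[OF k(1,2)] if_True Fil_def) (intro gen, auto simp del: sets_measure_of_conv)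
    next
      case 2
      have "snd -` A \<inter> space P \<in> sets ?S" if "A \<in> sets borel" for A
        using measurable_sets[OF snd[OF 2(2)] that] by (simp only: S(2))
      moreover have "BM r -` A \<inter> space P \<in> sets ?S" if "r \<in> {0..p (i - 2)}" "A \<in> sets borel" for r A
        using measurable_sets[OF BM[OF 2(2) that(1)] that(2)] by (simp only: S(2))
      ultimately have "{snd -` A \<inter> space P | A. A \<in> sets borel} \<union>
        {BM r -` A \<inter> space P | r A. r \<in> {0..p (i - 2)} \<and> A \<in> sets borel} \<union> null_sets P \<subseteq> sets ?S"
        using null by (auto simp del: sets_measure_of_conv)
      from gen[OF this] show ?thesis using 2 unfolding Fil_idx_eq[OF k(1,2)] Fil0_def by simp
    next
      case 3 then show ?thesis unfolding Fil_idx_eq[OF k(1,2)] using gen[OF null] by simp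
    qed
  qed
  then show sp: "space (Fil_idx P p (int k - 2) (int i - 2)) = space P"
    and sub: "sets (Fil_idx P p (int k - 2) (int i - 2)) \<subseteq> sigma_sets (space P) (past_sets p (i - 1))"
    unfolding S(1) by blast+
  have "sigma_sets (space P) (past_sets p (i - 1)) \<subseteq> sets P" using ev by (rule sets.sigma_sets_subset)
  with sp sub show "subalgebra P (Fil_idx P p (int k - 2) (int i - 2))" by (simp add: subalgebra_def)
qed

lemma Fil_gen_measurable:
  fixes X :: "sample => real \<times> real"
  assumes "\<G> \<subseteq> Pow (space P)" "\<And>A. A \<in> sets borel ==> X -` A \<inter> space P \<in> \<G>"
  shows "X \<in> borel_measurable (sigma (space P) \<G>)"
proof (rule measurableI)
  fix A :: "(real \<times> real) set" assume "A \<in> sets borel"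
  from assms(2)[OF this] show "X -` A \<inter> space (sigma (space P) \<G>) \<in> sets (sigma (space P) \<G>)"
    using assms(1) by (simp add: sigma_sets.Basic)
qed simp

lemma Fil_increment_measurable:
  assumes "r \<in> {t..s}" shows "(\<lambda>\<omega>. BM r \<omega> - BM t \<omega>) \<in> borel_measurable (Fil P t s)"
  unfolding Fil_def
proof (rule Fil_gen_measurable)
  have "null_sets P \<subseteq> Pow (space P)" using sets.sets_into_space null_setsD2 by blast
  then show "{(\<lambda>\<omega>. BM r \<omega> - BM t \<omega>) -` A \<inter> space P | r A. r \<in> {t..s} \<and> A \<in> sets borel} \<union> null_sets P \<subseteq> Pow (space P)"
    by (intro Un_least) auto
qed (use assms in blast)

lemma Fil0_measurable:
  shows "snd \<in> borel_measurable (Fil0 P s)" and "r \<in> {0..s} ==> BM r \<in> borel_measurable (Fil0 P s)"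
proof -
  have "null_sets P \<subseteq> Pow (space P)" using sets.sets_into_space null_setsD2 by blast
  then have *: "{snd -` A \<inter> space P | A. A \<in> sets borel} \<union>
      {BM r -` A \<inter> space P | r A. r \<in> {0..s} \<and> A \<in> sets borel} \<union> null_sets P \<subseteq> Pow (space P)"
    by (intro Un_least) auto
  show "snd \<in> borel_measurable (Fil0 P s)" unfolding Fil0_def by (rule Fil_gen_measurable[OF *]) blast
  show "BM r \<in> borel_measurable (Fil0 P s)" if "r \<in> {0..s}"
    unfolding Fil0_def by (rule Fil_gen_measurable[OF *]) (use that in blast)
qed

lemma Fil_idx_zeta:
  assumes tp: "time_partition T N p" and k: "1 \<le> k" "k \<le> i" "i \<le> N" and l: "k - 1 \<le> l" "l < i - 1"
  shows "zeta p l \<in> borel_measurable (Fil_idx P p (int k - 2) (int i - 2))"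
proof -
  have i: "2 \<le> i" using l by simp
  have eq: "zeta p l = (\<lambda>\<omega>. quantile_pair p l (BM (p l) \<omega> - BM (p (l - 1)) \<omega>))" if "l \<noteq> 0"
    using that by (simp add: fun_eq_iff zeta_BM)
  show ?thesis
  proof (cases "2 \<le> k")
    case True
    have r: "p (l - 1) \<in> {p (k - 2)..p (i - 2)}" "p l \<in> {p (k - 2)..p (i - 2)}"
      using k l True by (auto intro!: partition_mono[OF tp])
    have "(\<lambda>\<omega>. quantile_pair p l ((BM (p l) \<omega> - BM (p (k - 2)) \<omega>) - (BM (p (l - 1)) \<omega> - BM (p (k - 2)) \<omega>)))
      \<in> borel_measurable (Fil P (p (k - 2)) (p (i - 2)))"
      by (intro measurable_compose[OF _ quantile_pair_measurable] borel_measurable_diff Fil_increment_measurable r)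
    then show ?thesis using l True by (simp add: Fil_idx_eq[OF k(1,2)] eq)
  next
    case False
    show ?thesis
    proof (cases "l = 0")
      case True
      then have "zeta p l = snd" by (simp add: zeta_def fun_eq_iff)
      then show ?thesis using False i Fil0_measurable(1) by (simp add: Fil_idx_eq[OF k(1,2)])
    next
      case l0: False
      have r: "p (l - 1) \<in> {0..p (i - 2)}" "p l \<in> {0..p (i - 2)}"
        using k l partition_range[OF tp, of "l - 1"] partition_range[OF tp, of l] by (auto intro!: partition_mono[OF tp])
      have "(\<lambda>\<omega>. quantile_pair p l (BM (p l) \<omega> - BM (p (l - 1)) \<omega>)) \<in> borel_measurable (Fil0 P (p (i - 2)))"
        by (intro measurable_compose[OF _ quantile_pair_measurable] borel_measurable_diff Fil0_measurable(2) r)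
      then show ?thesis using False i l0 by (simp add: Fil_idx_eq[OF k(1,2)] eq)
    qed
  qed
qed

text \<open>Conditioning fixes the \<open>i - k\<close> signals that precede number \<open>i - 1\<close> and averages over the rest.\<close>

theorem signals_cond_exp:
  fixes H :: "noise_seq => real"
  assumes tp: "time_partition T N p" and k: "1 \<le> k" "k \<le> i" "i \<le> N"
    and H: "H \<in> borel_measurable noise" and B: "\<And>y. \<bar>H y\<bar> \<le> B"
    and dep: "\<And>y y'. (\<And>l. l < N + 1 - k ==> y l = y' l) ==> H y = H y'"
  shows "AE \<omega> in P. real_cond_exp P (Fil_idx P p (int k - 2) (int i - 2)) (\<lambda>\<omega>. H (signals p k N \<omega>)) \<omega>
      = (noise_avg (i - k) H (signals p k N \<omega>))"
    and "(\<integral>\<omega>. H (signals p k N \<omega>) \<partial>P) = (\<integral>\<omega>. (noise_avg (i - k) H (signals p k N \<omega>)) \<partial>P)"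
proof -
  let ?F = "Fil_idx P p (int k - 2) (int i - 2)" and ?m = "i - 1" and ?Y = "signals p k N"
  note F = Fil_idx_past[OF tp k]
  have m: "?m \<le> N" using k by simp
  have "distr P (restr_to_subalg P ?F \<Otimes>\<^sub>M PiM {?m..<N} (\<lambda>_. unif2)) (\<lambda>\<omega>. (\<omega>, \<lambda>j\<in>{?m..<N}. zeta p j \<omega>))
    = restr_to_subalg P ?F \<Otimes>\<^sub>M PiM {?m..<N} (\<lambda>_. unif2)"
    by (rule independent_block[OF P.prob_space_axioms past_sets_Int_stable[OF tp m] past_sets_events[OF tp m] space_past_sets _ _ _ F(3,2)])
      (use zeta_measurable[OF tp] past_independent[OF tp m] in auto)
  moreover have "(\<lambda>\<omega>. (\<omega>, \<lambda>j\<in>{?m..<N}. zeta p j \<omega>)) = (\<lambda>\<omega>. (\<omega>, \<lambda>j\<in>{?m..<N}. ?Y \<omega> (i - k + (j - ?m))))"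
    using k by (auto simp: fun_eq_iff signals_def)
  ultimately have block: "distr P (restr_to_subalg P ?F \<Otimes>\<^sub>M PiM {?m..<N} (\<lambda>_. unif2)) (\<lambda>\<omega>. (\<omega>, \<lambda>j\<in>{?m..<N}. ?Y \<omega> (i - k + (j - ?m))))
    = restr_to_subalg P ?F \<Otimes>\<^sub>M PiM {?m..<N} (\<lambda>_. unif2)" by (simp only:)
  have fut: "(\<lambda>\<omega>. ?Y \<omega> (i - k + l)) \<in> borel_measurable P" if "l < N - ?m" for l
  proof -
    have "i - k + l < N + 1 - k" "k - 1 + (i - k + l) \<le> N" using that k by auto
    then show ?thesis using zeta_measurable[OF tp, of "k - 1 + (i - k + l)"] by (simp only: signals_def if_True)
  qed
  have past: "(\<lambda>\<omega>. ?Y \<omega> l) \<in> borel_measurable ?F" if "l < i - k" for l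
  proof -
    have "l < N + 1 - k" "k - 1 \<le> k - 1 + l" "k - 1 + l < i - 1" using that k by auto
    then show ?thesis using Fil_idx_zeta[OF tp k, of "k - 1 + l"] by (simp only: signals_def if_True)
  qed
  have n: "i - k + (N - ?m) = N + 1 - k" using k by simp
  note * = cond_exp_of_block[OF P.prob_space_axioms F(3) block fut past H B dep, unfolded n]
  show "AE \<omega> in P. real_cond_exp P ?F (\<lambda>\<omega>. H (?Y \<omega>)) \<omega> = (noise_avg (i - k) H (?Y \<omega>))"
    by (rule *(1)) auto
  show "(\<integral>\<omega>. H (?Y \<omega>) \<partial>P) = (\<integral>\<omega>. (noise_avg (i - k) H (?Y \<omega>)) \<partial>P)"
    by (rule *(2)) auto
qed

end

section \<open>From partitions to grids\<close>

lemma measurable_unif2: "measurable M unif2 = borel_measurable M"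
  by (rule measurable_cong_sets) simp_all

lemma cell_bounds:
  assumes tp: "time_partition T N p" and t: "0 \<le> t" "t < T"
  shows "1 \<le> cell N p t" "cell N p t \<le> N" "p (cell N p t - 1) \<le> t" "t < p (cell N p t)"
    and "1 \<le> k ==> k \<le> N ==> p (k - 1) \<le> t ==> t < p k ==> cell N p t = k"
proof -
  let ?Q = "\<lambda>k. 1 \<le> k \<and> k \<le> N \<and> p (k - 1) \<le> t \<and> t < p k"
  have "grid N p" using tp partition_strict[OF tp] by (auto simp: grid_def time_partition_def)
  moreover have "p 0 \<le> t" "t < p N" using tp t by (auto simp: time_partition_def)
  ultimately obtain j where "j < N" "p j \<le> t" "t < p (Suc j)" by (rule grid_cell)
  then have ex: "?Q (Suc j)" by simp
  have le: "k' \<le> k" if "?Q k" "?Q k'" for k k'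
  proof (rule ccontr)
    assume "\<not> k' \<le> k"
    then have "p k \<le> p (k' - 1)" using that by (intro partition_mono[OF tp]) auto
    then show False using that by simp
  qed
  then have un: "?Q k ==> ?Q k' ==> k = k'" for k k' by (meson order_antisym)
  have "?Q (cell N p t)" unfolding cell_def using theI[of ?Q, OF ex un[OF _ ex]] .
  then show "1 \<le> cell N p t" "cell N p t \<le> N" "p (cell N p t - 1) \<le> t" "t < p (cell N p t)" by auto
  show "cell N p t = k" if "1 \<le> k" "k \<le> N" "p (k - 1) \<le> t" "t < p k"
    by (rule un[OF \<open>?Q (cell N p t)\<close>]) (use that in auto)
qed

lemma mesh_less_iff:
  assumes "1 \<le> N" shows "mesh N p < \<delta> \<longleftrightarrow> (\<forall>j<N. p (Suc j) - p j < \<delta>)"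
proof -
  have "mesh N p < \<delta> \<longleftrightarrow> (\<forall>j\<in>{1..N}. p j - p (j - 1) < \<delta>)"
    unfolding mesh_def using assms by (subst Max_less_iff) auto
  also have "\<dots> \<longleftrightarrow> (\<forall>j<N. p (Suc j) - p j < \<delta>)"
  proof
    assume *: "\<forall>j\<in>{1..N}. p j - p (j - 1) < \<delta>"
    show "\<forall>j<N. p (Suc j) - p j < \<delta>" using *[rule_format, of "Suc _"] by simp
  next
    assume *: "\<forall>j<N. p (Suc j) - p j < \<delta>"
    show "\<forall>j\<in>{1..N}. p j - p (j - 1) < \<delta>"
    proof
      fix j assume "j \<in> {1..N}"
      then obtain i where "j = Suc i" "i < N" by (cases j) auto
      then show "p j - p (j - 1) < \<delta>" using * by simp
    qed
  qed
  finally show ?thesis .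
qed

definition induced_grid :: "nat => (nat => real) => real => nat => real" where
  "induced_grid N p t j = (if j = 0 then t else p (cell N p t - 1 + j))"

lemma induced_fgrid:
  assumes tp: "time_partition T N p" and t: "0 \<le> t" "t < T" and "mesh N p < \<delta>"
  shows "fgrid T \<delta> t (N + 1 - cell N p t) (induced_grid N p t)"
proof -
  note c = cell_bounds[OF tp t]
  define K where "K = cell N p t - 1"
  have K: "cell N p t = Suc K" "K < N" using c(1,2) by (simp_all add: K_def)
  have N: "1 \<le> N" using K by simp
  have step: "p (Suc j) - p j < \<delta>" if "j < N" for j
    using assms(4) that unfolding mesh_less_iff[OF N] by blast
  have ind: "induced_grid N p t j = (if j = 0 then t else p (K + j))" for j by (simp add: induced_grid_def K)
  have "induced_grid N p t j < induced_grid N p t (Suc j) \<and> induced_grid N p t (Suc j) - induced_grid N p t j < \<delta>" if "j < N - K" for j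
    using that c(3,4) K partition_strict[OF tp, of "K + j" "K + Suc j"] step[of "K + j"] by (auto simp: ind)
  then show ?thesis
    using K tp by (auto simp: fgrid_def grid_def ind time_partition_def)
qed

text \<open>Every fine grid of \<open>[t, T]\<close> extends to a fine partition of \<open>[0, T]\<close>, of which \<open>t\<close> is a time.\<close>

lemma fgrid_partition:
  assumes fg: "fgrid T \<delta> t n ts" and t: "0 \<le> t" and \<delta>: "\<delta> > 0"
  obtains N p where "time_partition T N p" "mesh N p < \<delta>" "N + 1 - cell N p t = n" "induced_grid N p t = ts"
    "p (cell N p t - 1) = t"
proof -
  have g: "grid n ts" and ts: "ts 0 = t" "ts n = T" and step: "\<And>j. j < n ==> ts (Suc j) - ts j < \<delta>" using fg by (auto simp: fgrid_def)
  have n: "1 \<le> n" using g by (simp add: grid_def)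
  have tT: "t < T" using grid_strict[OF g, of 0 n] n ts by simp
  \<comment> \<open>Cut \<open>[0, t]\<close> into \<open>m\<close> equal pieces, none if \<open>t = 0\<close>.\<close>
  define m where "m = (if t = 0 then 0 else nat \<lceil>t / \<delta>\<rceil> + 1)"
  define p where "p j = (if j < m then t * j / m else ts (j - m))" for j
  have m: "t < m * \<delta>" if "m \<noteq> 0"
  proof -
    have "t / \<delta> < m" using that by (simp add: m_def split: if_splits) linarith
    then show ?thesis using \<delta> by (simp add: field_simps)
  qed
  have m0: "t = 0" if "m = 0" using that by (simp add: m_def split: if_splits)
  have t0: "0 < t" if "m \<noteq> 0" using that t by (simp add: m_def split: if_splits)
  have pj: "p j = t * j / m" if "j \<le> m" "m \<noteq> 0" for j using that ts by (cases "j = m") (auto simp: p_def)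
  have inc: "p j < p (Suc j) \<and> p (Suc j) - p j < \<delta>" if "j < m + n" for j
  proof (cases "j < m")
    case True
    then have "p (Suc j) - p j = t / m" using pj[of j] pj[of "Suc j"] by (simp add: field_simps)
    moreover have "0 < t / m" "t / m < \<delta>" using m t0 True by (simp_all add: field_simps)
    ultimately show ?thesis by simp
  next
    case False
    then show ?thesis using that g step[of "j - m"] by (simp add: p_def grid_def Suc_diff_le)
  qed
  have "grid (m + n) p" using inc n by (simp add: grid_def)
  then have "strict_mono_on {..m + n} p" by (intro strict_mono_onI) (use grid_strict[of "m + n" p] in auto)
  moreover have p0: "p 0 = 0" using pj[of 0] ts m0 by (cases "m = 0") (auto simp: p_def)
  ultimately have tp: "time_partition T (m + n) p" using n ts by (simp add: time_partition_def p_def)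
  have pm: "p (m + j) = ts j" for j by (simp add: p_def)
  have cell: "cell (m + n) p t = Suc m"
    by (rule cell_bounds(5)[OF tp t tT]) (use n pm[of 0] pm[of 1] ts grid_strict[OF g, of 0 1] in auto)
  show ?thesis
  proof (rule that[OF tp])
    show "mesh (m + n) p < \<delta>" using inc n by (simp add: mesh_less_iff)
    show "m + n + 1 - cell (m + n) p t = n" by (simp add: cell)
    show "induced_grid (m + n) p t = ts" using ts(1) by (intro ext) (simp add: induced_grid_def cell pm)
    show "p (cell (m + n) p t - 1) = t" using pm[of 0] ts by (simp add: cell)
  qed
qed

locale wiener_partition = wiener +
  fixes N p t
  assumes tp: "time_partition T N p" and t: "0 \<le> t" "t < T"
begin

definition K where "K = cell N p t - 1"
abbreviation n where "n \<equiv> N + 1 - cell N p t"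
abbreviation ts where "ts \<equiv> induced_grid N p t"
abbreviation Y where "Y \<equiv> signals p (cell N p t) N"

lemma K: "cell N p t = Suc K" "K < N" "n = N - K"
  using cell_bounds(1,2)[OF tp t] by (simp_all add: K_def)

lemma fgrid: "mesh N p < \<delta> ==> fgrid T \<delta> t n ts"
  by (rule induced_fgrid[OF tp t])

lemma grid: "grid n ts" "ts 0 = t" "ts n = T" "1 \<le> n"
  using fgrid[of "mesh N p + 1"] K by (simp_all add: fgrid_def)

lemma stage_times:
  assumes "j < n"
  shows "max t (p (K + j)) = ts j" "p (Suc (K + j)) = ts (Suc j)" "j \<noteq> 0 ==> p (K + j) = ts j"
proof -
  have t1: "p K \<le> t" "t < p (Suc K)" using cell_bounds(3,4)[OF tp t] by (simp_all add: K(1))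
  have ind: "ts j = (if j = 0 then t else p (K + j))" for j by (simp add: induced_grid_def K(1))
  show "max t (p (K + j)) = ts j"
  proof (cases "j = 0")
    case True then show ?thesis using t1 by (simp add: ind)
  next
    case False
    then have "p (Suc K) \<le> p (K + j)" using assms K by (intro partition_mono[OF tp]) auto
    then show ?thesis using t1 False by (simp add: ind)
  qed
  show "p (Suc (K + j)) = ts (Suc j)" "j \<noteq> 0 ==> p (K + j) = ts j" by (simp_all add: ind)
qed

lemma stage_index:
  assumes "l \<in> {cell N p t..N}"
  obtains j where "j < n" "l = Suc (K + j)"
  by (rule that[of "l - Suc K"]) (use assms K in auto)

lemma Y_zeta: "j < n ==> Y \<omega> j = zeta p (K + j) \<omega>"
  by (simp add: signals_def K_def)

definition matches :: "('b::metric_space, 'a) sample_strategy => ('b, 'a) noise_strategy => bool" where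
  "matches \<alpha> a \<longleftrightarrow> (\<forall>\<omega>\<in>Omega T. \<forall>v\<in>ctrls t T. \<forall>s\<in>{t..<T}. \<alpha> \<omega> v s = a (Y \<omega>) v s)"

text \<open>What the player with the projection \<open>sel\<close> has observed at stage \<open>j\<close>, in the format of the first argument
  of a strategy for a partition. Stage \<open>j\<close> takes place in cell \<open>K + j + 1\<close>.\<close>

definition stage_signal :: "(real \<times> real => real) => nat => noise_seq => noise_seq \<times> real" where
  "stage_signal sel j y = ((\<lambda>i\<in>{K..<K + j}. y (i - K)), sel (y j))"

lemma stage_signal_measurable:
  assumes "sel \<in> borel_measurable borel"
  shows "stage_signal sel j \<in> measurable noise (signal_space (Suc K) (Suc (K + j)))"
proof -
  have c: "(\<lambda>y. y i) \<in> borel_measurable noise" for i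
    using measurable_component_singleton[of i UNIV "\<lambda>_. unif2"] by (simp add: noise_def measurable_unif2)
  show ?thesis
    unfolding stage_signal_def[abs_def] signal_space_def
    by (auto intro!: measurable_Pair measurable_restrict c measurable_compose[OF c assms])
qed

lemma stage_signal_Y:
  assumes "j < n" shows "stage_signal sel j (Y \<omega>) = signal sel p (Suc K) (Suc (K + j)) \<omega>"
  using assms by (auto simp: stage_signal_def signal_def Y_zeta fun_eq_iff)

lemma stage_signal_cong: "same_signal sel j y y' ==> stage_signal sel j y = stage_signal sel j y'"
  by (auto simp: stage_signal_def same_signal_def fun_eq_iff)

lemma agree_stage: "j < n ==> agree t (p (K + j)) v w \<longleftrightarrow> agree t (ts j) v w"
  using stage_times(1,3)[of j] by (cases "j = 0") (auto simp: agree_def)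

definition stage_map :: "(real \<times> real => real) => nat =>
    (noise_seq \<times> real => (real => 'b::metric_space) => real => 'a::metric_space) =>
    ('b, 'a) sample_strategy => bool" where
  "stage_map sel j b \<alpha> \<longleftrightarrow> (\<lambda>(y, s, v). b y v s) \<in> borel_measurable
        (signal_space (Suc K) (Suc (K + j)) \<Otimes>\<^sub>M (restrict_space borel {ts j..ts (Suc j)} \<Otimes>\<^sub>M ctrl_space t T)) \<and>
     (\<forall>v\<in>ctrls t T. \<forall>v'\<in>ctrls t T. agree t (ts j) v v' -->
        (\<forall>y\<in>space (signal_space (Suc K) (Suc (K + j))). agree (ts j) (ts (Suc j)) (b y v) (b y v'))) \<and>
     (\<forall>\<omega>\<in>Omega T. \<forall>v\<in>ctrls t T. \<forall>s\<in>{ts j..<ts (Suc j)}.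
        \<alpha> \<omega> v s = b (signal sel p (Suc K) (Suc (K + j)) \<omega>) v s)"

lemma strategies_stages:
  fixes \<alpha> :: "('b::metric_space, 'a::metric_space) sample_strategy"
  shows "\<alpha> \<in> strategies sel T N p t \<longleftrightarrow> (\<exists>b. \<forall>j<n. stage_map sel j (b j) \<alpha>)"
proof -
  let ?S = "\<lambda>l a. (\<lambda>(y, s, v). a y v s) \<in> borel_measurable
        (signal_space (cell N p t) l \<Otimes>\<^sub>M
         (restrict_space borel {max t (p (l - 1))..p l} \<Otimes>\<^sub>M ctrl_space t T)) \<and>
     (\<forall>v\<in>ctrls t T. \<forall>v'\<in>ctrls t T.
        (AE s in lebesgue_on {t..p (l - 1)}. v s = v' s) -->
        (\<forall>y\<in>space (signal_space (cell N p t) l).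
           AE s in lebesgue_on {max t (p (l - 1))..p l}. a y v s = a y v' s)) \<and>
     (\<forall>\<omega>\<in>Omega T. \<forall>v\<in>ctrls t T. \<forall>s\<in>{max t (p (l - 1))..<p l}.
        \<alpha> \<omega> v s = a (signal sel p (cell N p t) l \<omega>) v s)"
  have eq: "?S (Suc (K + j)) a \<longleftrightarrow> stage_map sel j a \<alpha>" if j: "j < n" for j a
    unfolding stage_map_def diff_Suc_1 stage_times(1,2)[OF j] K(1) agree_iff_AE_lebesgue_on[symmetric] agree_stage[OF j] ..
  have l: "Suc (K + j) \<in> {cell N p t..N}" if "j < n" for j using that K by auto
  have "\<alpha> \<in> strategies sel T N p t \<longleftrightarrow> (\<exists>a. \<forall>l\<in>{cell N p t..N}. ?S l (a l))"
    unfolding strategies_def by (rule mem_Collect_eq)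
  also have "\<dots> \<longleftrightarrow> (\<forall>l\<in>{cell N p t..N}. \<exists>a. ?S l a)" by (rule bchoice_iff[symmetric])
  also have "\<dots> \<longleftrightarrow> (\<forall>j<n. \<exists>b. stage_map sel j b \<alpha>)"
  proof (intro iffI ballI allI impI)
    fix j assume a: "\<forall>l\<in>{cell N p t..N}. \<exists>a. ?S l a" and j: "j < n"
    from a[rule_format, OF l[OF j]] show "\<exists>b. stage_map sel j b \<alpha>" unfolding eq[OF j] .
  next
    fix l assume b: "\<forall>j<n. \<exists>b. stage_map sel j b \<alpha>" and "l \<in> {cell N p t..N}"
    then obtain j where j: "j < n" "l = Suc (K + j)" by (elim stage_index)
    from b[rule_format, OF j(1)] show "\<exists>a. ?S l a" unfolding j(2) eq[OF j(1)] .
  qed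
  also have "\<dots> \<longleftrightarrow> (\<exists>b. \<forall>j<n. stage_map sel j (b j) \<alpha>)" by (rule choice_iff')
  finally show ?thesis .
qed

text \<open>The strategy is assembled from its maps for the single stages. The stage is read off from the time, and
  joint measurability follows stage by stage.\<close>

lemma strategies_reduce:
  fixes \<alpha> :: "('b::metric_space, 'a::metric_space) sample_strategy"
  assumes sel: "sel \<in> borel_measurable borel" and \<alpha>: "\<alpha> \<in> strategies sel T N p t"
  obtains a where "a \<in> rstrat sel n ts" "matches \<alpha> a"
proof -
  from \<alpha> obtain b where b: "\<And>j. j < n ==> stage_map sel j (b j) \<alpha>" unfolding strategies_stages by auto
  define J where "J s = (if s \<in> {t..<T} then LEAST j. s < ts (Suc j) else 0)" for s
  have J: "J s = j" if "j < n" "ts j \<le> s" "s < ts (Suc j)" for s j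
  proof -
    have "(LEAST j. s < ts (Suc j)) = j"
    proof (rule Least_equality)
      fix i assume i: "s < ts (Suc i)"
      show "j \<le> i"
      proof (rule ccontr)
        assume "\<not> j \<le> i"
        then have "ts (Suc i) \<le> ts j" using that(1) by (intro grid_mono[OF grid(1)]) auto
        then show False using that i by simp
      qed
    qed (rule that(3))
    moreover have "t \<le> ts j" "ts (Suc j) \<le> T" using that(1) grid(2,3) grid_mono[OF grid(1), of 0 j] grid_mono[OF grid(1), of "Suc j" n] by auto
    ultimately show ?thesis using that by (simp add: J_def)
  qed
  have Jn: "J s \<in> {..<n}" for s
  proof (cases "s \<in> {t..<T}")
    case True
    then obtain j where "j < n" "ts j \<le> s" "s < ts (Suc j)"
      using grid_cell[OF grid(1), of s] grid(2,3) by auto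
    then show ?thesis using J by simp
  next
    case False
    then show ?thesis using grid(4) by (auto simp: J_def)
  qed
  \<comment> \<open>The map of stage \<open>j\<close> is given on \<open>[ts j, ts (Suc j)]\<close> only, so the time is clamped.\<close>
  define c where "c j s = max (ts j) (min (ts (Suc j)) s)" for j s
  define a where "a y w s = b (J s) (stage_signal sel (J s) y) w (c (J s) s)" for y :: noise_seq and w s
  have aj: "a y w s = b j (stage_signal sel j y) w s" if "j < n" "ts j \<le> s" "s < ts (Suc j)" for y w s j
    using that J[OF that] by (simp add: a_def c_def)
  have sg: "stage_signal sel j y \<in> space (signal_space (Suc K) (Suc (K + j)))" for j y
    using measurable_space[OF stage_signal_measurable[OF sel], of y] by simp
  let ?M = "noise \<Otimes>\<^sub>M (ctrl_space t T \<Otimes>\<^sub>M borel) :: (noise_seq \<times> (real => 'b) \<times> real) measure"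
  have "(\<lambda>x. b (J (snd (snd x))) (stage_signal sel (J (snd (snd x))) (fst x)) (fst (snd x)) (c (J (snd (snd x))) (snd (snd x))))
    \<in> borel_measurable ?M"
  proof (rule measurable_compose_countable'[where I="{..<n}" and g="\<lambda>x. J (snd (snd x))"])
    fix j assume "j \<in> {..<n}"
    then have j: "j < n" by simp
    have "c j \<in> borel_measurable borel" unfolding c_def[abs_def] by measurable
    then have c: "c j \<in> borel \<rightarrow>\<^sub>M restrict_space borel {ts j..ts (Suc j)}"
      using grid(1) j by (intro measurable_restrict_space2) (auto simp: c_def grid_def less_imp_le)
    have "(\<lambda>x. (stage_signal sel j (fst x), c j (snd (snd x)), fst (snd x))) \<in> measurable ?M
      (signal_space (Suc K) (Suc (K + j)) \<Otimes>\<^sub>M (restrict_space borel {ts j..ts (Suc j)} \<Otimes>\<^sub>M ctrl_space t T))"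
      by (intro measurable_Pair measurable_compose[OF measurable_fst stage_signal_measurable[OF sel]] measurable_compose[OF _ c]) measurable
    moreover have "(\<lambda>(y, s, v). b j y v s) \<in> borel_measurable
      (signal_space (Suc K) (Suc (K + j)) \<Otimes>\<^sub>M (restrict_space borel {ts j..ts (Suc j)} \<Otimes>\<^sub>M ctrl_space t T))"
      using b[OF j] unfolding stage_map_def by blast
    ultimately show "(\<lambda>x. b j (stage_signal sel j (fst x)) (fst (snd x)) (c j (snd (snd x)))) \<in> borel_measurable ?M"
      by (auto dest: measurable_compose)
  next
    have "J \<in> borel \<rightarrow>\<^sub>M count_space UNIV" unfolding J_def by measurable
    then have "J \<in> borel \<rightarrow>\<^sub>M count_space {..<n}" using Jn by (simp add: measurable_count_space_eq2_countable)
    then show "(\<lambda>x. J (snd (snd x))) \<in> ?M \<rightarrow>\<^sub>M count_space {..<n}" by measurable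
  qed simp
  then have "(\<lambda>(y, w, s). a y w s) \<in> borel_measurable ?M" by (simp add: a_def case_prod_beta')
  then have "a \<in> rstrat sel n ts"
    unfolding rstrat_def grid(2,3)
  proof (intro CollectI conjI allI impI ballI)
    fix j y y' and w :: "real => 'b" and s assume "j < n" "same_signal sel j y y'" "s \<in> {ts j..<ts (Suc j)}"
    then show "a y w s = a y' w s" using stage_signal_cong[of sel j y y'] by (simp add: aj)
  next
    fix j y and w w' :: "real => 'b" assume j: "j < n" and w: "w \<in> ctrls t T" "w' \<in> ctrls t T"
      and ag: "agree t (ts j) w w'"
    have "agree (ts j) (ts (Suc j)) (b j (stage_signal sel j y) w) (b j (stage_signal sel j y) w')"
      using b[OF j] w ag sg unfolding stage_map_def by blast
    then show "agree (ts j) (ts (Suc j)) (a y w) (a y w')"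
      by (subst agree_cong[OF aj aj]) (use j in auto)
  qed
  moreover have "matches \<alpha> a"
    unfolding matches_def
  proof (intro ballI)
    fix \<omega> and v :: "real => 'b" and s assume \<omega>: "\<omega> \<in> Omega T" and v: "v \<in> ctrls t T" and s: "s \<in> {t..<T}"
    then obtain j where j: "j < n" "ts j \<le> s" "s < ts (Suc j)"
      using grid_cell[OF grid(1), of s] grid(2,3) by auto
    have "\<alpha> \<omega> v s = b j (signal sel p (Suc K) (Suc (K + j)) \<omega>) v s"
      using b[OF j(1)] \<omega> v j(2,3) unfolding stage_map_def by auto
    then show "\<alpha> \<omega> v s = a (Y \<omega>) v s" unfolding aj[OF j] stage_signal_Y[OF j(1)] .
  qed
  ultimately show ?thesis by (rule that)
qed

text \<open>Conversely, the map of stage \<open>j\<close> has to be a function of the observations made until then. They are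
  completed to a noise sequence: \<open>emb\<close> completes the observed component of the current pair, and the
  later pairs are \<open>0\<close>. The strategy does not distinguish this sequence from the true one.\<close>

lemma strategies_lift:
  fixes a :: "('b::metric_space, 'a::metric_space) noise_strategy"
  assumes a: "a \<in> rstrat sel n ts" and emb: "emb \<in> borel_measurable borel" "\<And>c. sel (emb c) = c"
  shows "(\<lambda>\<omega>. a (Y \<omega>)) \<in> strategies sel T N p t" and "matches (\<lambda>\<omega>. a (Y \<omega>)) a"
proof -
  define gl where "gl j z i = (if i < j then fst z (K + i) else if i = j then emb (snd z) else 0)"
    for j i and z :: "noise_seq \<times> real"
  have gl: "gl j \<in> measurable (signal_space (Suc K) (Suc (K + j))) noise" for j
    unfolding noise_def
  proof (rule measurable_PiM_single')
    fix i
    have 1: "(\<lambda>z. fst z (K + i)) \<in> borel_measurable (signal_space (Suc K) (Suc (K + j)))" if "i < j"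
      unfolding signal_space_def
      by (rule measurable_compose[OF measurable_fst measurable_component_singleton]) (use that in simp)
    have 2: "(\<lambda>z. emb (snd z)) \<in> borel_measurable (signal_space (Suc K) (Suc (K + j)))"
      unfolding signal_space_def by (rule measurable_compose[OF measurable_snd emb(1)])
    consider "i < j" | "i = j" | "i > j" by linarith
    then show "(\<lambda>z. gl j z i) \<in> measurable (signal_space (Suc K) (Suc (K + j))) unif2"
      unfolding gl_def measurable_unif2 using 1 2 by cases simp_all
  qed simp
  have same: "same_signal sel j y (gl j (stage_signal sel j y))" for j y
    by (simp add: same_signal_def gl_def stage_signal_def emb)
  have "stage_map sel j (\<lambda>z. a (gl j z)) (\<lambda>\<omega>. a (Y \<omega>))" if j: "j < n" for j
    unfolding stage_map_def
  proof (intro conjI ballI impI)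
    let ?M = "signal_space (Suc K) (Suc (K + j)) \<Otimes>\<^sub>M (restrict_space borel {ts j..ts (Suc j)} \<Otimes>\<^sub>M ctrl_space t T :: (real \<times> (real => 'b)) measure)"
    have "(\<lambda>x. a (gl j (fst x)) (snd (snd x)) (fst (snd x))) \<in> borel_measurable ?M"
    proof (rule rstrat_compose_measurable[OF a])
      show "(\<lambda>x. gl j (fst x)) \<in> measurable ?M noise" by (rule measurable_compose[OF measurable_fst gl])
      show "(\<lambda>x. snd (snd x)) \<in> measurable ?M (ctrl_space (ts 0) (ts n))"
        unfolding grid(2,3) by (rule measurable_compose[OF measurable_snd measurable_snd])
      have "(\<lambda>x. fst (snd x)) \<in> measurable ?M (restrict_space borel {ts j..ts (Suc j)})"
        by (rule measurable_compose[OF measurable_snd measurable_fst])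
      moreover have "(\<lambda>s :: real. s) \<in> measurable (restrict_space borel {ts j..ts (Suc j)}) borel"
        by (intro measurable_restrict_space1) simp
      ultimately show "(\<lambda>x. fst (snd x)) \<in> borel_measurable ?M" by (rule measurable_compose)
    qed
    then show "(\<lambda>(y, s, v). a (gl j y) v s) \<in> borel_measurable ?M" by (simp add: case_prod_beta')
  next
    fix v v' :: "real => 'b" and z assume "v \<in> ctrls t T" "v' \<in> ctrls t T" "agree t (ts j) v v'"
    then show "agree (ts j) (ts (Suc j)) (a (gl j z) v) (a (gl j z) v')"
      by (rule rstrat_nonanticipating[OF a j, unfolded grid(2,3)])
  next
    fix \<omega> and v :: "real => 'b" and s assume "v \<in> ctrls t T" "s \<in> {ts j..<ts (Suc j)}"
    then show "a (Y \<omega>) v s = a (gl j (signal sel p (Suc K) (Suc (K + j)) \<omega>)) v s"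
      using rstrat_signal[OF a j same[of j "Y \<omega>"], unfolded grid(2,3), of v s] by (simp add: stage_signal_Y[OF j])
  qed
  then show "(\<lambda>\<omega>. a (Y \<omega>)) \<in> strategies sel T N p t" unfolding strategies_stages
    by (intro exI[of _ "\<lambda>j z. a (gl j z)"]) simp
  show "matches (\<lambda>\<omega>. a (Y \<omega>)) a" by (simp add: matches_def)
qed

end

lemma ctrl_space_const: "(\<lambda>_. c) \<in> ctrls t T"
  by (rule borel_in_ctrl) simp

lemma ctrl_space_cong:
  assumes w: "w \<in> ctrls t T" and eq: "\<And>s. t \<le> s ==> s < T ==> w' s = w s"
  shows "w' \<in> ctrls t T"
proof -
  have "(\<lambda>s. if s \<in> {T} then w' T else w s) \<in> borel_measurable (lebesgue_on {t..T})"
  proof (rule measurable_If_set)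
    show "{T} \<inter> space (lebesgue_on {t..T}) \<in> sets (lebesgue_on {t..T})"
      by (cases "t \<le> T") (auto simp: sets_restrict_space space_restrict_space image_iff intro!: bexI[of _ "{T}"])
  qed (use w in "auto simp: space_ctrl")
  moreover have "(if s \<in> {T} then w' T else w s) = w' s" if "s \<in> space (lebesgue_on {t..T})" for s
    using that eq[of s] by (auto simp: space_restrict_space)
  ultimately have "w' \<in> borel_measurable (lebesgue_on {t..T})" by (rule measurable_cong[THEN iffD1, rotated])
  then show ?thesis by (simp add: space_ctrl)
qed

lemma rctrl_rstrat:
  assumes u: "u \<in> rctrl sel n ts" shows "(\<lambda>y w. u y) \<in> rstrat sel n ts"
proof -
  have "(\<lambda>x. (fst x, snd (snd x))) \<in> measurable (play_space (ts 0) (ts n)) (noise \<Otimes>\<^sub>M borel)"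
    by (intro measurable_Pair measurable_fst measurable_compose[OF measurable_snd measurable_snd])
  from measurable_compose[OF this rctrl_measurable[OF u]]
  have "(\<lambda>(y, w, s). u y s) \<in> borel_measurable (play_space (ts 0) (ts n))"
    by (simp add: case_prod_beta')
  then show ?thesis using rctrl_signal[OF u] by (simp add: rstrat_def)
qed

lemma rstrat_rctrl:
  assumes a: "a \<in> rstrat sel n ts" and w: "w \<in> ctrls (ts 0) (ts n)"
  shows "(\<lambda>y. a y w) \<in> rctrl sel n ts"
proof -
  have "(\<lambda>x. a (fst x) w (snd x)) \<in> borel_measurable (noise \<Otimes>\<^sub>M borel)"
    by (rule rstrat_compose_measurable[OF a]) (use w in auto)
  then show ?thesis using rstrat_signal[OF a _ _ w] by (simp add: rctrl_def case_prod_beta')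
qed

text \<open>Controls are strategies that ignore the opponent, and a strategy becomes a control when the control of
  the opponent is fixed. In this way the correspondence for strategies yields one for controls.\<close>

lemma controls_strategies:
  fixes u :: "sample => real => 'a::metric_space"
  assumes u: "u \<in> controls sel T N p t"
  shows "(\<lambda>\<omega> (v :: real => 'b::metric_space) s. u \<omega> s) \<in> strategies sel T N p t"
proof -
  from u obtain a where a: "\<forall>l\<in>{cell N p t..N}. (\<lambda>(y, s). a l y s) \<in> borel_measurable
        (signal_space (cell N p t) l \<Otimes>\<^sub>M restrict_space borel {max t (p (l - 1))..p l}) \<and>
     (\<forall>\<omega>\<in>Omega T. \<forall>s\<in>{max t (p (l - 1))..<p l}. u \<omega> s = a l (signal sel p (cell N p t) l \<omega>) s)"
    unfolding controls_def by (elim CollectE exE)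
  show ?thesis unfolding strategies_def
  proof (intro CollectI exI[of _ "\<lambda>l y v s. a l y s"] ballI conjI)
    fix l assume l: "l \<in> {cell N p t..N}"
    let ?R = "restrict_space borel {max t (p (l - 1))..p l} :: real measure"
    have "(\<lambda>x. (fst x, fst (snd x))) \<in> measurable (signal_space (cell N p t) l \<Otimes>\<^sub>M (?R \<Otimes>\<^sub>M (ctrl_space t T :: (real => 'b) measure)))
       (signal_space (cell N p t) l \<Otimes>\<^sub>M ?R)"
      by (intro measurable_Pair measurable_fst measurable_compose[OF measurable_snd measurable_fst])
    from measurable_compose[OF this bspec[OF a l, THEN conjunct1]]
    show "(\<lambda>(y, s, v). a l y s) \<in> borel_measurable (signal_space (cell N p t) l \<Otimes>\<^sub>M (?R \<Otimes>\<^sub>M (ctrl_space t T :: (real => 'b) measure)))"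
      by (simp add: case_prod_beta')
  qed (use a in simp_all)
qed

lemma strategies_controls:
  fixes \<alpha> :: "('b::metric_space, 'a::metric_space) sample_strategy"
  assumes \<alpha>: "\<alpha> \<in> strategies sel T N p t" and w: "w \<in> ctrls t T"
  shows "(\<lambda>\<omega>. \<alpha> \<omega> w) \<in> controls sel T N p t"
proof -
  from \<alpha> obtain a where a: "\<forall>l\<in>{cell N p t..N}. (\<lambda>(y, s, v). a l y v s) \<in> borel_measurable
        (signal_space (cell N p t) l \<Otimes>\<^sub>M
         (restrict_space borel {max t (p (l - 1))..p l} \<Otimes>\<^sub>M ctrl_space t T)) \<and>
     (\<forall>v\<in>ctrls t T. \<forall>v'\<in>ctrls t T.
        (AE s in lebesgue_on {t..p (l - 1)}. v s = v' s) -->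
        (\<forall>y\<in>space (signal_space (cell N p t) l).
           AE s in lebesgue_on {max t (p (l - 1))..p l}. a l y v s = a l y v' s)) \<and>
     (\<forall>\<omega>\<in>Omega T. \<forall>v\<in>ctrls t T. \<forall>s\<in>{max t (p (l - 1))..<p l}.
        \<alpha> \<omega> v s = a l (signal sel p (cell N p t) l \<omega>) v s)"
    unfolding strategies_def by (elim CollectE exE)
  show ?thesis unfolding controls_def
  proof (intro CollectI exI[of _ "\<lambda>l y. a l y w"] ballI conjI)
    fix l assume l: "l \<in> {cell N p t..N}"
    let ?R = "restrict_space borel {max t (p (l - 1))..p l} :: real measure"
    have "(\<lambda>x. (fst x, snd x, w)) \<in> measurable (signal_space (cell N p t) l \<Otimes>\<^sub>M ?R) (signal_space (cell N p t) l \<Otimes>\<^sub>M (?R \<Otimes>\<^sub>M ctrl_space t T))"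
      using w by (intro measurable_Pair measurable_fst measurable_snd measurable_const)
    from measurable_compose[OF this bspec[OF a l, THEN conjunct1]]
    show "(\<lambda>(y, s). a l y w s) \<in> borel_measurable (signal_space (cell N p t) l \<Otimes>\<^sub>M ?R)"
      by (simp add: case_prod_beta')
  qed (use a w in simp_all)
qed

context wiener_partition
begin

lemma controls_reduce:
  fixes u :: "sample => real => 'a::metric_space"
  assumes sel: "sel \<in> borel_measurable borel" and u: "u \<in> controls sel T N p t"
  obtains u' where "u' \<in> rctrl sel n ts" "\<And>\<omega> s. \<omega> \<in> Omega T ==> t \<le> s ==> s < T ==> u \<omega> s = u' (Y \<omega>) s"
proof -
  obtain a where a: "a \<in> rstrat sel n ts" "matches (\<lambda>\<omega> (v :: real => real) s. u \<omega> s) a"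
    by (rule strategies_reduce[OF sel controls_strategies[OF u]])
  show ?thesis
  proof (rule that)
    show "(\<lambda>y. a y (\<lambda>_. 0)) \<in> rctrl sel n ts" by (rule rstrat_rctrl[OF a(1) ctrl_space_const])
    show "u \<omega> s = a (Y \<omega>) (\<lambda>_. 0) s" if "\<omega> \<in> Omega T" "t \<le> s" "s < T" for \<omega> s
      using a(2) that ctrl_space_const[of "0 :: real" t T] unfolding matches_def by simp
  qed
qed

lemma controls_lift:
  fixes u :: "'a::metric_space noise_control"
  assumes u: "u \<in> rctrl sel n ts" and emb: "emb \<in> borel_measurable borel" "\<And>c. sel (emb c) = c"
  shows "(\<lambda>\<omega>. u (Y \<omega>)) \<in> controls sel T N p t"
proof -
  have "(\<lambda>\<omega> (w :: real => real). u (Y \<omega>)) \<in> strategies sel T N p t"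
    by (rule strategies_lift(1)[OF rctrl_rstrat[OF u] emb])
  from strategies_controls[OF this ctrl_space_const[of 0]] show ?thesis .
qed

end

locale wiener_game = wiener T W + noise_game f C L fst snd
  for T W and f :: "real^'n => 'u::metric_space => 'v::metric_space => real^'n" and C L :: real

locale wiener_game_partition = wiener_game T W f C L + wiener_partition T W N p t
  for T W and f :: "real^'n => 'u::metric_space => 'v::metric_space => real^'n" and C L :: real and N p t
begin

lemma emb_fst: "(\<lambda>c :: real. (c, 0 :: real)) \<in> borel_measurable borel"
  and emb_snd: "(\<lambda>c :: real. (0 :: real, c)) \<in> borel_measurable borel"
  and sel_fst: "(fst :: real \<times> real => real) \<in> borel_measurable borel"
  and sel_snd: "(snd :: real \<times> real => real) \<in> borel_measurable borel"
  by (auto intro!: borel_measurable_continuous_onI continuous_intros)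

lemmas reduce_I = strategies_reduce[OF sel_fst]
lemmas reduce_II = strategies_reduce[OF sel_snd]
lemmas lift_I = strategies_lift[where sel=fst, OF _ emb_fst fst_conv]
lemmas lift_II = strategies_lift[where sel=snd, OF _ emb_snd snd_conv]
lemmas control_lift_I = controls_lift[where sel=fst, OF _ emb_fst fst_conv]
lemmas control_lift_II = controls_lift[where sel=snd, OF _ emb_snd snd_conv]

lemma final_signals:
  assumes pf: "payoff_function B K' g" and u: "u \<in> rctrl fst n ts" and v: "v \<in> rctrl snd n ts"
  shows "(\<lambda>y. g (traj f t T x (u y) (v y) T)) \<in> borel_measurable noise"
    and "\<bar>g (traj f t T x (u y) (v y) T)\<bar> \<le> B"
    and "(\<And>l. l < n ==> y l = y' l) ==> g (traj f t T x (u y) (v y) T) = g (traj f t T x (u y') (v y') T)"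
proof -
  show "(\<lambda>y. g (traj f t T x (u y) (v y) T)) \<in> borel_measurable noise"
    by (rule final_payoff_measurable[OF pf u v]) (use t in simp)
  show "\<bar>g (traj f t T x (u y) (v y) T)\<bar> \<le> B" using pf by (simp add: payoff_function_def)
  show "g (traj f t T x (u y) (v y) T) = g (traj f t T x (u y') (v y') T)" if "\<And>l. l < n ==> y l = y' l"
    using traj_past[OF grid(1) u v order.refl that] unfolding grid(2,3) by simp
qed

text \<open>The signals have the law of the noise sequence in all entries on which the payoff depends: this is the
  case of conditioning on nothing.\<close>

lemma payoff_signals:
  assumes pf: "payoff_function B K' g" and u': "u' \<in> rctrl fst n ts" and v': "v' \<in> rctrl snd n ts"
    and u: "\<And>\<omega>. \<omega> \<in> Omega T ==> u \<omega> \<in> ctrls t T \<and> agree t T (u \<omega>) (u' (Y \<omega>))"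
    and v: "\<And>\<omega>. \<omega> \<in> Omega T ==> v \<omega> \<in> ctrls t T \<and> agree t T (v \<omega>) (v' (Y \<omega>))"
  shows "payoff P f g T t x u v = (\<integral>y. g (traj f t T x (u' y) (v' y) T) \<partial>noise)"
proof -
  let ?H = "\<lambda>y. g (traj f t T x (u' y) (v' y) T)"
  have "payoff P f g T t x u v = (\<integral>\<omega>. ?H (Y \<omega>) \<partial>P)"
    unfolding payoff_def
  proof (rule Bochner_Integration.integral_cong[OF refl])
    fix \<omega> assume "\<omega> \<in> space P"
    then have "\<omega> \<in> Omega T" by (simp add: space_P)
    then show "g (traj f t T x (u \<omega>) (v \<omega>) T) = ?H (Y \<omega>)"
      using u v t rctrl_ctrl[OF u'] rctrl_ctrl[OF v'] by (subst traj_cong[where u'="u' (Y \<omega>)" and v'="v' (Y \<omega>)"]) auto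
  qed
  also have "\<dots> = (\<integral>\<omega>. (\<integral>z. ?H (comb_seq (cell N p t - cell N p t) (Y \<omega>) z) \<partial>noise) \<partial>P)"
    using cell_bounds(1,2)[OF tp t]
    by (rule signals_cond_exp(2)[OF tp _ order.refl _ final_signals[OF pf u' v']])
  also have "\<dots> = (\<integral>y. ?H y \<partial>noise)"
  proof -
    have "comb_seq (cell N p t - cell N p t) y z = z" for y z :: noise_seq by (simp add: comb_seq_def fun_eq_iff)
    then show ?thesis by (simp add: P.prob_space)
  qed
  finally show ?thesis .
qed

lemma associated_plays:
  assumes \<alpha>: "matches \<alpha> a" and \<beta>: "matches \<beta> b" and uv: "associated T N p t \<alpha> \<beta> u v" and \<omega>: "\<omega> \<in> Omega T"
  shows "plays t T (a (Y \<omega>)) (b (Y \<omega>)) (u \<omega>) (v \<omega>)"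
proof -
  obtain u' where u': "u' \<in> rctrl fst n ts" "\<And>s. t \<le> s ==> s < T ==> u \<omega> s = u' (Y \<omega>) s"
    using controls_reduce[OF sel_fst, of u] uv \<omega> unfolding associated_def by metis
  obtain v' where v': "v' \<in> rctrl snd n ts" "\<And>s. t \<le> s ==> s < T ==> v \<omega> s = v' (Y \<omega>) s"
    using controls_reduce[OF sel_snd, of v] uv \<omega> unfolding associated_def by metis
  have u: "u \<omega> \<in> ctrls t T" by (rule ctrl_space_cong[OF rctrl_ctrl[OF u'(1)] u'(2)])
  have v: "v \<omega> \<in> ctrls t T" by (rule ctrl_space_cong[OF rctrl_ctrl[OF v'(1)] v'(2)])
  have "agree t T (\<alpha> \<omega> (v \<omega>)) (u \<omega>)" "agree t T (\<beta> \<omega> (u \<omega>)) (v \<omega>)"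
    using uv \<omega> unfolding associated_def agree_iff_AE_lebesgue_on by blast+
  moreover have "agree t T (a (Y \<omega>) (v \<omega>)) (\<alpha> \<omega> (v \<omega>))" "agree t T (b (Y \<omega>) (u \<omega>)) (\<beta> \<omega> (u \<omega>))"
    using \<alpha> \<beta> \<omega> u v by (auto simp: matches_def intro!: agreeI)
  ultimately show ?thesis unfolding plays_def using u v by (blast intro: agree_trans)
qed

text \<open>The associated pairs all agree almost everywhere with the one play of \<open>a\<close> and \<open>b\<close> along the signals. So
  they have the same payoff, and the definite description denotes it.\<close>

lemma spayoff_rpay:
  assumes pf: "payoff_function B K' g" and a: "a \<in> rstrat fst n ts" and b: "b \<in> rstrat snd n ts"
    and \<alpha>: "matches \<alpha> a" and \<beta>: "matches \<beta> b"
  shows "spayoff P f g T N p t x \<alpha> \<beta> = rpay n ts g x a b"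
proof -
  obtain u v where u: "u \<in> rctrl fst n ts" and v: "v \<in> rctrl snd n ts"
    and pl: "\<And>y. plays (ts 0) (ts n) (a y) (b y) (u y) (v y)"
    by (rule plays_exists[OF grid(1) a b]) auto
  have r: "rpay n ts g x a b = (\<integral>y. g (traj f t T x (u y) (v y) T) \<partial>noise)"
    using rpay_eq[OF grid(1) a b pl, of g x] by (simp only: grid)
  have uni: "payoff P f g T t x u2 v2 = rpay n ts g x a b" if as: "associated T N p t \<alpha> \<beta> u2 v2" for u2 v2
    unfolding r
  proof (rule payoff_signals[OF pf u v])
    fix \<omega> assume \<omega>: "\<omega> \<in> Omega T"
    have "plays (ts 0) (ts n) (a (Y \<omega>)) (b (Y \<omega>)) (u2 \<omega>) (v2 \<omega>)"
      using associated_plays[OF \<alpha> \<beta> as \<omega>] by (simp only: grid)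
    from plays_unique[OF grid(1) a b this pl] this
    show "u2 \<omega> \<in> ctrls t T \<and> agree t T (u2 \<omega>) (u (Y \<omega>))"
      "v2 \<omega> \<in> ctrls t T \<and> agree t T (v2 \<omega>) (v (Y \<omega>))"
      unfolding plays_def grid(2,3) by blast+
  qed
  have as: "associated T N p t \<alpha> \<beta> (\<lambda>\<omega>. u (Y \<omega>)) (\<lambda>\<omega>. v (Y \<omega>))"
    unfolding associated_def
  proof (intro conjI ballI)
    show "(\<lambda>\<omega>. u (Y \<omega>)) \<in> controls fst T N p t" by (rule control_lift_I[OF u])
    show "(\<lambda>\<omega>. v (Y \<omega>)) \<in> controls snd T N p t" by (rule control_lift_II[OF v])
    fix \<omega> assume \<omega>: "\<omega> \<in> Omega T"
    have "plays t T (a (Y \<omega>)) (b (Y \<omega>)) (u (Y \<omega>)) (v (Y \<omega>))" using pl[of "Y \<omega>"] by (simp only: grid)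
    moreover from this have "agree t T (\<alpha> \<omega> (v (Y \<omega>))) (a (Y \<omega>) (v (Y \<omega>)))" "agree t T (\<beta> \<omega> (u (Y \<omega>))) (b (Y \<omega>) (u (Y \<omega>)))"
      using \<alpha> \<beta> \<omega> unfolding matches_def plays_def by (auto intro!: agreeI)
    ultimately show "AE s in lebesgue_on {t..T}. \<alpha> \<omega> (v (Y \<omega>)) s = u (Y \<omega>) s" "AE s in lebesgue_on {t..T}. \<beta> \<omega> (u (Y \<omega>)) s = v (Y \<omega>) s"
      unfolding agree_iff_AE_lebesgue_on[symmetric] plays_def by (blast intro: agree_trans)+
  qed
  show ?thesis unfolding spayoff_def
  proof (rule the_equality)
    show "\<exists>u v. associated T N p t \<alpha> \<beta> u v \<and> rpay n ts g x a b = payoff P f g T t x u v"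
      using as uni[OF as] by (intro exI conjI) auto
  qed (use uni in auto)
qed

end

section \<open>The two conditions on grids\<close>

lemma eventually_mesh_to_0:
  "(\<forall>\<^sub>F (N, p) in mesh_to_0 T. Q N p) \<longleftrightarrow> (\<exists>\<delta>>0. \<forall>N p. time_partition T N p \<and> mesh N p < \<delta> --> Q N p)"
  unfolding mesh_to_0_def by (subst eventually_INF_principal_mono) auto

text \<open>Limits over partitions of \<open>[0, T]\<close> are limits over grids of \<open>[t, T]\<close>: every grid is induced by
  a partition, and that is no coarser.\<close>

lemma fine_grids_mesh:
  assumes t: "0 \<le> t" "t < T"
  shows "fine_grids T t = filtermap (\<lambda>(N, p). (N + 1 - cell N p t, induced_grid N p t)) (mesh_to_0 T)"
proof (rule filter_eqI)
  fix Q :: "nat \<times> (nat => real) => bool"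
  have "(\<exists>\<delta>>0. \<forall>n ts. fgrid T \<delta> t n ts --> Q (n, ts)) \<longleftrightarrow>
    (\<exists>\<delta>>0. \<forall>N p. time_partition T N p \<and> mesh N p < \<delta> --> Q (N + 1 - cell N p t, induced_grid N p t))"
  proof (intro ex_cong1 conj_cong refl iffI allI impI)
    fix \<delta> :: real and n ts
    assume \<delta>: "\<delta> > 0" and *: "\<forall>N p. time_partition T N p \<and> mesh N p < \<delta> --> Q (N + 1 - cell N p t, induced_grid N p t)"
      and fg: "fgrid T \<delta> t n ts"
    obtain N p where "time_partition T N p" "mesh N p < \<delta>" "N + 1 - cell N p t = n" "induced_grid N p t = ts"
      by (rule fgrid_partition[OF fg t(1) \<delta>])
    with * show "Q (n, ts)" by auto
  qed (use induced_fgrid[OF _ t] in blast)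
  then show "eventually Q (fine_grids T t) \<longleftrightarrow>
    eventually Q (filtermap (\<lambda>(N, p). (N + 1 - cell N p t, induced_grid N p t)) (mesh_to_0 T))"
    using eventually_fine_grids[of "\<lambda>n ts. Q (n, ts)" T t]
      eventually_mesh_to_0[of "\<lambda>N p. Q (N + 1 - cell N p t, induced_grid N p t)" T]
    by (simp add: eventually_filtermap case_prod_beta')
qed

context noise_game
begin

definition near_equilibrium :: "(nat => real^'n => real) => (nat => real) => real^'n => real => nat => (nat => real) => bool" where
  "near_equilibrium g e x \<epsilon> n ts \<longleftrightarrow> (\<exists>a\<in>rstrat s1 n ts. \<exists>b\<in>rstrat s2 n ts.
     (\<forall>a'\<in>rstrat s1 n ts. \<forall>b'\<in>rstrat s2 n ts. rpay n ts (g 1) x a b \<ge> rpay n ts (g 1) x a' b - \<epsilon> \<and>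
       rpay n ts (g 2) x a b \<ge> rpay n ts (g 2) x a b' - \<epsilon>) \<and>
     (\<forall>m\<in>{1, 2}. \<bar>rpay n ts (g m) x a b - e m\<bar> \<le> \<epsilon>))"

definition individually_rational :: "(nat => real^'n => real) => (nat => real => real^'n => real) => (nat => real) =>
    real^'n => real => nat => (nat => real) => bool" where
  "individually_rational g U e x \<epsilon> n ts \<longleftrightarrow> (\<exists>u\<in>rctrl s1 n ts. \<exists>v\<in>rctrl s2 n ts. \<forall>m\<in>{1, 2}.
     continues n ts (g m) (U m) x \<epsilon> u v \<and>
     \<bar>(\<integral>y. g m (traj f (ts 0) (ts n) x (u y) (v y) (ts n)) \<partial>noise) - e m\<bar> \<le> \<epsilon>)"

end

text \<open>The conditions that the equivalence to be proved imposes on a single partition.\<close>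

definition partition_equilibrium :: "sample measure => (real^'n => 'u::metric_space => 'v::metric_space => real^'n) =>
    (nat => real^'n => real) => real => nat => (nat => real) => real => real^'n => (nat => real) => real => bool" where
  "partition_equilibrium P f g T N p t x e \<epsilon> \<longleftrightarrow>
     (\<exists>\<alpha>\<^sub>\<epsilon>\<in>strategies fst T N p t. \<exists>\<beta>\<^sub>\<epsilon>\<in>strategies snd T N p t.
        (\<forall>\<alpha>\<in>strategies fst T N p t. \<forall>\<beta>\<in>strategies snd T N p t.
           spayoff P f (g 1) T N p t x \<alpha>\<^sub>\<epsilon> \<beta>\<^sub>\<epsilon> \<ge> spayoff P f (g 1) T N p t x \<alpha> \<beta>\<^sub>\<epsilon> - \<epsilon> \<and>
           spayoff P f (g 2) T N p t x \<alpha>\<^sub>\<epsilon> \<beta>\<^sub>\<epsilon> \<ge> spayoff P f (g 2) T N p t x \<alpha>\<^sub>\<epsilon> \<beta> - \<epsilon>) \<and>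
        (\<forall>m\<in>{1, 2}. \<bar>spayoff P f (g m) T N p t x \<alpha>\<^sub>\<epsilon> \<beta>\<^sub>\<epsilon> - e m\<bar> \<le> \<epsilon>))"

definition partition_rational :: "sample measure => (real^'n => 'u::metric_space => 'v::metric_space => real^'n) =>
    (nat => real^'n => real) => (nat => real => real^'n => real) =>
    real => nat => (nat => real) => nat => real => real^'n => (nat => real) => real => bool" where
  "partition_rational P f g U T N p k t x e \<epsilon> \<longleftrightarrow>
     (\<exists>u\<in>controls fst T N p t. \<exists>v\<in>controls snd T N p t. \<forall>m\<in>{1, 2}.
        (\<forall>i\<in>{k..N}.
           measure P {\<omega> \<in> space P.
             real_cond_exp P (Fil_idx P p (int k - 2) (int i - 2))
               (\<lambda>\<omega>'. g m (traj f t T x (u \<omega>') (v \<omega>') T)) \<omega>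
             \<ge> U m (p (i - 1)) (traj f t T x (u \<omega>) (v \<omega>) (p (i - 1))) - \<epsilon>}
           \<ge> 1 - \<epsilon>) \<and>
        \<bar>(LINT \<omega>|P. g m (traj f t T x (u \<omega>) (v \<omega>) T)) - e m\<bar> \<le> \<epsilon>)"

context wiener_partition
begin

lemma stage_range: "j \<le> n ==> ts j \<in> {t..T}"
  using grid_mono[OF grid(1), of 0 j] grid_mono[OF grid(1), of j n] unfolding grid(2,3) by simp

lemma Y_measurable: "Y \<in> measurable P noise"
  unfolding noise_def
proof (rule measurable_PiM_single')
  fix l
  show "(\<lambda>\<omega>. Y \<omega> l) \<in> measurable P unif2"
  proof (cases "l < n")
    case True
    then have "K + l \<le> N" by (simp add: K)
    from zeta_measurable[OF tp this] show ?thesis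
      using True by (simp add: Y_zeta[OF True] measurable_unif2)
  next
    case False
    then have "(\<lambda>\<omega>. Y \<omega> l) = (\<lambda>_. 0)" by (simp add: signals_def fun_eq_iff)
    then show ?thesis by simp
  qed
qed simp

end

context wiener_game_partition
begin

text \<open>Every strategy for the partition matches one for the grid, and each of the latter is matched. So
  quantifiers over both kinds of strategies can be exchanged.\<close>

lemma reduced_quantifiers_I:
  fixes Q :: "('v, 'u) sample_strategy => bool"
  assumes "\<And>\<alpha> a. a \<in> rstrat fst n ts ==> matches \<alpha> a ==> Q \<alpha> \<longleftrightarrow> R a"
  shows "(\<exists>\<alpha>\<in>strategies fst T N p t. Q \<alpha>) \<longleftrightarrow> (\<exists>a\<in>rstrat fst n ts. R a)"
    and "(\<forall>\<alpha>\<in>strategies fst T N p t. Q \<alpha>) \<longleftrightarrow> (\<forall>a\<in>rstrat fst n ts. R a)"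
  using assms lift_I reduce_I by metis+

lemma reduced_quantifiers_II:
  fixes Q :: "('u, 'v) sample_strategy => bool"
  assumes "\<And>\<beta> b. b \<in> rstrat snd n ts ==> matches \<beta> b ==> Q \<beta> \<longleftrightarrow> R b"
  shows "(\<exists>\<beta>\<in>strategies snd T N p t. Q \<beta>) \<longleftrightarrow> (\<exists>b\<in>rstrat snd n ts. R b)"
    and "(\<forall>\<beta>\<in>strategies snd T N p t. Q \<beta>) \<longleftrightarrow> (\<forall>b\<in>rstrat snd n ts. R b)"
  using assms lift_II reduce_II by metis+

lemma nash_reduced:
  assumes pf: "\<And>m. m \<in> {1, 2} ==> payoff_function B K' (g m)"
  shows "partition_equilibrium P f g T N p t x e \<epsilon> \<longleftrightarrow> near_equilibrium g e x \<epsilon> n ts"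
proof -
  have sp: "spayoff P f (g m) T N p t x \<alpha> \<beta> = rpay n ts (g m) x a b"
    if "m \<in> {1, 2}" "a \<in> rstrat fst n ts" "matches \<alpha> a" "b \<in> rstrat snd n ts" "matches \<beta> b" for m \<alpha> \<beta> a b
    by (rule spayoff_rpay[OF pf[OF that(1)] that(2,4,3,5)])
  note sp1 = sp[of 1, simplified] and sp2 = sp[of 2, simplified]
  show ?thesis
    unfolding partition_equilibrium_def near_equilibrium_def
    by (intro reduced_quantifiers_I reduced_quantifiers_II conj_cong ball_cong refl) (simp_all add: sp sp1 sp2)
qed

text \<open>Almost surely the conditional expectation is \<open>cpay\<close> at the sequence of signals, and the event depends on
  the signals of the \<open>n\<close> stages only, which have the law of the noise.\<close>

lemma continuation_event:
  assumes pf: "payoff_function B K' g" and u': "u' \<in> rctrl fst n ts" and v': "v' \<in> rctrl snd n ts"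
    and u: "\<And>\<omega>. \<omega> \<in> Omega T ==> u \<omega> \<in> ctrls t T \<and> agree t T (u \<omega>) (u' (Y \<omega>))"
    and v: "\<And>\<omega>. \<omega> \<in> Omega T ==> v \<omega> \<in> ctrls t T \<and> agree t T (v \<omega>) (v' (Y \<omega>))"
    and j: "j < n" and U: "U (ts j) \<in> borel_measurable borel"
  shows "measure P {\<omega> \<in> space P. real_cond_exp P (Fil_idx P p (int (cell N p t) - 2) (int (cell N p t + j) - 2))
            (\<lambda>\<omega>'. g (traj f t T x (u \<omega>') (v \<omega>') T)) \<omega> \<ge> U (ts j) (traj f t T x (u \<omega>) (v \<omega>) (ts j)) - \<epsilon>}
    = measure noise {y. U (ts j) (traj f (ts 0) (ts n) x (u' y) (v' y) (ts j)) - \<epsilon> \<le> cpay n ts g x u' v' j y}"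
proof -
  let ?H = "\<lambda>y. g (traj f t T x (u' y) (v' y) T)"
  let ?F = "Fil_idx P p (int (cell N p t) - 2) (int (cell N p t + j) - 2)"
  let ?f = "\<lambda>\<omega>'. g (traj f t T x (u \<omega>') (v \<omega>') T)"
  let ?S = "{y. U (ts j) (traj f t T x (u' y) (v' y) (ts j)) - \<epsilon> \<le> cpay n ts g x u' v' j y}"
  let ?E = "{\<omega> \<in> space P. real_cond_exp P ?F ?f \<omega> \<ge> U (ts j) (traj f t T x (u \<omega>) (v \<omega>) (ts j)) - \<epsilon>}"
  note c = cell_bounds(1,2)[OF tp t]
  have k: "1 \<le> cell N p t" "cell N p t \<le> cell N p t + j" "cell N p t + j \<le> N" using c j by auto
  interpret fin: finite_measure_subalgebra P ?F by unfold_locales (rule Fil_idx_past(3)[OF tp k])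
  have tsj: "ts j \<in> {t..T}" by (rule stage_range) (use j in simp)
  have tr: "traj f t T x (u \<omega>) (v \<omega>) s = traj f t T x (u' (Y \<omega>)) (v' (Y \<omega>)) s" if "\<omega> \<in> space P" "s \<in> {t..T}" for \<omega> s
    using that u v rctrl_ctrl[OF u'] rctrl_ctrl[OF v'] by (intro traj_cong) (auto simp: space_P)
  have Tt: "T \<in> {t..T}" using t by simp
  have cp: "cpay n ts g x u' v' j y = (\<integral>z. ?H (comb_seq j y z) \<partial>noise)" for y unfolding cpay_def grid(2,3) ..
  have Hm: "(\<lambda>\<omega>. ?H (Y \<omega>)) \<in> borel_measurable P"
    by (rule measurable_compose[OF Y_measurable final_signals(1)[OF pf u' v']])
  have fm: "?f \<in> borel_measurable P"
    by (rule measurable_cong[THEN iffD2, OF _ Hm]) (simp only: tr[OF _ Tt])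
  have AE1: "AE \<omega> in P. real_cond_exp P ?F ?f \<omega> = real_cond_exp P ?F (\<lambda>\<omega>. ?H (Y \<omega>)) \<omega>"
    by (rule fin.real_cond_exp_cong[OF _ fm Hm]) (rule AE_I2, simp only: tr[OF _ Tt])
  have jj: "cell N p t + j - cell N p t = j" by simp
  have AE2: "AE \<omega> in P. real_cond_exp P ?F (\<lambda>\<omega>. ?H (Y \<omega>)) \<omega> = cpay n ts g x u' v' j (Y \<omega>)"
    using signals_cond_exp(1)[OF tp k final_signals[OF pf u' v'], unfolded jj] unfolding cp .
  have Utr: "(\<lambda>y. U (ts j) (traj f t T x (u' y) (v' y) (ts j))) \<in> borel_measurable noise"
    by (rule measurable_compose[OF final_measurable[OF u' v' tsj] U])
  have cm: "cpay n ts g x u' v' j \<in> borel_measurable noise" by (rule cpay_measurable(1)[OF pf grid(1) u' v'])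
  have S: "?S \<in> sets noise"
  proof -
    have "{y \<in> space noise. U (ts j) (traj f t T x (u' y) (v' y) (ts j)) - \<epsilon> \<le> cpay n ts g x u' v' j y} \<in> sets noise"
      using Utr cm by (intro borel_measurable_le borel_measurable_diff) auto
    then show ?thesis by simp
  qed
  have YS: "{\<omega>\<in>space P. Y \<omega> \<in> ?S} \<in> sets P"
    using measurable_sets[OF Y_measurable S] by (simp add: vimage_def Int_def conj_commute)
  have E: "?E \<in> sets P"
  proof (rule borel_measurable_le)
    have "(\<lambda>\<omega>. U (ts j) (traj f t T x (u' (Y \<omega>)) (v' (Y \<omega>)) (ts j)) - \<epsilon>) \<in> borel_measurable P"
      by (intro borel_measurable_diff measurable_compose[OF Y_measurable Utr]) simp
    then show "(\<lambda>\<omega>. U (ts j) (traj f t T x (u \<omega>) (v \<omega>) (ts j)) - \<epsilon>) \<in> borel_measurable P"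
      by (rule measurable_cong[THEN iffD2, rotated]) (simp only: tr[OF _ tsj])
  qed simp
  have "measure P ?E = measure P {\<omega>\<in>space P. Y \<omega> \<in> ?S}"
  proof (rule P.finite_measure_eq_AE[OF _ E YS])
    show "AE \<omega> in P. \<omega> \<in> ?E \<longleftrightarrow> \<omega> \<in> {\<omega>\<in>space P. Y \<omega> \<in> ?S}"
      using AE1 AE2 AE_space
    proof eventually_elim
      case (elim \<omega>)
      show ?case using elim by (simp only: mem_Collect_eq tr[OF elim(3) tsj])
    qed
  qed
  also have "\<dots> = (\<integral>\<omega>. indicator ?S (Y \<omega>) \<partial>P)"
  proof -
    have "(\<integral>\<omega>. indicator ?S (Y \<omega>) \<partial>P) = (\<integral>\<omega>. indicator {\<omega>\<in>space P. Y \<omega> \<in> ?S} \<omega> \<partial>P :: real)"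
      by (rule Bochner_Integration.integral_cong[OF refl]) (simp add: indicator_def)
    then show ?thesis using YS by (simp add: Int_absorb2)
  qed
  also have "\<dots> = (\<integral>\<omega>. (\<integral>z. indicator ?S (comb_seq (cell N p t - cell N p t) (Y \<omega>) z) \<partial>noise) \<partial>P)"
  proof (rule signals_cond_exp(2)[OF tp c(1) order.refl c(2), where B=1])
    show "indicator ?S \<in> borel_measurable noise" using S by simp
    show "\<bar>indicator ?S y :: real\<bar> \<le> 1" for y by (simp add: indicator_def)
    fix y y' :: noise_seq assume *: "\<And>l. l < n ==> y l = y' l"
    have "traj f t T x (u' y) (v' y) (ts j) = traj f t T x (u' y') (v' y') (ts j)"
      using traj_past[OF grid(1) u' v', of j y y'] j * unfolding grid(2,3) by simp
    moreover have "cpay n ts g x u' v' j y = cpay n ts g x u' v' j y'"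
    proof -
      have "comb_seq j y = comb_seq j y'" by (rule ext, rule comb_seq_eqI) (use j * in simp)
      then show ?thesis by (simp only: cpay_def)
    qed
    ultimately show "indicator ?S y = (indicator ?S y' :: real)" by (simp add: indicator_def)
  qed
  also have "\<dots> = measure noise ?S"
  proof -
    have "comb_seq (cell N p t - cell N p t) y z = z" for y z :: noise_seq by (simp add: comb_seq_def fun_eq_iff)
    then show ?thesis using S by (simp add: P.prob_space)
  qed
  finally show ?thesis unfolding grid(2,3) .
qed

lemma rational_reduced:
  assumes pf: "\<And>m. m \<in> {1, 2} ==> payoff_function B K' (g m)" and start: "p (cell N p t - 1) = t"
    and U: "\<And>m s. m \<in> {1, 2} ==> 0 \<le> s ==> s \<le> T ==> U m s \<in> borel_measurable borel"
  shows "partition_rational P f g U T N p (cell N p t) t x e \<epsilon> \<longleftrightarrow> individually_rational g U e x \<epsilon> n ts"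
proof -
  let ?A = "\<lambda>u v m i. {\<omega> \<in> space P. real_cond_exp P (Fil_idx P p (int (cell N p t) - 2) (int i - 2))
      (\<lambda>\<omega>'. g m (traj f t T x (u \<omega>') (v \<omega>') T)) \<omega> \<ge> U m (p (i - 1)) (traj f t T x (u \<omega>) (v \<omega>) (p (i - 1))) - \<epsilon>}"
  let ?A' = "\<lambda>u' v' m j. {y. U m (ts j) (traj f (ts 0) (ts n) x (u' y) (v' y) (ts j)) - \<epsilon> \<le> cpay n ts (g m) x u' v' j y}"
  let ?Q = "\<lambda>u v. \<forall>m\<in>{1, 2}. (\<forall>i\<in>{cell N p t..N}. measure P (?A u v m i) \<ge> 1 - \<epsilon>) \<and>
    \<bar>(LINT \<omega>|P. g m (traj f t T x (u \<omega>) (v \<omega>) T)) - e m\<bar> \<le> \<epsilon>"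
  let ?Q' = "\<lambda>u' v'. \<forall>m\<in>{1, 2}. continues n ts (g m) (U m) x \<epsilon> u' v' \<and>
     \<bar>(\<integral>y. g m (traj f (ts 0) (ts n) x (u' y) (v' y) (ts n)) \<partial>noise) - e m\<bar> \<le> \<epsilon>"
  have start': "p (K + j) = ts j" if "j < n" for j
    using stage_times(3)[OF that] start by (cases "j = 0") (simp_all add: induced_grid_def K)
  have QQ: "?Q u v \<longleftrightarrow> ?Q' u' v'" if u': "u' \<in> rctrl fst n ts" and v': "v' \<in> rctrl snd n ts"
    and u: "\<And>\<omega> s. \<omega> \<in> Omega T ==> t \<le> s ==> s < T ==> u \<omega> s = u' (Y \<omega>) s"
    and v: "\<And>\<omega> s. \<omega> \<in> Omega T ==> t \<le> s ==> s < T ==> v \<omega> s = v' (Y \<omega>) s" for u v u' v'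
  proof -
    have u2: "u \<omega> \<in> ctrls t T \<and> agree t T (u \<omega>) (u' (Y \<omega>))" if "\<omega> \<in> Omega T" for \<omega>
    proof
      show "u \<omega> \<in> ctrls t T" by (rule ctrl_space_cong[OF rctrl_ctrl[OF u'] u[OF that]])
      show "agree t T (u \<omega>) (u' (Y \<omega>))" by (rule agreeI[OF u[OF that]])
    qed
    have v2: "v \<omega> \<in> ctrls t T \<and> agree t T (v \<omega>) (v' (Y \<omega>))" if "\<omega> \<in> Omega T" for \<omega>
    proof
      show "v \<omega> \<in> ctrls t T" by (rule ctrl_space_cong[OF rctrl_ctrl[OF v'] v[OF that]])
      show "agree t T (v \<omega>) (v' (Y \<omega>))" by (rule agreeI[OF v[OF that]])
    qed
    have fin: "(LINT \<omega>|P. g m (traj f t T x (u \<omega>) (v \<omega>) T)) = (\<integral>y. g m (traj f (ts 0) (ts n) x (u' y) (v' y) (ts n)) \<partial>noise)"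
      if "m \<in> {1, 2}" for m
      using payoff_signals[OF pf[OF that] u' v' u2 v2] unfolding payoff_def grid(2,3) .
    have idx: "(\<forall>i\<in>{cell N p t..N}. R i) \<longleftrightarrow> (\<forall>j<n. R (cell N p t + j))" for R
    proof
      assume *: "\<forall>j<n. R (cell N p t + j)"
      show "\<forall>i\<in>{cell N p t..N}. R i"
      proof
        fix i assume "i \<in> {cell N p t..N}"
        then have "i - cell N p t < n" "cell N p t + (i - cell N p t) = i" by auto
        then show "R i" using * by metis
      qed
    qed auto
    have ev: "measure P (?A u v m (cell N p t + j)) = measure noise (?A' u' v' m j)"
      if m: "m \<in> {1, 2}" and j: "j < n" for m j
    proof -
      have "cell N p t + j - 1 = K + j" by (simp add: K)
      then have pj: "p (cell N p t + j - 1) = ts j" using start'[OF j] by simp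
      have "0 \<le> ts j" "ts j \<le> T" using stage_range[of j] j t by auto
      then show ?thesis unfolding pj by (intro continuation_event[OF pf[OF m] u' v' u2 v2 j] U[OF m])
    qed
    show ?thesis
      unfolding idx continues_def
    proof (intro ball_cong refl)
      fix m :: nat assume m: "m \<in> {1, 2}"
      show "((\<forall>j<n. 1 - \<epsilon> \<le> measure P (?A u v m (cell N p t + j))) \<and>
          \<bar>(LINT \<omega>|P. g m (traj f t T x (u \<omega>) (v \<omega>) T)) - e m\<bar> \<le> \<epsilon>) \<longleftrightarrow>
        (\<forall>j<n. measure noise (?A' u' v' m j) \<ge> 1 - \<epsilon>) \<and>
         \<bar>(\<integral>y. g m (traj f (ts 0) (ts n) x (u' y) (v' y) (ts n)) \<partial>noise) - e m\<bar> \<le> \<epsilon>"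
        unfolding fin[OF m] by (intro conj_cong refl all_cong) (simp only: ev[OF m])
    qed
  qed
  show ?thesis unfolding individually_rational_def partition_rational_def
  proof
    assume "\<exists>u\<in>controls fst T N p t. \<exists>v\<in>controls snd T N p t. ?Q u v"
    then obtain u v where u: "u \<in> controls fst T N p t" and v: "v \<in> controls snd T N p t" and Q: "?Q u v" by (elim bexE)
    obtain u' where u': "u' \<in> rctrl fst n ts" "\<And>\<omega> s. \<omega> \<in> Omega T ==> t \<le> s ==> s < T ==> u \<omega> s = u' (Y \<omega>) s"
      using controls_reduce[OF sel_fst u] by metis
    obtain v' where v': "v' \<in> rctrl snd n ts" "\<And>\<omega> s. \<omega> \<in> Omega T ==> t \<le> s ==> s < T ==> v \<omega> s = v' (Y \<omega>) s"
      using controls_reduce[OF sel_snd v] by metis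
    show "\<exists>u'\<in>rctrl fst n ts. \<exists>v'\<in>rctrl snd n ts. ?Q' u' v'"
      using Q QQ[OF u'(1) v'(1) u'(2) v'(2)] by (intro bexI[OF _ u'(1)] bexI[OF _ v'(1)]) blast
  next
    assume "\<exists>u'\<in>rctrl fst n ts. \<exists>v'\<in>rctrl snd n ts. ?Q' u' v'"
    then obtain u' v' where u': "u' \<in> rctrl fst n ts" and v': "v' \<in> rctrl snd n ts" and Q: "?Q' u' v'" by (elim bexE)
    show "\<exists>u\<in>controls fst T N p t. \<exists>v\<in>controls snd T N p t. ?Q u v"
      using Q QQ[OF u' v' refl refl] by (intro bexI[OF _ control_lift_I[OF u']] bexI[OF _ control_lift_II[OF v']]) blast
  qed
qed

end

section \<open>The limit functions are values of the noise game\<close>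

lemma less_SUP_INF_witness:
  fixes s :: "'a => 'b => real"
  assumes "A \<noteq> {}" and B: "\<And>\<alpha> \<beta>. \<alpha> \<in> A ==> \<beta> \<in> D ==> \<bar>s \<alpha> \<beta>\<bar> \<le> B"
    and less: "c < (SUP \<alpha>\<in>A. INF \<beta>\<in>D. s \<alpha> \<beta>)"
  shows "\<exists>\<alpha>\<in>A. \<forall>\<beta>\<in>D. c \<le> s \<alpha> \<beta>"
proof -
  obtain y where "y \<in> (\<lambda>\<alpha>. INF \<beta>\<in>D. s \<alpha> \<beta>) ` A" "c < y"
    by (rule less_cSupE[OF less]) (use assms(1) in auto)
  then obtain \<alpha> where \<alpha>: "\<alpha> \<in> A" "c < (INF \<beta>\<in>D. s \<alpha> \<beta>)" by auto
  have "c \<le> s \<alpha> \<beta>" if "\<beta> \<in> D" for \<beta>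
  proof -
    have "bdd_below (s \<alpha> ` D)" using B[OF \<alpha>(1)] by (intro bdd_belowI[of _ "- B"]) (auto simp: abs_le_iff minus_le_iff)
    from cINF_lower[OF this that] show ?thesis using \<alpha>(2) by linarith
  qed
  then show ?thesis using \<alpha>(1) by blast
qed

lemma eventually_secured:
  fixes s :: "'z => 'a => 'b => real"
  assumes lim: "((\<lambda>z. SUP \<alpha>\<in>A z. INF \<beta>\<in>D z. s z \<alpha> \<beta>) \<longlongrightarrow> c) F" and \<epsilon>: "\<epsilon> > 0"
    and ev: "\<forall>\<^sub>F z in F. A z \<noteq> {} \<and> (\<forall>\<alpha>\<in>A z. \<forall>\<beta>\<in>D z. \<bar>s z \<alpha> \<beta>\<bar> \<le> B)"
  shows "\<forall>\<^sub>F z in F. \<exists>\<alpha>\<in>A z. \<forall>\<beta>\<in>D z. c - \<epsilon> \<le> s z \<alpha> \<beta>"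
  using order_tendstoD(1)[OF lim, of "c - \<epsilon>", simplified, OF \<epsilon>] ev
proof eventually_elim
  case (elim z) then show ?case by (intro less_SUP_INF_witness[where B=B]) auto
qed

text \<open>The corresponding bound from above is the previous one for \<open>-s\<close>.\<close>

lemma eventually_held_down:
  fixes s :: "'z => 'a => 'b => real"
  assumes lim: "((\<lambda>z. INF \<alpha>\<in>A z. SUP \<beta>\<in>D z. s z \<alpha> \<beta>) \<longlongrightarrow> c) F" and \<epsilon>: "\<epsilon> > 0"
    and ev: "\<forall>\<^sub>F z in F. A z \<noteq> {} \<and> (\<forall>\<alpha>\<in>A z. \<forall>\<beta>\<in>D z. \<bar>s z \<alpha> \<beta>\<bar> \<le> B)"
  shows "\<forall>\<^sub>F z in F. \<exists>\<alpha>\<in>A z. \<forall>\<beta>\<in>D z. s z \<alpha> \<beta> \<le> c + \<epsilon>"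
proof -
  have "(SUP \<alpha>\<in>A z. INF \<beta>\<in>D z. - s z \<alpha> \<beta>) = - (INF \<alpha>\<in>A z. SUP \<beta>\<in>D z. s z \<alpha> \<beta>)" for z
    by (simp add: Inf_real_def image_image)
  then have "((\<lambda>z. SUP \<alpha>\<in>A z. INF \<beta>\<in>D z. - s z \<alpha> \<beta>) \<longlongrightarrow> - c) F" using tendsto_minus[OF lim] by simp
  from eventually_secured[OF this \<epsilon>, of B] ev show ?thesis by (simp add: minus_le_iff algebra_simps)
qed

context wiener_game_partition
begin

lemma strategies_nonempty: "(strategies fst T N p t :: ('v, 'u) sample_strategy set) \<noteq> {}"
  "(strategies snd T N p t :: ('u, 'v) sample_strategy set) \<noteq> {}"
  using lift_I(1)[OF const_rstrat] lift_II(1)[OF const_rstrat] by blast+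

lemma spayoff_bounded:
  assumes pf: "payoff_function B K' g" and \<alpha>: "\<alpha> \<in> strategies fst T N p t" and \<beta>: "\<beta> \<in> strategies snd T N p t"
  shows "\<bar>spayoff P f g T N p t x \<alpha> \<beta>\<bar> \<le> B"
proof -
  obtain a where a: "a \<in> rstrat fst n ts" "matches \<alpha> a" by (rule reduce_I[OF \<alpha>])
  obtain b where b: "b \<in> rstrat snd n ts" "matches \<beta> b" by (rule reduce_II[OF \<beta>])
  note o = outcome[OF grid(1) a(1) b(1), unfolded grid(2,3)]
  have "integrable noise (\<lambda>y. g (traj f t T x (fst (outcome n ts a b) y) (snd (outcome n ts a b) y) T))"
    by (rule bounded_integrable_noise[OF final_signals(1,2)[OF pf o(1,2)]])
  then have "\<bar>rpay n ts g x a b\<bar> \<le> B"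
    using final_signals(2)[OF pf o(1,2), of x] unfolding rpay_def grid(2,3)
    by (auto intro!: noise_prob.integral_le_const noise_prob.integral_ge_const simp: abs_le_iff minus_le_iff)
  then show ?thesis by (simp only: spayoff_rpay[OF pf a(1) b(1) a(2) b(2)])
qed

end

context wiener_game
begin

lemma partition_game:
  assumes "time_partition T N p" "0 \<le> t" "t < T" shows "wiener_game_partition T W f C L N p t"
  using assms by unfold_locales

text \<open>The filters of partitions and of grids correspond, and so do the strategies for a partition and for
  the grid that it induces. So whatever a player can guarantee in the given game for fine partitions,
  they can guarantee in the noise game on fine grids.\<close>

lemma eventually_partition: "\<forall>\<^sub>F z in mesh_to_0 T. time_partition T (fst z) (snd z)"
proof -
  have "\<forall>\<^sub>F (N, p) in mesh_to_0 T. time_partition T N p"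
    unfolding eventually_mesh_to_0 by (auto intro: exI[of _ 1])
  then show ?thesis by (simp add: case_prod_beta')
qed

context
  fixes B K' :: real and g :: "real^'n => real" and t :: real
  assumes pf: "payoff_function B K' g" and t: "0 \<le> t" "t < T"
begin

lemma eventually_strategies_bounded:
  "\<forall>\<^sub>F (N, p) in mesh_to_0 T. strategies fst T N p t \<noteq> ({} :: ('v, 'u) sample_strategy set) \<and>
     strategies snd T N p t \<noteq> ({} :: ('u, 'v) sample_strategy set) \<and>
     (\<forall>\<alpha>\<in>strategies fst T N p t. \<forall>\<beta>\<in>strategies snd T N p t. \<bar>spayoff P f g T N p t x \<alpha> \<beta>\<bar> \<le> B)"
proof (rule eventually_mono[OF eventually_partition], clarsimp)
  fix N p assume tp: "time_partition T N p"
  interpret wiener_game_partition T W f C L N p t by (rule partition_game[OF tp t])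
  show "strategies fst T N p t \<noteq> ({} :: ('v, 'u) sample_strategy set) \<and>
     strategies snd T N p t \<noteq> ({} :: ('u, 'v) sample_strategy set) \<and>
     (\<forall>\<alpha>\<in>strategies fst T N p t. \<forall>\<beta>\<in>strategies snd T N p t. \<bar>spayoff P f g T N p t x \<alpha> \<beta>\<bar> \<le> B)"
    using strategies_nonempty spayoff_bounded[OF pf] by blast
qed

lemma eventually_guaranteed_I:
  assumes "\<forall>\<^sub>F (N, p) in mesh_to_0 T. \<exists>\<alpha>\<in>strategies fst T N p t. \<forall>\<beta>\<in>strategies snd T N p t. R (spayoff P f g T N p t x \<alpha> \<beta>)"
  shows "\<forall>\<^sub>F (n, ts) in fine_grids T t. \<exists>a\<in>rstrat fst n ts. \<forall>b\<in>rstrat snd n ts. R (rpay n ts g x a b)"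
  unfolding fine_grids_mesh[OF t] eventually_filtermap case_prod_beta'
  using assms[unfolded case_prod_beta'] eventually_partition
proof eventually_elim
  case (elim z)
  interpret wiener_game_partition T W f C L "fst z" "snd z" t by (rule partition_game[OF elim(2) t])
  have "(\<exists>\<alpha>\<in>strategies fst T (fst z) (snd z) t. \<forall>\<beta>\<in>strategies snd T (fst z) (snd z) t. R (spayoff P f g T (fst z) (snd z) t x \<alpha> \<beta>))
    \<longleftrightarrow> (\<exists>a\<in>rstrat fst n ts. \<forall>b\<in>rstrat snd n ts. R (rpay n ts g x a b))"
    by (intro reduced_quantifiers_I reduced_quantifiers_II) (simp add: spayoff_rpay[OF pf])
  with elim(1) show ?case by simp
qed

lemma eventually_guaranteed_II:
  assumes "\<forall>\<^sub>F (N, p) in mesh_to_0 T. \<exists>\<beta>\<in>strategies snd T N p t. \<forall>\<alpha>\<in>strategies fst T N p t. R (spayoff P f g T N p t x \<alpha> \<beta>)"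
  shows "\<forall>\<^sub>F (n, ts) in fine_grids T t. \<exists>b\<in>rstrat snd n ts. \<forall>a\<in>rstrat fst n ts. R (rpay n ts g x a b)"
  unfolding fine_grids_mesh[OF t] eventually_filtermap case_prod_beta'
  using assms[unfolded case_prod_beta'] eventually_partition
proof eventually_elim
  case (elim z)
  interpret wiener_game_partition T W f C L "fst z" "snd z" t by (rule partition_game[OF elim(2) t])
  have "(\<exists>\<beta>\<in>strategies snd T (fst z) (snd z) t. \<forall>\<alpha>\<in>strategies fst T (fst z) (snd z) t. R (spayoff P f g T (fst z) (snd z) t x \<alpha> \<beta>))
    \<longleftrightarrow> (\<exists>b\<in>rstrat snd n ts. \<forall>a\<in>rstrat fst n ts. R (rpay n ts g x a b))"
    by (intro reduced_quantifiers_I reduced_quantifiers_II) (simp add: spayoff_rpay[OF pf])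
  with elim(1) show ?case by simp
qed

lemma eventually_secured_I:
  assumes "((\<lambda>(N, p). SUP \<alpha>\<in>strategies fst T N p t. INF \<beta>\<in>strategies snd T N p t. spayoff P f g T N p t x \<alpha> \<beta>) \<longlongrightarrow> c) (mesh_to_0 T)"
    and "\<epsilon> > 0"
  shows "\<forall>\<^sub>F (n, ts) in fine_grids T t. \<exists>a\<in>rstrat fst n ts. \<forall>b\<in>rstrat snd n ts. c - \<epsilon> \<le> rpay n ts g x a b"
  by (rule eventually_guaranteed_I, unfold case_prod_beta',
    rule eventually_secured[OF assms[unfolded case_prod_beta'], where B=B],
    rule eventually_mono[OF eventually_strategies_bounded[of x]]) auto

lemma eventually_secured_II:
  assumes "((\<lambda>(N, p). SUP \<beta>\<in>strategies snd T N p t. INF \<alpha>\<in>strategies fst T N p t. spayoff P f g T N p t x \<alpha> \<beta>) \<longlongrightarrow> c) (mesh_to_0 T)"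
    and "\<epsilon> > 0"
  shows "\<forall>\<^sub>F (n, ts) in fine_grids T t. \<exists>b\<in>rstrat snd n ts. \<forall>a\<in>rstrat fst n ts. c - \<epsilon> \<le> rpay n ts g x a b"
  by (rule eventually_guaranteed_II, unfold case_prod_beta',
    rule eventually_secured[OF assms[unfolded case_prod_beta'], where B=B],
    rule eventually_mono[OF eventually_strategies_bounded[of x]]) auto

lemma eventually_held_down_I:
  assumes "((\<lambda>(N, p). INF \<alpha>\<in>strategies fst T N p t. SUP \<beta>\<in>strategies snd T N p t. spayoff P f g T N p t x \<alpha> \<beta>) \<longlongrightarrow> c) (mesh_to_0 T)"
    and "\<epsilon> > 0"
  shows "\<forall>\<^sub>F (n, ts) in fine_grids T t. \<exists>a\<in>rstrat fst n ts. \<forall>b\<in>rstrat snd n ts. rpay n ts g x a b \<le> c + \<epsilon>"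
  by (rule eventually_guaranteed_I, unfold case_prod_beta',
    rule eventually_held_down[OF assms[unfolded case_prod_beta'], where B=B],
    rule eventually_mono[OF eventually_strategies_bounded[of x]]) auto

lemma eventually_held_down_II:
  assumes "((\<lambda>(N, p). INF \<beta>\<in>strategies snd T N p t. SUP \<alpha>\<in>strategies fst T N p t. spayoff P f g T N p t x \<alpha> \<beta>) \<longlongrightarrow> c) (mesh_to_0 T)"
    and "\<epsilon> > 0"
  shows "\<forall>\<^sub>F (n, ts) in fine_grids T t. \<exists>b\<in>rstrat snd n ts. \<forall>a\<in>rstrat fst n ts. rpay n ts g x a b \<le> c + \<epsilon>"
  by (rule eventually_guaranteed_II, unfold case_prod_beta',
    rule eventually_held_down[OF assms[unfolded case_prod_beta'], where B=B],
    rule eventually_mono[OF eventually_strategies_bounded[of x]]) auto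

end

text \<open>Of the two limits that define \<open>U 1\<close>, the one of the suprema over \<open>\<alpha>\<close> lets player I secure the value, and the
  other one lets player II hold the payoff down to it. For \<open>U 2\<close> the roles of the players are exchanged.\<close>

lemma values_game_value:
  assumes pf: "\<And>m. m \<in> {1, 2} ==> payoff_function B K' (g m)" and vf: "value_functions P f g T U"
  shows "game_value (g 1) T (U 1)"
    and "noise_game.game_value (\<lambda>x v u. f x u v) snd fst (g 2) T (U 2)"
proof -
  have end1: "\<forall>x. U 1 T x = g 1 x" and end2: "\<forall>x. U 2 T x = g 2 x" using vf unfolding value_functions_def by simp_all
  have pf1: "payoff_function B K' (g 1)" and pf2: "payoff_function B K' (g 2)" using pf by simp_all
  have lim: "((\<lambda>(N, p). INF \<beta>\<in>strategies snd T N p t. SUP \<alpha>\<in>strategies fst T N p t.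
            spayoff P f (g 1) T N p t x \<alpha> \<beta>) \<longlongrightarrow> U 1 t x) (mesh_to_0 T)"
        "((\<lambda>(N, p). SUP \<alpha>\<in>strategies fst T N p t. INF \<beta>\<in>strategies snd T N p t.
            spayoff P f (g 1) T N p t x \<alpha> \<beta>) \<longlongrightarrow> U 1 t x) (mesh_to_0 T)"
        "((\<lambda>(N, p). SUP \<beta>\<in>strategies snd T N p t. INF \<alpha>\<in>strategies fst T N p t.
            spayoff P f (g 2) T N p t x \<alpha> \<beta>) \<longlongrightarrow> U 2 t x) (mesh_to_0 T)"
        "((\<lambda>(N, p). INF \<alpha>\<in>strategies fst T N p t. SUP \<beta>\<in>strategies snd T N p t.
            spayoff P f (g 2) T N p t x \<alpha> \<beta>) \<longlongrightarrow> U 2 t x) (mesh_to_0 T)"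
    if "t \<in> {0..<T}" for t x
    using vf[unfolded value_functions_def, THEN conjunct1, rule_format, OF that, of x] by - ((elim conjE, assumption)+)
  show "game_value (g 1) T (U 1)"
    unfolding game_value_def eventually_fine_grids[symmetric] secures_def holds_down_def
  proof (intro conjI end1 ballI allI impI)
    fix t x and \<epsilon> :: real assume t: "t \<in> {0..<T}" and \<epsilon>: "\<epsilon> > 0"
    then have t': "0 \<le> t" "t < T" by auto
    show "\<forall>\<^sub>F (n, ts) in fine_grids T t. (\<exists>a\<in>rstrat fst n ts. \<forall>b\<in>rstrat snd n ts. U 1 t x - \<epsilon> \<le> rpay n ts (g 1) x a b) \<and>
      (\<exists>b\<in>rstrat snd n ts. \<forall>a\<in>rstrat fst n ts. rpay n ts (g 1) x a b \<le> U 1 t x + \<epsilon>)"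
      using eventually_secured_I[OF pf1 t' lim(2)[OF t, of x] \<epsilon>] eventually_held_down_II[OF pf1 t' lim(1)[OF t, of x] \<epsilon>]
      by eventually_elim auto
  qed
  interpret sw: noise_game "\<lambda>x v u. f x u v" C L snd fst by (rule swapped)
  show "sw.game_value (g 2) T (U 2)"
    unfolding sw.game_value_def eventually_fine_grids[symmetric] sw.secures_def sw.holds_down_def
  proof (intro conjI end2 ballI allI impI)
    fix t x and \<epsilon> :: real assume t: "t \<in> {0..<T}" and \<epsilon>: "\<epsilon> > 0"
    then have t': "0 \<le> t" "t < T" by auto
    have gr: "\<forall>\<^sub>F (n, ts) in fine_grids T t. grid n ts"
      unfolding eventually_fine_grids by (auto simp: fgrid_def intro: exI[of _ 1])
    show "\<forall>\<^sub>F (n, ts) in fine_grids T t. (\<exists>b\<in>rstrat snd n ts. \<forall>a\<in>rstrat fst n ts. U 2 t x - \<epsilon> \<le> sw.rpay n ts (g 2) x b a) \<and>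
      (\<exists>a\<in>rstrat fst n ts. \<forall>b\<in>rstrat snd n ts. sw.rpay n ts (g 2) x b a \<le> U 2 t x + \<epsilon>)"
      using eventually_secured_II[OF pf2 t' lim(3)[OF t, of x] \<epsilon>] eventually_held_down_I[OF pf2 t' lim(4)[OF t, of x] \<epsilon>] gr
    proof eventually_elim
      case (elim z)
      then show ?case unfolding case_prod_beta' by (simp add: rpay_swap cong: bex_cong ball_cong)
    qed
  qed
qed

end

section \<open>The characterization\<close>

context noise_game
begin

lemma cpay_swap: "noise_game.cpay (\<lambda>x v u. f x u v) n ts g x v u j y = cpay n ts g x u v j y"
proof -
  interpret sw: noise_game "\<lambda>x v u. f x u v" C L s2 s1 by (rule swapped)
  show ?thesis unfolding sw.cpay_def cpay_def traj_swap ..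
qed

lemma cpay_uminus: "cpay n ts (\<lambda>x. - g x) x u v j y = - cpay n ts g x u v j y"
  by (simp add: cpay_def)

lemma continues_swap: "noise_game.continues (\<lambda>x v u. f x u v) n ts g V x \<epsilon> v u \<longleftrightarrow> continues n ts g V x \<epsilon> u v"
proof -
  interpret sw: noise_game "\<lambda>x v u. f x u v" C L s2 s1 by (rule swapped)
  show ?thesis unfolding sw.continues_def continues_def traj_swap cpay_swap ..
qed

lemma continues_mono:
  assumes pf: "payoff_function B K g" and gv: "game_value g T U" and fg: "fgrid T \<delta> t n ts" and t: "0 \<le> t" "t < T"
    and u: "u \<in> rctrl s1 n ts" and v: "v \<in> rctrl s2 n ts" and \<eta>: "\<eta> \<le> \<epsilon>" and c: "continues n ts g U x \<eta> u v"
  shows "continues n ts g U x \<epsilon> u v"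
  unfolding continues_def
proof (intro allI impI)
  fix j assume j: "j < n"
  let ?S = "\<lambda>\<epsilon>. {y \<in> space noise. U (ts j) (traj f (ts 0) (ts n) x (u y) (v y) (ts j)) - \<epsilon> \<le> cpay n ts g x u v j y}"
  have gr: "grid n ts" and ends: "ts 0 = t" "ts n = T" using fg by (auto simp: fgrid_def)
  have tj: "t \<le> ts j" "ts j \<le> T" using grid_mono[OF gr, of 0 j] grid_mono[OF gr, of j n] j ends by auto
  then have "(\<lambda>y. U (ts j) (traj f (ts 0) (ts n) x (u y) (v y) (ts j))) \<in> borel_measurable noise"
    using t ends by (intro measurable_compose[OF final_measurable[OF u v] value_measurable[OF pf gv]]) auto
  then have "?S \<epsilon> \<in> sets noise"
    using cpay_measurable(1)[OF pf gr u v] by (intro borel_measurable_le borel_measurable_diff) auto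
  moreover have "?S \<eta> \<subseteq> ?S \<epsilon>" using \<eta> by auto
  ultimately have "measure noise (?S \<eta>) \<le> measure noise (?S \<epsilon>)" by (intro noise_prob.finite_measure_mono)
  then show "1 - \<epsilon> \<le> measure noise {y. U (ts j) (traj f (ts 0) (ts n) x (u y) (v y) (ts j)) - \<epsilon> \<le> cpay n ts g x u v j y}"
    using c[unfolded continues_def, rule_format, OF j] \<eta> by simp
qed

text \<open>The punishing player is here player II, who wants to keep player I from gaining: the roles of the
  players are exchanged and the payoff is \<open>-g\<close>.\<close>

lemma eventually_enforceable:
  assumes pf: "payoff_function B K g" and gv: "game_value g T U" and t: "0 \<le> t" "t < T" and \<epsilon>: "\<epsilon> > 0"
  obtains \<epsilon>' where "\<epsilon>' > 0" "\<forall>\<^sub>F (n, ts) in fine_grids T t. \<forall>u\<in>rctrl s1 n ts. \<forall>v\<in>rctrl s2 n ts.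
    continues n ts g U x \<epsilon>' u v --> noise_game.enforceable (\<lambda>x v u. f x u v) s2 s1 n ts (\<lambda>x. - g x) x \<epsilon> v u"
proof -
  interpret sw: noise_game "\<lambda>x v u. f x u v" C L s2 s1 by (rule swapped)
  obtain \<epsilon>' where "\<epsilon>' > 0" and ev: "\<forall>\<^sub>F (n, ts) in fine_grids T t. \<forall>v\<in>rctrl s2 n ts. \<forall>u\<in>rctrl s1 n ts.
      (\<forall>j<n. measure noise {y. sw.cpay n ts (\<lambda>x. - g x) x v u j y \<le>
        - U (ts j) (traj (\<lambda>x v u. f x u v) (ts 0) (ts n) x (v y) (u y) (ts j)) + \<epsilon>'} \<ge> 1 - \<epsilon>') -->
      sw.enforceable n ts (\<lambda>x. - g x) x \<epsilon> v u"
    by (rule sw.punishment[OF payoff_function_uminus[OF pf] game_value_swap[OF gv] t \<epsilon>])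
  moreover have "- c \<le> - d + \<epsilon>' \<longleftrightarrow> d - \<epsilon>' \<le> c" for c d :: real by linarith
  ultimately show ?thesis
    by (intro that[of \<epsilon>']) (auto elim!: eventually_mono simp: continues_def cpay_swap cpay_uminus traj_swap)
qed

text \<open>In one direction the play of a near-equilibrium satisfies the condition for each player. In the other
  direction each player follows their part of the play that is given, and deters the opponent from
  deviating by the strategy that enforces it.\<close>

theorem equilibrium_iff_rational:
  assumes pf: "\<And>m. m \<in> {1, 2} ==> payoff_function B K (g m)"
    and gv1: "game_value (g 1) T (U 1)" and gv2: "noise_game.game_value (\<lambda>x v u. f x u v) s2 s1 (g 2) T (U 2)"
    and t: "0 \<le> t" "t < T"
  shows "(\<forall>\<epsilon>>0. \<forall>\<^sub>F (n, ts) in fine_grids T t. near_equilibrium g e x \<epsilon> n ts) \<longleftrightarrow>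
    (\<forall>\<epsilon>>0. \<forall>\<^sub>F (n, ts) in fine_grids T t. individually_rational g U e x \<epsilon> n ts)"
proof (intro iffI allI impI)
  interpret sw: noise_game "\<lambda>x v u. f x u v" C L s2 s1 by (rule swapped)
  have pf1: "payoff_function B K (g 1)" and pf2: "payoff_function B K (g 2)" using pf by simp_all
  fix \<epsilon> :: real assume \<epsilon>: "\<epsilon> > 0"
  {
    assume L: "\<forall>\<epsilon>>0. \<forall>\<^sub>F (n, ts) in fine_grids T t. near_equilibrium g e x \<epsilon> n ts"
    define \<eta> where "\<eta> = min \<epsilon> (\<epsilon>\<^sup>2 / 2)"
    have \<eta>: "\<eta> > 0" "\<eta> \<le> \<epsilon>" "\<eta> \<le> \<epsilon>\<^sup>2 / 2" using \<epsilon> by (auto simp: \<eta>_def)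
    show "\<forall>\<^sub>F (n, ts) in fine_grids T t. individually_rational g U e x \<epsilon> n ts"
      using L[rule_format, OF \<eta>(1)] eventually_fgrid
        equilibrium_continues[OF pf1 gv1 t \<epsilon>, of x] sw.equilibrium_continues[OF pf2 gv2 t \<epsilon>, of x]
    proof eventually_elim
      case (elim z)
      obtain n ts where z: "z = (n, ts)" by (cases z)
      note ne = elim(1)[unfolded z prod.case] and fg = elim(2)[unfolded z prod.case]
        and 1 = elim(3)[unfolded z prod.case, rule_format] and 2 = elim(4)[unfolded z prod.case, rule_format]
      have gr: "grid n ts" using fg by (simp add: fgrid_def)
      obtain a b where a: "a \<in> rstrat s1 n ts" and b: "b \<in> rstrat s2 n ts"
        and N1: "\<And>a'. a' \<in> rstrat s1 n ts ==> rpay n ts (g 1) x a' b - \<eta> \<le> rpay n ts (g 1) x a b"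
        and N2: "\<And>b'. b' \<in> rstrat s2 n ts ==> rpay n ts (g 2) x a b' - \<eta> \<le> rpay n ts (g 2) x a b"
        and e: "\<And>m. m \<in> {1, 2} ==> \<bar>rpay n ts (g m) x a b - e m\<bar> \<le> \<eta>"
        using ne unfolding near_equilibrium_def by blast
      obtain u v where u: "u \<in> rctrl s1 n ts" and v: "v \<in> rctrl s2 n ts"
        and pl: "\<And>y. plays (ts 0) (ts n) (a y) (b y) (u y) (v y)"
        by (rule plays_exists[OF gr a b]) auto
      have c1: "continues n ts (g 1) (U 1) x \<epsilon> u v"
      proof (rule 1[OF a b u v pl])
        show "rpay n ts (g 1) x a' b \<le> rpay n ts (g 1) x a b + \<epsilon>\<^sup>2 / 2" if "a' \<in> rstrat s1 n ts" for a'
          using N1[OF that] \<eta>(3) by linarith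
      qed
      have "sw.continues n ts (g 2) (U 2) x \<epsilon> v u"
      proof (rule 2[OF b a v u plays_swap[THEN iffD1, OF pl]])
        show "sw.rpay n ts (g 2) x b' a \<le> sw.rpay n ts (g 2) x b a + \<epsilon>\<^sup>2 / 2" if "b' \<in> rstrat s2 n ts" for b'
          unfolding rpay_swap[OF gr a b] rpay_swap[OF gr a that] using N2[OF that] \<eta>(3) by linarith
      qed
      then have c2: "continues n ts (g 2) (U 2) x \<epsilon> u v" unfolding continues_swap .
      show ?case
        unfolding z prod.case individually_rational_def
      proof (intro bexI[OF _ u] bexI[OF _ v] ballI conjI)
        fix m :: nat assume m: "m \<in> {1, 2}"
        show "continues n ts (g m) (U m) x \<epsilon> u v" using m c1 c2 by auto
        show "\<bar>(\<integral>y. g m (traj f (ts 0) (ts n) x (u y) (v y) (ts n)) \<partial>noise) - e m\<bar> \<le> \<epsilon>"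
          using e[OF m] \<eta>(2) unfolding rpay_eq[OF gr a b pl] by linarith
      qed
    qed
  }
  {
    assume R: "\<forall>\<epsilon>>0. \<forall>\<^sub>F (n, ts) in fine_grids T t. individually_rational g U e x \<epsilon> n ts"
    obtain \<epsilon>1 where \<epsilon>1: "\<epsilon>1 > 0" and ev1: "\<forall>\<^sub>F (n, ts) in fine_grids T t. \<forall>u\<in>rctrl s1 n ts. \<forall>v\<in>rctrl s2 n ts.
      continues n ts (g 1) (U 1) x \<epsilon>1 u v --> sw.enforceable n ts (\<lambda>x. - g 1 x) x \<epsilon> v u"
      by (rule eventually_enforceable[OF pf1 gv1 t \<epsilon>])
    obtain \<epsilon>2 where \<epsilon>2: "\<epsilon>2 > 0" and ev2: "\<forall>\<^sub>F (n, ts) in fine_grids T t. \<forall>v\<in>rctrl s2 n ts. \<forall>u\<in>rctrl s1 n ts.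
      sw.continues n ts (g 2) (U 2) x \<epsilon>2 v u --> enforceable n ts (\<lambda>x. - g 2 x) x \<epsilon> u v"
      by (rule sw.eventually_enforceable[OF pf2 gv2 t \<epsilon>])
    define \<eta> where "\<eta> = min \<epsilon> (min \<epsilon>1 \<epsilon>2)"
    have \<eta>: "\<eta> > 0" "\<eta> \<le> \<epsilon>" "\<eta> \<le> \<epsilon>1" "\<eta> \<le> \<epsilon>2" using \<epsilon> \<epsilon>1 \<epsilon>2 by (auto simp: \<eta>_def)
    show "\<forall>\<^sub>F (n, ts) in fine_grids T t. near_equilibrium g e x \<epsilon> n ts"
      using R[rule_format, OF \<eta>(1)] eventually_fgrid ev1 ev2
    proof eventually_elim
      case (elim z)
      obtain n ts where z: "z = (n, ts)" by (cases z)
      note ir = elim(1)[unfolded z prod.case] and fg = elim(2)[unfolded z prod.case]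
        and 1 = elim(3)[unfolded z prod.case, rule_format] and 2 = elim(4)[unfolded z prod.case, rule_format]
      have gr: "grid n ts" using fg by (simp add: fgrid_def)
      obtain u v where u: "u \<in> rctrl s1 n ts" and v: "v \<in> rctrl s2 n ts"
        and c: "\<And>m. m \<in> {1, 2} ==> continues n ts (g m) (U m) x \<eta> u v"
        and e: "\<And>m. m \<in> {1, 2} ==> \<bar>(\<integral>y. g m (traj f (ts 0) (ts n) x (u y) (v y) (ts n)) \<partial>noise) - e m\<bar> \<le> \<eta>"
        using ir unfolding individually_rational_def by blast
      have c1: "continues n ts (g 1) (U 1) x \<epsilon>1 u v"
        by (rule continues_mono[OF pf1 gv1 fg t u v \<eta>(3) c]) simp
      have c2: "sw.continues n ts (g 2) (U 2) x \<epsilon>2 v u"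
        by (rule sw.continues_mono[OF pf2 gv2 fg t v u \<eta>(4)]) (simp add: continues_swap c)
      obtain a where a: "a \<in> rstrat s1 n ts"
        and a1: "\<And>y w. w \<in> ctrls (ts 0) (ts n) ==> agree (ts 0) (ts n) w (v y) ==> a y w = u y"
        and a2: "\<And>b. b \<in> rstrat s2 n ts ==> (\<integral>y. - g 2 (traj f (ts 0) (ts n) x (u y) (v y) (ts n)) \<partial>noise) - \<epsilon> \<le> rpay n ts (\<lambda>x. - g 2 x) x a b"
        using 2[OF v u c2] unfolding enforceable_def by blast
      obtain b where b: "b \<in> rstrat s2 n ts"
        and b1: "\<And>y w. w \<in> ctrls (ts 0) (ts n) ==> agree (ts 0) (ts n) w (u y) ==> b y w = v y"
        and b2: "\<And>a. a \<in> rstrat s1 n ts ==> (\<integral>y. - g 1 (traj f (ts 0) (ts n) x (u y) (v y) (ts n)) \<partial>noise) - \<epsilon> \<le> sw.rpay n ts (\<lambda>x. - g 1 x) x b a"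
        using 1[OF u v c1] unfolding sw.enforceable_def traj_swap by blast
      have "plays (ts 0) (ts n) (a y) (b y) (u y) (v y)" for y
        using a1[OF rctrl_ctrl[OF v] agree_refl] b1[OF rctrl_ctrl[OF u] agree_refl] rctrl_ctrl[OF u] rctrl_ctrl[OF v]
        unfolding plays_def by simp
      note pay = rpay_eq[OF gr a b this]
      show ?case
        unfolding z prod.case near_equilibrium_def
      proof (intro bexI[OF _ a] bexI[OF _ b] conjI ballI)
        fix a' :: "('v, 'u) noise_strategy" and b' :: "('u, 'v) noise_strategy"
        assume "a' \<in> rstrat s1 n ts" "b' \<in> rstrat s2 n ts"
        then show "rpay n ts (g 1) x a b \<ge> rpay n ts (g 1) x a' b - \<epsilon>" "rpay n ts (g 2) x a b \<ge> rpay n ts (g 2) x a b' - \<epsilon>"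
          using b2[of a'] a2[of b'] unfolding pay by (simp_all add: rpay_swap[OF gr] rpay_uminus b)
      next
        show "\<bar>rpay n ts (g m) x a b - e m\<bar> \<le> \<epsilon>" if "m \<in> {1, 2}" for m
          using e[OF that] \<eta>(2) unfolding pay by linarith
      qed
    qed
  }
qed

end

context wiener_game
begin

lemma nash_payoff_iff:
  assumes pf: "\<And>m. m \<in> {1, 2} ==> payoff_function B K' (g m)" and t: "0 \<le> t" "t < T"
  shows "nash_payoff P f g T t x e \<longleftrightarrow> (\<forall>\<epsilon>>0. \<forall>\<^sub>F (n, ts) in fine_grids T t. near_equilibrium g e x \<epsilon> n ts)"
proof -
  have red: "partition_equilibrium P f g T N p t x e \<epsilon> \<longleftrightarrow>
      near_equilibrium g e x \<epsilon> (N + 1 - cell N p t) (induced_grid N p t)" if tp: "time_partition T N p" for N p \<epsilon>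
  proof -
    interpret wiener_game_partition T W f C L N p t by (rule partition_game[OF tp t])
    show ?thesis by (rule nash_reduced[where g=g, OF pf])
  qed
  have "(\<exists>\<delta>>0. \<forall>N p. time_partition T N p \<and> mesh N p \<le> \<delta> --> partition_equilibrium P f g T N p t x e \<epsilon>) \<longleftrightarrow>
    (\<forall>\<^sub>F (N, p) in mesh_to_0 T. partition_equilibrium P f g T N p t x e \<epsilon>)" for \<epsilon>
    unfolding eventually_mesh_to_0
  proof (intro iffI; elim exE conjE)
    fix \<delta> :: real
    assume \<delta>: "\<delta> > 0" and *: "\<forall>N p. time_partition T N p \<and> mesh N p < \<delta> --> partition_equilibrium P f g T N p t x e \<epsilon>"
    \<comment> \<open>One condition bounds the mesh strictly, the other one does not.\<close>
    have "mesh N p < \<delta>" if "mesh N p \<le> \<delta> / 2" for N p using that \<delta> by linarith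
    with * \<delta> show "\<exists>\<delta>>0. \<forall>N p. time_partition T N p \<and> mesh N p \<le> \<delta> --> partition_equilibrium P f g T N p t x e \<epsilon>"
      by (intro exI[of _ "\<delta> / 2"]) simp
  qed (force intro: less_imp_le)
  moreover have "(\<forall>\<^sub>F (N, p) in mesh_to_0 T. partition_equilibrium P f g T N p t x e \<epsilon>) \<longleftrightarrow>
    (\<forall>\<^sub>F (n, ts) in fine_grids T t. near_equilibrium g e x \<epsilon> n ts)" for \<epsilon>
    unfolding fine_grids_mesh[OF t] eventually_filtermap case_prod_beta' fst_conv snd_conv
    by (rule eventually_subst, rule eventually_mono[OF eventually_partition]) (rule red)
  ultimately show ?thesis unfolding nash_payoff_def partition_equilibrium_def[symmetric] by (simp only:)
qed

text \<open>Here only the partitions through \<open>t\<close> count, and these suffice to induce all grids.\<close>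

lemma rational_condition_iff:
  assumes pf: "\<And>m. m \<in> {1, 2} ==> payoff_function B K' (g m)" and t: "0 \<le> t" "t < T"
    and U: "\<And>m s. m \<in> {1, 2} ==> 0 \<le> s ==> s \<le> T ==> U m s \<in> borel_measurable borel"
  shows "(\<exists>\<delta>>0. \<forall>N p k. time_partition T N p \<and> mesh N p < \<delta> \<and> 1 \<le> k \<and> k \<le> N \<and> t = p (k - 1) -->
       partition_rational P f g U T N p k t x e \<epsilon>) \<longleftrightarrow>
    (\<forall>\<^sub>F (n, ts) in fine_grids T t. individually_rational g U e x \<epsilon> n ts)"
proof -
  have red: "partition_rational P f g U T N p (cell N p t) t x e \<epsilon> \<longleftrightarrow>
      individually_rational g U e x \<epsilon> (N + 1 - cell N p t) (induced_grid N p t)"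
    if tp: "time_partition T N p" and k: "p (cell N p t - 1) = t" for N p
  proof -
    interpret wiener_game_partition T W f C L N p t by (rule partition_game[OF tp t])
    show ?thesis by (rule rational_reduced[where g=g and U=U, OF pf k U])
  qed
  have cellk: "cell N p t = k" if "time_partition T N p" "1 \<le> k" "k \<le> N" "t = p (k - 1)" for N p k
    by (rule cell_bounds(5)[OF that(1) t that(2,3)]) (use that partition_strict[OF that(1), of "k - 1" k] in auto)
  show ?thesis
    unfolding eventually_fine_grids
  proof (intro ex_cong1 conj_cong refl iffI allI impI; (elim conjE)?)
    fix \<delta> :: real and n ts
    assume \<delta>: "\<delta> > 0" and Q: "\<forall>N p k. time_partition T N p \<and> mesh N p < \<delta> \<and> 1 \<le> k \<and> k \<le> N \<and> t = p (k - 1) -->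
       partition_rational P f g U T N p k t x e \<epsilon>" and fg: "fgrid T \<delta> t n ts"
    obtain N p where tp: "time_partition T N p" "mesh N p < \<delta>" and eq: "N + 1 - cell N p t = n" "induced_grid N p t = ts" "p (cell N p t - 1) = t"
      by (rule fgrid_partition[OF fg t(1) \<delta>])
    show "individually_rational g U e x \<epsilon> n ts"
      using Q tp eq(3) cell_bounds(1,2)[OF tp(1) t] red[OF tp(1) eq(3)] unfolding eq(1,2) by metis
  next
    fix \<delta> :: real and N p k
    assume Q: "\<forall>n ts. fgrid T \<delta> t n ts --> individually_rational g U e x \<epsilon> n ts"
      and A: "time_partition T N p" "mesh N p < \<delta>" "1 \<le> k" "k \<le> N" "t = p (k - 1)"
    have k: "cell N p t = k" by (rule cellk[OF A(1,3,4,5)])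
    show "partition_rational P f g U T N p k t x e \<epsilon>"
      using red[OF A(1)] Q induced_fgrid[OF A(1) t A(2)] A(5) unfolding k by simp
  qed
qed

end

lemma lipschitz_payoff_function:
  fixes g :: "'x::real_normed_vector => real"
  assumes "\<And>x. \<bar>g x\<bar> \<le> B" "M-lipschitz_on UNIV g" "M \<le> K"
  shows "payoff_function B K g"
  unfolding payoff_function_def
proof (intro conjI allI)
  show "0 \<le> K" using lipschitz_on_nonneg[OF assms(2)] assms(3) by linarith
  fix x y
  have "\<bar>g x - g y\<bar> \<le> M * norm (x - y)" using lipschitz_onD[OF assms(2), of x y] by (simp add: dist_norm)
  also have "\<dots> \<le> K * norm (x - y)" by (rule mult_right_mono[OF assms(3)]) simp
  finally show "\<bar>g x - g y\<bar> \<le> K * norm (x - y)" .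
qed (rule assms(1))

theorem theorem4p1:
  fixes f :: "real^'n \<Rightarrow> 'u::metric_space \<Rightarrow> 'v::metric_space \<Rightarrow> real^'n"
    and g :: "nat \<Rightarrow> real^'n \<Rightarrow> real"
    and T t :: real and x :: "real^'n"
    and W :: "(real \<Rightarrow> real \<times> real) measure" and P :: "sample measure"
    and U :: "nat \<Rightarrow> real \<Rightarrow> real^'n \<Rightarrow> real"
    and e :: "nat \<Rightarrow> real"
  assumes "T > 0"
    and "compact (UNIV :: 'u set)" and "compact (UNIV :: 'v set)"
    and "bounded (range (\<lambda>(x, u, v). f x u v))"
    and "\<And>x. continuous_on UNIV (\<lambda>(u, v). f x u v)"
    and "\<exists>L. \<forall>u v. L-lipschitz_on UNIV (\<lambda>x. f x u v)"
    and "\<And>m. m \<in> {1, 2} \<Longrightarrow> bounded (range (g m))"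
    and "\<And>m. m \<in> {1, 2} \<Longrightarrow> \<exists>L. L-lipschitz_on UNIV (g m)"
    and "wiener_measure T W" and "P = wiener_ext W"
    and "value_functions P f g T U"
    and "0 \<le> t" and "t < T"
  shows "nash_payoff P f g T t x e \<longleftrightarrow>
    (\<forall>\<epsilon>>0. \<exists>\<delta>>0. \<forall>N p k.
       time_partition T N p \<and> mesh N p < \<delta> \<and> 1 \<le> k \<and> k \<le> N \<and> t = p (k - 1) \<longrightarrow>
       (\<exists>u\<in>controls fst T N p t. \<exists>v\<in>controls snd T N p t. \<forall>m\<in>{1, 2}.
          (\<forall>i\<in>{k..N}.
             measure P {\<omega> \<in> space P.
               real_cond_exp P (Fil_idx P p (int k - 2) (int i - 2))
                 (\<lambda>\<omega>'. g m (traj f t T x (u \<omega>') (v \<omega>') T)) \<omega>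
               \<ge> U m (p (i - 1)) (traj f t T x (u \<omega>) (v \<omega>) (p (i - 1))) - \<epsilon>}
             \<ge> 1 - \<epsilon>) \<and>
          \<bar>(LINT \<omega>|P. g m (traj f t T x (u \<omega>) (v \<omega>) T)) - e m\<bar> \<le> \<epsilon>))"
proof -
  obtain C where C: "\<And>x u v. norm (f x u v) \<le> C"
    using assms(4) unfolding bounded_iff by auto
  obtain L0 where L0: "\<And>u v. L0-lipschitz_on UNIV (\<lambda>x. f x u v)" using assms(6) by auto
  \<comment> \<open>The Lipschitz constant is required to be positive, which \<open>L0\<close> may fail to be.\<close>
  interpret wiener_game T W f C "L0 + 1"
  proof unfold_locales
    have "L0 \<ge> 0" using lipschitz_on_nonneg[OF L0] .
    then show "0 < L0 + 1" by simp
    fix x y u v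
    have "norm (f x u v - f y u v) \<le> L0 * norm (x - y)" using lipschitz_onD[OF L0, of x y u v] by (simp add: dist_norm)
    also have "\<dots> \<le> (L0 + 1) * norm (x - y)" by (rule mult_right_mono) auto
    finally show "norm (f x u v - f y u v) \<le> (L0 + 1) * norm (x - y)" .
  qed (use assms C in auto)
  obtain B1 where B1: "\<And>x. \<bar>g 1 x\<bar> \<le> B1" using assms(7)[of 1] unfolding bounded_iff by auto
  obtain B2 where B2: "\<And>x. \<bar>g 2 x\<bar> \<le> B2" using assms(7)[of 2] unfolding bounded_iff by auto
  obtain K1 where K1: "K1-lipschitz_on UNIV (g 1)" using assms(8)[of 1] by auto
  obtain K2 where K2: "K2-lipschitz_on UNIV (g 2)" using assms(8)[of 2] by auto
  have pf1: "payoff_function (max B1 B2) (max K1 K2) (g 1)"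
    by (rule lipschitz_payoff_function[OF _ K1]) (use B1 in "auto simp: le_max_iff_disj")
  have pf2: "payoff_function (max B1 B2) (max K1 K2) (g 2)"
    by (rule lipschitz_payoff_function[OF _ K2]) (use B2 in "auto simp: le_max_iff_disj")
  have pf: "payoff_function (max B1 B2) (max K1 K2) (g m)" if "m \<in> {1, 2}" for m
    using that pf1 pf2 by auto
  have P: "P = wiener_ext W" by fact
  note gv = values_game_value[where g=g, OF pf assms(11)[unfolded P]]
  interpret sw: noise_game "\<lambda>x v u. f x u v" C "L0 + 1" snd fst by (rule swapped)
  have U: "U m s \<in> borel_measurable borel" if "m \<in> {1, 2}" "0 \<le> s" "s \<le> T" for m s
    using that value_measurable[OF pf1 gv(1) that(2,3)] sw.value_measurable[OF pf2 gv(2) that(2,3)] by auto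
  note 1 = nash_payoff_iff[where g=g and e=e and x=x, OF pf assms(12,13)]
  note 2 = rational_condition_iff[where g=g and U=U and e=e and x=x, OF pf assms(12,13) U]
  note 3 = equilibrium_iff_rational[where g=g and U=U and e=e and x=x, OF pf gv assms(12,13)]
  show ?thesis unfolding P partition_rational_def[symmetric] by (simp only: 1 2 3)
qed

end
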